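(* Let $\Omega\subset\mathbb{R}^d$, $d\le3$, be a bounded convex domain, $\nu>0$, $R>0$, and $C^*=\tfrac32\big(R^2+(3R^2)^{4/3}\nu^{-1/3}+\nu^{-1}\big)+1$. Fix a quasi-uniformity constant $c>0$. Then for every $\gamma>0$ and every $\lambda\ge 2(C^*+\gamma)$ there exists $H_0>0$ such that for every quasi-uniform partition $\mathcal{T}_H=\{T\}$ of $\Omega$ of size $H\le H_0$ with constant $c$, and every choice of points $x_T\in T$, the pointwise feedback operator $\mathcal{F}:H_n^2(\Omega)\to H_n^{-2}(\Omega)$ defined by $$\langle\mathcal{F}z,v\rangle=\lambda\sum_{T\in\mathcal{T}_H}|T|\,z(x_T)\,v(x_T),\qquad z,v\in H_n^2(\Omega),$$ satisfies $$\nu\|\Delta z\|_{L^2(\Omega)}^2+2\langle\mathcal{F}z,z\rangle\ge (C^*+\gamma)\|z\|_{L^2(\Omega)}^2\qquad\forall z\in H_n^2(\Omega).$$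
   Context: $H_n^2(\Omega)=\{v\in H^2(\Omega):\partial_n v=0\text{ on }\partial\Omega\}$ and $H_n^{-2}(\Omega)=H_n^2(\Omega)'$ is its dual, with $\langle\cdot,\cdot\rangle$ the duality pairing. A partition $\mathcal{T}_H=\{T\}$ of $\Omega$ into subdomains is quasi-uniform of size $H$ with constant $c>0$ if each $T$ contains a ball of size $cH$ and is contained in a ball of size $H$. $|T|$ denotes the volume of $T$. Functions in $H_n^2(\Omega)$ are continuous for $d\le 3$, so point values are well defined. *)

theory Defs
  imports "HOL-Analysis.Analysis"
begin

section \<open>Smooth functions and weak derivatives\<close>

definition partial_deriv :: "'a \<Rightarrow> ('a::euclidean_space \<Rightarrow> real) \<Rightarrow> 'a \<Rightarrow> real" where
  "partial_deriv b f x = frechet_derivative f (at x) b"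

primrec Ck :: "nat \<Rightarrow> ('a::euclidean_space \<Rightarrow> real) \<Rightarrow> bool" where
  "Ck 0 f \<longleftrightarrow> continuous_on UNIV f"
| "Ck (Suc k) f \<longleftrightarrow> (\<forall>x. f differentiable (at x)) \<and> (\<forall>b\<in>Basis. Ck k (partial_deriv b f))"

definition smooth :: "('a::euclidean_space \<Rightarrow> real) \<Rightarrow> bool" where
  "smooth f \<longleftrightarrow> (\<forall>k. Ck k f)"

definition test_fun :: "'a::euclidean_space set \<Rightarrow> ('a \<Rightarrow> real) \<Rightarrow> bool" where
  "test_fun \<Omega> \<phi> \<longleftrightarrow> smooth \<phi> \<and> compact (closure {x. \<phi> x \<noteq> 0}) \<and> closure {x. \<phi> x \<noteq> 0} \<subseteq> \<Omega>"

text \<open>Elements of the function spaces below are represented by functions on the whole space, of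
  which only the values almost everywhere in \<open>\<Omega>\<close> matter.\<close>

definition L2 :: "'a::euclidean_space set \<Rightarrow> ('a \<Rightarrow> real) set" where
  "L2 \<Omega> = {f. f \<in> borel_measurable (lebesgue_on \<Omega>) \<and> integrable (lebesgue_on \<Omega>) (\<lambda>x. (f x)\<^sup>2)}"

definition L2_nrm :: "'a::euclidean_space set \<Rightarrow> ('a \<Rightarrow> real) \<Rightarrow> real" where
  "L2_nrm \<Omega> f = sqrt (LINT x|lebesgue_on \<Omega>. (f x)\<^sup>2)"

definition is_weak_partial ::
    "'a::euclidean_space set \<Rightarrow> 'a \<Rightarrow> ('a \<Rightarrow> real) \<Rightarrow> ('a \<Rightarrow> real) \<Rightarrow> bool" where
  "is_weak_partial \<Omega> b u g \<longleftrightarrow> g \<in> L2 \<Omega> \<and>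
     (\<forall>\<phi>. test_fun \<Omega> \<phi> \<longrightarrow>
        (LINT x|lebesgue_on \<Omega>. u x * partial_deriv b \<phi> x) = - (LINT x|lebesgue_on \<Omega>. g x * \<phi> x))"

definition weak_partial :: "'a::euclidean_space set \<Rightarrow> 'a \<Rightarrow> ('a \<Rightarrow> real) \<Rightarrow> 'a \<Rightarrow> real" where
  "weak_partial \<Omega> b u = (SOME g. is_weak_partial \<Omega> b u g)"

definition H1 :: "'a::euclidean_space set \<Rightarrow> ('a \<Rightarrow> real) set" where
  "H1 \<Omega> = {u \<in> L2 \<Omega>. \<forall>b\<in>Basis. \<exists>g. is_weak_partial \<Omega> b u g}"

definition H1_nrm :: "'a::euclidean_space set \<Rightarrow> ('a \<Rightarrow> real) \<Rightarrow> real" where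
  "H1_nrm \<Omega> u = sqrt ((L2_nrm \<Omega> u)\<^sup>2 + (\<Sum>b\<in>Basis. (L2_nrm \<Omega> (weak_partial \<Omega> b u))\<^sup>2))"

definition H2 :: "'a::euclidean_space set \<Rightarrow> ('a \<Rightarrow> real) set" where
  "H2 \<Omega> = {u \<in> H1 \<Omega>. \<forall>b\<in>Basis. weak_partial \<Omega> b u \<in> H1 \<Omega>}"

definition H2_nrm :: "'a::euclidean_space set \<Rightarrow> ('a \<Rightarrow> real) \<Rightarrow> real" where
  "H2_nrm \<Omega> u = sqrt ((L2_nrm \<Omega> u)\<^sup>2 + (\<Sum>b\<in>Basis. (L2_nrm \<Omega> (weak_partial \<Omega> b u))\<^sup>2)
     + (\<Sum>b\<in>Basis. \<Sum>c\<in>Basis. (L2_nrm \<Omega> (weak_partial \<Omega> c (weak_partial \<Omega> b u)))\<^sup>2))"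

definition laplacian :: "'a::euclidean_space set \<Rightarrow> ('a \<Rightarrow> real) \<Rightarrow> 'a \<Rightarrow> real" where
  "laplacian \<Omega> u x = (\<Sum>b\<in>Basis. weak_partial \<Omega> b (weak_partial \<Omega> b u) x)"

section \<open>Surface measure, traces and the normal derivative\<close>

text \<open>The case distinction makes the empty set weightless for \<open>s = 0\<close> too, where singletons
  count \<open>1\<close> because \<open>0 ^ 0 = 1\<close>. Boundedness is required because \<open>diameter\<close> is meaningless for
  unbounded sets.\<close>

definition hausdorff_pre :: "nat \<Rightarrow> real \<Rightarrow> 'a::euclidean_space set \<Rightarrow> ennreal" where
  "hausdorff_pre s \<delta> A =
     (INF C \<in> {C :: nat \<Rightarrow> 'a set. A \<subseteq> (\<Union>i. C i) \<and> (\<forall>i. bounded (C i) \<and> diameter (C i) \<le> \<delta>)}.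
        \<Sum>i. if C i = {} then 0 else ennreal (unit_ball_vol (real s) * (diameter (C i) / 2) ^ s))"

definition hausdorff_outer :: "nat \<Rightarrow> 'a::euclidean_space set \<Rightarrow> ennreal" where
  "hausdorff_outer s A = (SUP \<delta> \<in> {0<..}. hausdorff_pre s \<delta> A)"

text \<open>The metric outer measure \<open>hausdorff_outer s\<close> is countably additive on Borel sets by
  Caratheodory's criterion, so \<open>measure_of\<close> yields its restriction to the Borel sets.\<close>

definition hausdorff_measure :: "nat \<Rightarrow> 'a::euclidean_space measure" where
  "hausdorff_measure s = measure_of UNIV (sets borel) (hausdorff_outer s)"

definition surface_measure :: "'a::euclidean_space set \<Rightarrow> 'a measure" where
  "surface_measure \<Omega> = restrict_space (hausdorff_measure (DIM('a) - 1)) (frontier \<Omega>)"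

text \<open>The boundary trace of an \<open>H1\<close> function is the continuous extension to \<open>H1\<close>, with values in
  \<open>L2\<close> of the boundary, of the restriction map on functions smooth up to the boundary.\<close>

definition is_trace :: "'a::euclidean_space set \<Rightarrow> ('a \<Rightarrow> real) \<Rightarrow> ('a \<Rightarrow> real) \<Rightarrow> bool" where
  "is_trace \<Omega> w g \<longleftrightarrow>
     g \<in> borel_measurable (surface_measure \<Omega>) \<and>
     integrable (surface_measure \<Omega>) (\<lambda>x. (g x)\<^sup>2) \<and>
     (\<exists>f :: nat \<Rightarrow> 'a \<Rightarrow> real. (\<forall>k. smooth (f k)) \<and>
        (\<lambda>k. H1_nrm \<Omega> (\<lambda>x. f k x - w x)) \<longlonglongrightarrow> 0 \<and>
        (\<lambda>k. \<integral>\<^sup>+x. ennreal ((f k x - g x)\<^sup>2) \<partial>surface_measure \<Omega>) \<longlonglongrightarrow> 0)"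

definition trace_op :: "'a::euclidean_space set \<Rightarrow> ('a \<Rightarrow> real) \<Rightarrow> 'a \<Rightarrow> real" where
  "trace_op \<Omega> w = (SOME g. is_trace \<Omega> w g)"

text \<open>For convex \<open>\<Omega>\<close> the unit normal of a supporting hyperplane; it is unique at almost every
  boundary point, namely wherever the boundary is differentiable.\<close>

definition outer_normal :: "'a::euclidean_space set \<Rightarrow> 'a \<Rightarrow> 'a" where
  "outer_normal \<Omega> x = (SOME n. norm n = 1 \<and> (\<forall>y\<in>\<Omega>. n \<bullet> (y - x) \<le> 0))"

definition normal_deriv :: "'a::euclidean_space set \<Rightarrow> ('a \<Rightarrow> real) \<Rightarrow> 'a \<Rightarrow> real" where
  "normal_deriv \<Omega> u x = (\<Sum>b\<in>Basis. trace_op \<Omega> (weak_partial \<Omega> b u) x * (outer_normal \<Omega> x \<bullet> b))"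

definition H2n :: "'a::euclidean_space set \<Rightarrow> ('a \<Rightarrow> real) set" where
  "H2n \<Omega> = {u \<in> H2 \<Omega>. AE x in surface_measure \<Omega>. normal_deriv \<Omega> u x = 0}"

text \<open>Functionals act on representatives; the bound forces them to respect equality almost
  everywhere. The duality pairing of \<open>L\<close> with \<open>v\<close> is \<open>L v\<close>.\<close>

definition H2n_dual :: "'a::euclidean_space set \<Rightarrow> (('a \<Rightarrow> real) \<Rightarrow> real) set" where
  "H2n_dual \<Omega> = {L. (\<forall>u\<in>H2n \<Omega>. \<forall>v\<in>H2n \<Omega>. L (\<lambda>x. u x + v x) = L u + L v) \<and>
                    (\<forall>a. \<forall>u\<in>H2n \<Omega>. L (\<lambda>x. a * u x) = a * L u) \<and>
                    (\<exists>C. \<forall>u\<in>H2n \<Omega>. \<bar>L u\<bar> \<le> C * H2_nrm \<Omega> u)}"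

section \<open>Partitions and the feedback operator\<close>

text \<open>Subdomains are open and connected, so they partition \<open>\<Omega>\<close> up to a null set. The size of a
  ball is its radius.\<close>

definition quasi_uniform_partition ::
    "real \<Rightarrow> real \<Rightarrow> 'a::euclidean_space set \<Rightarrow> 'a set set \<Rightarrow> bool" where
  "quasi_uniform_partition c H \<Omega> \<T> \<longleftrightarrow>
     finite \<T> \<and> disjoint \<T> \<and> \<Union>\<T> \<subseteq> \<Omega> \<and> negligible (\<Omega> - \<Union>\<T>) \<and>
     (\<forall>T\<in>\<T>. open T \<and> connected T \<and> T \<noteq> {} \<and>
        (\<exists>y. ball y (c * H) \<subseteq> T) \<and> (\<exists>y. T \<subseteq> ball y H))"

text \<open>The value at \<open>x\<close> of the continuous representative of \<open>z\<close>.\<close>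

definition point_value :: "'a::euclidean_space set \<Rightarrow> ('a \<Rightarrow> real) \<Rightarrow> 'a \<Rightarrow> real" where
  "point_value \<Omega> z x =
     (THE r. \<exists>u. continuous_on \<Omega> u \<and> (AE y in lebesgue_on \<Omega>. u y = z y) \<and> u x = r)"

definition feedback ::
    "'a::euclidean_space set \<Rightarrow> real \<Rightarrow> 'a set set \<Rightarrow> ('a set \<Rightarrow> 'a) \<Rightarrow>
     ('a \<Rightarrow> real) \<Rightarrow> ('a \<Rightarrow> real) \<Rightarrow> real" where
  "feedback \<Omega> lam \<T> p z v =
     lam * (\<Sum>T\<in>\<T>. measure lebesgue T * point_value \<Omega> z (p T) * point_value \<Omega> v (p T))"

definition C_star :: "real \<Rightarrow> real \<Rightarrow> real" where
  "C_star R \<nu> = 3/2 * (R\<^sup>2 + (3 * R\<^sup>2) powr (4/3) * \<nu> powr (-1/3) + 1 / \<nu>) + 1"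

end

theory Submission
  imports Defs
begin

text \<open>The point values enter only through nonnegative terms, so those of the subdomains near the
  boundary may be dropped and replaced by the mean square of \<open>z\<close> over a thin boundary layer. That mean square
  is at most the thickness of the layer times the squared \<open>H1\<close> norm, and the Neumann condition bounds the
  gradient by \<open>z\<close> and \<open>\<Delta> z\<close> alone (Green's formula with test function \<open>z\<close>). On the
  subdomains away from the boundary an interior potential estimate bounds the oscillation of \<open>z\<close> by a small
  multiple of the norms of \<open>z\<close> and \<open>\<Delta> z\<close>; this is where \<open>d \<le> 3\<close> enters. Hence
  no regularity up to the boundary is needed.

  Green's formula for the abstract traces rests on the Minkowski gauge \<open>\<rho>\<close> of the convex set: integrating by parts
  against the Lipschitz cut-off \<open>max 0 (s - \<rho>)\<close> expresses boundary terms through the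
  image of the volume under radial projection, and this cone measure is comparable with the
  Hausdorff measure on the boundary.\<close>

section \<open>Smooth functions and bump functions\<close>

text \<open>The obstacle is Green's formula. The normal derivative is built from chosen traces, a
  chosen supporting normal and the Hausdorff measure of a boundary that is merely convex. A
  divergence theorem with the exact surface density is avoided: since the flux of the gradient
  vanishes a.e. on the boundary, it suffices to bound the integral of a divergence by a multiple of
  the mean absolute flux, and for this comparable measures are enough. Homogeneity of the gauge
  makes the cone measure accessible: a function constant along rays has the same mean over a thin
  layer as over \<Omega>. The dimension enters by scaling. The derivative in \<sigma> of the average
  of \<open>z\<close> at scale \<sigma> is \<sigma>^(1-d) times the integral of \<Delta> z against a
  bump of radius \<sigma>, whose L2 norm is of order \<sigma>^(d/2); the power \<sigma>^(1-d/2) is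
  integrable at 0 exactly for d < 4. With M = \<open>C_star R \<nu>\<close> + \<gamma> and Q the
  weighted sum of squared samples, the threshold for \<open>lam\<close> makes the feedback term at
  least 4 M Q. One factor 2 pays for (p + q)^2 \<le> 2 p^2 + 2 q^2, the other leaves room to absorb
  an error proportional to the squared norm of \<open>z\<close>.\<close>

lemma partial_deriv_eq:
  "(f has_derivative D) (at x) \<Longrightarrow> partial_deriv b f x = D b"
  unfolding partial_deriv_def by (metis frechet_derivative_at)

lemma differentiable_partial_deriv:
  "f differentiable (at x) \<Longrightarrow> (f has_derivative (\<lambda>h. frechet_derivative f (at x) h)) (at x)"
  by (simp add: frechet_derivative_works)

lemma Ck_SucD: "Ck (Suc k) f \<Longrightarrow> Ck k f"
proof (induction k arbitrary: f)
  case 0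
  then show ?case
    by (auto simp: continuous_on_eq_continuous_within differentiable_imp_continuous_within)
qed auto

lemma Ck_const [simp]: "Ck k (\<lambda>x. c)"
proof (induction k arbitrary: c)
  case (Suc k)
  have "partial_deriv b (\<lambda>x. c) = (\<lambda>x. 0)" for b :: 'a
    by (auto intro!: ext partial_deriv_eq[THEN trans] derivative_eq_intros)
  then show ?case using Suc by simp
qed auto

lemma partial_deriv_add:
  assumes "f differentiable (at x)" "g differentiable (at x)"
  shows "partial_deriv b (\<lambda>x. f x + g x) x = partial_deriv b f x + partial_deriv b g x"
  using has_derivative_add[OF differentiable_partial_deriv[OF assms(1)] differentiable_partial_deriv[OF assms(2)]]
  by (simp add: partial_deriv_eq partial_deriv_def[symmetric])

lemma partial_deriv_mult:
  fixes f g :: "'a::euclidean_space \<Rightarrow> real"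
  assumes "f differentiable (at x)" "g differentiable (at x)"
  shows "partial_deriv b (\<lambda>x. f x * g x) x = f x * partial_deriv b g x + partial_deriv b f x * g x"
  using has_derivative_mult[OF differentiable_partial_deriv[OF assms(1)] differentiable_partial_deriv[OF assms(2)]]
  by (simp add: partial_deriv_eq partial_deriv_def[symmetric])

lemma Ck_add: "Ck k f \<Longrightarrow> Ck k g \<Longrightarrow> Ck k (\<lambda>x. f x + g x)"
proof (induction k arbitrary: f g)
  case 0 then show ?case by (auto intro: continuous_intros)
next
  case (Suc k)
  have "partial_deriv b (\<lambda>x. f x + g x) = (\<lambda>x. partial_deriv b f x + partial_deriv b g x)" for b
    using Suc.prems by (auto intro!: ext partial_deriv_add)
  then show ?case using Suc by auto
qed

lemma Ck_mult: "Ck k f \<Longrightarrow> Ck k g \<Longrightarrow> Ck k (\<lambda>x. f x * g x)"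
proof (induction k arbitrary: f g)
  case 0 then show ?case by (auto intro: continuous_intros)
next
  case (Suc k)
  have "partial_deriv b (\<lambda>x. f x * g x) = (\<lambda>x. f x * partial_deriv b g x + partial_deriv b f x * g x)" for b
    using Suc.prems by (auto intro!: ext partial_deriv_mult)
  then show ?case using Suc Ck_SucD[of k f] Ck_SucD[of k g] by (auto intro!: Ck_add)
qed

lemma partial_deriv_affine:
  fixes f :: "'a::euclidean_space \<Rightarrow> real"
  assumes "f differentiable (at (v + t *\<^sub>R x))"
  shows "((\<lambda>x. f (v + t *\<^sub>R x)) has_derivative (\<lambda>h. frechet_derivative f (at (v + t *\<^sub>R x)) (t *\<^sub>R h))) (at x)"
    and "partial_deriv b (\<lambda>x. f (v + t *\<^sub>R x)) x = t * partial_deriv b f (v + t *\<^sub>R x)"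
proof -
  have *: "((\<lambda>x. v + t *\<^sub>R x) has_derivative (\<lambda>h. t *\<^sub>R h)) (at x)"
    by (auto intro!: derivative_eq_intros)
  show 1: "((\<lambda>x. f (v + t *\<^sub>R x)) has_derivative (\<lambda>h. frechet_derivative f (at (v + t *\<^sub>R x)) (t *\<^sub>R h))) (at x)"
    using has_derivative_compose[OF * differentiable_partial_deriv[OF assms]] by simp
  have "linear (frechet_derivative f (at (v + t *\<^sub>R x)))"
    using differentiable_partial_deriv[OF assms] has_derivative_linear by blast
  then show "partial_deriv b (\<lambda>x. f (v + t *\<^sub>R x)) x = t * partial_deriv b f (v + t *\<^sub>R x)"
    using partial_deriv_eq[OF 1] by (simp add: partial_deriv_def linear_cmul)
qed

lemma Ck_affine: "Ck k f \<Longrightarrow> Ck k (\<lambda>x. f (v + t *\<^sub>R x))"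
proof (induction k arbitrary: f)
  case 0
  then show ?case by (auto intro!: continuous_on_compose2[of UNIV f] continuous_intros)
next
  case (Suc k)
  have "partial_deriv b (\<lambda>x. f (v + t *\<^sub>R x)) = (\<lambda>x. t * partial_deriv b f (v + t *\<^sub>R x))" for b
    using Suc.prems by (auto intro!: ext partial_deriv_affine)
  moreover have "(\<lambda>x. f (v + t *\<^sub>R x)) differentiable (at x)" for x
    using partial_deriv_affine(1)[of f v t x] Suc.prems by (auto simp: differentiable_def)
  ultimately show ?case using Suc by (auto intro!: Ck_mult)
qed

lemma Ck_inner: "Ck k (\<lambda>x. (x - c) \<bullet> v)"
proof (induction k)
  case 0 then show ?case by (auto intro!: continuous_intros)
next
  case (Suc k)
  have d: "((\<lambda>x. (x - c) \<bullet> v) has_derivative (\<lambda>h. h \<bullet> v)) (at x)" for x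
    by (auto intro!: derivative_eq_intros)
  have "partial_deriv b (\<lambda>x. (x - c) \<bullet> v) = (\<lambda>x. b \<bullet> v)" for b
    using partial_deriv_eq[OF d] by auto
  then show ?case using d by (auto simp: differentiable_def)
qed

lemma Ck_inner_self: "Ck k (\<lambda>x. x \<bullet> x)"
proof (cases k)
  case 0 then show ?thesis by (auto intro!: continuous_intros)
next
  case (Suc k)
  have d: "((\<lambda>x. x \<bullet> x) has_derivative (\<lambda>h. 2 * (x \<bullet> h))) (at x)" for x :: 'a
    by (auto intro!: derivative_eq_intros simp: inner_commute)
  have "partial_deriv b (\<lambda>x. x \<bullet> x) = (\<lambda>x. 2 * ((x - 0) \<bullet> b))" for b :: 'a
    using partial_deriv_eq[OF d] by auto
  then show ?thesis using d Suc by (auto simp: differentiable_def intro!: Ck_mult Ck_inner[of _ 0, simplified])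
qed

text \<open>Powers of 1/s are carried along because differentiating s^(-n) exp (-1/s) produces the
  indices n+1 and n+2; up to linear combinations the family is closed under derivatives.\<close>

definition expinv :: "nat \<Rightarrow> real \<Rightarrow> real" where
  "expinv n s = (if s > 0 then inverse s ^ n * exp (- inverse s) else 0)"

lemma expinv_nonneg: "expinv n s \<ge> 0"
  by (simp add: expinv_def)

lemma expinv_eq_0_iff: "expinv n s = 0 \<longleftrightarrow> s \<le> 0"
  by (auto simp: expinv_def)

lemma expinv_tendsto_0: "((\<lambda>s. expinv n s) \<longlongrightarrow> 0) (at_right 0)"
proof -
  have "((\<lambda>x::real. x ^ n / exp x) \<longlongrightarrow> 0) at_top"
    by (rule tendsto_power_div_exp_0)
  then have "((\<lambda>s::real. inverse s ^ n / exp (inverse s)) \<longlongrightarrow> 0) (at_right 0)"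
    by (rule filterlim_compose) (rule filterlim_inverse_at_top_right)
  then show ?thesis
    by (rule Lim_transform_eventually)
      (auto simp: expinv_def eventually_at_right_less exp_minus divide_inverse intro!: eventually_at_rightI[of 0 1])
qed

lemma expinv_Suc: "expinv (Suc n) s = inverse s * expinv n s"
  by (simp add: expinv_def)

lemma DERIV_expinv: "DERIV (expinv n) s :> - real n * expinv (n+1) s + expinv (n+2) s"
proof -
  consider "s > 0" | "s < 0" | "s = 0" by linarith
  then show ?thesis
  proof cases
    case 1
    have "DERIV (\<lambda>s. inverse s ^ n * exp (- inverse s)) s :>
        real n * inverse s ^ (n - 1) * (- (inverse s * inverse s)) * exp (- inverse s)
          + inverse s ^ n * (exp (- inverse s) * (inverse s * inverse s))"
      using 1 by (auto intro!: derivative_eq_intros simp: power2_eq_square)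
    moreover have "real n * inverse s ^ (n - 1) * (- (inverse s * inverse s)) * exp (- inverse s)
          + inverse s ^ n * (exp (- inverse s) * (inverse s * inverse s))
        = - real n * expinv (n+1) s + expinv (n+2) s"
      using 1 by (cases n) (auto simp: expinv_def algebra_simps)
    ultimately have "DERIV (\<lambda>s. inverse s ^ n * exp (- inverse s)) s :> - real n * expinv (n+1) s + expinv (n+2) s"
      by simp
    then show ?thesis
      by (rule has_field_derivative_transform_within_open[where S="{0<..}"]) (use 1 in \<open>auto simp: expinv_def\<close>)
  next
    case 2
    have "DERIV (\<lambda>s. 0) s :> - real n * expinv (n+1) s + expinv (n+2) s"
      using 2 by (auto intro!: derivative_eq_intros simp: expinv_def)
    then show ?thesis
      by (rule has_field_derivative_transform_within_open[where S="{..<0}"]) (use 2 in \<open>auto simp: expinv_def\<close>)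
  next
    case 3
    \<comment> \<open>At the origin the right difference quotient of index n is itself
      \<open>expinv (Suc n)\<close>, so its limit is again covered by the decay lemma.\<close>
    have r: "((\<lambda>h. (expinv n (0 + h) - expinv n 0) / h) \<longlongrightarrow> 0) (at_right 0)"
      using expinv_tendsto_0[of "Suc n"]
      by (auto simp: expinv_Suc divide_inverse mult.commute expinv_def[of n 0])
    have l: "((\<lambda>h. (expinv n (0 + h) - expinv n 0) / h) \<longlongrightarrow> 0) (at_left 0)"
      by (rule Lim_transform_eventually[of "\<lambda>_. 0"])
        (auto simp: expinv_def intro!: eventually_at_leftI[of "-1"])
    show ?thesis
      using filterlim_split_at[OF l r] 3 by (simp add: DERIV_def expinv_def)
  qed
qed

text \<open>Each derivative raises the index of \<open>expinv\<close>, so the induction on k has to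
  leave n arbitrary. The chain rule produces products of \<open>expinv\<close> of higher index with
  first partials of q, both of class k.\<close>

lemma Ck_expinv: "Ck k q \<Longrightarrow> Ck k (\<lambda>x. expinv n (q x))"
proof (induction k arbitrary: n)
  case 0
  have "continuous_on UNIV (expinv n)"
    using DERIV_expinv DERIV_isCont by (blast intro: continuous_at_imp_continuous_on)
  then show ?case using 0 by (auto intro: continuous_on_compose2)
next
  case (Suc k)
  have d: "((\<lambda>x. expinv n (q x)) has_derivative
      (\<lambda>h. (- real n * expinv (n+1) (q x) + expinv (n+2) (q x)) * frechet_derivative q (at x) h)) (at x)" for x
    using has_derivative_compose[OF differentiable_partial_deriv[of q x] DERIV_expinv[of n, unfolded has_field_derivative_def, of "q x"]]
      Suc.prems by simp
  have e: "partial_deriv b (\<lambda>x. expinv n (q x)) =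
     (\<lambda>x. (- real n * expinv (n+1) (q x) + expinv (n+2) (q x)) * partial_deriv b q x)" for b
    using partial_deriv_eq[OF d] by (auto simp: partial_deriv_def)
  have "Ck k (partial_deriv b (\<lambda>x. expinv n (q x)))" if "b \<in> Basis" for b
    unfolding e using Suc Ck_SucD[of k q] that by (intro Ck_mult Ck_add Ck_const) auto
  then show ?case
    using d by (auto simp: differentiable_def)
qed

definition bump :: "nat \<Rightarrow> 'a::euclidean_space \<Rightarrow> real" where
  "bump n x = expinv n (1 - x \<bullet> x)"

lemma smooth_bump: "smooth (bump n)"
proof -
  have "Ck k (\<lambda>x::'a. 1 + (-1) * (x \<bullet> x))" for k
    by (intro Ck_add Ck_mult Ck_const Ck_inner_self)
  then show ?thesis unfolding smooth_def bump_def using Ck_expinv by force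
qed

lemma bump_nonneg: "bump n x \<ge> 0"
  by (simp add: bump_def expinv_nonneg)

lemma bump_eq_0_iff: "bump n x = 0 \<longleftrightarrow> norm x \<ge> 1"
proof -
  have "x \<bullet> x \<ge> 1 \<longleftrightarrow> norm x \<ge> 1"
    by (metis abs_1 abs_norm_cancel abs_square_le_1 not_le norm_eq_square power2_norm_eq_inner power2_le_iff_abs_le power_one real_sqrt_ge_1_iff norm_eq_sqrt_inner)
  then show ?thesis by (simp add: bump_def expinv_eq_0_iff)
qed

text \<open>For index 0 the term of index n+1 drops out, so the gradient of \<open>bump 0\<close> is
  exactly -2 x times \<open>bump 2\<close>. This is why the mollifier is built from index 2: x times
  it is then a gradient.\<close>

lemma bump_deriv: "partial_deriv b (bump 0) x = - 2 * (x \<bullet> b) * bump 2 x"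
proof -
  have d: "((\<lambda>x. 1 - x \<bullet> x) has_derivative (\<lambda>h. - 2 * (x \<bullet> h))) (at x)" for x :: 'a
    by (auto intro!: derivative_eq_intros simp: inner_commute)
  show ?thesis
    using has_derivative_compose[OF d DERIV_expinv[of 0, unfolded has_field_derivative_def, of "1 - x \<bullet> x"]]
    by (subst partial_deriv_eq) (auto simp: bump_def[abs_def] numeral_2_eq_2 mult_ac)
qed

section \<open>Smooth functions and test functions\<close>

lemma smoothD: "smooth f \<Longrightarrow> f differentiable (at x)" "smooth f \<Longrightarrow> continuous_on UNIV f"
  "smooth f \<Longrightarrow> b \<in> Basis \<Longrightarrow> smooth (partial_deriv b f)"
proof -
  assume "smooth f"
  then have s: "Ck (Suc k) f" for k by (auto simp: smooth_def)
  show "f differentiable (at x)" using s[of 0] by auto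
  show "continuous_on UNIV f" using Ck_SucD[OF s[of 0]] by simp
  show "smooth (partial_deriv b f)" if "b \<in> Basis" using s that by (auto simp: smooth_def)
qed

lemma smooth_add: "smooth f \<Longrightarrow> smooth g \<Longrightarrow> smooth (\<lambda>x. f x + g x)"
  and smooth_mult: "smooth f \<Longrightarrow> smooth g \<Longrightarrow> smooth (\<lambda>x. f x * g x)"
  and smooth_const: "smooth (\<lambda>x. c)"
  and smooth_affine: "smooth f \<Longrightarrow> smooth (\<lambda>x. f (v + t *\<^sub>R x))"
  and smooth_inner: "smooth (\<lambda>x. (x - w) \<bullet> u)"
  by (auto simp: smooth_def Ck_add Ck_mult Ck_affine Ck_inner)

lemma smooth_diff: "smooth f \<Longrightarrow> smooth g \<Longrightarrow> smooth (\<lambda>x. f x - g x)"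
  using smooth_add[of f "\<lambda>x. (-1) * g x"] smooth_mult[OF smooth_const[of "-1"], of g] by simp

lemma test_fun_partial:
  assumes "test_fun \<Omega> \<phi>" "b \<in> Basis"
  shows "test_fun \<Omega> (partial_deriv b \<phi>)"
proof -
  have "partial_deriv b \<phi> x = 0" if "x \<notin> closure {x. \<phi> x \<noteq> 0}" for x
  proof -
    have "((\<lambda>x. 0::real) has_derivative (\<lambda>h. 0)) (at x)" by simp
    then have "(\<phi> has_derivative (\<lambda>h. 0)) (at x)"
      by (rule has_derivative_transform_within_open[where s="- closure {x. \<phi> x \<noteq> 0}"])
        (use that closure_subset[of "{x. \<phi> x \<noteq> 0}"] in auto)
    then show ?thesis by (simp add: partial_deriv_eq)
  qed
  then have "closure {x. partial_deriv b \<phi> x \<noteq> 0} \<subseteq> closure {x. \<phi> x \<noteq> 0}"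
    by (intro closure_minimal) auto
  with assms show ?thesis
    unfolding test_fun_def
    by (meson closed_closure compact_closure bounded_subset compact_imp_bounded order_trans smoothD(3) closure_closure compact_eq_bounded_closed)
qed

text \<open>The argument is (c - y)/s, written as v + t y so that the rules for affine arguments
  apply; the support is the closed ball of radius s around c.\<close>

lemma test_fun_bump:
  assumes "s > 0" "cball c s \<subseteq> \<Omega>"
  shows "test_fun \<Omega> (\<lambda>y. bump n ((1/s) *\<^sub>R c + (- 1/s) *\<^sub>R y))"
proof -
  have "norm ((1/s) *\<^sub>R c + (- 1/s) *\<^sub>R y) = dist c y / s" for y
  proof -
    have "(1/s) *\<^sub>R c + (- 1/s) *\<^sub>R y = (1/s) *\<^sub>R (c - y)" by (simp add: algebra_simps)
    then show ?thesis using assms(1) by (simp only: norm_scaleR dist_norm) simp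
  qed
  then have "{y. bump n ((1/s) *\<^sub>R c + (- 1/s) *\<^sub>R y) \<noteq> 0} = ball c s"
    using assms(1) by (auto simp: bump_eq_0_iff not_le simp del: scaleR_minus_left)
  then show ?thesis
    using assms smooth_affine[OF smooth_bump, of n "(1/s) *\<^sub>R c" "- 1/s"]
    by (simp add: test_fun_def)
qed

lemma test_fun_scale: "test_fun \<Omega> \<phi> \<Longrightarrow> test_fun \<Omega> (\<lambda>y. c * \<phi> y)"
proof (cases "c = 0")
  case True then show ?thesis by (simp add: test_fun_def smooth_const)
next
  case False then show "test_fun \<Omega> \<phi> \<Longrightarrow> ?thesis" by (auto simp: test_fun_def smooth_const intro!: smooth_mult)
qed

lemma bounded_smooth_compact_support:
  assumes "smooth f" "\<And>x. norm x \<ge> 1 \<Longrightarrow> f x = 0"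
  obtains B where "B \<ge> 0" "\<And>x. \<bar>f x\<bar> \<le> B"
proof -
  have "bounded (f ` cball 0 1)"
    by (meson assms(1) compact_cball compact_continuous_image compact_imp_bounded continuous_on_subset smoothD(2) subset_UNIV)
  then obtain B where B: "\<And>x. x \<in> cball 0 1 \<Longrightarrow> \<bar>f x\<bar> \<le> B" by (force simp: bounded_iff)
  have "\<bar>f x\<bar> \<le> max 0 B" for x
    using assms(2)[of x] B[of x] by (cases "norm x \<ge> 1") auto
  then show ?thesis using that[of "max 0 B"] by auto
qed

section \<open>Square integrable functions and averaging\<close>

text \<open>The squared L2 norm as an extended real: limits, Fatou and Fubini apply without first
  establishing integrability.\<close>

definition nsq :: "'a measure \<Rightarrow> ('a \<Rightarrow> real) \<Rightarrow> ennreal" where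
  "nsq M f = (\<integral>\<^sup>+x. ennreal ((f x)\<^sup>2) \<partial>M)"

lemma nsq_add_le:
  assumes [measurable]: "f \<in> borel_measurable M" "g \<in> borel_measurable M"
  shows "nsq M (\<lambda>x. f x + g x) \<le> 2 * nsq M f + 2 * nsq M g"
proof -
  have "(f x + g x)\<^sup>2 \<le> 2 * (f x)\<^sup>2 + 2 * (g x)\<^sup>2" for x
    using sum_squares_bound[of "f x" "g x"] by (simp add: power2_sum)
  then have "nsq M (\<lambda>x. f x + g x) \<le> (\<integral>\<^sup>+x. 2 * ennreal ((f x)\<^sup>2) + 2 * ennreal ((g x)\<^sup>2) \<partial>M)"
    unfolding nsq_def
    by (intro nn_integral_mono) (simp flip: ennreal_numeral ennreal_mult ennreal_plus)
  then show ?thesis unfolding nsq_def by (simp add: nn_integral_add nn_integral_cmult)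
qed

lemma nsq_cong_AE: "AE x in M. f x = g x \<Longrightarrow> nsq M f = nsq M g"
  unfolding nsq_def by (rule nn_integral_cong_AE) auto

lemma nsq_minus_commute: "nsq M (\<lambda>x. f x - g x) = nsq M (\<lambda>x. g x - f x)"
  unfolding nsq_def by (simp add: power2_commute)

lemma nn_integral_lborel_affine:
  fixes c :: "'a::euclidean_space"
  assumes [measurable]: "f \<in> borel_measurable borel" and t: "t \<noteq> 0"
  shows "(\<integral>\<^sup>+x. f x \<partial>lborel) = ennreal (\<bar>t\<bar> ^ DIM('a)) * (\<integral>\<^sup>+x. f (c + t *\<^sub>R x) \<partial>lborel)"
  by (subst lborel_affine[OF t, of c]) (simp add: nn_integral_density nn_integral_distr nn_integral_cmult ennreal_power)

lemma integral_lborel_affine: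
  fixes c :: "'a::euclidean_space" and f :: "'a \<Rightarrow> real"
  assumes [measurable]: "f \<in> borel_measurable borel" and t: "t \<noteq> 0"
  shows "(\<integral>x. f x \<partial>lborel) = \<bar>t\<bar> ^ DIM('a) * (\<integral>x. f (c + t *\<^sub>R x) \<partial>lborel)"
  by (subst lborel_affine[OF t, of c]) (simp add: integral_density integral_distr ennreal_power)

text \<open>Dilation by t changes the squared norm by the factor t^(-d), at most 2^d for t \<ge>
  1/2. The bound is uniform in t and c, as needed to transfer convergence from a dense
  class.\<close>

lemma nsq_affine:
  fixes c :: "'a::euclidean_space"
  assumes [measurable]: "w \<in> borel_measurable borel" and t: "t \<ge> 1/2"
  shows "nsq lborel (\<lambda>x. w (c + t *\<^sub>R x)) \<le> ennreal (2 ^ DIM('a)) * nsq lborel w"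
proof -
  have "1 \<le> ennreal (2 ^ DIM('a)) * ennreal (\<bar>t\<bar> ^ DIM('a))"
  proof -
    have "1 \<le> (2 * \<bar>t\<bar>) ^ DIM('a)" using t by (intro one_le_power) auto
    then show ?thesis by (simp flip: ennreal_mult ennreal_1 add: power_mult_distrib)
  qed
  then have "1 * nsq lborel (\<lambda>x. w (c + t *\<^sub>R x)) \<le> ennreal (2 ^ DIM('a)) * ennreal (\<bar>t\<bar> ^ DIM('a)) * nsq lborel (\<lambda>x. w (c + t *\<^sub>R x))"
    by (intro mult_right_mono) auto
  moreover have "nsq lborel w = ennreal (\<bar>t\<bar> ^ DIM('a)) * nsq lborel (\<lambda>x. w (c + t *\<^sub>R x))"
    unfolding nsq_def using t by (subst nn_integral_lborel_affine[of _ t c]) auto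
  ultimately show ?thesis by (simp add: mult.assoc)
qed

lemma nsq_tendsto_0_dominated:
  assumes [measurable]: "\<And>n. f n \<in> borel_measurable M" "g \<in> borel_measurable M" "b \<in> borel_measurable M"
    and "\<And>n. AE x in M. (f n x - g x)\<^sup>2 \<le> b x" "(\<integral>\<^sup>+x. ennreal (b x) \<partial>M) < \<infinity>"
    and "AE x in M. (\<lambda>n. f n x) \<longlonglongrightarrow> g x"
  shows "(\<lambda>n. nsq M (\<lambda>x. f n x - g x)) \<longlonglongrightarrow> 0"
proof -
  have "(\<lambda>n. \<integral>\<^sup>+x. ennreal ((f n x - g x)\<^sup>2) \<partial>M) \<longlonglongrightarrow> (\<integral>\<^sup>+x. 0 \<partial>M)"
  proof (rule nn_integral_dominated_convergence[where w="\<lambda>x. ennreal (b x)"])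
    show "AE x in M. (\<lambda>n. ennreal ((f n x - g x)\<^sup>2)) \<longlonglongrightarrow> 0"
      using assms(6)
    proof eventually_elim
      case (elim x)
      have "(\<lambda>n. (f n x - g x)\<^sup>2) \<longlonglongrightarrow> (g x - g x)\<^sup>2" using elim by (intro tendsto_intros)
      then show ?case using tendsto_ennrealI by fastforce
    qed
    show "AE x in M. ennreal ((f j x - g x)\<^sup>2) \<le> ennreal (b x)" for j
      using assms(4)[of j] by eventually_elim (rule ennreal_leI)
  qed (use assms in auto)
  then show ?thesis by (simp add: nsq_def)
qed

lemma emeasure_ball_finite: "emeasure lborel (cball 0 (K::real) :: 'a::euclidean_space set) < \<infinity>"
  using emeasure_bounded_finite by blast

lemma nn_integral_indicator_cball_finite:
  "(\<integral>\<^sup>+x. ennreal (c * indicator (cball 0 (K::real) :: 'a::euclidean_space set) x) \<partial>lborel) < \<infinity>"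
proof -
  have "(\<integral>\<^sup>+x. ennreal (c * indicator (cball 0 K :: 'a set) x) \<partial>lborel) = (\<integral>\<^sup>+x. ennreal c * indicator (cball 0 K :: 'a set) x \<partial>lborel)"
    by (intro nn_integral_cong) (auto simp: indicator_def)
  then show ?thesis
    using emeasure_ball_finite[of K, where 'a='a] by (simp add: nn_integral_cmult_indicator ennreal_mult_less_top)
qed

text \<open>An a.e. approximation by continuous functions becomes one in L2 after clipping at height
  M and multiplying by a cut-off: neither changes the limit, and together they provide a constant on
  a ball as dominating function.\<close>

lemma square_integrable_approx_bounded:
  fixes w :: "'a::euclidean_space \<Rightarrow> real"
  assumes [measurable]: "w \<in> borel_measurable borel"
    and M: "M > 0" "\<And>x. \<bar>w x\<bar> \<le> M" and K: "\<And>x. norm x > K \<Longrightarrow> w x = 0" and e: "e > 0"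
  shows "\<exists>g. continuous_on UNIV g \<and> (\<forall>x. norm x > K + 1 \<longrightarrow> g x = 0) \<and> nsq lborel (\<lambda>x. g x - w x) < e"
proof -
  have "w measurable_on UNIV"
    by (intro lebesgue_measurable_imp_measurable_on) (auto intro: measurable_completion)
  then obtain N g where N: "negligible N" and cont: "\<And>n. continuous_on UNIV (g n)"
    and lim: "\<And>x. x \<notin> N \<Longrightarrow> (\<lambda>n. g n x) \<longlonglongrightarrow> w x"
    unfolding measurable_on_def by auto
  define h where "h n x = max 0 (min 1 (K + 1 - norm x)) * max (- M) (min M (g n x))" for n x
  have ch: "continuous_on UNIV (h n)" for n
    unfolding h_def by (intro continuous_intros cont)
  have h0: "h n x = 0" if "norm x > K + 1" for n x
    using that by (simp add: h_def)
  have hb: "\<bar>h n x\<bar> \<le> M" for n x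
  proof -
    have "\<bar>max 0 (min 1 (K + 1 - norm x))\<bar> * \<bar>max (- M) (min M (g n x))\<bar> \<le> 1 * M"
      using M by (intro mult_mono) auto
    then show ?thesis by (simp only: h_def abs_mult mult_1)
  qed
  have "(\<lambda>n. nsq lborel (\<lambda>x. h n x - w x)) \<longlonglongrightarrow> 0"
  proof (rule nsq_tendsto_0_dominated[where b="\<lambda>x. (2 * M)\<^sup>2 * indicator (cball 0 (K + 1)) x"])
    show "h n \<in> borel_measurable lborel" for n using borel_measurable_continuous_onI[OF ch] by simp
    show "AE x in lborel. (h n x - w x)\<^sup>2 \<le> (2 * M)\<^sup>2 * indicator (cball 0 (K + 1)) x" for n
    proof (rule AE_I2)
      fix x
      have "\<bar>h n x - w x\<bar> \<le> 2 * M" using hb[of n x] M(2)[of x] by linarith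
      then have "(h n x - w x)\<^sup>2 \<le> (2 * M)\<^sup>2" by (metis abs_ge_zero power2_abs power_mono)
      then show "(h n x - w x)\<^sup>2 \<le> (2 * M)\<^sup>2 * indicator (cball 0 (K + 1)) x"
        using h0[of x n] K[of x] by (auto simp: indicator_def)
    qed
    have "AE x in lebesgue. x \<notin> N"
      using N by (simp add: AE_iff_null_sets negligible_iff_null_sets AE_not_in)
    then have "AE x in lebesgue. (\<lambda>n. h n x) \<longlonglongrightarrow> w x"
    proof eventually_elim
      case (elim x)
      have "(\<lambda>n. h n x) \<longlonglongrightarrow> max 0 (min 1 (K + 1 - norm x)) * max (- M) (min M (w x))"
        unfolding h_def by (intro tendsto_intros lim elim)
      moreover have "max 0 (min 1 (K + 1 - norm x)) * max (- M) (min M (w x)) = w x"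
      proof (cases "norm x > K")
        case True then show ?thesis using K M(1) by simp
      next
        case False
        then have "min 1 (K + 1 - norm x) = 1" "min M (w x) = w x" "max (- M) (w x) = w x"
          using M(2)[of x] by auto
        then show ?thesis by simp
      qed
      ultimately show ?case by simp
    qed
    moreover have [measurable]: "h n \<in> borel_measurable borel" for n using borel_measurable_continuous_onI[OF ch] by simp
    have "Measurable.pred lborel (\<lambda>x. (\<lambda>n. h n x) \<longlonglongrightarrow> w x)" by simp
    ultimately show "AE x in lborel. (\<lambda>n. h n x) \<longlonglongrightarrow> w x" by (simp add: AE_completion_iff)
  qed (use nn_integral_indicator_cball_finite in \<open>auto intro!: borel_measurable_times borel_measurable_indicator\<close>)
  from order_tendstoD(2)[OF this e] obtain n where "nsq lborel (\<lambda>x. h n x - w x) < e"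
    by (auto simp: eventually_sequentially)
  then show ?thesis using ch h0 by blast
qed

text \<open>Reduces to the bounded case by clipping at increasing heights, with the square of w as
  dominating function. The two errors e/4 add up to e through the factor 2 in
  \<open>nsq_add_le\<close>.\<close>

lemma square_integrable_approx:
  fixes w :: "'a::euclidean_space \<Rightarrow> real"
  assumes [measurable]: "w \<in> borel_measurable borel" and fin: "nsq lborel w < \<infinity>"
    and K: "\<And>x. norm x > K \<Longrightarrow> w x = 0" and e: "e > 0"
  shows "\<exists>g. continuous_on UNIV g \<and> (\<forall>x. norm x > K + 1 \<longrightarrow> g x = 0) \<and> nsq lborel (\<lambda>x. g x - w x) < e"
proof -
  define v where "v n x = max (- real (Suc n)) (min (real (Suc n)) (w x))" for n x
  have [measurable]: "v n \<in> borel_measurable borel" for n unfolding v_def by measurable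
  have e4: "e / 4 > 0" using e by (simp add: ennreal_divide_eq_0_iff zero_less_iff_neq_zero)
  have "(\<lambda>n. nsq lborel (\<lambda>x. v n x - w x)) \<longlonglongrightarrow> 0"
  proof (rule nsq_tendsto_0_dominated[where b="\<lambda>x. (w x)\<^sup>2"])
    show "AE x in lborel. (v n x - w x)\<^sup>2 \<le> (w x)\<^sup>2" for n
    proof (rule AE_I2)
      fix x
      have "\<bar>v n x - w x\<bar> \<le> \<bar>w x\<bar>" unfolding v_def by linarith
      then show "(v n x - w x)\<^sup>2 \<le> (w x)\<^sup>2" by (simp add: abs_le_square_iff)
    qed
    show "AE x in lborel. (\<lambda>n. v n x) \<longlonglongrightarrow> w x"
    proof (rule AE_I2)
      fix x
      obtain m where m: "\<bar>w x\<bar> \<le> real m" using real_arch_simple by blast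
      have "v n x = w x" if "n \<ge> m" for n
        using m that unfolding v_def by linarith
      then show "(\<lambda>n. v n x) \<longlonglongrightarrow> w x"
        by (intro tendsto_eventually eventually_sequentiallyI[of m])
    qed
  qed (use fin in \<open>auto simp: nsq_def\<close>)
  from order_tendstoD(2)[OF this e4] obtain n where n: "nsq lborel (\<lambda>x. v n x - w x) < e / 4"
    by (auto simp: eventually_sequentially)
  obtain g where g: "continuous_on UNIV g" "\<And>x. norm x > K + 1 \<Longrightarrow> g x = 0" "nsq lborel (\<lambda>x. g x - v n x) < e / 4"
  proof -
    have "\<bar>v n x\<bar> \<le> real (Suc n)" for x unfolding v_def by linarith
    moreover have "norm x > K \<Longrightarrow> v n x = 0" for x using K[of x] by (simp add: v_def)
    ultimately have "\<exists>g. continuous_on UNIV g \<and> (\<forall>x. norm x > K + 1 \<longrightarrow> g x = 0) \<and> nsq lborel (\<lambda>x. g x - v n x) < e / 4"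
      using e4 by (intro square_integrable_approx_bounded[of "v n" "real (Suc n)" K]) auto
    then show thesis using that by blast
  qed
  have [measurable]: "g \<in> borel_measurable borel" using borel_measurable_continuous_onI[OF g(1)] .
  have "nsq lborel (\<lambda>x. g x - w x) = nsq lborel (\<lambda>x. (g x - v n x) + (v n x - w x))" by simp
  also have "\<dots> \<le> 2 * nsq lborel (\<lambda>x. g x - v n x) + 2 * nsq lborel (\<lambda>x. v n x - w x)"
    by (rule nsq_add_le) auto
  also have "\<dots> < 2 * (e / 4) + 2 * (e / 4)"
    using n g(3) by (intro add_strict_mono ennreal_mult_strict_left_mono) auto
  also have "\<dots> = e"
  proof (cases e rule: ennreal_cases)
    case (real r)
    then show ?thesis by (simp add: divide_ennreal flip: ennreal_numeral ennreal_mult ennreal_plus)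
  qed (auto simp: ennreal_top_divide ennreal_top_mult ennreal_mult_top)
  finally show ?thesis using g by blast
qed

text \<open>Affine maps close to the identity move functions little in L2: for continuous functions
  of compact support by dominated convergence, and in general because \<open>nsq_affine\<close>
  controls the error of approximating w uniformly in n.\<close>

lemma nsq_affine_tendsto:
  fixes w :: "'a::euclidean_space \<Rightarrow> real"
  assumes [measurable]: "w \<in> borel_measurable borel" and fin: "nsq lborel w < \<infinity>"
    and K: "\<And>x. norm x > K \<Longrightarrow> w x = 0"
    and t: "t \<longlonglongrightarrow> 1" "\<And>n. t n \<ge> 1/2" and c: "c \<longlonglongrightarrow> 0"
  shows "(\<lambda>n. nsq lborel (\<lambda>x. w (c n + t n *\<^sub>R x) - w x)) \<longlonglongrightarrow> 0"
proof -
  obtain B where B: "B > 0" "\<And>n. norm (c n) \<le> B"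
    using convergent_imp_Bseq[OF convergentI[OF c]] by (auto elim: BseqE)
  have cont: "(\<lambda>n. nsq lborel (\<lambda>x. g (c n + t n *\<^sub>R x) - g x)) \<longlonglongrightarrow> 0"
    if g: "continuous_on UNIV g" "\<And>x. norm x > L \<Longrightarrow> g x = 0" for g :: "'a \<Rightarrow> real" and L
  proof -
    have [measurable]: "g \<in> borel_measurable borel" using borel_measurable_continuous_onI[OF g(1)] .
    have "bounded (g ` cball 0 L)"
      by (meson g(1) compact_cball compact_continuous_image compact_imp_bounded continuous_on_subset subset_UNIV)
    then obtain M where M: "\<And>x. x \<in> cball 0 L \<Longrightarrow> \<bar>g x\<bar> \<le> M" by (force simp: bounded_iff)
    have Mb: "\<bar>g x\<bar> \<le> \<bar>M\<bar>" for x using M[of x] g(2)[of x] by (cases "norm x \<le> L") auto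
    show ?thesis
    proof (rule nsq_tendsto_0_dominated[where b="\<lambda>x. (2 * \<bar>M\<bar>)\<^sup>2 * indicator (cball 0 (2 * (\<bar>L\<bar> + B))) x"])
      show "AE x in lborel. (g (c n + t n *\<^sub>R x) - g x)\<^sup>2 \<le> (2 * \<bar>M\<bar>)\<^sup>2 * indicator (cball 0 (2 * (\<bar>L\<bar> + B))) x" for n
      proof (rule AE_I2)
        fix x
        have "\<bar>g (c n + t n *\<^sub>R x) - g x\<bar> \<le> 2 * \<bar>M\<bar>" using Mb[of "c n + t n *\<^sub>R x"] Mb[of x] by linarith
        then have 1: "(g (c n + t n *\<^sub>R x) - g x)\<^sup>2 \<le> (2 * \<bar>M\<bar>)\<^sup>2" by (metis abs_ge_zero power2_abs power_mono)
        have 2: "g (c n + t n *\<^sub>R x) = 0 \<and> g x = 0" if x: "norm x > 2 * (\<bar>L\<bar> + B)"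
        proof -
          have "1/2 * norm x \<le> t n * norm x" using t(2)[of n] by (intro mult_right_mono) auto
          then have "norm (t n *\<^sub>R x) > \<bar>L\<bar> + B" using x t(2)[of n] by auto
          moreover have "norm (t n *\<^sub>R x) \<le> norm (c n + t n *\<^sub>R x) + norm (c n)"
            by (metis add.commute add_diff_cancel_left' norm_triangle_ineq4)
          ultimately have "norm (c n + t n *\<^sub>R x) > L" using B(2)[of n] by linarith
          then show ?thesis using g(2) x B(1) by auto
        qed
        show "(g (c n + t n *\<^sub>R x) - g x)\<^sup>2 \<le> (2 * \<bar>M\<bar>)\<^sup>2 * indicator (cball 0 (2 * (\<bar>L\<bar> + B))) x"
          using 1 2 by (cases "norm x > 2 * (\<bar>L\<bar> + B)") (auto simp: indicator_def)
      qed
      show "AE x in lborel. (\<lambda>n. g (c n + t n *\<^sub>R x)) \<longlonglongrightarrow> g x"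
      proof (rule AE_I2)
        fix x
        have "(\<lambda>n. c n + t n *\<^sub>R x) \<longlonglongrightarrow> 0 + 1 *\<^sub>R x" by (intro tendsto_intros t c)
        moreover have "isCont g (0 + 1 *\<^sub>R x)" using g(1) by (simp add: continuous_on_eq_continuous_at)
        ultimately show "(\<lambda>n. g (c n + t n *\<^sub>R x)) \<longlonglongrightarrow> g x" using isCont_tendsto_compose[of "0 + 1 *\<^sub>R x" g "\<lambda>n. c n + t n *\<^sub>R x"] by simp
      qed
    qed (use nn_integral_indicator_cball_finite in \<open>auto intro!: borel_measurable_times borel_measurable_indicator\<close>)
  qed
  show ?thesis
  proof (rule order_tendstoI)
    fix e :: ennreal assume e: "e > 0"
    obtain r where r: "r > 0" "ennreal r < e"
    proof -
      obtain z where z: "0 < z" "z < e" using dense[OF e] by blast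
      show thesis
      proof (cases z rule: ennreal_cases)
        case (real r) then show thesis using z that[of r] by auto
      qed (use z in auto)
    qed
    \<comment> \<open>Chosen so that the two replacements of w by g contribute (2 * 2^d + 4) q = r/2
      in total; the term with g alone contributes 4 * r/8.\<close>
    define q where "q = r / (2 * (2 * 2 ^ DIM('a) + 4))"
    have D2: "(2 * 2 ^ DIM('a) + 4 :: real) > 0" by (simp add: pos_add_strict)
    have q: "q > 0" using r D2 by (simp add: q_def)
    obtain g where g: "continuous_on UNIV g" "\<And>x. norm x > K + 1 \<Longrightarrow> g x = 0"
      "nsq lborel (\<lambda>x. g x - w x) < ennreal q"
      using square_integrable_approx[OF assms(1) fin K, where e="ennreal q"] q by auto
    have [measurable]: "g \<in> borel_measurable borel" using borel_measurable_continuous_onI[OF g(1)] .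
    have r8: "ennreal (r / 8) > 0" using r by simp
    have "eventually (\<lambda>n. nsq lborel (\<lambda>x. g (c n + t n *\<^sub>R x) - g x) < ennreal (r / 8)) sequentially"
      using order_tendstoD(2)[OF cont[OF g(1,2)] r8] by simp
    then show "eventually (\<lambda>n. nsq lborel (\<lambda>x. w (c n + t n *\<^sub>R x) - w x) < e) sequentially"
    proof eventually_elim
      case (elim n)
      let ?T = "\<lambda>x. c n + t n *\<^sub>R x"
      have "nsq lborel (\<lambda>x. w (?T x) - w x) = nsq lborel (\<lambda>x. (w (?T x) - g (?T x)) + ((g (?T x) - g x) + (g x - w x)))"
        by simp
      also have "\<dots> \<le> 2 * nsq lborel (\<lambda>x. w (?T x) - g (?T x)) + 2 * nsq lborel (\<lambda>x. (g (?T x) - g x) + (g x - w x))"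
        by (rule nsq_add_le) auto
      also have "\<dots> \<le> 2 * (ennreal (2 ^ DIM('a)) * nsq lborel (\<lambda>x. w x - g x)) + 2 * (2 * nsq lborel (\<lambda>x. g (?T x) - g x) + 2 * nsq lborel (\<lambda>x. g x - w x))"
        using nsq_affine[of "\<lambda>x. w x - g x" "t n" "c n", OF _ t(2)]
        by (intro add_mono mult_left_mono nsq_add_le) auto
      also have "\<dots> \<le> 2 * (ennreal (2 ^ DIM('a)) * ennreal q) + 2 * (2 * ennreal (r / 8) + 2 * ennreal q)"
        using elim g(3) nsq_minus_commute[of lborel w g]
        by (intro add_mono mult_left_mono) (auto intro: less_imp_le)
      also have "\<dots> = ennreal ((2 * 2 ^ DIM('a) + 4) * q + r / 2)"
        using q r by (simp flip: ennreal_numeral ennreal_mult ennreal_plus add: algebra_simps)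
      also have "(2 * 2 ^ DIM('a) + 4) * q + r / 2 = r"
        using D2 by (simp add: q_def field_simps)
      finally show ?case using r by auto
    qed
  qed auto
qed

section \<open>The mollifier and scaled averages\<close>

definition kmass :: "'a::euclidean_space itself \<Rightarrow> real" where
  "kmass _ = (\<integral>x. bump 2 (x::'a) \<partial>lborel)"

definition mker :: "'a::euclidean_space \<Rightarrow> real" where
  "mker x = bump 2 x / kmass TYPE('a)"

lemma bump_measurable [measurable]: "bump n \<in> borel_measurable borel"
  using smoothD(2)[OF smooth_bump] borel_measurable_continuous_onI by blast

lemma integrable_compact_support:
  fixes f :: "'a::euclidean_space \<Rightarrow> real"
  assumes [measurable]: "f \<in> borel_measurable borel" and B: "\<And>x. \<bar>f x\<bar> \<le> B" and 0: "\<And>x. norm x > K \<Longrightarrow> f x = 0"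
  shows "integrable lborel f"
proof (rule integrableI_bounded_set[where A="cball 0 K" and B=B])
  show "emeasure lborel (cball 0 K :: 'a set) < \<infinity>" by (rule emeasure_ball_finite)
qed (use B 0 in \<open>auto simp: not_le intro!: AE_I2\<close>)

lemma bump_bounded: obtains B where "B \<ge> 0" "\<And>x::'a::euclidean_space. \<bar>bump n x\<bar> \<le> B"
  using bounded_smooth_compact_support[OF smooth_bump, of n] bump_eq_0_iff by metis

lemma kmass_pos: "kmass TYPE('a::euclidean_space) > 0"
proof -
  obtain B where B: "B \<ge> 0" "\<And>x::'a. \<bar>bump 2 x\<bar> \<le> B" using bump_bounded by blast
  have int: "integrable lborel (bump 2 :: 'a \<Rightarrow> real)"
    by (rule integrable_compact_support[OF _ B(2), where K=1]) (auto simp: bump_eq_0_iff)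
  have "kmass TYPE('a) \<noteq> 0"
  proof
    assume "kmass TYPE('a) = 0"
    then have "AE x::'a in lborel. bump 2 x = 0"
      using integral_nonneg_eq_0_iff_AE[OF int] by (simp add: kmass_def bump_nonneg)
    then have "emeasure lborel {x::'a. bump 2 x \<noteq> 0} = 0"
      by (subst (asm) AE_iff_measurable[OF _ refl]) auto
    moreover have "{x::'a. bump 2 x \<noteq> 0} = ball 0 1" by (auto simp: bump_eq_0_iff)
    ultimately show False using emeasure_ball[of 1 "0::'a", simplified] unit_ball_vol_pos[of "real DIM('a)"] by auto
  qed
  moreover have "kmass TYPE('a) \<ge> 0" unfolding kmass_def by (rule integral_nonneg_AE) (simp add: bump_nonneg)
  ultimately show ?thesis by linarith
qed

lemma mker_props:
  fixes x :: "'a::euclidean_space"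
  shows mker_measurable [measurable]: "(mker :: 'a::euclidean_space \<Rightarrow> real) \<in> borel_measurable borel"
    and mker_nonneg: "mker x \<ge> 0"
    and mker_eq_0: "norm x \<ge> 1 \<Longrightarrow> mker x = 0"
    and mker_integrable: "integrable lborel (mker :: 'a \<Rightarrow> real)"
    and mker_integral: "(\<integral>x. mker x \<partial>(lborel :: 'a measure)) = 1"
    and mker_nn_integral: "(\<integral>\<^sup>+x. ennreal (mker x) \<partial>(lborel :: 'a measure)) = 1"
proof -
  show m: "(mker :: 'a \<Rightarrow> real) \<in> borel_measurable borel" unfolding mker_def[abs_def] by measurable
  show nn: "mker x \<ge> 0" for x :: 'a using kmass_pos[where 'a='a] by (simp add: mker_def bump_nonneg)
  show "norm x \<ge> 1 \<Longrightarrow> mker x = 0" for x :: 'a by (simp add: mker_def bump_eq_0_iff)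
  obtain B where B: "B \<ge> 0" "\<And>x::'a. \<bar>bump 2 x\<bar> \<le> B" using bump_bounded by blast
  have int: "integrable lborel (bump 2 :: 'a \<Rightarrow> real)"
    by (rule integrable_compact_support[OF _ B(2), where K=1]) (auto simp: bump_eq_0_iff)
  then show i: "integrable lborel (mker :: 'a \<Rightarrow> real)" unfolding mker_def[abs_def] by simp
  show 1: "(\<integral>x. mker x \<partial>(lborel :: 'a measure)) = 1"
    using kmass_pos[where 'a='a] by (simp add: mker_def kmass_def)
  show "(\<integral>\<^sup>+x. ennreal (mker x) \<partial>(lborel :: 'a measure)) = 1"
    using nn_integral_eq_integral[OF i] nn 1 by simp
qed

text \<open>Mollification at scale s composed with the affine map x \<mapsto> c + t x. The affine
  part will be a contraction towards an interior point, which makes room for the mollifier; t = 1, c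
  = 0 is plain mollification.\<close>

definition average :: "real \<Rightarrow> 'a::euclidean_space \<Rightarrow> real \<Rightarrow> ('a \<Rightarrow> real) \<Rightarrow> 'a \<Rightarrow> real" where
  "average t c s w x = (\<integral>y. mker y * w (c + t *\<^sub>R x + s *\<^sub>R y) \<partial>lborel)"

lemma integrable_of_nsq:
  fixes w :: "'a::euclidean_space \<Rightarrow> real"
  assumes [measurable]: "w \<in> borel_measurable borel" and fin: "nsq lborel w < \<infinity>"
    and K: "\<And>x. norm x > K \<Longrightarrow> w x = 0"
  shows "integrable lborel w" "integrable lborel (\<lambda>x. (w x)\<^sup>2)"
proof -
  show 2: "integrable lborel (\<lambda>x. (w x)\<^sup>2)"
    using fin by (intro integrableI_bounded) (auto simp: nsq_def)
  have "integrable lborel (indicator (cball 0 K :: 'a set) :: 'a \<Rightarrow> real)"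
    using emeasure_ball_finite by (intro integrable_real_indicator) auto
  then have "integrable lborel (\<lambda>x. indicator (cball 0 K) x + (w x)\<^sup>2)" using 2 by simp
  then show "integrable lborel w"
  proof (rule Bochner_Integration.integrable_bound)
    show "AE x in lborel. norm (w x) \<le> norm (indicator (cball 0 K) x + (w x)\<^sup>2)"
    proof (rule AE_I2)
      fix x
      have "\<bar>w x\<bar> \<le> 1 + (w x)\<^sup>2"
      proof -
        have "2 * \<bar>w x\<bar> \<le> 1 + (w x)\<^sup>2" using sum_squares_bound[of 1 "\<bar>w x\<bar>"] by simp
        then show ?thesis using abs_ge_zero[of "w x"] by linarith
      qed
      then show "norm (w x) \<le> norm (indicator (cball 0 K) x + (w x)\<^sup>2)"
        using K[of x] by (auto simp: indicator_def)
    qed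
  qed auto
qed

lemma integrable_affine:
  fixes c :: "'a::euclidean_space" and f :: "'a \<Rightarrow> real"
  assumes "integrable lborel f" and s: "s \<noteq> 0"
  shows "integrable lborel (\<lambda>x. f (c + s *\<^sub>R x))"
proof -
  have [measurable]: "f \<in> borel_measurable borel" using assms(1) by auto
  have "(\<integral>\<^sup>+x. ennreal (norm (f x)) \<partial>lborel) < \<infinity>" using assms(1) by (simp add: integrable_iff_bounded)
  moreover have "(\<integral>\<^sup>+x. ennreal (norm (f x)) \<partial>lborel) = ennreal (\<bar>s\<bar> ^ DIM('a)) * (\<integral>\<^sup>+x. ennreal (norm (f (c + s *\<^sub>R x))) \<partial>lborel)"
    using s by (intro nn_integral_lborel_affine) auto
  moreover have "\<bar>s\<bar> ^ DIM('a) > 0" using s by simp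
  ultimately have "(\<integral>\<^sup>+x. ennreal (norm (f (c + s *\<^sub>R x))) \<partial>lborel) < \<infinity>"
    by (auto simp: ennreal_mult_less_top)
  then show ?thesis by (intro integrableI_bounded) auto
qed

lemma integrable_mker_mult:
  fixes w :: "'a::euclidean_space \<Rightarrow> real"
  assumes w: "integrable lborel w" and s: "s \<noteq> 0"
  shows "integrable lborel (\<lambda>y. mker y * w (c + s *\<^sub>R y))"
proof -
  have [measurable]: "w \<in> borel_measurable borel" using w by auto
  obtain B where B: "B \<ge> 0" "\<And>x::'a. \<bar>bump 2 x\<bar> \<le> B" using bump_bounded by blast
  have b: "\<bar>mker x\<bar> \<le> B / kmass TYPE('a)" for x :: 'a
    using B(2)[of x] kmass_pos[where 'a='a] by (simp add: mker_def abs_mult divide_right_mono)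
  show ?thesis
  proof (rule Bochner_Integration.integrable_bound[where f="\<lambda>y. (B / kmass TYPE('a)) * w (c + s *\<^sub>R y)"])
    show "AE y in lborel. norm (mker y * w (c + s *\<^sub>R y)) \<le> norm ((B / kmass TYPE('a)) * w (c + s *\<^sub>R y))"
    proof (rule AE_I2)
      fix y show "norm (mker y * w (c + s *\<^sub>R y)) \<le> norm ((B / kmass TYPE('a)) * w (c + s *\<^sub>R y))"
        unfolding norm_mult[of "mker y"] norm_mult[of "B / kmass TYPE('a)"]
        by (intro mult_right_mono) (use b[of y] B(1) kmass_pos[where 'a='a] in auto)
    qed
  qed (auto intro!: integrable_affine assms)
qed

text \<open>Jensen's inequality for the probability density \<open>mker\<close>.\<close>

lemma average_diff_le:
  fixes w :: "'a::euclidean_space \<Rightarrow> real"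
  assumes w: "integrable lborel w" and s: "s \<noteq> 0"
  shows "ennreal ((average t c s w x - w x)\<^sup>2)
    \<le> (\<integral>\<^sup>+y. ennreal (mker y) * ennreal ((w (c + t *\<^sub>R x + s *\<^sub>R y) - w x)\<^sup>2) \<partial>lborel)"
proof -
  have [measurable]: "w \<in> borel_measurable borel" using w by auto
  let ?F = "\<lambda>y. w (c + t *\<^sub>R x + s *\<^sub>R y) - w x"
  have i: "integrable lborel (\<lambda>y. mker y * w (c + t *\<^sub>R x + s *\<^sub>R y))"
    using integrable_mker_mult[OF w s] by blast
  have "average t c s w x - w x = (\<integral>y. mker y * w (c + t *\<^sub>R x + s *\<^sub>R y) \<partial>lborel) - (\<integral>y. mker y * w x \<partial>(lborel :: 'a measure))"
    by (simp add: average_def mker_integral)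
  also have "\<dots> = (\<integral>y. mker y * ?F y \<partial>lborel)"
    using i mker_integrable by (subst Bochner_Integration.integral_diff[symmetric]) (auto simp: right_diff_distrib)
  finally have "ennreal \<bar>average t c s w x - w x\<bar> \<le> (\<integral>\<^sup>+y. ennreal \<bar>mker y * ?F y\<bar> \<partial>lborel)"
    using integral_norm_bound_ennreal[of lborel "\<lambda>y. mker y * ?F y"] i mker_integrable[where 'a='a]
    by (simp add: right_diff_distrib)
  also have "\<dots> = (\<integral>\<^sup>+y. ennreal (sqrt (mker y)) * ennreal (sqrt (mker y) * \<bar>?F y\<bar>) \<partial>lborel)"
    by (intro nn_integral_cong) (simp flip: ennreal_mult add: mker_nonneg abs_mult)
  finally have "(ennreal \<bar>average t c s w x - w x\<bar>)\<^sup>2 \<le> (\<integral>\<^sup>+y. ennreal (sqrt (mker y)) * ennreal (sqrt (mker y) * \<bar>?F y\<bar>) \<partial>lborel)\<^sup>2"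
    by (intro power_mono) auto
  also have "\<dots> \<le> (\<integral>\<^sup>+y. (ennreal (sqrt (mker y)))\<^sup>2 \<partial>(lborel :: 'a measure)) * (\<integral>\<^sup>+y. (ennreal (sqrt (mker y) * \<bar>?F y\<bar>))\<^sup>2 \<partial>lborel)"
    by (rule Cauchy_Schwarz_nn_integral[where f="\<lambda>y. ennreal (sqrt (mker y))" and g="\<lambda>y. ennreal (sqrt (mker y) * \<bar>?F y\<bar>)"]) auto
  also have "\<dots> = (\<integral>\<^sup>+y. ennreal (mker y) \<partial>(lborel :: 'a measure)) * (\<integral>\<^sup>+y. ennreal (mker y) * ennreal ((?F y)\<^sup>2) \<partial>lborel)"
    by (simp add: ennreal_power mker_nonneg power_mult_distrib ennreal_mult)
  finally show ?thesis
    by (simp add: mker_nn_integral ennreal_power)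
qed

text \<open>Jensen and Fubini bound the squared error by the average over y of the squared errors of
  the affine maps with shift c n + s n y. Each of these tends to 0 and all stay below the constant
  B, so dominated convergence applies in y.\<close>

lemma average_tendsto:
  fixes w :: "'a::euclidean_space \<Rightarrow> real"
  assumes [measurable]: "w \<in> borel_measurable borel" and fin: "nsq lborel w < \<infinity>"
    and K: "\<And>x. norm x > K \<Longrightarrow> w x = 0"
    and t: "t \<longlonglongrightarrow> 1" "\<And>n. t n \<ge> 1/2" and c: "c \<longlonglongrightarrow> 0" and s: "s \<longlonglongrightarrow> 0" "\<And>n. s n \<noteq> 0"
  shows "(\<lambda>n. nsq lborel (\<lambda>x. average (t n) (c n) (s n) w x - w x)) \<longlonglongrightarrow> 0"
proof -
  define G where "G n y = nsq lborel (\<lambda>x. w ((c n + s n *\<^sub>R y) + t n *\<^sub>R x) - w x)" for n y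
  have wi: "integrable lborel w" using integrable_of_nsq[OF assms(1-2) K] by simp
  have [measurable]: "G n \<in> borel_measurable borel" for n
    unfolding G_def nsq_def by measurable
  define B where "B = 2 * (ennreal (2 ^ DIM('a)) * nsq lborel w) + 2 * nsq lborel w"
  have GB: "G n y \<le> B" for n y
  proof -
    have "G n y = nsq lborel (\<lambda>x. w ((c n + s n *\<^sub>R y) + t n *\<^sub>R x) + - w x)" by (simp add: G_def)
    also have "\<dots> \<le> 2 * nsq lborel (\<lambda>x. w ((c n + s n *\<^sub>R y) + t n *\<^sub>R x)) + 2 * nsq lborel (\<lambda>x. - w x)"
      by (rule nsq_add_le) auto
    also have "\<dots> \<le> B" unfolding B_def
      by (intro add_mono mult_left_mono nsq_affine t) (auto simp: nsq_def)
    finally show ?thesis .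
  qed
  have le: "nsq lborel (\<lambda>x. average (t n) (c n) (s n) w x - w x) \<le> (\<integral>\<^sup>+y. ennreal (mker y) * G n y \<partial>lborel)" for n
  proof -
    have "nsq lborel (\<lambda>x. average (t n) (c n) (s n) w x - w x) \<le>
      (\<integral>\<^sup>+x. (\<integral>\<^sup>+y. ennreal (mker y) * ennreal ((w (c n + t n *\<^sub>R x + s n *\<^sub>R y) - w x)\<^sup>2) \<partial>lborel) \<partial>lborel)"
      unfolding nsq_def by (intro nn_integral_mono average_diff_le wi s)
    also have "\<dots> = (\<integral>\<^sup>+y. (\<integral>\<^sup>+x. ennreal (mker y) * ennreal ((w (c n + t n *\<^sub>R x + s n *\<^sub>R y) - w x)\<^sup>2) \<partial>lborel) \<partial>lborel)"
      by (rule lborel_pair.Fubini') measurable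
    also have "\<dots> = (\<integral>\<^sup>+y. ennreal (mker y) * G n y \<partial>lborel)"
      by (intro nn_integral_cong) (simp add: G_def nsq_def nn_integral_cmult add_ac)
    finally show ?thesis .
  qed
  have "(\<lambda>n. \<integral>\<^sup>+y. ennreal (mker y) * G n y \<partial>lborel) \<longlonglongrightarrow> (\<integral>\<^sup>+y. 0 \<partial>(lborel :: 'a measure))"
  proof (rule nn_integral_dominated_convergence[where w="\<lambda>y. ennreal (mker y) * B"])
    show "AE y in lborel. ennreal (mker y) * G n y \<le> ennreal (mker y) * B" for n
      using GB by (intro AE_I2 mult_left_mono) auto
    have "B < \<infinity>" using fin unfolding B_def by (auto simp: ennreal_mult_less_top)
    then show "(\<integral>\<^sup>+y. ennreal (mker y) * B \<partial>(lborel :: 'a measure)) < \<infinity>"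
      by (simp add: nn_integral_multc mker_nn_integral)
    show "AE y in lborel. (\<lambda>n. ennreal (mker y) * G n y) \<longlonglongrightarrow> 0"
    proof (rule AE_I2)
      fix y :: 'a
      have "(\<lambda>n. c n + s n *\<^sub>R y) \<longlonglongrightarrow> 0 + 0 *\<^sub>R y" by (intro tendsto_intros c s)
      then have "(\<lambda>n. G n y) \<longlonglongrightarrow> 0"
        unfolding G_def by (intro nsq_affine_tendsto[OF assms(1-2) K t]) auto
      then have "(\<lambda>n. ennreal (mker y) * G n y) \<longlonglongrightarrow> ennreal (mker y) * 0"
        by (intro ennreal_tendsto_cmult) auto
      then show "(\<lambda>n. ennreal (mker y) * G n y) \<longlonglongrightarrow> 0" by simp
    qed
  qed measurable
  then have "(\<lambda>n. \<integral>\<^sup>+y. ennreal (mker y) * G n y \<partial>lborel) \<longlonglongrightarrow> 0" by simp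
  from tendsto_sandwich[OF always_eventually always_eventually tendsto_const this] le show ?thesis by simp
qed

section \<open>The space L2\<close>

lemma integrable_mult_square:
  fixes f g :: "'a \<Rightarrow> real"
  assumes "f \<in> borel_measurable M" "g \<in> borel_measurable M"
    and "integrable M (\<lambda>x. (f x)\<^sup>2)" "integrable M (\<lambda>x. (g x)\<^sup>2)"
  shows "integrable M (\<lambda>x. f x * g x)"
proof (rule Bochner_Integration.integrable_bound[of _ "\<lambda>x. (f x)\<^sup>2 + (g x)\<^sup>2"])
  show "AE x in M. norm (f x * g x) \<le> norm ((f x)\<^sup>2 + (g x)\<^sup>2)"
  proof (rule AE_I2)
    fix x
    have "2 * (\<bar>f x\<bar> * \<bar>g x\<bar>) \<le> (f x)\<^sup>2 + (g x)\<^sup>2"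
      using sum_squares_bound[of "\<bar>f x\<bar>" "\<bar>g x\<bar>"] by simp
    moreover have "0 \<le> \<bar>f x\<bar> * \<bar>g x\<bar>" by simp
    ultimately have "\<bar>f x\<bar> * \<bar>g x\<bar> \<le> (f x)\<^sup>2 + (g x)\<^sup>2" by linarith
    then show "norm (f x * g x) \<le> norm ((f x)\<^sup>2 + (g x)\<^sup>2)"
      by (simp add: abs_mult)
  qed
qed (use assms in auto)

text \<open>The discriminant argument for the nonnegative quadratic t \<mapsto> A + 2 t B + t^2
  C.\<close>

lemma integral_Cauchy_Schwarz:
  fixes f g :: "'a \<Rightarrow> real"
  assumes f: "f \<in> borel_measurable M" and g: "g \<in> borel_measurable M"
    and f2: "integrable M (\<lambda>x. (f x)\<^sup>2)" and g2: "integrable M (\<lambda>x. (g x)\<^sup>2)"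
  shows "\<bar>\<integral>x. f x * g x \<partial>M\<bar> \<le> sqrt (\<integral>x. (f x)\<^sup>2 \<partial>M) * sqrt (\<integral>x. (g x)\<^sup>2 \<partial>M)"
proof -
  define A B C where "A = (\<integral>x. (f x)\<^sup>2 \<partial>M)" and "B = (\<integral>x. f x * g x \<partial>M)" and "C = (\<integral>x. (g x)\<^sup>2 \<partial>M)"
  have fg: "integrable M (\<lambda>x. f x * g x)" by (rule integrable_mult_square[OF f g f2 g2])
  have q: "0 \<le> A + 2 * t * B + t\<^sup>2 * C" for t
  proof -
    have "(\<integral>x. (f x + t * g x)\<^sup>2 \<partial>M) = (\<integral>x. (f x)\<^sup>2 + 2 * t * (f x * g x) + t\<^sup>2 * (g x)\<^sup>2 \<partial>M)"
      by (intro Bochner_Integration.integral_cong) (auto simp: power2_eq_square algebra_simps)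
    also have "\<dots> = A + 2 * t * B + t\<^sup>2 * C"
      using f2 g2 fg unfolding A_def B_def C_def by simp
    finally have "(\<integral>x. (f x + t * g x)\<^sup>2 \<partial>M) = A + 2 * t * B + t\<^sup>2 * C" .
    moreover have "0 \<le> (\<integral>x. (f x + t * g x)\<^sup>2 \<partial>M)" by simp
    ultimately show ?thesis by simp
  qed
  have "C \<ge> 0" "A \<ge> 0" unfolding A_def C_def by auto
  have "B\<^sup>2 \<le> A * C"
  proof (cases "C = 0")
    case True
    have "B = 0"
    proof (rule ccontr)
      assume "B \<noteq> 0"
      \<comment> \<open>With C = 0 this value of t makes the quadratic equal to -1.\<close>
      then have "2 * (- (A + 1) / (2 * B)) * B = - (A + 1)" by simp
      then show False using q[of "- (A + 1) / (2 * B)"] True by simp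
    qed
    then show ?thesis using True by simp
  next
    case False
    then have "C > 0" using \<open>C \<ge> 0\<close> by simp
    have "(- B / C)\<^sup>2 * C = B\<^sup>2 / C" "2 * (- B / C) * B = - 2 * (B\<^sup>2 / C)"
      using False by (simp_all add: power2_eq_square)
    then have "B\<^sup>2 / C \<le> A" using q[of "- B / C"] by linarith
    then show ?thesis using \<open>C > 0\<close> by (simp add: pos_divide_le_eq)
  qed
  then have "sqrt (B\<^sup>2) \<le> sqrt (A * C)" by (rule real_sqrt_le_mono)
  then show ?thesis by (simp add: A_def B_def C_def real_sqrt_mult)
qed

lemma L2_nrm_nonneg: "L2_nrm \<Omega> f \<ge> 0"
  by (simp add: L2_nrm_def)

lemma L2_nrm_sq: "(L2_nrm \<Omega> f)\<^sup>2 = (LINT x|lebesgue_on \<Omega>. (f x)\<^sup>2)"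
  by (simp add: L2_nrm_def)

lemma L2_mult_integrable:
  "f \<in> L2 \<Omega> \<Longrightarrow> g \<in> L2 \<Omega> \<Longrightarrow> integrable (lebesgue_on \<Omega>) (\<lambda>x. f x * g x)"
  unfolding L2_def by (intro integrable_mult_square) auto

lemma L2_Cauchy_Schwarz:
  "f \<in> L2 \<Omega> \<Longrightarrow> g \<in> L2 \<Omega> \<Longrightarrow> \<bar>LINT x|lebesgue_on \<Omega>. f x * g x\<bar> \<le> L2_nrm \<Omega> f * L2_nrm \<Omega> g"
  unfolding L2_def L2_nrm_def by (intro integral_Cauchy_Schwarz) auto

lemma L2_add: "f \<in> L2 \<Omega> \<Longrightarrow> g \<in> L2 \<Omega> \<Longrightarrow> (\<lambda>x. f x + g x) \<in> L2 \<Omega>"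
  using L2_mult_integrable[of f \<Omega> g] unfolding L2_def
  by (auto simp: power2_sum mult.assoc)

lemma L2_cmult: "f \<in> L2 \<Omega> \<Longrightarrow> (\<lambda>x. c * f x) \<in> L2 \<Omega>"
  unfolding L2_def by (auto simp: power_mult_distrib)

lemma L2_diff: "f \<in> L2 \<Omega> \<Longrightarrow> g \<in> L2 \<Omega> \<Longrightarrow> (\<lambda>x. f x - g x) \<in> L2 \<Omega>"
  using L2_add[OF _ L2_cmult[of g \<Omega> "-1"], of f] by simp

lemma L2_sum: "finite B \<Longrightarrow> (\<And>b. b \<in> B \<Longrightarrow> f b \<in> L2 \<Omega>) \<Longrightarrow> (\<lambda>x. \<Sum>b\<in>B. f b x) \<in> L2 \<Omega>"
proof (induction B rule: finite_induct)
  case empty then show ?case by (simp add: L2_def)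
next
  case (insert b B) then show ?case by (auto intro: L2_add)
qed

lemma L2_nrm_cmult: "L2_nrm \<Omega> (\<lambda>x. c * f x) = \<bar>c\<bar> * L2_nrm \<Omega> f"
  by (simp add: L2_nrm_def power_mult_distrib real_sqrt_mult)

lemma L2_nrm_triangle:
  assumes "f \<in> L2 \<Omega>" "g \<in> L2 \<Omega>"
  shows "L2_nrm \<Omega> (\<lambda>x. f x + g x) \<le> L2_nrm \<Omega> f + L2_nrm \<Omega> g"
proof (rule power2_le_imp_le)
  have "(L2_nrm \<Omega> (\<lambda>x. f x + g x))\<^sup>2 = (LINT x|lebesgue_on \<Omega>. (f x)\<^sup>2 + (g x)\<^sup>2 + 2 * (f x * g x))"
    unfolding L2_nrm_sq by (intro Bochner_Integration.integral_cong) (auto simp: power2_sum)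
  also have "\<dots> = (L2_nrm \<Omega> f)\<^sup>2 + (L2_nrm \<Omega> g)\<^sup>2 + 2 * (LINT x|lebesgue_on \<Omega>. f x * g x)"
    using assms L2_mult_integrable[OF assms] unfolding L2_nrm_sq by (simp add: L2_def)
  also have "\<dots> \<le> (L2_nrm \<Omega> f + L2_nrm \<Omega> g)\<^sup>2"
    using L2_Cauchy_Schwarz[OF assms] by (simp add: power2_sum)
  finally show "(L2_nrm \<Omega> (\<lambda>x. f x + g x))\<^sup>2 \<le> (L2_nrm \<Omega> f + L2_nrm \<Omega> g)\<^sup>2" .
qed (simp add: L2_nrm_nonneg)

lemma L2_nrm_sum_le:
  "finite B \<Longrightarrow> (\<And>b. b \<in> B \<Longrightarrow> f b \<in> L2 \<Omega>) \<Longrightarrow> L2_nrm \<Omega> (\<lambda>x. \<Sum>b\<in>B. f b x) \<le> (\<Sum>b\<in>B. L2_nrm \<Omega> (f b))"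
proof (induction B rule: finite_induct)
  case empty then show ?case by (simp add: L2_nrm_def)
next
  case (insert b B)
  have "L2_nrm \<Omega> (\<lambda>x. f b x + (\<Sum>b\<in>B. f b x)) \<le> L2_nrm \<Omega> (f b) + L2_nrm \<Omega> (\<lambda>x. \<Sum>b\<in>B. f b x)"
    using insert by (intro L2_nrm_triangle L2_sum) auto
  then show ?case using insert by force
qed

lemma L2_nrm_minus_commute: "L2_nrm \<Omega> (\<lambda>x. f x - g x) = L2_nrm \<Omega> (\<lambda>x. g x - f x)"
  by (simp add: L2_nrm_def power2_commute)

lemma L2_nrm_diff_le:
  assumes "f \<in> L2 \<Omega>" "g \<in> L2 \<Omega>"
  shows "\<bar>L2_nrm \<Omega> f - L2_nrm \<Omega> g\<bar> \<le> L2_nrm \<Omega> (\<lambda>x. f x - g x)"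
  using L2_nrm_triangle[OF L2_diff[OF assms] assms(2)] L2_nrm_triangle[OF L2_diff[OF assms(2,1)] assms(1)]
  by (simp add: L2_nrm_minus_commute[of \<Omega> g f])

lemma L2_nrm_tendsto:
  assumes "\<And>n. f n \<in> L2 \<Omega>" "g \<in> L2 \<Omega>" "(\<lambda>n. L2_nrm \<Omega> (\<lambda>x. f n x - g x)) \<longlonglongrightarrow> 0"
  shows "(\<lambda>n. L2_nrm \<Omega> (f n)) \<longlonglongrightarrow> L2_nrm \<Omega> g"
proof -
  have "(\<lambda>n. L2_nrm \<Omega> (f n) - L2_nrm \<Omega> g) \<longlonglongrightarrow> 0"
    by (rule tendsto_0_le[OF assms(3), of _ 1])
      (use L2_nrm_diff_le[OF assms(1,2)] in \<open>auto simp: L2_nrm_nonneg\<close>)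
  then show ?thesis by (rule LIM_zero_cancel)
qed

lemma L2_inner_tendsto:
  assumes "\<And>n. f n \<in> L2 \<Omega>" "g \<in> L2 \<Omega>" "(\<lambda>n. L2_nrm \<Omega> (\<lambda>x. f n x - g x)) \<longlonglongrightarrow> 0" "h \<in> L2 \<Omega>"
  shows "(\<lambda>n. LINT x|lebesgue_on \<Omega>. f n x * h x) \<longlonglongrightarrow> (LINT x|lebesgue_on \<Omega>. g x * h x)"
proof -
  have eq: "(LINT x|lebesgue_on \<Omega>. f n x * h x) - (LINT x|lebesgue_on \<Omega>. g x * h x)
      = (LINT x|lebesgue_on \<Omega>. (f n x - g x) * h x)" for n
    using L2_mult_integrable[OF assms(1)[of n] assms(4)] L2_mult_integrable[OF assms(2,4)]
    by (simp add: left_diff_distrib)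
  have "(\<lambda>n. (LINT x|lebesgue_on \<Omega>. f n x * h x) - (LINT x|lebesgue_on \<Omega>. g x * h x)) \<longlonglongrightarrow> 0"
    unfolding eq
    by (rule tendsto_0_le[OF assms(3), of _ "L2_nrm \<Omega> h"])
      (use L2_Cauchy_Schwarz[OF L2_diff[OF assms(1,2)] assms(4)] in \<open>auto simp: L2_nrm_nonneg\<close>)
  then show ?thesis by (rule LIM_zero_cancel)
qed

lemma L2_nrm_nsq: "f \<in> borel_measurable (lebesgue_on \<Omega>) \<Longrightarrow> L2_nrm \<Omega> f = sqrt (enn2real (nsq (lebesgue_on \<Omega>) f))"
  unfolding L2_nrm_def nsq_def by (subst integral_eq_nn_integral) auto

lemma L2_iff_nsq: "f \<in> L2 \<Omega> \<longleftrightarrow> f \<in> borel_measurable (lebesgue_on \<Omega>) \<and> nsq (lebesgue_on \<Omega>) f < \<infinity>"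
  unfolding L2_def nsq_def by (auto simp: integrable_iff_bounded)

lemma L2_nrm_tendsto_0_if_nsq:
  assumes "\<And>n. f n \<in> borel_measurable (lebesgue_on \<Omega>)" "(\<lambda>n. nsq (lebesgue_on \<Omega>) (f n)) \<longlonglongrightarrow> 0"
  shows "(\<lambda>n. L2_nrm \<Omega> (f n)) \<longlonglongrightarrow> 0"
proof -
  have "(\<lambda>n. sqrt (enn2real (nsq (lebesgue_on \<Omega>) (f n)))) \<longlonglongrightarrow> sqrt (enn2real 0)"
    using tendsto_enn2real[where l=0 and u="\<lambda>n. nsq (lebesgue_on \<Omega>) (f n)" and F=sequentially] assms(2)
    by (intro tendsto_real_sqrt) simp
  then show ?thesis using assms(1) by (simp add: L2_nrm_nsq)
qed

lemma L2_cong_AE: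
  assumes "f \<in> L2 \<Omega>" "g \<in> borel_measurable (lebesgue_on \<Omega>)" "AE x in lebesgue_on \<Omega>. f x = g x"
  shows "g \<in> L2 \<Omega>" "L2_nrm \<Omega> g = L2_nrm \<Omega> f"
  using assms nsq_cong_AE[OF assms(3)] by (auto simp: L2_iff_nsq L2_nrm_nsq)

lemma AE_lebesgue_on_iff: "open \<Omega> \<Longrightarrow> (AE x in lebesgue_on \<Omega>. P x) \<longleftrightarrow> (AE x in lborel. x \<in> \<Omega> \<longrightarrow> P x)"
  by (simp add: AE_restrict_space_iff AE_completion_iff)

lemma measurable_lebesgue_on_borel: "f \<in> borel_measurable borel \<Longrightarrow> f \<in> borel_measurable (lebesgue_on \<Omega>)"
  by (intro measurable_restrict_space1 measurable_completion) auto

lemma continuous_measurable_lebesgue_on: "continuous_on UNIV f \<Longrightarrow> f \<in> borel_measurable (lebesgue_on \<Omega>)"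
  by (intro measurable_lebesgue_on_borel borel_measurable_continuous_onI)

lemma nn_integral_lebesgue_on:
  assumes "open \<Omega>" "h \<in> borel_measurable borel"
  shows "(\<integral>\<^sup>+x. h x \<partial>lebesgue_on \<Omega>) = (\<integral>\<^sup>+x. h x * indicator \<Omega> x \<partial>lborel)"
  using assms by (simp add: nn_integral_restrict_space nn_integral_completion)

lemma integral_lebesgue_on:
  fixes h :: "'a::euclidean_space \<Rightarrow> real"
  assumes "open \<Omega>" "h \<in> borel_measurable borel"
  shows "(LINT x|lebesgue_on \<Omega>. h x) = (\<integral>x. indicator \<Omega> x * h x \<partial>lborel)"
  using assms by (simp add: integral_restrict_space) (intro integral_completion borel_measurable_times; simp)

lemma nsq_lebesgue_on_le:
  assumes "open \<Omega>" "h \<in> borel_measurable borel"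
  shows "nsq (lebesgue_on \<Omega>) h \<le> nsq lborel h"
  unfolding nsq_def using assms
  by (subst nn_integral_lebesgue_on) (auto intro!: nn_integral_mono simp: indicator_def)

text \<open>Elements of \<open>L2 \<Omega>\<close> are only Lebesgue measurable on \<Omega> and
  arbitrary elsewhere. A Borel version vanishing outside \<Omega> turns integrals over \<Omega> into
  integrals over the whole space, where affine substitution and Fubini are available.\<close>

lemma borel_representative:
  fixes f :: "'a::euclidean_space \<Rightarrow> real"
  assumes \<Omega>: "open \<Omega>" and f: "f \<in> L2 \<Omega>"
  obtains w where "w \<in> borel_measurable borel" "\<And>x. x \<notin> \<Omega> \<Longrightarrow> w x = 0"
    "AE x in lebesgue_on \<Omega>. w x = f x" "nsq lborel w < \<infinity>"
proof -
  have "f \<in> borel_measurable (lebesgue_on \<Omega>)" using f by (simp add: L2_def)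
  then have "(\<lambda>x. if x \<in> \<Omega> then f x else 0) \<in> borel_measurable lebesgue"
    using \<Omega> by (intro borel_measurable_if_I) auto
  from completion_ex_borel_measurable_real[OF this] obtain v where
    [measurable]: "v \<in> borel_measurable lborel" and v: "AE x in lborel. (if x \<in> \<Omega> then f x else 0) = v x"
    by auto
  have [measurable]: "\<Omega> \<in> sets borel" using \<Omega> by simp
  define w where "w x = indicator \<Omega> x * v x" for x
  have w: "w \<in> borel_measurable borel" unfolding w_def[abs_def] by measurable
  have ae: "AE x in lebesgue_on \<Omega>. w x = f x"
    unfolding AE_lebesgue_on_iff[OF \<Omega>] using v by eventually_elim (auto simp: w_def)
  have "nsq lborel w = nsq (lebesgue_on \<Omega>) w"
    unfolding nsq_def using w \<Omega>
    by (subst nn_integral_lebesgue_on) (auto intro!: nn_integral_cong simp: indicator_def w_def)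
  also have "\<dots> = nsq (lebesgue_on \<Omega>) f" by (rule nsq_cong_AE[OF ae])
  also have "\<dots> < \<infinity>" using f by (simp add: L2_iff_nsq)
  finally have fin: "nsq lborel w < \<infinity>" .
  have "w x = 0" if "x \<notin> \<Omega>" for x using that by (simp add: w_def)
  then show ?thesis using that[OF w _ ae fin] by blast
qed

lemma L2_bounded:
  assumes \<Omega>: "open \<Omega>" "bounded \<Omega>" and f: "f \<in> borel_measurable (lebesgue_on \<Omega>)" and B: "\<And>x. x \<in> \<Omega> \<Longrightarrow> \<bar>f x\<bar> \<le> B"
  shows "f \<in> L2 \<Omega>"
proof -
  have "integrable (lebesgue_on \<Omega>) (\<lambda>x. (f x)\<^sup>2)"
  proof (rule integrableI_bounded_set[where A=\<Omega> and B="B\<^sup>2"])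
    show "emeasure (lebesgue_on \<Omega>) \<Omega> < \<infinity>"
      using \<Omega> emeasure_bounded_finite[OF \<Omega>(2)] by (simp add: emeasure_restrict_space)
    show "AE x in lebesgue_on \<Omega>. x \<in> \<Omega> \<longrightarrow> norm ((f x)\<^sup>2) \<le> B\<^sup>2"
    proof (intro AE_I2 impI)
      fix x assume "x \<in> \<Omega>"
      then have "\<bar>f x\<bar>\<^sup>2 \<le> B\<^sup>2" using B by (intro power_mono) auto
      then show "norm ((f x)\<^sup>2) \<le> B\<^sup>2" by simp
    qed
  qed (use f \<Omega> in auto)
  then show ?thesis using f by (simp add: L2_def)
qed

lemma continuous_bounded_on_bounded:
  fixes f :: "'a::euclidean_space \<Rightarrow> real"
  assumes "bounded S" "continuous_on UNIV f"
  obtains B where "B \<ge> 0" "\<And>x. x \<in> S \<Longrightarrow> \<bar>f x\<bar> \<le> B"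
proof -
  have "compact (closure S)" using assms(1) by (simp add: compact_closure)
  then have "bounded (f ` closure S)"
    by (meson assms(2) compact_continuous_image compact_imp_bounded continuous_on_subset subset_UNIV)
  then obtain B where B: "\<forall>y\<in>f ` closure S. norm y \<le> B" unfolding bounded_iff by blast
  have "\<bar>f x\<bar> \<le> \<bar>B\<bar>" if "x \<in> S" for x using B that closure_subset[of S] by force
  then show ?thesis using that[of "\<bar>B\<bar>"] by auto
qed

lemma L2_continuous:
  assumes "open \<Omega>" "bounded \<Omega>" "continuous_on UNIV f"
  shows "f \<in> L2 \<Omega>"
  by (rule continuous_bounded_on_bounded[OF assms(2,3)])
    (rule L2_bounded[OF assms(1,2) continuous_measurable_lebesgue_on[OF assms(3)]])

section \<open>Calculus\<close>

lemma frechet_derivative_partials: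
  fixes f :: "'a::euclidean_space \<Rightarrow> real"
  assumes "f differentiable (at x)"
  shows "frechet_derivative f (at x) h = (\<Sum>b\<in>Basis. (h \<bullet> b) * partial_deriv b f x)"
proof -
  have l: "linear (frechet_derivative f (at x))"
    using differentiable_partial_deriv[OF assms] has_derivative_linear by blast
  have "frechet_derivative f (at x) h = frechet_derivative f (at x) (\<Sum>b\<in>Basis. (h \<bullet> b) *\<^sub>R b)"
    by (simp add: euclidean_representation)
  also have "\<dots> = (\<Sum>b\<in>Basis. (h \<bullet> b) * partial_deriv b f x)"
    using l by (simp add: linear_sum linear_cmul partial_deriv_def)
  finally show ?thesis .
qed

lemma lipschitz_of_partials:
  fixes f :: "'a::euclidean_space \<Rightarrow> real" and B :: real
  assumes S: "convex S" and d: "\<And>x. x \<in> S \<Longrightarrow> f differentiable (at x)"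
    and B: "\<And>b x. b \<in> Basis \<Longrightarrow> x \<in> S \<Longrightarrow> \<bar>partial_deriv b f x\<bar> \<le> B"
  shows "x \<in> S \<Longrightarrow> \<bar>frechet_derivative f (at x) h\<bar> \<le> DIM('a) * B * norm h"
    and "x \<in> S \<Longrightarrow> y \<in> S \<Longrightarrow> \<bar>f x - f y\<bar> \<le> DIM('a) * B * norm (x - y)"
proof -
  show 1: "\<bar>frechet_derivative f (at x) h\<bar> \<le> DIM('a) * B * norm h" if "x \<in> S" for x h
  proof -
    have "\<bar>frechet_derivative f (at x) h\<bar> \<le> (\<Sum>b\<in>Basis. \<bar>h \<bullet> b\<bar> * \<bar>partial_deriv b f x\<bar>)"
      unfolding frechet_derivative_partials[OF d[OF that]] by (rule order_trans[OF sum_abs]) (simp add: abs_mult)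
    also have "\<dots> \<le> (\<Sum>b\<in>(Basis :: 'a set). norm h * B)"
      using that by (intro sum_mono mult_mono Basis_le_norm B) auto
    finally show ?thesis by (simp add: mult_ac)
  qed
  show "\<bar>f x - f y\<bar> \<le> DIM('a) * B * norm (x - y)" if xy: "x \<in> S" "y \<in> S"
  proof -
    have "norm (f x - f y) \<le> (DIM('a) * B) * norm (x - y)"
    proof (rule differentiable_bound[OF S _ _ xy])
      show "(f has_derivative frechet_derivative f (at x)) (at x within S)" if "x \<in> S" for x
        using differentiable_partial_deriv[OF d[OF that]] has_derivative_at_withinI by blast
      show "onorm (frechet_derivative f (at x)) \<le> DIM('a) * B" if "x \<in> S" for x
        by (rule onorm_le) (use 1[OF that] in simp)
    qed
    then show ?thesis by simp
  qed
qed

lemma tendsto_at_0_iff_sequentially: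
  fixes f :: "'a::real_normed_vector \<Rightarrow> real"
  shows "(f \<longlongrightarrow> l) (at 0) \<longleftrightarrow> (\<forall>h. (\<forall>n::nat. h n \<noteq> 0) \<and> h \<longlonglongrightarrow> 0 \<longrightarrow> (\<lambda>n. f (h n)) \<longlonglongrightarrow> l)"
  unfolding tendsto_at_iff_sequentially comp_def by auto

lemma smooth_bounded_partials:
  fixes \<psi> :: "'a::euclidean_space \<Rightarrow> real"
  assumes \<psi>: "smooth \<psi>" and c: "compact (closure {x. \<psi> x \<noteq> 0})"
  obtains B where "B \<ge> 0" "\<And>x. \<bar>\<psi> x\<bar> \<le> B" "\<And>b x. b \<in> Basis \<Longrightarrow> \<bar>partial_deriv b \<psi> x\<bar> \<le> B"
proof -
  have t: "test_fun UNIV \<psi>" using assms by (simp add: test_fun_def)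
  have "\<exists>B\<ge>0. \<forall>x. \<bar>\<phi> x\<bar> \<le> B" if p: "test_fun UNIV \<phi>" for \<phi> :: "'a \<Rightarrow> real"
  proof -
    have "bounded (closure {x. \<phi> x \<noteq> 0})" using p by (intro compact_imp_bounded) (simp add: test_fun_def)
    then have "bounded {x. \<phi> x \<noteq> 0}" by (rule bounded_subset) (rule closure_subset)
    then obtain B where "B \<ge> 0" "\<And>x. x \<in> {x. \<phi> x \<noteq> 0} \<Longrightarrow> \<bar>\<phi> x\<bar> \<le> B"
      using continuous_bounded_on_bounded[OF _ smoothD(2)] p by (metis test_fun_def)
    then show ?thesis by (metis abs_zero mem_Collect_eq)
  qed
  note ex = this
  obtain B0 where B0: "B0 \<ge> 0" "\<And>x. \<bar>\<psi> x\<bar> \<le> B0" using ex[OF t] by blast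
  have "\<forall>b\<in>Basis. \<exists>B\<ge>0. \<forall>x. \<bar>partial_deriv b \<psi> x\<bar> \<le> B"
    using ex test_fun_partial[OF t] by blast
  then obtain B where B: "\<And>b. b \<in> Basis \<Longrightarrow> B b \<ge> 0 \<and> (\<forall>x. \<bar>partial_deriv b \<psi> x\<bar> \<le> B b)" by metis
  have "\<bar>partial_deriv b \<psi> x\<bar> \<le> B0 + (\<Sum>b\<in>Basis. B b)" if "b \<in> Basis" for b x
  proof -
    have "B b \<le> (\<Sum>b\<in>Basis. B b)" using B that by (intro member_le_sum) auto
    then show ?thesis using B[OF that, THEN conjunct2, rule_format, of x] B0(1) by linarith
  qed
  moreover have "(\<Sum>b\<in>Basis. B b) \<ge> 0" using B by (intro sum_nonneg) auto
  ultimately show ?thesis using that[of "B0 + (\<Sum>b\<in>Basis. B b)"] B0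
    by (meson add_increasing2 add_nonneg_nonneg order_trans le_add_same_cancel1)
qed

lemma partial_quotient_tendsto:
  fixes f :: "'a::euclidean_space \<Rightarrow> real"
  assumes "f differentiable (at x)"
  shows "(\<lambda>n. real (Suc n) * (f (x + inverse (real (Suc n)) *\<^sub>R v) - f x)) \<longlonglongrightarrow> frechet_derivative f (at x) v"
proof -
  have d: "(f has_derivative frechet_derivative f (at x)) (at (x + 0 *\<^sub>R v))" using differentiable_partial_deriv[OF assms] by simp
  have "((\<lambda>s::real. x + s *\<^sub>R v) has_derivative (\<lambda>s. s *\<^sub>R v)) (at 0)" by (auto intro!: derivative_eq_intros)
  from has_derivative_compose[OF this d]
  have "((\<lambda>s. f (x + s *\<^sub>R v)) has_derivative (\<lambda>s. frechet_derivative f (at x) (s *\<^sub>R v))) (at 0)" .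
  moreover have "linear (frechet_derivative f (at x))"
    using differentiable_partial_deriv[OF assms] has_derivative_linear by blast
  then have "(\<lambda>s. frechet_derivative f (at x) (s *\<^sub>R v)) = (\<lambda>s. frechet_derivative f (at x) v * s)"
    by (auto simp: linear_cmul)
  ultimately have "((\<lambda>s. f (x + s *\<^sub>R v)) has_field_derivative frechet_derivative f (at x) v) (at 0)"
    by (simp add: has_field_derivative_def)
  then have "((\<lambda>h. (f (x + h *\<^sub>R v) - f x) / h) \<longlongrightarrow> frechet_derivative f (at x) v) (at 0)"
    by (simp add: DERIV_def)
  then have "(\<lambda>n. (f (x + inverse (real (Suc n)) *\<^sub>R v) - f x) / inverse (real (Suc n))) \<longlonglongrightarrow> frechet_derivative f (at x) v"
    unfolding tendsto_at_0_iff_sequentially using LIMSEQ_inverse_real_of_nat by simp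
  then show ?thesis by (simp add: field_simps)
qed

lemma lipschitz_quotient_bound:
  fixes f :: "'a::real_normed_vector \<Rightarrow> real"
  assumes "\<And>x y. \<bar>f x - f y\<bar> \<le> L * norm (x - y)"
  shows "\<bar>real (Suc n) * (f (x + inverse (real (Suc n)) *\<^sub>R v) - f x)\<bar> \<le> L * norm v"
proof -
  have "\<bar>real (Suc n) * (f (x + inverse (real (Suc n)) *\<^sub>R v) - f x)\<bar> \<le> real (Suc n) * (L * norm (inverse (real (Suc n)) *\<^sub>R v))"
    unfolding abs_mult using assms[of "x + inverse (real (Suc n)) *\<^sub>R v" x] by (intro mult_mono) auto
  also have "\<dots> = L * norm v" by (simp add: field_simps)
  finally show ?thesis .
qed

text \<open>Translation invariance makes the integral of every difference quotient vanish; the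
  Lipschitz bound lets this pass to the limit.\<close>

lemma integral_partial_deriv_0:
  fixes \<psi> :: "'a::euclidean_space \<Rightarrow> real"
  assumes \<psi>: "smooth \<psi>" and c: "compact (closure {x. \<psi> x \<noteq> 0})" and b: "b \<in> Basis"
  shows "(\<integral>x. partial_deriv b \<psi> x \<partial>lborel) = 0"
proof -
  obtain B where B: "B \<ge> 0" "\<And>x. \<bar>\<psi> x\<bar> \<le> B" "\<And>b x. b \<in> Basis \<Longrightarrow> \<bar>partial_deriv b \<psi> x\<bar> \<le> B"
    using smooth_bounded_partials[OF \<psi> c] by blast
  define L where "L = DIM('a) * B"
  have lip: "\<bar>\<psi> x - \<psi> y\<bar> \<le> L * norm (x - y)" for x y
    unfolding L_def by (rule lipschitz_of_partials(2)[of UNIV]) (use B smoothD(1)[OF \<psi>] in auto)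
  obtain K where K: "\<And>x. \<psi> x \<noteq> 0 \<Longrightarrow> norm x \<le> K"
    using c closure_subset[of "{x. \<psi> x \<noteq> 0}"] by (force simp: bounded_iff dest!: compact_imp_bounded)
  have [measurable]: "\<psi> \<in> borel_measurable borel" "partial_deriv b \<psi> \<in> borel_measurable borel"
    using smoothD[OF \<psi>] b by (auto intro: borel_measurable_continuous_onI smoothD)
  define q where "q n x = real (Suc n) * (\<psi> (x + inverse (real (Suc n)) *\<^sub>R b) - \<psi> x)" for n x
  have [measurable]: "q n \<in> borel_measurable borel" for n unfolding q_def by measurable
  have i\<psi>: "integrable lborel \<psi>"
    by (rule integrable_compact_support[OF _ B(2), where K=K]) (use K in force)+
  have q0: "(\<integral>x. q n x \<partial>lborel) = 0" for n
  proof -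
    have "(\<integral>x. \<psi> (inverse (real (Suc n)) *\<^sub>R b + 1 *\<^sub>R x) \<partial>lborel) = (\<integral>x. \<psi> x \<partial>lborel)"
      by (subst integral_lborel_affine[of \<psi> 1 "inverse (real (Suc n)) *\<^sub>R b"]) auto
    moreover have "integrable lborel (\<lambda>x. \<psi> (inverse (real (Suc n)) *\<^sub>R b + 1 *\<^sub>R x))"
      by (rule integrable_affine[OF i\<psi>]) simp
    ultimately show ?thesis using i\<psi> unfolding q_def by (simp add: add.commute del: of_nat_Suc)
  qed
  have "(\<lambda>n. \<integral>x. q n x \<partial>lborel) \<longlonglongrightarrow> (\<integral>x. partial_deriv b \<psi> x \<partial>lborel)"
  proof (rule integral_dominated_convergence[where w="\<lambda>x. L * indicator (cball 0 (K + 1)) x"])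
    show "integrable lborel (\<lambda>x::'a. L * indicator (cball 0 (K + 1)) x)"
      using emeasure_ball_finite by (intro integrable_mult_right integrable_real_indicator) auto
    show "AE x in lborel. (\<lambda>n. q n x) \<longlonglongrightarrow> partial_deriv b \<psi> x"
      unfolding q_def partial_deriv_def by (intro AE_I2 partial_quotient_tendsto smoothD \<psi>)
    show "AE x in lborel. norm (q n x) \<le> L * indicator (cball 0 (K + 1)) x" for n
    proof (rule AE_I2)
      fix x
      show "norm (q n x) \<le> L * indicator (cball 0 (K + 1)) x"
      proof (cases "norm x \<le> K + 1")
        case True then show ?thesis using lipschitz_quotient_bound[OF lip, of n x b] b by (simp add: q_def)
      next
        case False
        have "norm x \<le> norm (x + inverse (real (Suc n)) *\<^sub>R b) + norm (inverse (real (Suc n)) *\<^sub>R b)"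
          by (metis add_diff_cancel_right' norm_triangle_ineq4)
        moreover have "norm (inverse (real (Suc n)) *\<^sub>R b) \<le> 1" using b by (simp add: field_simps)
        ultimately have "\<psi> (x + inverse (real (Suc n)) *\<^sub>R b) = 0" "\<psi> x = 0" using K False by (smt (verit))+
        then show ?thesis using False by (simp add: q_def)
      qed
    qed
  qed (simp_all)
  then show ?thesis using q0 LIMSEQ_unique by (simp add: LIMSEQ_const_iff)
qed

text \<open>Differentiation under the integral sign, for the full differential and not just along
  coordinates, because \<open>partial_deriv\<close> is defined through it. The general affine
  argument covers the kernels of contracted averages.\<close>

lemma convolution_derivative:
  fixes \<psi> w :: "'a::euclidean_space \<Rightarrow> real"
  assumes \<psi>: "smooth \<psi>" and c: "compact (closure {x. \<psi> x \<noteq> 0})" and w: "integrable lborel w"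
  shows "(\<lambda>x. \<integral>u. \<psi> (v + t *\<^sub>R x + k *\<^sub>R u) * w u \<partial>lborel) differentiable (at x)"
    and "b \<in> Basis \<Longrightarrow> partial_deriv b (\<lambda>x. \<integral>u. \<psi> (v + t *\<^sub>R x + k *\<^sub>R u) * w u \<partial>lborel) x
          = t * (\<integral>u. partial_deriv b \<psi> (v + t *\<^sub>R x + k *\<^sub>R u) * w u \<partial>lborel)"
proof -
  obtain B where B: "B \<ge> 0" "\<And>x. \<bar>\<psi> x\<bar> \<le> B" "\<And>b x. b \<in> Basis \<Longrightarrow> \<bar>partial_deriv b \<psi> x\<bar> \<le> B"
    using smooth_bounded_partials[OF \<psi> c] by blast
  define L where "L = DIM('a) * B"
  have L0: "L \<ge> 0" using B by (simp add: L_def)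
  have lip: "\<bar>\<psi> x - \<psi> y\<bar> \<le> L * norm (x - y)" for x y
    unfolding L_def by (rule lipschitz_of_partials(2)[of UNIV]) (use B smoothD(1)[OF \<psi>] in auto)
  have lin: "\<bar>frechet_derivative \<psi> (at x) h\<bar> \<le> L * norm h" for x h
    unfolding L_def by (rule lipschitz_of_partials(1)[of UNIV]) (use B smoothD(1)[OF \<psi>] in auto)
  have [measurable]: "\<psi> \<in> borel_measurable borel" "w \<in> borel_measurable borel"
    using smoothD[OF \<psi>] w by (auto intro: borel_measurable_continuous_onI)
  have pm[measurable]: "partial_deriv b \<psi> \<in> borel_measurable borel" if "b \<in> Basis" for b
    using smoothD[OF \<psi>] that by (auto intro: borel_measurable_continuous_onI smoothD)
  have bi: "integrable lborel (\<lambda>u. g u * w u)" if "g \<in> borel_measurable borel" "\<And>u. \<bar>g u\<bar> \<le> M" for g M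
  proof (rule Bochner_Integration.integrable_bound[of _ "\<lambda>u. M * w u"])
    show "AE x in lborel. norm (g x * w x) \<le> norm (M * w x)"
      unfolding norm_mult using that(2) by (intro AE_I2 mult_right_mono) (auto intro: order_trans[OF _ abs_ge_self])
  qed (use w that in auto)
  define F where "F x = (\<integral>u. \<psi> (v + t *\<^sub>R x + k *\<^sub>R u) * w u \<partial>lborel)" for x
  define D where "D x b = (\<integral>u. partial_deriv b \<psi> (v + t *\<^sub>R x + k *\<^sub>R u) * w u \<partial>lborel)" for x b
  have d: "(F has_derivative (\<lambda>h. \<Sum>b\<in>Basis. (t * (h \<bullet> b)) * D x b)) (at x)" for x
  proof -
    let ?z = "\<lambda>u. v + t *\<^sub>R x + k *\<^sub>R u"
    have "(\<lambda>n. norm (F (x + h n) - F x - (\<Sum>b\<in>Basis. (t * (h n \<bullet> b)) * D x b)) / norm (h n)) \<longlonglongrightarrow> 0"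
      if h: "\<And>n. h n \<noteq> 0" "h \<longlonglongrightarrow> 0" for h
    proof -
      \<comment> \<open>The remainder of the first order expansion divided by the increment: it
        tends to 0 pointwise and is bounded by 2 L |t|, which with the integrability of w gives
        domination.\<close>
      define q where "q n u = (\<psi> (?z u + t *\<^sub>R h n) - \<psi> (?z u) - frechet_derivative \<psi> (at (?z u)) (t *\<^sub>R h n)) / norm (h n)" for n u
      have fp: "frechet_derivative \<psi> (at (?z u)) (t *\<^sub>R h n) = (\<Sum>b\<in>Basis. (t * (h n \<bullet> b)) * partial_deriv b \<psi> (?z u))" for n u
        using frechet_derivative_partials[OF smoothD(1)[OF \<psi>]] by simp
      have [measurable]: "q n \<in> borel_measurable borel" for n unfolding q_def fp by measurable
      have eq: "(F (x + h n) - F x - (\<Sum>b\<in>Basis. (t * (h n \<bullet> b)) * D x b)) / norm (h n) = (\<integral>u. q n u * w u \<partial>lborel)" for n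
      proof -
        have i1: "integrable lborel (\<lambda>u. \<psi> (?z u + t *\<^sub>R h n) * w u)" by (rule bi[where M=B]) (auto simp: B)
        have i2: "integrable lborel (\<lambda>u. \<psi> (?z u) * w u)" by (rule bi[where M=B]) (auto simp: B)
        have i3: "integrable lborel (\<lambda>u. partial_deriv b \<psi> (?z u) * w u)" if "b \<in> Basis" for b
          by (rule bi[where M=B]) (use that in \<open>auto simp: B\<close>)
        have "(\<integral>u. q n u * w u \<partial>lborel) = (\<integral>u. (\<psi> (?z u + t *\<^sub>R h n) * w u - \<psi> (?z u) * w u
             - (\<Sum>b\<in>Basis. (t * (h n \<bullet> b)) * (partial_deriv b \<psi> (?z u) * w u))) / norm (h n) \<partial>lborel)"
          unfolding q_def fp by (intro Bochner_Integration.integral_cong) (auto simp: left_diff_distrib sum_distrib_right diff_divide_distrib mult.assoc)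
        also have "\<dots> = ((\<integral>u. \<psi> (?z u + t *\<^sub>R h n) * w u \<partial>lborel) - (\<integral>u. \<psi> (?z u) * w u \<partial>lborel)
             - (\<Sum>b\<in>Basis. (t * (h n \<bullet> b)) * (\<integral>u. partial_deriv b \<psi> (?z u) * w u \<partial>lborel))) / norm (h n)"
          using i1 i2 i3 by simp
        finally show ?thesis by (simp add: F_def D_def scaleR_add_right add_ac)
      qed
      have "(\<lambda>n. \<integral>u. q n u * w u \<partial>lborel) \<longlonglongrightarrow> (\<integral>u. 0 \<partial>(lborel :: 'a measure))"
      proof (rule integral_dominated_convergence[where w="\<lambda>u. (2 * L * \<bar>t\<bar>) * \<bar>w u\<bar>"])
        show "AE u in lborel. (\<lambda>n. q n u * w u) \<longlonglongrightarrow> 0"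
        proof (rule AE_I2)
          fix u
          have dd: "(\<psi> has_derivative frechet_derivative \<psi> (at (?z u))) (at (?z u + t *\<^sub>R 0))"
            using differentiable_partial_deriv[OF smoothD(1)[OF \<psi>]] by simp
          have "((\<lambda>h. ?z u + t *\<^sub>R h) has_derivative (\<lambda>h. t *\<^sub>R h)) (at 0)" by (auto intro!: derivative_eq_intros)
          from has_derivative_compose[OF this dd]
          have "((\<lambda>h. norm (\<psi> (?z u + t *\<^sub>R h) - \<psi> (?z u) - frechet_derivative \<psi> (at (?z u)) (t *\<^sub>R h)) / norm h) \<longlongrightarrow> 0) (at 0)"
            by (simp add: has_derivative_at)
          then have "(\<lambda>n. \<bar>q n u\<bar>) \<longlonglongrightarrow> 0"
            unfolding tendsto_at_0_iff_sequentially q_def using h by simp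
          then have "(\<lambda>n. q n u) \<longlonglongrightarrow> 0" by (simp add: tendsto_rabs_zero_iff)
          then show "(\<lambda>n. q n u * w u) \<longlonglongrightarrow> 0" by (rule tendsto_mult_left_zero)
        qed
        show "AE u in lborel. norm (q n u * w u) \<le> (2 * L * \<bar>t\<bar>) * \<bar>w u\<bar>" for n
        proof (rule AE_I2)
          fix u
          have "\<bar>\<psi> (?z u + t *\<^sub>R h n) - \<psi> (?z u) - frechet_derivative \<psi> (at (?z u)) (t *\<^sub>R h n)\<bar> \<le> 2 * L * \<bar>t\<bar> * norm (h n)"
            using lip[of "?z u + t *\<^sub>R h n" "?z u"] lin[of "?z u" "t *\<^sub>R h n"] by (simp add: mult_ac)
          then have "\<bar>q n u\<bar> \<le> 2 * L * \<bar>t\<bar>" using h(1)[of n] by (simp add: q_def divide_le_eq)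
          then show "norm (q n u * w u) \<le> (2 * L * \<bar>t\<bar>) * \<bar>w u\<bar>"
            by (simp add: abs_mult mult_right_mono)
        qed
      qed (use w in auto)
      then have "(\<lambda>n. \<bar>\<integral>u. q n u * w u \<partial>lborel\<bar>) \<longlonglongrightarrow> 0" by (simp add: tendsto_rabs_zero_iff)
      then show ?thesis unfolding eq[symmetric] by simp
    qed
    then show ?thesis
      unfolding has_derivative_at tendsto_at_0_iff_sequentially
      by (auto intro!: bounded_linear_sum bounded_linear_mult_const bounded_linear_const_mult bounded_linear_inner_left)
  qed
  show "(\<lambda>x. \<integral>u. \<psi> (v + t *\<^sub>R x + k *\<^sub>R u) * w u \<partial>lborel) differentiable (at x)"
    using d by (auto simp: differentiable_def F_def[abs_def])
  show "partial_deriv b (\<lambda>x. \<integral>u. \<psi> (v + t *\<^sub>R x + k *\<^sub>R u) * w u \<partial>lborel) x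
      = t * (\<integral>u. partial_deriv b \<psi> (v + t *\<^sub>R x + k *\<^sub>R u) * w u \<partial>lborel)" if b: "b \<in> Basis"
  proof -
    have "(\<Sum>c\<in>Basis. (t * (b \<bullet> c)) * D x c) = (\<Sum>c\<in>Basis. if c = b then t * D x b else 0)"
      using b by (intro sum.cong) (auto simp: inner_Basis)
    then have "(\<Sum>c\<in>Basis. (t * (b \<bullet> c)) * D x c) = t * D x b" using b by simp
    then show ?thesis using partial_deriv_eq[OF d, of b x] by (simp add: D_def F_def[abs_def])
  qed
qed

text \<open>A derivative of a convolution is a convolution with a derivative of \<psi>, again smooth
  with compact support; hence the induction keeps \<psi> arbitrary among test functions.\<close>

lemma smooth_convolution:
  fixes \<psi> w :: "'a::euclidean_space \<Rightarrow> real"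
  assumes "smooth \<psi>" "compact (closure {x. \<psi> x \<noteq> 0})" and w: "integrable lborel w"
  shows "smooth (\<lambda>x. \<integral>u. \<psi> (v + t *\<^sub>R x + k *\<^sub>R u) * w u \<partial>lborel)"
proof -
  have "Ck m (\<lambda>x. \<integral>u. \<psi> (v + t *\<^sub>R x + k *\<^sub>R u) * w u \<partial>lborel)"
    if "test_fun UNIV \<psi>" for m and \<psi> :: "'a \<Rightarrow> real"
    using that
  proof (induction m arbitrary: \<psi>)
    case 0
    then show ?case
      using convolution_derivative(1)[OF _ _ w, of \<psi>]
      by (auto simp: continuous_on_eq_continuous_within test_fun_def intro!: differentiable_imp_continuous_within)
  next
    case (Suc m)
    have t: "smooth \<psi>" "compact (closure {x. \<psi> x \<noteq> 0})" using Suc.prems by (auto simp: test_fun_def)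
    have "partial_deriv b (\<lambda>x. \<integral>u. \<psi> (v + t *\<^sub>R x + k *\<^sub>R u) * w u \<partial>lborel)
      = (\<lambda>x. t * (\<integral>u. partial_deriv b \<psi> (v + t *\<^sub>R x + k *\<^sub>R u) * w u \<partial>lborel))" if "b \<in> Basis" for b
      using convolution_derivative(2)[OF t w that] by auto
    then show ?case
      using Suc.IH test_fun_partial[OF Suc.prems] convolution_derivative(1)[OF t w]
      by (auto intro!: Ck_mult Ck_const)
  qed
  then show ?thesis using assms by (simp add: smooth_def test_fun_def)
qed

section \<open>Weak derivatives\<close>

lemma mker_minus: "mker (- x) = mker x"
  by (simp add: mker_def bump_def)

lemma smooth_mker: "smooth (mker :: 'a::euclidean_space \<Rightarrow> real)"
proof -
  have "smooth (\<lambda>x::'a. (1 / kmass TYPE('a)) * bump 2 x)"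
    by (intro smooth_mult smooth_const smooth_bump)
  then show ?thesis by (simp add: mker_def[abs_def])
qed

lemma bounded_support: "(\<And>x. norm x \<ge> 1 \<Longrightarrow> f x = 0) \<Longrightarrow> compact (closure {x::'a::euclidean_space. f x \<noteq> (0::real)})"
  unfolding compact_closure
  by (rule bounded_subset[of "cball 0 1"]) (auto, meson linear)

lemma compact_support_mker: "compact (closure {x::'a::euclidean_space. mker x \<noteq> 0})"
  by (rule bounded_support) (rule mker_eq_0)

lemma test_fun_mker:
  assumes "s > 0" "cball (z::'a::euclidean_space) s \<subseteq> \<Omega>"
  shows "test_fun \<Omega> (\<lambda>u. mker ((1/s) *\<^sub>R z + (- 1/s) *\<^sub>R u))"
  using test_fun_scale[OF test_fun_bump[OF assms, of 2], of "1 / kmass TYPE('a)"]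
  by (simp add: mker_def)

text \<open>Substitution moves x from the rough function w into the smooth kernel; evenness of
  \<open>mker\<close> fixes the sign of the argument. In this form the average can be differentiated
  in x, and the kernel, as a function of u, can serve as a test function.\<close>

lemma average_kernel:
  fixes w :: "'a::euclidean_space \<Rightarrow> real"
  assumes [measurable]: "w \<in> borel_measurable borel" and s: "s \<noteq> 0"
  shows "average t c s w x = (\<integral>u. mker ((1/s) *\<^sub>R c + (t/s) *\<^sub>R x + (- 1/s) *\<^sub>R u) * w u \<partial>lborel) / \<bar>s\<bar> ^ DIM('a)"
proof -
  let ?z = "c + t *\<^sub>R x"
  have eq: "mker ((1/s) *\<^sub>R c + (t/s) *\<^sub>R x + (- 1/s) *\<^sub>R (?z + s *\<^sub>R y)) = mker y" for y :: 'a
  proof -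
    have "(1/s) *\<^sub>R c + (t/s) *\<^sub>R x + (- 1/s) *\<^sub>R (?z + s *\<^sub>R y) = - y" using s by (simp add: algebra_simps)
    then show ?thesis by (simp only: mker_minus)
  qed
  have "(\<integral>u. mker ((1/s) *\<^sub>R c + (t/s) *\<^sub>R x + (- 1/s) *\<^sub>R u) * w u \<partial>lborel) = \<bar>s\<bar> ^ DIM('a) * (\<integral>y. mker y * w (?z + s *\<^sub>R y) \<partial>lborel)"
    by (subst integral_lborel_affine[of _ s ?z]) (use s eq in auto)
  then show ?thesis using s by (simp add: average_def)
qed

lemma average_measurable [measurable]:
  fixes w :: "'a::euclidean_space \<Rightarrow> real"
  assumes [measurable]: "w \<in> borel_measurable borel"
  shows "average t c s w \<in> borel_measurable borel"
  unfolding average_def[abs_def] by measurable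

lemma representative_integral:
  fixes w f h :: "'a::euclidean_space \<Rightarrow> real"
  assumes \<Omega>: "open \<Omega>" and w: "w \<in> borel_measurable borel" "\<And>x. x \<notin> \<Omega> \<Longrightarrow> w x = 0"
    and ae: "AE x in lebesgue_on \<Omega>. w x = f x" and f: "f \<in> borel_measurable (lebesgue_on \<Omega>)"
    and h: "h \<in> borel_measurable borel"
  shows "(LINT x|lebesgue_on \<Omega>. f x * h x) = (\<integral>x. w x * h x \<partial>lborel)"
proof -
  have "(LINT x|lebesgue_on \<Omega>. f x * h x) = (LINT x|lebesgue_on \<Omega>. w x * h x)"
    using ae f measurable_lebesgue_on_borel[OF w(1), of \<Omega>] measurable_lebesgue_on_borel[OF h, of \<Omega>]
    by (intro integral_cong_AE) (auto elim!: eventually_mono)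
  also have "\<dots> = (\<integral>x. indicator \<Omega> x * (w x * h x) \<partial>lborel)"
    using w h by (intro integral_lebesgue_on \<Omega>) auto
  also have "\<dots> = (\<integral>x. w x * h x \<partial>lborel)"
    using w(2) by (intro Bochner_Integration.integral_cong) (auto simp: indicator_def)
  finally show ?thesis .
qed

lemma bounded_outside:
  assumes "bounded \<Omega>" obtains K where "\<And>x. norm x > K \<Longrightarrow> x \<notin> \<Omega>"
  using assms unfolding bounded_iff by (meson not_le)

text \<open>By Fatou an a.e. limit and an L2 limit of the same sequence agree; this identifies
  pointwise limits of averages.\<close>

lemma nsq_liminf_0:
  fixes w :: "'a \<Rightarrow> real"
  assumes [measurable]: "\<And>n. f n \<in> borel_measurable M" "w \<in> borel_measurable M" "v \<in> borel_measurable M"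
    and "AE x in M. (\<lambda>n. f n x) \<longlonglongrightarrow> v x" "(\<lambda>n. nsq M (\<lambda>x. f n x - w x)) \<longlonglongrightarrow> 0"
  shows "AE x in M. v x = w x"
proof -
  have "(\<integral>\<^sup>+x. ennreal ((v x - w x)\<^sup>2) \<partial>M) \<le> (\<integral>\<^sup>+x. liminf (\<lambda>n. ennreal ((f n x - w x)\<^sup>2)) \<partial>M)"
  proof (rule nn_integral_mono_AE)
    show "AE x in M. ennreal ((v x - w x)\<^sup>2) \<le> liminf (\<lambda>n. ennreal ((f n x - w x)\<^sup>2))"
      using assms(4)
    proof eventually_elim
      case (elim x)
      have "(\<lambda>n. ennreal ((f n x - w x)\<^sup>2)) \<longlonglongrightarrow> ennreal ((v x - w x)\<^sup>2)"
        by (intro tendsto_ennrealI tendsto_intros elim)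
      from lim_imp_Liminf[OF _ this] show ?case by simp
    qed
  qed
  also have "\<dots> \<le> liminf (\<lambda>n. \<integral>\<^sup>+x. ennreal ((f n x - w x)\<^sup>2) \<partial>M)"
    by (rule nn_integral_liminf) measurable
  also have "\<dots> = 0" using assms(5) by (simp add: nsq_def lim_imp_Liminf)
  finally have "(\<integral>\<^sup>+x. ennreal ((v x - w x)\<^sup>2) \<partial>M) = 0" by simp
  then have "AE x in M. ennreal ((v x - w x)\<^sup>2) = 0"
    by (subst (asm) nn_integral_0_iff_AE) auto
  then show ?thesis by eventually_elim (simp add: ennreal_eq_0_iff)
qed

lemma interior_radius:
  assumes "open \<Omega>" "x \<in> \<Omega>"
  shows "\<exists>m. \<forall>n\<ge>m. cball x (inverse (real (Suc n))) \<subseteq> \<Omega>"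
proof -
  obtain e where e: "e > 0" "cball x e \<subseteq> \<Omega>" using assms open_contains_cball by blast
  obtain m where m: "inverse (real (Suc m)) < e" using reals_Archimedean e(1) by blast
  have "cball x (inverse (real (Suc n))) \<subseteq> cball x e" if "n \<ge> m" for n
  proof -
    have "inverse (real (Suc n)) \<le> inverse (real (Suc m))" using that by (intro le_imp_inverse_le) auto
    with m show ?thesis by (intro subset_cball) linarith
  qed
  then show ?thesis using e(2) by blast
qed

lemma average_scale_tendsto:
  fixes w :: "'a::euclidean_space \<Rightarrow> real"
  assumes "w \<in> borel_measurable borel" "nsq lborel w < \<infinity>" "bounded \<Omega>" "\<And>x. x \<notin> \<Omega> \<Longrightarrow> w x = 0"
  shows "(\<lambda>n. nsq lborel (\<lambda>x. average 1 0 (inverse (real (Suc n))) w x - w x)) \<longlonglongrightarrow> 0"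
proof -
  obtain K where K: "\<And>x. norm x > K \<Longrightarrow> x \<notin> \<Omega>" using bounded_outside[OF assms(3)] by blast
  show ?thesis
    by (rule average_tendsto[OF assms(1,2), of K "\<lambda>_. 1" "\<lambda>_. 0" "\<lambda>n. inverse (real (Suc n))"])
      (use K assms(4) LIMSEQ_inverse_real_of_nat in auto)
qed

text \<open>For x in \<Omega> the mollifying kernel of small radius is a test function, so the
  averages at x vanish eventually, while they converge to the function in L2.\<close>

theorem fundamental_lemma:
  fixes g :: "'a::euclidean_space \<Rightarrow> real"
  assumes \<Omega>: "open \<Omega>" "bounded \<Omega>" and g: "g \<in> L2 \<Omega>"
    and test: "\<And>\<phi>. test_fun \<Omega> \<phi> \<Longrightarrow> (LINT x|lebesgue_on \<Omega>. g x * \<phi> x) = 0"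
  shows "AE x in lebesgue_on \<Omega>. g x = 0"
proof -
  obtain w where w: "w \<in> borel_measurable borel" "\<And>x. x \<notin> \<Omega> \<Longrightarrow> w x = 0"
    and ae: "AE x in lebesgue_on \<Omega>. w x = g x" and fin: "nsq lborel w < \<infinity>"
    using borel_representative[OF \<Omega>(1) g] by blast
  have [measurable]: "w \<in> borel_measurable borel" by fact
  let ?A = "\<lambda>n. average 1 0 (inverse (real (Suc n))) w"
  have z: "?A n x = 0" if "cball x (inverse (real (Suc n))) \<subseteq> \<Omega>" for n x
  proof -
    let ?s = "inverse (real (Suc n))"
    have t: "test_fun \<Omega> (\<lambda>u. mker ((1/?s) *\<^sub>R x + (- 1/?s) *\<^sub>R u))"
      by (rule test_fun_mker[OF _ that]) simp
    then have "(\<lambda>u. mker ((1/?s) *\<^sub>R x + (- 1/?s) *\<^sub>R u)) \<in> borel_measurable borel"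
      by (intro borel_measurable_continuous_onI smoothD) (simp add: test_fun_def)
    then have "(\<integral>u. w u * mker ((1/?s) *\<^sub>R x + (- 1/?s) *\<^sub>R u) \<partial>lborel) = 0"
      using test[OF t] representative_integral[OF \<Omega>(1) w ae] g by (simp add: L2_def)
    then show ?thesis by (subst average_kernel) (auto simp: mult.commute)
  qed
  \<comment> \<open>Outside \<Omega> nothing is known about the averages. Setting them to 0 there,
    where w vanishes too, only lowers the error.\<close>
  have "AE x in lborel. 0 = w x"
  proof (rule nsq_liminf_0[where f="\<lambda>n x. if x \<in> \<Omega> then ?A n x else 0"])
    show "AE x in lborel. (\<lambda>n. if x \<in> \<Omega> then ?A n x else 0) \<longlonglongrightarrow> 0"
    proof (rule AE_I2)
      fix x
      show "(\<lambda>n. if x \<in> \<Omega> then ?A n x else 0) \<longlonglongrightarrow> 0"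
      proof (cases "x \<in> \<Omega>")
        case True
        from interior_radius[OF \<Omega>(1) True] z have "eventually (\<lambda>n. ?A n x = 0) sequentially"
          unfolding eventually_sequentially by blast
        then show ?thesis using True by (simp add: tendsto_eventually)
      qed auto
    qed
    show "(\<lambda>n. nsq lborel (\<lambda>x. (if x \<in> \<Omega> then ?A n x else 0) - w x)) \<longlonglongrightarrow> 0"
    proof (rule tendsto_sandwich[OF always_eventually always_eventually tendsto_const average_scale_tendsto[OF w(1) fin \<Omega>(2) w(2)]])
      show "\<forall>n. nsq lborel (\<lambda>x. (if x \<in> \<Omega> then ?A n x else 0) - w x) \<le> nsq lborel (\<lambda>x. ?A n x - w x)"
        unfolding nsq_def using w(2) by (auto intro!: nn_integral_mono ennreal_leI)
    qed auto
    show "(\<lambda>x. if x \<in> \<Omega> then ?A n x else 0) \<in> borel_measurable lborel" for n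
      using \<Omega>(1) by (intro measurable_If_set) auto
  qed (use w in auto)
  then have "AE x in lebesgue_on \<Omega>. w x = 0"
    unfolding AE_lebesgue_on_iff[OF \<Omega>(1)] by eventually_elim simp
  with ae show ?thesis by eventually_elim simp
qed

section \<open>Uniqueness and rules for weak derivatives\<close>

lemma test_fun_continuous: "test_fun \<Omega> \<phi> \<Longrightarrow> continuous_on UNIV \<phi>"
  by (intro smoothD) (simp add: test_fun_def)

lemma test_fun_L2: "open \<Omega> \<Longrightarrow> bounded \<Omega> \<Longrightarrow> test_fun \<Omega> \<phi> \<Longrightarrow> \<phi> \<in> L2 \<Omega>"
  by (intro L2_continuous test_fun_continuous)

lemma weak_partial_unique:
  assumes \<Omega>: "open \<Omega>" "bounded \<Omega>" and g: "is_weak_partial \<Omega> b u g" and h: "is_weak_partial \<Omega> b u h"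
  shows "AE x in lebesgue_on \<Omega>. g x = h x"
proof -
  have L: "g \<in> L2 \<Omega>" "h \<in> L2 \<Omega>" using g h by (auto simp: is_weak_partial_def)
  have "AE x in lebesgue_on \<Omega>. g x - h x = 0"
  proof (rule fundamental_lemma[OF \<Omega> L2_diff[OF L]])
    fix \<phi> assume t: "test_fun \<Omega> \<phi>"
    have "(LINT x|lebesgue_on \<Omega>. g x * \<phi> x) = (LINT x|lebesgue_on \<Omega>. h x * \<phi> x)"
      using g h t unfolding is_weak_partial_def by (metis neg_equal_iff_equal)
    then show "(LINT x|lebesgue_on \<Omega>. (g x - h x) * \<phi> x) = 0"
      using L2_mult_integrable[OF L(1) test_fun_L2[OF \<Omega> t]] L2_mult_integrable[OF L(2) test_fun_L2[OF \<Omega> t]]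
      by (simp add: left_diff_distrib)
  qed
  then show ?thesis by eventually_elim simp
qed

lemma is_weak_partial_diff:
  assumes \<Omega>: "open \<Omega>" "bounded \<Omega>" and b: "b \<in> Basis" and L: "u \<in> L2 \<Omega>" "v \<in> L2 \<Omega>"
    and g: "is_weak_partial \<Omega> b u g" and h: "is_weak_partial \<Omega> b v h"
  shows "is_weak_partial \<Omega> b (\<lambda>x. u x - v x) (\<lambda>x. g x - h x)"
proof -
  have L': "g \<in> L2 \<Omega>" "h \<in> L2 \<Omega>" using g h by (auto simp: is_weak_partial_def)
  have "(LINT x|lebesgue_on \<Omega>. (u x - v x) * partial_deriv b \<phi> x) = - (LINT x|lebesgue_on \<Omega>. (g x - h x) * \<phi> x)"
    if t: "test_fun \<Omega> \<phi>" for \<phi>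
  proof -
    note t' = test_fun_L2[OF \<Omega> test_fun_partial[OF t b]]
    show ?thesis
      using L2_mult_integrable[OF L'(1) test_fun_L2[OF \<Omega> t]] L2_mult_integrable[OF L'(2) test_fun_L2[OF \<Omega> t]]
        L2_mult_integrable[OF L(1) t'] L2_mult_integrable[OF L(2) t'] g h t
      by (simp add: left_diff_distrib is_weak_partial_def)
  qed
  then show ?thesis using L2_diff[OF L'] by (simp add: is_weak_partial_def)
qed

lemma smooth_partial_continuous: "smooth f \<Longrightarrow> b \<in> Basis \<Longrightarrow> continuous_on UNIV (partial_deriv b f)"
  by (intro smoothD)

lemma test_fun_mult: "smooth f \<Longrightarrow> test_fun \<Omega> \<phi> \<Longrightarrow> test_fun \<Omega> (\<lambda>x. f x * \<phi> x)"
proof -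
  assume f: "smooth f" and t: "test_fun \<Omega> \<phi>"
  have "closure {x. f x * \<phi> x \<noteq> 0} \<subseteq> closure {x. \<phi> x \<noteq> 0}"
    by (rule closure_mono) auto
  then have "compact (closure {x. f x * \<phi> x \<noteq> 0})"
    using t compact_Int_closed[of "closure {x. \<phi> x \<noteq> 0}" "closure {x. f x * \<phi> x \<noteq> 0}"]
    by (simp add: test_fun_def Int_absorb1)
  then show ?thesis using f t \<open>closure {x. f x * \<phi> x \<noteq> 0} \<subseteq> closure {x. \<phi> x \<noteq> 0}\<close>
    unfolding test_fun_def by (auto intro: smooth_mult)
qed

text \<open>The product f \<phi> is a test function, so the integral of its derivative vanishes; the
  product rule does the rest.\<close>

lemma is_weak_partial_smooth:
  assumes \<Omega>: "open \<Omega>" "bounded \<Omega>" and b: "b \<in> Basis" and f: "smooth f"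
  shows "is_weak_partial \<Omega> b f (partial_deriv b f)"
proof -
  have Lf: "f \<in> L2 \<Omega>" "partial_deriv b f \<in> L2 \<Omega>"
    using f b by (auto intro!: L2_continuous[OF \<Omega>] smoothD)
  have "(LINT x|lebesgue_on \<Omega>. f x * partial_deriv b \<phi> x) = - (LINT x|lebesgue_on \<Omega>. partial_deriv b f x * \<phi> x)"
    if t: "test_fun \<Omega> \<phi>" for \<phi>
  proof -
    have s: "smooth \<phi>" using t by (simp add: test_fun_def)
    have t2: "test_fun \<Omega> (\<lambda>x. f x * \<phi> x)" by (rule test_fun_mult[OF f t])
    have z: "x \<notin> \<Omega> \<Longrightarrow> partial_deriv b (\<lambda>x. f x * \<phi> x) x = 0" for x
      using test_fun_partial[OF t2 b] closure_subset[of "{x. partial_deriv b (\<lambda>x. f x * \<phi> x) x \<noteq> 0}"]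
      unfolding test_fun_def by auto
    have "(LINT x|lebesgue_on \<Omega>. f x * partial_deriv b \<phi> x) + (LINT x|lebesgue_on \<Omega>. partial_deriv b f x * \<phi> x)
      = (LINT x|lebesgue_on \<Omega>. partial_deriv b (\<lambda>x. f x * \<phi> x) x)"
      using L2_mult_integrable[OF Lf(1) test_fun_L2[OF \<Omega> test_fun_partial[OF t b]]]
        L2_mult_integrable[OF Lf(2) test_fun_L2[OF \<Omega> t]] partial_deriv_mult[OF smoothD(1)[OF f] smoothD(1)[OF s]]
      by simp
    also have "\<dots> = (\<integral>x. indicator \<Omega> x * partial_deriv b (\<lambda>x. f x * \<phi> x) x \<partial>lborel)"
      using test_fun_continuous[OF test_fun_partial[OF t2 b]]
      by (intro integral_lebesgue_on[OF \<Omega>(1)] borel_measurable_continuous_onI)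
    also have "\<dots> = (\<integral>x. partial_deriv b (\<lambda>x. f x * \<phi> x) x \<partial>lborel)"
      using z by (intro Bochner_Integration.integral_cong) (auto simp: indicator_def)
    also have "\<dots> = 0" using t2 b by (intro integral_partial_deriv_0) (auto simp: test_fun_def)
    finally show ?thesis by simp
  qed
  then show ?thesis using Lf by (simp add: is_weak_partial_def)
qed

lemma partial_deriv_cmult:
  fixes f :: "'a::euclidean_space \<Rightarrow> real"
  assumes "f differentiable (at x)"
  shows "partial_deriv b (\<lambda>x. c * f x) x = c * partial_deriv b f x"
  using partial_deriv_eq[OF has_derivative_mult_right[OF differentiable_partial_deriv[OF assms]]]
  by (simp add: partial_deriv_def[symmetric])

lemma is_weak_partial_weak_partial: "is_weak_partial \<Omega> b u g \<Longrightarrow> is_weak_partial \<Omega> b u (weak_partial \<Omega> b u)"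
  unfolding weak_partial_def by (rule someI[where P="is_weak_partial \<Omega> b u"])

lemma H1_weak_partial: "u \<in> H1 \<Omega> \<Longrightarrow> b \<in> Basis \<Longrightarrow> is_weak_partial \<Omega> b u (weak_partial \<Omega> b u)"
  unfolding H1_def using is_weak_partial_weak_partial by blast

lemma H1_L2: "u \<in> H1 \<Omega> \<Longrightarrow> u \<in> L2 \<Omega>" "u \<in> H1 \<Omega> \<Longrightarrow> b \<in> Basis \<Longrightarrow> weak_partial \<Omega> b u \<in> L2 \<Omega>"
  using H1_weak_partial[of u \<Omega> b] by (auto simp: H1_def is_weak_partial_def)

lemma weak_partial_AE:
  assumes \<Omega>: "open \<Omega>" "bounded \<Omega>" and g: "is_weak_partial \<Omega> b u g"
  shows "AE x in lebesgue_on \<Omega>. weak_partial \<Omega> b u x = g x"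
  by (rule weak_partial_unique[OF \<Omega> is_weak_partial_weak_partial[OF g] g])

lemma L2_nrm_weak_partial:
  assumes \<Omega>: "open \<Omega>" "bounded \<Omega>" and g: "is_weak_partial \<Omega> b u g"
  shows "L2_nrm \<Omega> (weak_partial \<Omega> b u) = L2_nrm \<Omega> g"
proof -
  have "is_weak_partial \<Omega> b u (weak_partial \<Omega> b u)" using g by (rule is_weak_partial_weak_partial)
  then have "weak_partial \<Omega> b u \<in> borel_measurable (lebesgue_on \<Omega>)" "g \<in> L2 \<Omega>"
    using g by (auto simp: is_weak_partial_def L2_def)
  moreover have "AE x in lebesgue_on \<Omega>. g x = weak_partial \<Omega> b u x"
    using weak_partial_AE[OF assms] by eventually_elim simp
  ultimately show ?thesis by (intro L2_cong_AE(2))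
qed

section \<open>Density of smooth functions\<close>

text \<open>The ball consists of convex combinations of x with points of the ball of radius r around
  a. The margin (1 - t) r is the mollification radius used in
  \<open>H1_smooth_approx\<close>.\<close>

lemma convex_contraction_cball:
  fixes \<Omega> :: "'a::euclidean_space set"
  assumes cvx: "convex \<Omega>" and r: "cball a r \<subseteq> \<Omega>" and t: "0 < t" "t < 1" and x: "x \<in> \<Omega>"
  shows "cball ((1 - t) *\<^sub>R a + t *\<^sub>R x) ((1 - t) * r) \<subseteq> \<Omega>"
proof
  fix y assume y: "y \<in> cball ((1 - t) *\<^sub>R a + t *\<^sub>R x) ((1 - t) * r)"
  define e where "e = (1 / (1 - t)) *\<^sub>R (y - ((1 - t) *\<^sub>R a + t *\<^sub>R x))"
  have "norm (y - ((1 - t) *\<^sub>R a + t *\<^sub>R x)) \<le> (1 - t) * r" using y by (simp add: dist_norm norm_minus_commute)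
  then have "norm e \<le> r" using t by (simp add: e_def divide_le_eq mult.commute)
  then have "a + e \<in> \<Omega>" using r by (auto simp: dist_norm subset_iff)
  moreover have "y = (1 - t) *\<^sub>R (a + e) + t *\<^sub>R x" using t by (simp add: e_def scaleR_add_right)
  ultimately show "y \<in> \<Omega>" using cvx x t unfolding convex_def by auto
qed

text \<open>Contraction towards a before mollifying keeps the kernel at every x of \<Omega>
  supported in \<Omega>. The weak derivative can then be inserted at all points up to the boundary,
  at the price of a factor \<open>t k\<close> in the gradient, which tends to 1.\<close>

theorem H1_smooth_approx:
  fixes \<Omega> :: "'a::euclidean_space set"
  assumes \<Omega>: "open \<Omega>" "bounded \<Omega>" "convex \<Omega>" "\<Omega> \<noteq> {}" and u: "u \<in> H1 \<Omega>"
  obtains f where "\<And>k. smooth (f k)" "(\<lambda>k. L2_nrm \<Omega> (\<lambda>x. f k x - u x)) \<longlonglongrightarrow> 0"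
    "\<And>b. b \<in> Basis \<Longrightarrow> (\<lambda>k. L2_nrm \<Omega> (\<lambda>x. partial_deriv b (f k) x - weak_partial \<Omega> b u x)) \<longlonglongrightarrow> 0"
proof -
  obtain a where "a \<in> \<Omega>" using \<Omega> by auto
  then obtain r where r: "r > 0" "cball a r \<subseteq> \<Omega>" using \<Omega>(1) open_contains_cball by blast
  obtain K where K: "\<And>x. norm x > K \<Longrightarrow> x \<notin> \<Omega>" using bounded_outside[OF \<Omega>(2)] by blast
  \<comment> \<open>The double successor gives 1/2 \<le> t n < 1 already at n = 0, as
    \<open>nsq_affine\<close> requires.\<close>
  define t where "t n = 1 - inverse (real (Suc (Suc n)))" for n
  define c where "c n = (1 - t n) *\<^sub>R a" for n
  define s where "s n = (1 - t n) * r" for n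
  have t1: "1 - t n > 0" "1 - t n \<le> 1/2" for n
    by (simp_all add: t_def field_simps del: of_nat_Suc) 
  have t2: "0 < t n" "t n < 1" "t n \<ge> 1/2" for n using t1[of n] by linarith+
  have s0: "s n > 0" for n using t1 r by (simp add: s_def)
  have l0: "(\<lambda>n. inverse (real (Suc (Suc n)))) \<longlonglongrightarrow> 0"
    using LIMSEQ_Suc[OF LIMSEQ_inverse_real_of_nat] by simp
  then have lt: "t \<longlonglongrightarrow> 1" unfolding t_def using tendsto_diff[OF tendsto_const[of 1] l0] by simp
  have lc: "c \<longlonglongrightarrow> 0" unfolding c_def t_def using tendsto_scaleR[OF l0 tendsto_const[of a]] by simp
  have ls: "s \<longlonglongrightarrow> 0" unfolding s_def t_def using tendsto_mult[OF l0 tendsto_const[of r]] by simp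
  have avg: "(\<lambda>n. nsq lborel (\<lambda>x. average (t n) (c n) (s n) w x - w x)) \<longlonglongrightarrow> 0"
    if "w \<in> borel_measurable borel" "nsq lborel w < \<infinity>" "\<And>x. x \<notin> \<Omega> \<Longrightarrow> w x = 0" for w
    by (rule average_tendsto[OF that(1,2), of K]) (use K that(3) lt lc ls t2 s0 in \<open>auto simp: less_imp_neq[symmetric]\<close>)
  have sm: "smooth (average (t n) (c n) (s n) w)"
    if w: "w \<in> borel_measurable borel" "nsq lborel w < \<infinity>" "\<And>x. x \<notin> \<Omega> \<Longrightarrow> w x = 0" for w n
  proof -
    have "smooth (\<lambda>x. (1 / \<bar>s n\<bar> ^ DIM('a)) * (\<integral>v. mker ((1/s n) *\<^sub>R c n + (t n/s n) *\<^sub>R x + (- 1/s n) *\<^sub>R v) * w v \<partial>lborel))"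
      using integrable_of_nsq(1)[OF w(1,2), of K] K w(3)
      by (intro smooth_mult smooth_const smooth_convolution smooth_mker compact_support_mker) auto
    moreover have "average (t n) (c n) (s n) w = (\<lambda>x. (1 / \<bar>s n\<bar> ^ DIM('a)) * (\<integral>v. mker ((1/s n) *\<^sub>R c n + (t n/s n) *\<^sub>R x + (- 1/s n) *\<^sub>R v) * w v \<partial>lborel))"
      using average_kernel[OF w(1)] s0[of n] by auto
    ultimately show ?thesis by simp
  qed
  have avgL: "(\<lambda>n. L2_nrm \<Omega> (\<lambda>x. average (t n) (c n) (s n) w x - w x)) \<longlonglongrightarrow> 0"
    if w: "w \<in> borel_measurable borel" "nsq lborel w < \<infinity>" "\<And>x. x \<notin> \<Omega> \<Longrightarrow> w x = 0" for w
  proof (rule L2_nrm_tendsto_0_if_nsq)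
    have [measurable]: "w \<in> borel_measurable borel" by fact
    have m: "(\<lambda>x. average (t n) (c n) (s n) w x - w x) \<in> borel_measurable borel" for n by measurable
    then show "(\<lambda>x. average (t n) (c n) (s n) w x - w x) \<in> borel_measurable (lebesgue_on \<Omega>)" for n
      by (rule measurable_lebesgue_on_borel)
    show "(\<lambda>n. nsq (lebesgue_on \<Omega>) (\<lambda>x. average (t n) (c n) (s n) w x - w x)) \<longlonglongrightarrow> 0"
      using tendsto_sandwich[OF always_eventually always_eventually tendsto_const avg[OF w]] nsq_lebesgue_on_le[OF \<Omega>(1) m] by simp
  qed
  obtain w where w: "w \<in> borel_measurable borel" "\<And>x. x \<notin> \<Omega> \<Longrightarrow> w x = 0"
    and wae: "AE x in lebesgue_on \<Omega>. w x = u x" and wfin: "nsq lborel w < \<infinity>"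
    using borel_representative[OF \<Omega>(1) H1_L2(1)[OF u]] by blast
  let ?f = "\<lambda>n. average (t n) (c n) (s n) w"
  show ?thesis
  proof
    show "smooth (?f k)" for k by (rule sm[OF w(1) wfin w(2)])
    have um: "u \<in> borel_measurable (lebesgue_on \<Omega>)" using H1_L2(1)[OF u] by (simp add: L2_def)
    have "L2_nrm \<Omega> (\<lambda>x. ?f k x - u x) = L2_nrm \<Omega> (\<lambda>x. ?f k x - w x)" for k
      unfolding L2_nrm_def using wae um measurable_lebesgue_on_borel[OF w(1), of \<Omega>] measurable_lebesgue_on_borel[OF average_measurable[OF w(1)], of _ _ _ \<Omega>]
      by (intro arg_cong[where f=sqrt] integral_cong_AE) (auto elim!: eventually_mono)
    then show "(\<lambda>k. L2_nrm \<Omega> (\<lambda>x. ?f k x - u x)) \<longlonglongrightarrow> 0" using avgL[OF w(1) wfin w(2)] by simp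
    fix b :: 'a assume b: "b \<in> Basis"
    let ?g = "weak_partial \<Omega> b u"
    have wp: "is_weak_partial \<Omega> b u ?g" by (rule H1_weak_partial[OF u b])
    have gL: "?g \<in> L2 \<Omega>" by (rule H1_L2(2)[OF u b])
    obtain h where h: "h \<in> borel_measurable borel" "\<And>x. x \<notin> \<Omega> \<Longrightarrow> h x = 0"
      and hae: "AE x in lebesgue_on \<Omega>. h x = ?g x" and hfin: "nsq lborel h < \<infinity>"
      using borel_representative[OF \<Omega>(1) gL] by blast
    let ?h = "\<lambda>n. average (t n) (c n) (s n) h"
    have wi: "integrable lborel w" using integrable_of_nsq(1)[OF w(1) wfin, of K] K w(2) by auto
    \<comment> \<open>Differentiating the kernel in x yields the factor t/s, differentiating it in
      the integration variable yields -1/s. Trading one for the other and inserting the weak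
      derivative in the latter leaves the factor t.\<close>
    have pd: "partial_deriv b (?f k) x = t k * ?h k x" if x: "x \<in> \<Omega>" for k x
    proof -
      let ?z = "c k + t k *\<^sub>R x" and ?s = "s k" and ?v = "\<lambda>u. (1/s k) *\<^sub>R c k + (t k/s k) *\<^sub>R x + (- 1/s k) *\<^sub>R u"
      have sk: "s k > 0" by (rule s0)
      have v: "?v u = (1/?s) *\<^sub>R ?z + (- 1/?s) *\<^sub>R u" for u by (simp add: scaleR_add_right)
      have cb: "cball ?z ?s \<subseteq> \<Omega>"
        using convex_contraction_cball[OF \<Omega>(3) r(2) t2(1,2) x] by (simp add: c_def s_def)
      have tf: "test_fun \<Omega> (\<lambda>u. mker (?v u))" unfolding v by (rule test_fun_mker[OF sk cb])
      have pv: "partial_deriv b (\<lambda>u. mker (?v u)) u = (- 1/?s) * partial_deriv b mker (?v u)" for u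
        by (rule partial_deriv_affine(2)[OF smoothD(1)[OF smooth_mker]])
      have m1: "(\<lambda>u. mker (?v u)) \<in> borel_measurable borel" "partial_deriv b (\<lambda>u. mker (?v u)) \<in> borel_measurable borel"
        using test_fun_continuous[OF tf] test_fun_continuous[OF test_fun_partial[OF tf b]] by (auto intro: borel_measurable_continuous_onI)
      have "(\<integral>v. w v * partial_deriv b (\<lambda>u. mker (?v u)) v \<partial>lborel) = (LINT x|lebesgue_on \<Omega>. u x * partial_deriv b (\<lambda>u. mker (?v u)) x)"
        by (rule representative_integral[OF \<Omega>(1) w wae um m1(2), symmetric])
      also have "\<dots> = - (LINT x|lebesgue_on \<Omega>. ?g x * mker (?v x))"
        using wp tf by (simp add: is_weak_partial_def)
      also have "\<dots> = - (\<integral>v. h v * mker (?v v) \<partial>lborel)"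
        using gL by (subst representative_integral[OF \<Omega>(1) h hae _ m1(1)]) (auto simp: L2_def)
      finally have "(\<integral>v. w v * ((- 1/?s) * partial_deriv b mker (?v v)) \<partial>lborel) = - (\<integral>v. h v * mker (?v v) \<partial>lborel)"
        unfolding pv .
      moreover have "(\<integral>v. w v * ((- 1/?s) * partial_deriv b mker (?v v)) \<partial>lborel) = (- 1/?s) * (\<integral>v. partial_deriv b mker (?v v) * w v \<partial>lborel)"
        by (subst integral_mult_right_zero[symmetric]) (simp add: mult_ac)
      ultimately have eq: "(\<integral>v. partial_deriv b mker (?v v) * w v \<partial>lborel) = ?s * (\<integral>v. mker (?v v) * h v \<partial>lborel)"
        using sk by (simp add: field_simps mult.commute)
      define G where "G x = (\<integral>v. mker ((1/s k) *\<^sub>R c k + (t k/s k) *\<^sub>R x + (- 1/s k) *\<^sub>R v) * w v \<partial>lborel)" for x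
      have feq: "?f k = (\<lambda>x. (1 / \<bar>s k\<bar> ^ DIM('a)) * G x)"
        unfolding G_def using average_kernel[OF w(1)] sk by auto
      note cd = convolution_derivative[OF smooth_mker compact_support_mker wi,
        where v="(1/s k) *\<^sub>R c k" and t="t k/s k" and k="- 1/s k" and x=x, folded G_def[abs_def]]
      have "partial_deriv b (?f k) x = (1 / \<bar>s k\<bar> ^ DIM('a)) * partial_deriv b G x"
        unfolding feq by (rule partial_deriv_cmult[OF cd(1)])
      also have "\<dots> = (1 / \<bar>s k\<bar> ^ DIM('a)) * ((t k / ?s) * (\<integral>v. partial_deriv b mker (?v v) * w v \<partial>lborel))"
        by (simp only: cd(2)[OF b])
      also have "\<dots> = t k * ?h k x"
        unfolding eq using average_kernel[OF h(1), of ?s "t k" "c k" x] sk by simp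
      finally show ?thesis .
    qed
    have hm: "h \<in> borel_measurable (lebesgue_on \<Omega>)" by (rule measurable_lebesgue_on_borel[OF h(1)])
    have hL: "h \<in> L2 \<Omega>" using nsq_cong_AE[OF hae] gL hm by (simp add: L2_iff_nsq)
    have HL: "?h k \<in> L2 \<Omega>" for k by (intro L2_continuous \<Omega> smoothD sm h hfin)
    have le: "L2_nrm \<Omega> (\<lambda>x. partial_deriv b (?f k) x - ?g x) \<le> L2_nrm \<Omega> (\<lambda>x. ?h k x - h x) + (1 - t k) * L2_nrm \<Omega> h" for k
    proof -
      have pm: "partial_deriv b (?f k) \<in> borel_measurable (lebesgue_on \<Omega>)"
        by (intro continuous_measurable_lebesgue_on smooth_partial_continuous sm w wfin b)
      have "L2_nrm \<Omega> (\<lambda>x. partial_deriv b (?f k) x - ?g x) = L2_nrm \<Omega> (\<lambda>x. t k * (?h k x - h x) + (t k - 1) * h x)"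
        unfolding L2_nrm_def
      proof (intro arg_cong[where f=sqrt] integral_cong_AE)
        have "AE x in lebesgue_on \<Omega>. x \<in> \<Omega>" by (rule AE_I2) simp
        with hae show "AE x in lebesgue_on \<Omega>. (partial_deriv b (?f k) x - ?g x)\<^sup>2 = (t k * (?h k x - h x) + (t k - 1) * h x)\<^sup>2"
          by eventually_elim (simp add: pd algebra_simps)
      qed (use pm hm gL HL[of k] in \<open>auto simp: L2_def\<close>)
      also have "\<dots> \<le> L2_nrm \<Omega> (\<lambda>x. t k * (?h k x - h x)) + L2_nrm \<Omega> (\<lambda>x. (t k - 1) * h x)"
        by (intro L2_nrm_triangle L2_cmult L2_diff HL hL)
      also have "\<dots> = t k * L2_nrm \<Omega> (\<lambda>x. ?h k x - h x) + (1 - t k) * L2_nrm \<Omega> h"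
        using t2[of k] unfolding L2_nrm_cmult by simp
      also have "\<dots> \<le> 1 * L2_nrm \<Omega> (\<lambda>x. ?h k x - h x) + (1 - t k) * L2_nrm \<Omega> h"
        using t2[of k] by (intro add_mono mult_right_mono) (auto simp: L2_nrm_nonneg)
      finally show ?thesis by simp
    qed
    have "(\<lambda>k. L2_nrm \<Omega> (\<lambda>x. ?h k x - h x) + (1 - t k) * L2_nrm \<Omega> h) \<longlonglongrightarrow> 0 + (1 - 1) * L2_nrm \<Omega> h"
      by (intro tendsto_intros avgL h hfin lt)
    then have "(\<lambda>k. L2_nrm \<Omega> (\<lambda>x. ?h k x - h x) + (1 - t k) * L2_nrm \<Omega> h) \<longlonglongrightarrow> 0" by simp
    from tendsto_sandwich[OF always_eventually always_eventually tendsto_const this] le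
    show "(\<lambda>k. L2_nrm \<Omega> (\<lambda>x. partial_deriv b (?f k) x - ?g x)) \<longlonglongrightarrow> 0"
      by (simp add: L2_nrm_nonneg)
  qed
qed

section \<open>The interior estimate\<close>

lemma DERIV_integral:
  fixes P P' :: "real \<Rightarrow> 'a \<Rightarrow> real" and w :: "'a \<Rightarrow> real"
  assumes s: "a < s" "s < b"
    and d: "\<And>\<sigma> u. a < \<sigma> \<Longrightarrow> \<sigma> < b \<Longrightarrow> DERIV (\<lambda>\<sigma>. P \<sigma> u) \<sigma> :> P' \<sigma> u"
    and C: "\<And>\<sigma> u. a < \<sigma> \<Longrightarrow> \<sigma> < b \<Longrightarrow> \<bar>P' \<sigma> u\<bar> \<le> C"
    and int: "\<And>\<sigma>. a < \<sigma> \<Longrightarrow> \<sigma> < b \<Longrightarrow> integrable M (\<lambda>u. P \<sigma> u * w u)"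
    and w: "integrable M w" and m: "(\<lambda>u. P' s u * w u) \<in> borel_measurable M"
  shows "DERIV (\<lambda>\<sigma>. \<integral>u. P \<sigma> u * w u \<partial>M) s :> (\<integral>u. P' s u * w u \<partial>M)"
  unfolding DERIV_def tendsto_at_0_iff_sequentially
proof (intro allI impI, elim conjE)
  fix h :: "nat \<Rightarrow> real" assume h: "\<forall>n. h n \<noteq> 0" "h \<longlonglongrightarrow> 0"
  define I where "I n \<longleftrightarrow> a < s + h n \<and> s + h n < b" for n
  have lim: "(\<lambda>n. s + h n) \<longlonglongrightarrow> s" using tendsto_add[OF tendsto_const[of s] h(2)] by simp
  have ev: "eventually I sequentially"
    using order_tendstoD(1)[OF lim s(1)] order_tendstoD(2)[OF lim s(2)] unfolding I_def by eventually_elim simp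
  \<comment> \<open>Set to 0 while s + h n is outside the interval, where neither integrability nor
    the derivative bound is given; this concerns finitely many n only.\<close>
  define q where "q n u = (if I n then (P (s + h n) u * w u - P s u * w u) / h n else 0)" for n u
  have qm: "q n \<in> borel_measurable M" for n
    unfolding q_def using int[of "s + h n"] int[OF s] by (cases "I n") (auto simp: I_def)
  have "(\<lambda>n. \<integral>u. q n u \<partial>M) \<longlonglongrightarrow> (\<integral>u. P' s u * w u \<partial>M)"
  proof (rule integral_dominated_convergence[where w="\<lambda>u. C * \<bar>w u\<bar>"])
    show "AE u in M. (\<lambda>n. q n u) \<longlonglongrightarrow> P' s u * w u"
    proof (rule AE_I2)
      fix u
      have "(\<lambda>n. (P (s + h n) u - P s u) / h n) \<longlonglongrightarrow> P' s u"
        using d[OF s, of u] h unfolding DERIV_def tendsto_at_0_iff_sequentially by blast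
      then have "(\<lambda>n. (P (s + h n) u - P s u) / h n * w u) \<longlonglongrightarrow> P' s u * w u"
        by (rule tendsto_mult_right)
      then show "(\<lambda>n. q n u) \<longlonglongrightarrow> P' s u * w u"
        by (rule Lim_transform_eventually)
          (use ev in \<open>eventually_elim, simp add: q_def left_diff_distrib diff_divide_distrib\<close>)
    qed
    show "AE u in M. norm (q n u) \<le> C * \<bar>w u\<bar>" for n
    proof (rule AE_I2)
      fix u
      show "norm (q n u) \<le> C * \<bar>w u\<bar>"
      proof (cases "I n")
        case True
        have "norm (P (s + h n) u - P s u) \<le> C * norm ((s + h n) - s)"
        proof (rule field_differentiable_bound[of "{a<..<b}" "\<lambda>\<sigma>. P \<sigma> u" "\<lambda>\<sigma>. P' \<sigma> u"])
          show "((\<lambda>\<sigma>. P \<sigma> u) has_field_derivative P' z u) (at z within {a<..<b})" if "z \<in> {a<..<b}" for z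
            using d[of z u] that by (auto intro: has_field_derivative_at_within)
        qed (use True s C in \<open>auto simp: I_def\<close>)
        then have "\<bar>P (s + h n) u - P s u\<bar> / \<bar>h n\<bar> \<le> C" using h(1) by (simp add: divide_le_eq)
        then have "\<bar>P (s + h n) u - P s u\<bar> / \<bar>h n\<bar> * \<bar>w u\<bar> \<le> C * \<bar>w u\<bar>" by (rule mult_right_mono) simp
        moreover have "q n u = (P (s + h n) u - P s u) / h n * w u"
          using True by (simp add: q_def left_diff_distrib diff_divide_distrib)
        ultimately show ?thesis by (simp add: abs_mult)
      next
        case False
        have "C \<ge> 0" using C[OF s, of u] by linarith
        then show ?thesis using False by (simp add: q_def)
      qed
    qed
  qed (use w m qm in auto)
  then show "(\<lambda>n. ((\<integral>u. P (s + h n) u * w u \<partial>M) - (\<integral>u. P s u * w u \<partial>M)) / h n) \<longlonglongrightarrow> (\<integral>u. P' s u * w u \<partial>M)"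
  proof (rule Lim_transform_eventually)
    show "eventually (\<lambda>n. (\<integral>u. q n u \<partial>M) = ((\<integral>u. P (s + h n) u * w u \<partial>M) - (\<integral>u. P s u * w u \<partial>M)) / h n) sequentially"
      using ev
    proof eventually_elim
      case (elim n)
      then have "integrable M (\<lambda>u. P (s + h n) u * w u)" "integrable M (\<lambda>u. P s u * w u)"
        using int[of "s + h n"] int[OF s] by (auto simp: I_def)
      then show ?case using elim by (simp add: q_def)
    qed
  qed
qed

text \<open>The mollifier satisfies \<open>x * mker x = - \<nabla> pker x\<close>, so that its derivative with respect to the
  scale is a Laplacian.\<close>

definition pker :: "'a::euclidean_space \<Rightarrow> real" where
  "pker x = 1 / (2 * kmass TYPE('a)) * bump 0 x"

definition lapker :: "'a::euclidean_space \<Rightarrow> real" where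
  "lapker x = (\<Sum>b\<in>Basis. partial_deriv b (partial_deriv b pker) x)"

lemma smooth_pker: "smooth pker"
  unfolding pker_def[abs_def] by (intro smooth_mult smooth_const smooth_bump)

lemma pker_eq_0: "norm x \<ge> 1 \<Longrightarrow> pker x = 0"
  by (simp add: pker_def bump_eq_0_iff)

lemma partial_pker:
  fixes x :: "'a::euclidean_space"
  shows "partial_deriv b pker x = - ((x \<bullet> b) * mker x)"
  unfolding pker_def[abs_def]
  by (subst partial_deriv_cmult[OF smoothD(1)[OF smooth_bump]]) (simp add: bump_deriv mker_def)

text \<open>Since the gradient of \<open>pker\<close> is -x times the mollifier, its Laplacian is
  minus the divergence of that product; the product rule gives the dimension and the radial
  derivative.\<close>

lemma lapker_eq:
  fixes x :: "'a::euclidean_space"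
  shows "lapker x = - real DIM('a) * mker x - frechet_derivative mker (at x) x"
proof -
  have "partial_deriv b (partial_deriv b pker) x = - mker x - (x \<bullet> b) * partial_deriv b mker x" if b: "b \<in> Basis" for b
  proof -
    have p: "partial_deriv b pker = (\<lambda>x. (-1) * (((x - 0) \<bullet> b) * mker x))" by (auto simp: partial_pker)
    have i: "(\<lambda>x::'a. (x - 0) \<bullet> b) differentiable (at x)" by (rule smoothD(1)[OF smooth_inner])
    have pi: "partial_deriv b (\<lambda>x::'a. (x - 0) \<bullet> b) x = b \<bullet> b"
      by (rule partial_deriv_eq) (auto intro!: derivative_eq_intros)
    have m: "(\<lambda>x. ((x - 0) \<bullet> b) * mker x) differentiable (at x)"
      by (rule smoothD(1)[OF smooth_mult[OF smooth_inner smooth_mker]])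
    have "partial_deriv b (partial_deriv b pker) x = (-1) * partial_deriv b (\<lambda>x. ((x - 0) \<bullet> b) * mker x) x"
      unfolding p by (rule partial_deriv_cmult[OF m])
    also have "partial_deriv b (\<lambda>x. ((x - 0) \<bullet> b) * mker x) x = ((x - 0) \<bullet> b) * partial_deriv b mker x + (b \<bullet> b) * mker x"
      unfolding partial_deriv_mult[OF i smoothD(1)[OF smooth_mker]] pi by simp
    finally show ?thesis using b by simp
  qed
  then show ?thesis
    by (simp add: lapker_def frechet_derivative_partials[OF smoothD(1)[OF smooth_mker]] sum_subtractf)
qed

lemma lapker_bounded:
  shows lapker_continuous: "continuous_on UNIV (lapker :: 'a::euclidean_space \<Rightarrow> real)"
    and "\<exists>B\<ge>0. \<forall>x::'a. \<bar>lapker x\<bar> \<le> B"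
proof -
  show c: "continuous_on UNIV (lapker :: 'a \<Rightarrow> real)"
    unfolding lapker_def[abs_def] by (intro continuous_on_sum smooth_partial_continuous smoothD(3) smooth_pker)
  have "test_fun UNIV (partial_deriv b (partial_deriv b pker))" if "b \<in> Basis" for b :: 'a
    by (intro test_fun_partial that) (use smooth_pker bounded_support[OF pker_eq_0] in \<open>auto simp: test_fun_def\<close>)
  then have "\<exists>B\<ge>0. \<forall>x::'a. \<bar>partial_deriv b (partial_deriv b pker) x\<bar> \<le> B" if "b \<in> Basis" for b
    using smooth_bounded_partials[of "partial_deriv b (partial_deriv b pker)"] that by (metis test_fun_def)
  then obtain B where B: "\<And>b. b \<in> Basis \<Longrightarrow> B b \<ge> 0 \<and> (\<forall>x::'a. \<bar>partial_deriv b (partial_deriv b pker) x\<bar> \<le> B b)"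
    by metis
  have "\<bar>lapker x\<bar> \<le> sum B Basis" for x :: 'a
    unfolding lapker_def by (rule order_trans[OF sum_abs]) (use B in \<open>auto intro!: sum_mono\<close>)
  moreover have "sum B Basis \<ge> 0" using B by (intro sum_nonneg) auto
  ultimately show "\<exists>B\<ge>0. \<forall>x::'a. \<bar>lapker x\<bar> \<le> B" by blast
qed

text \<open>Differentiating the scaled kernel in \<sigma> produces the dimension times
  \<open>mker\<close> plus its radial derivative, with a minus sign, over \<sigma>^(d+1). By
  \<open>lapker_eq\<close> this is a scaled Laplacian, so the change of an average with its scale is
  governed by the Laplacian of the function alone.\<close>

lemma mker_scale_derivative:
  fixes x u :: "'a::euclidean_space"
  assumes \<sigma>: "\<sigma> > 0"
  shows "DERIV (\<lambda>\<sigma>. mker ((1/\<sigma>) *\<^sub>R x + (- 1/\<sigma>) *\<^sub>R u) / \<sigma> ^ DIM('a)) \<sigma> :>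
    lapker ((1/\<sigma>) *\<^sub>R x + (- 1/\<sigma>) *\<^sub>R u) / \<sigma> ^ Suc DIM('a)"
proof -
  define y where "y = (1/\<sigma>) *\<^sub>R x + (- 1/\<sigma>) *\<^sub>R u"
  have dv: "((\<lambda>\<sigma>. (1/\<sigma>) *\<^sub>R x + (- 1/\<sigma>) *\<^sub>R u) has_derivative (\<lambda>h. (- h / \<sigma>) *\<^sub>R y)) (at \<sigma>)"
    using \<sigma> unfolding y_def
    by (auto intro!: derivative_eq_intros ext simp: scaleR_add_right power2_eq_square field_simps)
  have dm: "(mker has_derivative frechet_derivative mker (at y)) (at ((1/\<sigma>) *\<^sub>R x + (- 1/\<sigma>) *\<^sub>R u))"
    using differentiable_partial_deriv[OF smoothD(1)[OF smooth_mker]] by (simp add: y_def)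
  have lin: "linear (frechet_derivative mker (at y))"
    using differentiable_partial_deriv[OF smoothD(1)[OF smooth_mker]] has_derivative_linear by blast
  have "(\<lambda>h. frechet_derivative mker (at y) ((- h / \<sigma>) *\<^sub>R y)) = (*) (- (frechet_derivative mker (at y) y) / \<sigma>)"
    by (auto simp: linear_cmul[OF lin] simp del: scaleR_minus_left)
  with has_derivative_compose[OF dv dm]
  have d1: "DERIV (\<lambda>\<sigma>. mker ((1/\<sigma>) *\<^sub>R x + (- 1/\<sigma>) *\<^sub>R u)) \<sigma> :> - (frechet_derivative mker (at y) y) / \<sigma>"
    by (simp add: has_field_derivative_def)
  have d2: "DERIV (\<lambda>\<sigma>. \<sigma> ^ DIM('a)) \<sigma> :> real DIM('a) * \<sigma> ^ (DIM('a) - 1)"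
    by (auto intro!: derivative_eq_intros)
  have p: "\<sigma> ^ DIM('a) = \<sigma> * \<sigma> ^ (DIM('a) - 1)"
    by (metis DIM_positive power_eq_if not_gr_zero)
  have "(- (frechet_derivative mker (at y) y) / \<sigma> * \<sigma> ^ DIM('a) - mker y * (real DIM('a) * \<sigma> ^ (DIM('a) - 1))) / (\<sigma> ^ DIM('a) * \<sigma> ^ DIM('a))
      = lapker y / \<sigma> ^ Suc DIM('a)"
    unfolding lapker_eq using \<sigma> by (simp add: p field_simps)
  with DERIV_divide[OF d1 d2] \<sigma> show ?thesis by (simp add: y_def)
qed

section \<open>Averages of H2 functions under change of scale\<close>

lemma H2_laplacian_L2:
  assumes "z \<in> H2 \<Omega>"
  shows "laplacian \<Omega> z \<in> L2 \<Omega>"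
  unfolding laplacian_def[abs_def] using assms
  by (intro L2_sum) (auto simp: H2_def intro: H1_L2(2))

lemma weak_laplacian:
  assumes \<Omega>: "open \<Omega>" "bounded \<Omega>" and z: "z \<in> H2 \<Omega>" and \<phi>: "test_fun \<Omega> \<phi>"
  shows "(LINT x|lebesgue_on \<Omega>. z x * (\<Sum>b\<in>Basis. partial_deriv b (partial_deriv b \<phi>) x)) = (LINT x|lebesgue_on \<Omega>. laplacian \<Omega> z x * \<phi> x)"
proof -
  have zH: "z \<in> H1 \<Omega>" and dH: "\<And>b. b \<in> Basis \<Longrightarrow> weak_partial \<Omega> b z \<in> H1 \<Omega>" using z by (auto simp: H2_def)
  have t: "test_fun \<Omega> (partial_deriv b \<phi>)" if "b \<in> Basis" for b using \<phi> that by (rule test_fun_partial)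
  have e: "(LINT x|lebesgue_on \<Omega>. z x * partial_deriv b (partial_deriv b \<phi>) x)
      = (LINT x|lebesgue_on \<Omega>. weak_partial \<Omega> b (weak_partial \<Omega> b z) x * \<phi> x)" if b: "b \<in> Basis" for b
    using H1_weak_partial[OF zH b] H1_weak_partial[OF dH[OF b] b] t[OF b] \<phi> by (simp add: is_weak_partial_def)
  have i1: "integrable (lebesgue_on \<Omega>) (\<lambda>x. z x * partial_deriv b (partial_deriv b \<phi>) x)" if "b \<in> Basis" for b
    by (intro L2_mult_integrable H1_L2(1)[OF zH] test_fun_L2[OF \<Omega>] test_fun_partial \<phi> that)
  have i2: "integrable (lebesgue_on \<Omega>) (\<lambda>x. weak_partial \<Omega> b (weak_partial \<Omega> b z) x * \<phi> x)" if "b \<in> Basis" for b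
    by (intro L2_mult_integrable H1_L2(2)[OF dH] test_fun_L2[OF \<Omega>] \<phi> that)
  show ?thesis
    using e i1 i2 by (simp add: laplacian_def sum_distrib_left sum_distrib_right Bochner_Integration.integral_sum)
qed

definition pkmass :: "'a::euclidean_space itself \<Rightarrow> real" where
  "pkmass _ = sqrt (\<integral>x. (pker (x::'a))\<^sup>2 \<partial>lborel)"

lemma L2_nrm_pker_le:
  fixes x :: "'a::euclidean_space"
  assumes \<Omega>: "open \<Omega>" and \<sigma>: "\<sigma> > 0"
  shows "L2_nrm \<Omega> (\<lambda>u. pker ((1/\<sigma>) *\<^sub>R x + (- 1/\<sigma>) *\<^sub>R u)) \<le> sqrt (\<sigma> ^ DIM('a)) * pkmass TYPE('a)"
proof -
  let ?v = "\<lambda>u. (1/\<sigma>) *\<^sub>R x + (- 1/\<sigma>) *\<^sub>R u"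
  have [measurable]: "(pker :: 'a \<Rightarrow> real) \<in> borel_measurable borel"
    by (intro borel_measurable_continuous_onI smoothD smooth_pker)
  obtain B where B: "B \<ge> 0" "\<And>x::'a. \<bar>pker x\<bar> \<le> B"
    using bounded_smooth_compact_support[OF smooth_pker pker_eq_0] by blast
  have ip: "integrable lborel (\<lambda>x::'a. (pker x)\<^sup>2)"
  proof (rule integrable_compact_support[where B="B\<^sup>2" and K=1])
    show "\<bar>(pker x)\<^sup>2\<bar> \<le> B\<^sup>2" for x :: 'a
      using power_mono[OF B(2)[of x], of 2] by simp
  qed (auto simp: pker_eq_0)
  have "(\<integral>y. (pker (y::'a))\<^sup>2 \<partial>lborel) = \<bar>- 1/\<sigma>\<bar> ^ DIM('a) * (\<integral>u. (pker (?v u))\<^sup>2 \<partial>lborel)"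
    using \<sigma> by (intro integral_lborel_affine) auto
  then have e: "(\<integral>u. (pker (?v u))\<^sup>2 \<partial>lborel) = \<sigma> ^ DIM('a) * (\<integral>y. (pker (y::'a))\<^sup>2 \<partial>lborel)"
    using \<sigma> by (simp add: power_divide)
  have "(LINT u|lebesgue_on \<Omega>. (pker (?v u))\<^sup>2) = (\<integral>u. indicator \<Omega> u * (pker (?v u))\<^sup>2 \<partial>lborel)"
    by (rule integral_lebesgue_on[OF \<Omega>]) measurable
  also have "\<dots> \<le> (\<integral>u. (pker (?v u))\<^sup>2 \<partial>lborel)"
  proof (rule integral_mono')
    show "integrable lborel (\<lambda>u. (pker (?v u))\<^sup>2)"
      using integrable_affine[OF ip, of "- 1/\<sigma>" "(1/\<sigma>) *\<^sub>R x"] \<sigma> by simp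
  qed (auto simp: indicator_def)
  finally have "sqrt (LINT u|lebesgue_on \<Omega>. (pker (?v u))\<^sup>2) \<le> sqrt (\<sigma> ^ DIM('a) * (\<integral>y. (pker (y::'a))\<^sup>2 \<partial>lborel))"
    unfolding e by (rule real_sqrt_le_mono)
  then show ?thesis by (simp add: L2_nrm_def pkmass_def real_sqrt_mult)
qed

lemma pkmass_nonneg: "pkmass TYPE('a::euclidean_space) \<ge> 0"
  by (simp add: pkmass_def)

text \<open>The scale derivative is \<sigma>^(1-d) times the integral of the Laplacian against a
  scaled \<open>pker\<close>. Cauchy-Schwarz and \<open>L2_nrm_pker_le\<close> bound it by c
  \<sigma>^(1-d/2), hence by c / sqrt \<sigma>, whose primitive 2 c sqrt \<sigma> gives a bound
  independent of s0.\<close>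

lemma average_scale_cauchy:
  fixes z w :: "'a::euclidean_space \<Rightarrow> real"
  assumes \<Omega>: "open \<Omega>" "bounded \<Omega>" and d3: "DIM('a) \<le> 3" and z: "z \<in> H2 \<Omega>"
    and w: "w \<in> borel_measurable borel" "\<And>x. x \<notin> \<Omega> \<Longrightarrow> w x = 0"
    and wae: "AE x in lebesgue_on \<Omega>. w x = z x" and wfin: "nsq lborel w < \<infinity>"
    and s: "0 < s0" "s0 \<le> s" "s \<le> 1" and x: "cball x s \<subseteq> \<Omega>"
  shows "\<bar>average 1 0 s w x - average 1 0 s0 w x\<bar> \<le> 2 * pkmass TYPE('a) * L2_nrm \<Omega> (laplacian \<Omega> z) * sqrt s"
proof -
  define c where "c = pkmass TYPE('a) * L2_nrm \<Omega> (laplacian \<Omega> z)"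
  have c0: "c \<ge> 0" by (simp add: c_def pkmass_nonneg L2_nrm_nonneg)
  obtain K where K: "\<And>x. norm x > K \<Longrightarrow> x \<notin> \<Omega>" using bounded_outside[OF \<Omega>(2)] by blast
  have wi: "integrable lborel w" using integrable_of_nsq(1)[OF w(1) wfin, of K] K w(2) by auto
  have [measurable]: "w \<in> borel_measurable borel" by fact
  have [measurable]: "(lapker :: 'a \<Rightarrow> real) \<in> borel_measurable borel"
    by (intro borel_measurable_continuous_onI lapker_continuous)
  have zL: "z \<in> L2 \<Omega>" using z by (simp add: H2_def H1_L2)
  let ?v = "\<lambda>\<sigma> u. (1/\<sigma>) *\<^sub>R x + (- 1/\<sigma>) *\<^sub>R u"
  define h where "h \<sigma> = (\<integral>u. mker (?v \<sigma> u) / \<sigma> ^ DIM('a) * w u \<partial>lborel)" for \<sigma> :: real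
  have ha: "average 1 0 \<sigma> w x = h \<sigma>" if "\<sigma> > 0" for \<sigma>
    using average_kernel[OF w(1), of \<sigma> 1 0 x] that by (simp add: h_def)
  obtain Bl where Bl: "Bl \<ge> 0" "\<And>x::'a. \<bar>lapker x\<bar> \<le> Bl" using lapker_bounded(2) by blast
  obtain Bm where Bm: "Bm \<ge> 0" "\<And>x::'a. \<bar>mker x\<bar> \<le> Bm"
    using bounded_smooth_compact_support[OF smooth_mker mker_eq_0] by blast
  have dh: "DERIV h \<sigma> :> (\<integral>u. lapker (?v \<sigma> u) / \<sigma> ^ Suc DIM('a) * w u \<partial>lborel)" if \<sigma>: "\<sigma> > 0" for \<sigma>
    unfolding h_def
  \<comment> \<open>Any range of scales around \<sigma> bounded away from 0 would do; it bounds the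
    scale derivatives of the kernel uniformly.\<close>
  proof (rule DERIV_integral[where a="\<sigma>/2" and b="2*\<sigma>" and C="Bl / (\<sigma>/2) ^ Suc DIM('a)"])
    fix \<tau> :: real assume t: "\<sigma>/2 < \<tau>" "\<tau> < 2*\<sigma>"
    then have t0: "\<tau> > 0" using \<sigma> by simp
    show "DERIV (\<lambda>\<tau>. mker (?v \<tau> u) / \<tau> ^ DIM('a)) \<tau> :> lapker (?v \<tau> u) / \<tau> ^ Suc DIM('a)" for u
      by (rule mker_scale_derivative[OF t0])
    show "\<bar>lapker (?v \<tau> u) / \<tau> ^ Suc DIM('a)\<bar> \<le> Bl / (\<sigma>/2) ^ Suc DIM('a)" for u
    proof -
      have "(\<sigma>/2) ^ Suc DIM('a) \<le> \<tau> ^ Suc DIM('a)" using t \<sigma> by (intro power_mono) auto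
      then have "\<bar>lapker (?v \<tau> u)\<bar> / \<tau> ^ Suc DIM('a) \<le> Bl / (\<sigma>/2) ^ Suc DIM('a)"
        using Bl t0 \<sigma> by (intro frac_le) auto
      then show ?thesis using t0 by (simp add: abs_divide)
    qed
    show "integrable lborel (\<lambda>u. mker (?v \<tau> u) / \<tau> ^ DIM('a) * w u)"
    proof (rule Bochner_Integration.integrable_bound[of _ "\<lambda>u. Bm / \<tau> ^ DIM('a) * w u"])
      show "AE u in lborel. norm (mker (?v \<tau> u) / \<tau> ^ DIM('a) * w u) \<le> norm (Bm / \<tau> ^ DIM('a) * w u)"
        unfolding norm_mult using Bm t0 by (intro AE_I2 mult_right_mono) (auto simp: divide_right_mono)
    qed (use wi in auto)
  qed (use \<sigma> wi in auto)
  have bound: "\<bar>\<integral>u. lapker (?v \<sigma> u) / \<sigma> ^ Suc DIM('a) * w u \<partial>lborel\<bar> \<le> c / sqrt \<sigma>" if \<sigma>: "0 < \<sigma>" "\<sigma> \<le> s" for \<sigma>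
  proof -
    have cb: "cball x \<sigma> \<subseteq> \<Omega>" using x subset_cball[OF \<sigma>(2), of x] by blast
    define \<phi> where "\<phi> u = pker (?v \<sigma> u)" for u
    have tf: "test_fun \<Omega> \<phi>"
      using test_fun_scale[OF test_fun_bump[OF \<sigma>(1) cb, of 0], of "1 / (2 * kmass TYPE('a))"]
      by (simp add: \<phi>_def[abs_def] pker_def)
    have p1: "partial_deriv b \<phi> = (\<lambda>u. (- 1/\<sigma>) * partial_deriv b pker (?v \<sigma> u))" for b
      unfolding \<phi>_def[abs_def] by (rule ext, rule partial_deriv_affine(2)[OF smoothD(1)[OF smooth_pker]])
    have p2: "partial_deriv b (partial_deriv b \<phi>) u = (- 1/\<sigma>) * ((- 1/\<sigma>) * partial_deriv b (partial_deriv b pker) (?v \<sigma> u))" if b: "b \<in> Basis" for b u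
    proof -
      have sp: "smooth (partial_deriv b pker)" by (rule smoothD(3)[OF smooth_pker b])
      show ?thesis unfolding p1
        by (subst partial_deriv_cmult[OF smoothD(1)[OF smooth_affine[OF sp]]], subst partial_deriv_affine(2)[OF smoothD(1)[OF sp]]) simp
    qed
    have lap: "(\<Sum>b\<in>Basis. partial_deriv b (partial_deriv b \<phi>) u) = lapker (?v \<sigma> u) / \<sigma>\<^sup>2" for u
      using \<sigma> by (simp add: p2 lapker_def sum_divide_distrib power2_eq_square)
    have "(\<integral>u. w u * (lapker (?v \<sigma> u) / \<sigma>\<^sup>2) \<partial>lborel) = (LINT x|lebesgue_on \<Omega>. z x * (\<Sum>b\<in>Basis. partial_deriv b (partial_deriv b \<phi>) x))"
      unfolding lap using zL
      by (intro representative_integral[OF \<Omega>(1) w wae, symmetric]) (auto simp: L2_def)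
    also have "\<dots> = (LINT x|lebesgue_on \<Omega>. laplacian \<Omega> z x * \<phi> x)" by (rule weak_laplacian[OF \<Omega> z tf])
    finally have e: "(\<integral>u. w u * (lapker (?v \<sigma> u) / \<sigma>\<^sup>2) \<partial>lborel) = (LINT x|lebesgue_on \<Omega>. laplacian \<Omega> z x * \<phi> x)" .
    have "(\<integral>u. lapker (?v \<sigma> u) / \<sigma> ^ Suc DIM('a) * w u \<partial>lborel) = (\<integral>u. (\<sigma> / \<sigma> ^ DIM('a)) * (w u * (lapker (?v \<sigma> u) / \<sigma>\<^sup>2)) \<partial>lborel)"
      using \<sigma> by (intro Bochner_Integration.integral_cong) (auto simp: power2_eq_square mult_ac)
    also have "\<dots> = (\<sigma> / \<sigma> ^ DIM('a)) * (LINT x|lebesgue_on \<Omega>. laplacian \<Omega> z x * \<phi> x)"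
      unfolding e[symmetric] by simp
    finally have e2: "(\<integral>u. lapker (?v \<sigma> u) / \<sigma> ^ Suc DIM('a) * w u \<partial>lborel) = (\<sigma> / \<sigma> ^ DIM('a)) * (LINT x|lebesgue_on \<Omega>. laplacian \<Omega> z x * \<phi> x)" .
    have "\<bar>LINT x|lebesgue_on \<Omega>. laplacian \<Omega> z x * \<phi> x\<bar> \<le> L2_nrm \<Omega> (laplacian \<Omega> z) * L2_nrm \<Omega> \<phi>"
      by (intro L2_Cauchy_Schwarz H2_laplacian_L2 z test_fun_L2[OF \<Omega> tf])
    also have "\<dots> \<le> L2_nrm \<Omega> (laplacian \<Omega> z) * (sqrt (\<sigma> ^ DIM('a)) * pkmass TYPE('a))"
      unfolding \<phi>_def by (intro mult_left_mono L2_nrm_pker_le \<Omega> \<sigma>) (simp add: L2_nrm_nonneg)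
    also have "\<dots> = c * sqrt (\<sigma> ^ DIM('a))" by (simp add: c_def)
    finally have "\<bar>\<integral>u. lapker (?v \<sigma> u) / \<sigma> ^ Suc DIM('a) * w u \<partial>lborel\<bar> \<le> (\<sigma> / \<sigma> ^ DIM('a)) * (c * sqrt (\<sigma> ^ DIM('a)))"
      unfolding e2 abs_mult using \<sigma> by (intro mult_mono) auto
    also have "\<dots> = c * (\<sigma> / sqrt (\<sigma> ^ DIM('a)))"
      using \<sigma> by (simp add: field_simps real_sqrt_mult[symmetric])
    also have "\<dots> \<le> c * (1 / sqrt \<sigma>)"
    proof (intro mult_left_mono c0)
      \<comment> \<open>Here the bound on the dimension is used; \<sigma> \<le> 1 makes powers
        decrease with the exponent.\<close>
      have "\<sigma> ^ 3 \<le> \<sigma> ^ DIM('a)" using \<sigma> s d3 by (intro power_decreasing) auto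
      then have "sqrt (\<sigma> ^ 2 * \<sigma>) \<le> sqrt (\<sigma> ^ DIM('a))" by (simp add: power3_eq_cube power2_eq_square)
      then have "\<sigma> * sqrt \<sigma> \<le> sqrt (\<sigma> ^ DIM('a))" using \<sigma> by (simp add: real_sqrt_mult)
      then show "\<sigma> / sqrt (\<sigma> ^ DIM('a)) \<le> 1 / sqrt \<sigma>" using \<sigma> by (simp add: field_simps)
    qed
    finally show ?thesis by simp
  qed
  define D where "D \<sigma> = (\<integral>u. lapker (?v \<sigma> u) / \<sigma> ^ Suc DIM('a) * w u \<partial>lborel)" for \<sigma>
  have D: "DERIV h \<sigma> :> D \<sigma>" "\<bar>D \<sigma>\<bar> \<le> c / sqrt \<sigma>" if "s0 \<le> \<sigma>" "\<sigma> \<le> s" for \<sigma>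
    using dh[of \<sigma>] bound[of \<sigma>] that s unfolding D_def by auto
  have ds: "DERIV (\<lambda>\<sigma>. 2 * c * sqrt \<sigma>) \<sigma> :> c / sqrt \<sigma>" if "\<sigma> > 0" for \<sigma>
    using that by (auto intro!: derivative_eq_intros simp: field_simps)
  \<comment> \<open>Monotonicity of h + 2 c sqrt \<sigma> and of 2 c sqrt \<sigma> - h replaces
    integrating the derivative of h over [s0, s].\<close>
  have up: "h s0 + 2 * c * sqrt s0 \<le> h s + 2 * c * sqrt s"
  proof (rule DERIV_nonneg_imp_nondecreasing[OF s(2)])
    fix \<sigma> assume i: "s0 \<le> \<sigma>" "\<sigma> \<le> s"
    then have "DERIV (\<lambda>\<sigma>. h \<sigma> + 2 * c * sqrt \<sigma>) \<sigma> :> D \<sigma> + c / sqrt \<sigma>" "0 \<le> D \<sigma> + c / sqrt \<sigma>"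
      using s DERIV_add[OF D(1)[OF i] ds[of \<sigma>]] D(2)[OF i] by (simp, linarith)
    then show "\<exists>y. DERIV (\<lambda>\<sigma>. h \<sigma> + 2 * c * sqrt \<sigma>) \<sigma> :> y \<and> 0 \<le> y" by blast
  qed
  have lo: "2 * c * sqrt s0 - h s0 \<le> 2 * c * sqrt s - h s"
  proof (rule DERIV_nonneg_imp_nondecreasing[OF s(2)])
    fix \<sigma> assume i: "s0 \<le> \<sigma>" "\<sigma> \<le> s"
    then have "DERIV (\<lambda>\<sigma>. 2 * c * sqrt \<sigma> - h \<sigma>) \<sigma> :> c / sqrt \<sigma> - D \<sigma>" "0 \<le> c / sqrt \<sigma> - D \<sigma>"
      using s DERIV_diff[OF ds[of \<sigma>] D(1)[OF i]] D(2)[OF i] by (simp, linarith)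
    then show "\<exists>y. DERIV (\<lambda>\<sigma>. 2 * c * sqrt \<sigma> - h \<sigma>) \<sigma> :> y \<and> 0 \<le> y" by blast
  qed
  have "c * sqrt s0 \<ge> 0" using c0 s by simp
  then have "\<bar>h s - h s0\<bar> \<le> 2 * c * sqrt s" using up lo by (simp add: abs_le_iff)
  then show ?thesis using s by (simp add: ha c_def mult.assoc)
qed

text \<open>The set where the two functions differ is open, and nonempty open sets are not
  negligible. This makes the definite description in \<open>point_value\<close> meaningful.\<close>

lemma continuous_representative_unique:
  fixes u v :: "'a::euclidean_space \<Rightarrow> real"
  assumes \<Omega>: "open \<Omega>" and c: "continuous_on \<Omega> u" "continuous_on \<Omega> v"
    and ae: "AE x in lebesgue_on \<Omega>. u x = v x" and x: "x \<in> \<Omega>"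
  shows "u x = v x"
proof (rule ccontr)
  assume ne: "u x \<noteq> v x"
  have "open {y\<in>\<Omega>. u y - v y \<in> - {0}}"
    using continuous_open_preimage[OF continuous_on_diff[OF c] \<Omega> open_Compl[OF closed_singleton[of 0]]]
    by (simp add: vimage_def Int_def)
  moreover have "x \<in> {y\<in>\<Omega>. u y - v y \<in> - {0}}" using x ne by simp
  ultimately have "\<not> negligible {y\<in>\<Omega>. u y - v y \<in> - {0}}" using open_not_negligible by blast
  moreover have "AE y in lebesgue. y \<in> \<Omega> \<longrightarrow> u y = v y" using ae \<Omega> by (simp add: AE_restrict_space_iff)
  then obtain N where N: "N \<in> null_sets lebesgue" "{y. \<not> (y \<in> \<Omega> \<longrightarrow> u y = v y)} \<subseteq> N"
    unfolding eventually_ae_filter by auto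
  then have "negligible {y\<in>\<Omega>. u y - v y \<in> - {0}}"
    unfolding negligible_iff_null_sets[symmetric] by (elim negligible_subset) auto
  ultimately show False by blast
qed

lemma point_value_eq:
  assumes \<Omega>: "open \<Omega>" and u: "continuous_on \<Omega> u" "AE y in lebesgue_on \<Omega>. u y = z y" and x: "x \<in> \<Omega>"
  shows "point_value \<Omega> z x = u x"
  unfolding point_value_def
proof (rule the_equality)
  show "\<exists>v. continuous_on \<Omega> v \<and> (AE y in lebesgue_on \<Omega>. v y = z y) \<and> v x = u x" using u by blast
  fix r assume "\<exists>v. continuous_on \<Omega> v \<and> (AE y in lebesgue_on \<Omega>. v y = z y) \<and> v x = r"
  then obtain v where v: "continuous_on \<Omega> v" "AE y in lebesgue_on \<Omega>. v y = z y" "v x = r" by blast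
  have "AE y in lebesgue_on \<Omega>. v y = u y" using v(2) u(2) by eventually_elim simp
  from continuous_representative_unique[OF \<Omega> v(1) u(1) this x] v(3) show "r = u x" by simp
qed

text \<open>The representative u is the limit of the averages as the scale tends to 0, and it
  differs from the average at scale s by at most \<kappa> sqrt s times the norm of the Laplacian. At
  a fixed scale the average is bounded and Lipschitz through its kernel, with a constant that blows
  up as s tends to 0. The first error can therefore be made small through s, and afterwards the
  second through the distance of the points.\<close>

theorem interior_estimate:
  fixes \<Omega> :: "'a::euclidean_space set"
  assumes \<Omega>: "open \<Omega>" "bounded \<Omega>" and d3: "DIM('a) \<le> 3"
  obtains C L where "C \<ge> 0" "\<And>s. s > 0 \<Longrightarrow> L s \<ge> 0"
    "\<And>z. z \<in> H2 \<Omega> \<Longrightarrow> \<exists>u. continuous_on \<Omega> u \<and> (AE x in lebesgue_on \<Omega>. u x = z x) \<and>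
      (\<forall>x s. 0 < s \<longrightarrow> s \<le> 1 \<longrightarrow> cball x s \<subseteq> \<Omega> \<longrightarrow>
         \<bar>u x\<bar> \<le> C * sqrt s * L2_nrm \<Omega> (laplacian \<Omega> z) + L s * L2_nrm \<Omega> z) \<and>
      (\<forall>x y s. 0 < s \<longrightarrow> s \<le> 1 \<longrightarrow> cball x s \<subseteq> \<Omega> \<longrightarrow> cball y s \<subseteq> \<Omega> \<longrightarrow>
         \<bar>u x - u y\<bar> \<le> C * sqrt s * L2_nrm \<Omega> (laplacian \<Omega> z) + L s * norm (x - y) * L2_nrm \<Omega> z)"
proof -
  define \<kappa> where "\<kappa> = 2 * pkmass TYPE('a)"
  have k0: "\<kappa> \<ge> 0" by (simp add: \<kappa>_def pkmass_nonneg)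
  obtain Bm where Bm: "Bm \<ge> 0" "\<And>x::'a. \<bar>mker x\<bar> \<le> Bm" "\<And>b x::'a. b \<in> Basis \<Longrightarrow> \<bar>partial_deriv b mker x\<bar> \<le> Bm"
    using smooth_bounded_partials[OF smooth_mker compact_support_mker] by blast
  define Lm where "Lm = DIM('a) * Bm"
  have Lm0: "Lm \<ge> 0" using Bm by (simp add: Lm_def)
  have lip: "\<bar>mker x - mker y\<bar> \<le> Lm * norm (x - y)" for x y :: 'a
    unfolding Lm_def by (rule lipschitz_of_partials(2)[of UNIV]) (use Bm smoothD(1)[OF smooth_mker] in auto)
  define V where "V = L2_nrm \<Omega> (\<lambda>_. 1)"
  have V0: "V \<ge> 0" by (simp add: V_def L2_nrm_nonneg)
  \<comment> \<open>\<open>Bm\<close> bounds the kernel and \<open>Lm / s\<close> its Lipschitz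
    constant at scale s; the sum serves both estimates. The factor V passes from the L1 to the L2
    norm.\<close>
  define L where "L s = (Bm + Lm / s) / s ^ DIM('a) * V" for s
  have L0: "s > 0 \<Longrightarrow> L s \<ge> 0" for s using Bm Lm0 V0 by (simp add: L_def)
  obtain K where K: "\<And>x. norm x > K \<Longrightarrow> x \<notin> \<Omega>" using bounded_outside[OF \<Omega>(2)] by blast
  show ?thesis
  \<comment> \<open>The oscillation estimate compares u with its average at both points, hence twice
    \<kappa>.\<close>
  proof (rule that[of "2 * \<kappa>" L])
    show "2 * \<kappa> \<ge> 0" using k0 by simp
    show "s > 0 \<Longrightarrow> L s \<ge> 0" for s by (rule L0)
    fix z assume z: "z \<in> H2 \<Omega>"
    define G where "G = L2_nrm \<Omega> (laplacian \<Omega> z)"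
    define N where "N = L2_nrm \<Omega> z"
    have G0: "G \<ge> 0" and N0: "N \<ge> 0" by (auto simp: G_def N_def L2_nrm_nonneg)
    have zL: "z \<in> L2 \<Omega>" using z by (simp add: H2_def H1_L2)
    obtain w where w: "w \<in> borel_measurable borel" "\<And>x. x \<notin> \<Omega> \<Longrightarrow> w x = 0"
      and wae: "AE x in lebesgue_on \<Omega>. w x = z x" and wfin: "nsq lborel w < \<infinity>"
      using borel_representative[OF \<Omega>(1) zL] by blast
    have [measurable]: "w \<in> borel_measurable borel" by fact
    have wi: "integrable lborel w" using integrable_of_nsq(1)[OF w(1) wfin, of K] K w(2) by auto
    let ?A = "\<lambda>s. average 1 0 s w"
    let ?An = "\<lambda>n. ?A (inverse (real (Suc n)))"
    note cauchy = average_scale_cauchy[OF \<Omega> d3 z w wae wfin, folded \<kappa>_def G_def]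
    have w1: "(\<integral>x. \<bar>w x\<bar> \<partial>lborel) \<le> V * N"
    proof -
      have "(\<integral>x. \<bar>w x\<bar> * 1 \<partial>lborel) = (LINT x|lebesgue_on \<Omega>. \<bar>z x\<bar> * 1)"
        by (rule representative_integral[symmetric, OF \<Omega>(1)])
          (use w wae zL in \<open>auto simp: L2_def elim!: eventually_mono\<close>)
      also have "\<dots> \<le> L2_nrm \<Omega> (\<lambda>x. \<bar>z x\<bar>) * V"
        unfolding V_def using L2_Cauchy_Schwarz[of "\<lambda>x. \<bar>z x\<bar>" \<Omega> "\<lambda>_. 1"] zL L2_continuous[OF \<Omega>, of "\<lambda>_. 1"]
        by (auto simp: L2_def)
      also have "L2_nrm \<Omega> (\<lambda>x. \<bar>z x\<bar>) = N" by (simp add: L2_nrm_def N_def)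
      finally show ?thesis by (simp add: mult.commute)
    qed
    let ?v = "\<lambda>s x u. (1/s) *\<^sub>R x + (- 1/s) *\<^sub>R (u::'a)"
    have Ak: "?A s x = (\<integral>u. mker (?v s x u) * w u \<partial>lborel) / s ^ DIM('a)" if "s > 0" for s x
      using average_kernel[OF w(1), of s 1 0 x] that by simp
    have im: "integrable lborel (\<lambda>u. mker (?v s x u) * w u)" for s x
    proof (rule Bochner_Integration.integrable_bound[of _ "\<lambda>u. Bm * w u"])
      show "AE u in lborel. norm (mker (?v s x u) * w u) \<le> norm (Bm * w u)"
        unfolding norm_mult using Bm by (intro AE_I2 mult_right_mono) (auto intro: order_trans[OF _ abs_ge_self])
    qed (use wi in auto)
    have aw: "integrable lborel (\<lambda>u. \<bar>w u\<bar>)" using wi by simp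
    have ib: "\<bar>\<integral>u. F u \<partial>lborel\<bar> \<le> (\<integral>u. M * \<bar>w u\<bar> \<partial>lborel)"
      if "integrable lborel F" "\<And>u. \<bar>F u\<bar> \<le> M * \<bar>w u\<bar>" for F M
    proof (rule order_trans[OF integral_abs_bound])
      show "(\<integral>u. \<bar>F u\<bar> \<partial>lborel) \<le> (\<integral>u. M * \<bar>w u\<bar> \<partial>lborel)"
        by (rule integral_mono) (use that aw in auto)
    qed
    have A1: "\<bar>?A s x\<bar> \<le> L s * N" if s: "s > 0" for s x
    proof -
      have "\<bar>\<integral>u. mker (?v s x u) * w u \<partial>lborel\<bar> \<le> (\<integral>u. Bm * \<bar>w u\<bar> \<partial>lborel)"
        by (rule ib[OF im]) (simp add: abs_mult mult_right_mono Bm)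
      also have "\<dots> \<le> Bm * (V * N)" using w1 Bm by (simp add: mult_left_mono)
      also have "\<dots> \<le> (Bm + Lm / s) * (V * N)" using Lm0 s V0 N0 by (intro mult_right_mono) auto
      finally have "\<bar>\<integral>u. mker (?v s x u) * w u \<partial>lborel\<bar> / s ^ DIM('a) \<le> (Bm + Lm / s) * (V * N) / s ^ DIM('a)"
        using s by (intro divide_right_mono) auto
      then show ?thesis using s by (simp add: Ak L_def abs_divide mult_ac)
    qed
    have A2: "\<bar>?A s x - ?A s y\<bar> \<le> L s * norm (x - y) * N" if s: "s > 0" for s x y
    proof -
      have vv: "?v s x u - ?v s y u = (1/s) *\<^sub>R (x - y)" for u by (simp add: algebra_simps)
      have lp: "\<bar>mker (?v s x u) - mker (?v s y u)\<bar> \<le> Lm / s * norm (x - y)" for u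
        using lip[of "?v s x u" "?v s y u"] s unfolding vv by simp
      have "\<bar>(\<integral>u. mker (?v s x u) * w u \<partial>lborel) - (\<integral>u. mker (?v s y u) * w u \<partial>lborel)\<bar>
        = \<bar>\<integral>u. (mker (?v s x u) - mker (?v s y u)) * w u \<partial>lborel\<bar>"
        unfolding left_diff_distrib by (subst Bochner_Integration.integral_diff[OF im im]) simp
      also have "\<dots> \<le> (\<integral>u. (Lm / s * norm (x - y)) * \<bar>w u\<bar> \<partial>lborel)"
      proof (rule ib)
        show "integrable lborel (\<lambda>u. (mker (?v s x u) - mker (?v s y u)) * w u)"
          unfolding left_diff_distrib by (rule Bochner_Integration.integrable_diff[OF im im])
        show "\<bar>(mker (?v s x u) - mker (?v s y u)) * w u\<bar> \<le> (Lm / s * norm (x - y)) * \<bar>w u\<bar>" for u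
          unfolding abs_mult by (rule mult_right_mono[OF lp]) simp
      qed
      also have "\<dots> \<le> (Lm / s * norm (x - y)) * (V * N)" using w1 Lm0 s
        by (subst integral_mult_right_zero) (intro mult_left_mono mult_nonneg_nonneg divide_nonneg_nonneg; simp)
      also have "\<dots> \<le> ((Bm + Lm / s) * norm (x - y)) * (V * N)" using Bm Lm0 s V0 N0 by (intro mult_right_mono) auto
      finally have "\<bar>(\<integral>u. mker (?v s x u) * w u \<partial>lborel) - (\<integral>u. mker (?v s y u) * w u \<partial>lborel)\<bar> / s ^ DIM('a)
         \<le> ((Bm + Lm / s) * norm (x - y)) * (V * N) / s ^ DIM('a)" using s by (intro divide_right_mono) auto
      then show ?thesis using s by (simp add: Ak[OF s] L_def abs_divide mult_ac flip: diff_divide_distrib)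
    qed
    have conv: "convergent (\<lambda>n. ?An n x)" and near: "\<And>s. 0 < s \<Longrightarrow> s \<le> 1 \<Longrightarrow> cball x s \<subseteq> \<Omega> \<Longrightarrow> \<bar>?A s x - lim (\<lambda>n. ?An n x)\<bar> \<le> \<kappa> * G * sqrt s"
      if x: "x \<in> \<Omega>" for x
    proof -
      have ev: "eventually (\<lambda>n. \<bar>?A s x - ?An n x\<bar> \<le> \<kappa> * G * sqrt s) sequentially"
        if s: "0 < s" "s \<le> 1" "cball x s \<subseteq> \<Omega>" for s
      proof -
        have "eventually (\<lambda>n. inverse (real (Suc n)) < s) sequentially"
          using order_tendstoD(2)[OF LIMSEQ_inverse_real_of_nat s(1)] .
        then show ?thesis
          by eventually_elim (use cauchy[OF _ _ _ s(2,3)] in auto)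
      qed
      have "Cauchy (\<lambda>n. ?An n x)"
      proof (rule metric_CauchyI)
        fix e :: real assume e: "e > 0"
        obtain r where r: "r > 0" "cball x r \<subseteq> \<Omega>" using x \<Omega>(1) open_contains_cball by blast
        \<comment> \<open>A scale with \<kappa> G sqrt s \<le> e/4; the summand 1 guards against
          \<kappa> G = 0.\<close>
        define s where "s = min (min 1 r) ((e / (4 * (\<kappa> * G + 1)))\<^sup>2)"
        have kg: "\<kappa> * G \<ge> 0" using k0 G0 by simp
        have s: "0 < s" "s \<le> 1" "s \<le> r" using r e kg by (auto simp: s_def)
        have cb: "cball x s \<subseteq> \<Omega>" using r(2) subset_cball[OF s(3), of x] by blast
        have "sqrt s \<le> sqrt ((e / (4 * (\<kappa> * G + 1)))\<^sup>2)" unfolding s_def by (intro real_sqrt_le_mono min.cobounded2)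
        also have "\<dots> = e / (4 * (\<kappa> * G + 1))" using e kg by simp
        finally have "\<kappa> * G * sqrt s \<le> \<kappa> * G * (e / (4 * (\<kappa> * G + 1)))" using kg by (intro mult_left_mono)
        also have "\<dots> \<le> (\<kappa> * G + 1) * (e / (4 * (\<kappa> * G + 1)))" using kg e by (intro mult_right_mono) auto
        also have "\<dots> = e / 4" using kg by (simp add: field_simps)
        finally have small: "\<kappa> * G * sqrt s \<le> e / 4" .
        obtain m where m: "\<And>n. n \<ge> m \<Longrightarrow> \<bar>?A s x - ?An n x\<bar> \<le> \<kappa> * G * sqrt s"
          using ev[OF s(1,2) cb] unfolding eventually_sequentially by blast
        show "\<exists>M. \<forall>n\<ge>M. \<forall>k\<ge>M. dist (?An n x) (?An k x) < e"
        proof (intro exI allI impI)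
          fix n k assume "m \<le> n" "m \<le> k"
          then show "dist (?An n x) (?An k x) < e" using m[of n] m[of k] small e by (simp add: dist_real_def)
        qed
      qed
      then show c: "convergent (\<lambda>n. ?An n x)" by (simp add: Cauchy_convergent_iff)
      fix s :: real assume s: "0 < s" "s \<le> 1" "cball x s \<subseteq> \<Omega>"
      have "(\<lambda>n. \<bar>?A s x - ?An n x\<bar>) \<longlonglongrightarrow> \<bar>?A s x - lim (\<lambda>n. ?An n x)\<bar>"
        using c by (intro tendsto_intros) (simp add: convergent_LIMSEQ_iff)
      then show "\<bar>?A s x - lim (\<lambda>n. ?An n x)\<bar> \<le> \<kappa> * G * sqrt s"
        by (rule tendsto_upperbound[OF _ ev[OF s]]) simp
    qed
    define u where "u x = lim (\<lambda>n. ?An n x)" for x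
    have inn: "x \<in> \<Omega>" if "0 < s" "cball x s \<subseteq> \<Omega>" for x s using that by auto
    have u1: "\<bar>u x\<bar> \<le> 2 * \<kappa> * sqrt s * G + L s * N" if s: "0 < s" "s \<le> 1" "cball x s \<subseteq> \<Omega>" for x s
    proof -
      have "\<kappa> * G * sqrt s \<ge> 0" using k0 G0 s by simp
      then show ?thesis using near[OF inn[OF s(1,3)] s, folded u_def] A1[OF s(1), of x] by (simp add: mult_ac)
    qed
    have u2: "\<bar>u x - u y\<bar> \<le> 2 * \<kappa> * sqrt s * G + L s * norm (x - y) * N" if s: "0 < s" "s \<le> 1" "cball x s \<subseteq> \<Omega>" "cball y s \<subseteq> \<Omega>" for x y s
      using near[OF inn[OF s(1,3)] s(1-3), folded u_def] near[OF inn[OF s(1,4)] s(1,2,4), folded u_def] A2[OF s(1), of x y]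
      by (simp add: mult_ac)
    have cu: "continuous_on \<Omega> u"
      unfolding continuous_on_iff
    proof (intro ballI allI impI)
      fix x and e :: real assume x: "x \<in> \<Omega>" and e: "e > 0"
      obtain r where r: "r > 0" "cball x r \<subseteq> \<Omega>" using x \<Omega>(1) open_contains_cball by blast
      define q where "q = 2 * \<kappa> * G + 1"
      have q: "q > 0" "2 * \<kappa> * G \<le> q" using k0 G0 by (auto simp: q_def add_pos_nonneg intro!: add_nonneg_pos)
      define s where "s = min (min 1 (r/2)) ((e / (2 * q))\<^sup>2)"
      have s: "0 < s" "s \<le> 1" "s \<le> r/2" using r e q by (auto simp: s_def)
      have "sqrt s \<le> sqrt ((e / (2 * q))\<^sup>2)" unfolding s_def by (intro real_sqrt_le_mono min.cobounded2)
      also have "\<dots> = e / (2 * q)" using e q by simp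
      finally have "2 * \<kappa> * G * sqrt s \<le> q * (e / (2 * q))" using q s k0 G0 by (intro mult_mono) auto
      then have small: "2 * \<kappa> * sqrt s * G \<le> e / 2" using q by (simp add: mult_ac)
      define p where "p = L s * N + 1"
      have p: "p > 0" "L s * N \<ge> 0" using L0[OF s(1)] N0 by (auto simp: p_def intro!: add_nonneg_pos)
      define \<delta> where "\<delta> = min (r/2) (e / (2 * p))"
      show "\<exists>d>0. \<forall>y\<in>\<Omega>. dist y x < d \<longrightarrow> dist (u y) (u x) < e"
      proof (intro exI conjI ballI impI)
        show "\<delta> > 0" using r e p by (simp add: \<delta>_def)
        fix y assume y: "y \<in> \<Omega>" "dist y x < \<delta>"
        have "cball y s \<subseteq> cball x r" "cball x s \<subseteq> cball x r" using y s by (auto simp: cball_subset_cball_iff \<delta>_def dist_commute)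
        then have cb: "cball y s \<subseteq> \<Omega>" "cball x s \<subseteq> \<Omega>" using r(2) by auto
        have "L s * norm (y - x) * N = L s * N * norm (y - x)" by simp
        also have "\<dots> \<le> L s * N * (e / (2 * p))" using p y by (intro mult_left_mono) (auto simp: \<delta>_def dist_norm)
        also have "\<dots> < p * (e / (2 * p))" using p e by (intro mult_strict_right_mono) (auto simp: p_def)
        also have "\<dots> = e / 2" using p by simp
        finally show "dist (u y) (u x) < e" using u2[OF s(1,2) cb] small by (simp add: dist_real_def)
      qed
    qed
    have "AE x in lborel. (if x \<in> \<Omega> then u x else 0) = w x"
    proof (rule nsq_liminf_0[where f="\<lambda>n x. if x \<in> \<Omega> then ?An n x else 0"])
      show "AE x in lborel. (\<lambda>n. if x \<in> \<Omega> then ?An n x else 0) \<longlonglongrightarrow> (if x \<in> \<Omega> then u x else 0)"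
      proof (rule AE_I2)
        fix x
        show "(\<lambda>n. if x \<in> \<Omega> then ?An n x else 0) \<longlonglongrightarrow> (if x \<in> \<Omega> then u x else 0)"
          using conv[of x] by (cases "x \<in> \<Omega>") (auto simp: u_def convergent_LIMSEQ_iff)
      qed
      show "(\<lambda>n. nsq lborel (\<lambda>x. (if x \<in> \<Omega> then ?An n x else 0) - w x)) \<longlonglongrightarrow> 0"
      proof (rule tendsto_sandwich[OF always_eventually always_eventually tendsto_const average_scale_tendsto[OF w(1) wfin \<Omega>(2) w(2)]])
        show "\<forall>n. nsq lborel (\<lambda>x. (if x \<in> \<Omega> then ?An n x else 0) - w x) \<le> nsq lborel (\<lambda>x. ?An n x - w x)"
          unfolding nsq_def using w(2) by (auto intro!: nn_integral_mono ennreal_leI)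
      qed auto
      show "(\<lambda>x. if x \<in> \<Omega> then ?An n x else 0) \<in> borel_measurable lborel" for n
        using \<Omega>(1) by (intro measurable_If_set) auto
      have "u \<in> borel_measurable borel" unfolding u_def[abs_def] by (intro borel_measurable_lim_metric average_measurable w)
      then show "(\<lambda>x. if x \<in> \<Omega> then u x else 0) \<in> borel_measurable lborel"
        using \<Omega>(1) by (intro measurable_If_set) auto
    qed (use w in auto)
    then have "AE x in lebesgue_on \<Omega>. u x = w x"
      unfolding AE_lebesgue_on_iff[OF \<Omega>(1)] by eventually_elim (auto split: if_splits)
    with wae have "AE x in lebesgue_on \<Omega>. u x = z x" by eventually_elim simp
    then show "\<exists>u. continuous_on \<Omega> u \<and> (AE x in lebesgue_on \<Omega>. u x = z x) \<and>
      (\<forall>x s. 0 < s \<longrightarrow> s \<le> 1 \<longrightarrow> cball x s \<subseteq> \<Omega> \<longrightarrow>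
         \<bar>u x\<bar> \<le> 2 * \<kappa> * sqrt s * L2_nrm \<Omega> (laplacian \<Omega> z) + L s * L2_nrm \<Omega> z) \<and>
      (\<forall>x y s. 0 < s \<longrightarrow> s \<le> 1 \<longrightarrow> cball x s \<subseteq> \<Omega> \<longrightarrow> cball y s \<subseteq> \<Omega> \<longrightarrow>
         \<bar>u x - u y\<bar> \<le> 2 * \<kappa> * sqrt s * L2_nrm \<Omega> (laplacian \<Omega> z) + L s * norm (x - y) * L2_nrm \<Omega> z)"
      using cu u1 u2 unfolding G_def N_def by blast
  qed
qed

section \<open>The Minkowski gauge of a convex body\<close>

lemma continuous_bounded_ex:
  fixes f :: "'a::euclidean_space \<Rightarrow> real"
  shows "bounded S \<Longrightarrow> continuous_on UNIV f \<Longrightarrow> \<exists>B\<ge>0. \<forall>x\<in>S. \<bar>f x\<bar> \<le> B"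
  by (rule continuous_bounded_on_bounded) auto

text \<open>The inner radius r makes the gauge Lipschitz with constant 1/r, the outer radius R
  bounds the distance from a by R times the gauge. This R is unrelated to the argument of
  \<open>C_star\<close> of the same name.\<close>

locale convex_body =
  fixes \<Omega> :: "'a::euclidean_space set" and a :: 'a and r R :: real
  assumes op: "open \<Omega>" and cvx: "convex \<Omega>" and r0: "r > 0" and inner: "cball a r \<subseteq> \<Omega>" and outer: "\<Omega> \<subseteq> ball a R"
begin

lemma a_in: "a \<in> \<Omega>"
  using inner r0 by auto

lemma r_le_R: "r < R"
proof -
  obtain b :: 'a where "b \<in> Basis" using nonempty_Basis by blast
  then have "a + r *\<^sub>R b \<in> cball a r" using r0 by (simp add: dist_norm)
  then have "a + r *\<^sub>R b \<in> ball a R" using inner outer by blast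
  then have "dist a (a + r *\<^sub>R b) < R" by simp
  then show ?thesis using r0 \<open>b \<in> Basis\<close> by (simp add: dist_norm)
qed

lemma R0: "R > 0"
  using r_le_R r0 by simp

lemma bdd: "bounded \<Omega>"
  using outer bounded_subset bounded_ball by blast

definition gauge_scales :: "'a \<Rightarrow> real set" where
  "gauge_scales x = {t. 0 < t \<and> a + (1/t) *\<^sub>R (x - a) \<in> \<Omega>}"

definition \<rho> :: "'a \<Rightarrow> real" where
  "\<rho> x = Inf (gauge_scales x)"

lemma gauge_scales_large: "t > 0 \<Longrightarrow> t \<ge> norm (x - a) / r \<Longrightarrow> t \<in> gauge_scales x"
proof -
  assume t: "t > 0" "t \<ge> norm (x - a) / r"
  then have "norm (x - a) / t \<le> r" using r0 by (simp add: field_simps)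
  then have "a + (1/t) *\<^sub>R (x - a) \<in> cball a r" using t by (simp add: dist_norm)
  then show ?thesis using t inner by (auto simp: gauge_scales_def)
qed

lemma gauge_scales_up: "t \<in> gauge_scales x \<Longrightarrow> t \<le> t' \<Longrightarrow> t' \<in> gauge_scales x"
proof -
  assume t: "t \<in> gauge_scales x" "t \<le> t'"
  then have t0: "t > 0" by (simp add: gauge_scales_def)
  have "a + (1/t') *\<^sub>R (x - a) = (1 - t/t') *\<^sub>R a + (t/t') *\<^sub>R (a + (1/t) *\<^sub>R (x - a))"
    using t0 t(2) by (simp add: algebra_simps)
  moreover have "\<dots> \<in> \<Omega>"
    using t t0 a_in by (intro convexD[OF cvx]) (auto simp: gauge_scales_def)
  ultimately show ?thesis using t0 t(2) by (simp add: gauge_scales_def)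
qed

lemma gauge_scales_bdd: "bdd_below (gauge_scales x)"
  by (rule bdd_belowI[of _ 0]) (simp add: gauge_scales_def)

lemma gauge_scales_nonempty: "gauge_scales x \<noteq> {}"
  using gauge_scales_large[of "norm (x - a) / r + 1" x] r0 by (force simp: add_nonneg_pos)

lemma \<rho>_nonneg: "\<rho> x \<ge> 0"
  unfolding \<rho>_def by (rule cInf_greatest[OF gauge_scales_nonempty]) (simp add: gauge_scales_def)

text \<open>The infimum is never attained: \<Omega> is open, so a scale that works can still be
  lowered a little. The strict inequality therefore describes membership exactly.\<close>

lemma \<rho>_less_iff: "t > 0 \<Longrightarrow> \<rho> x < t \<longleftrightarrow> a + (1/t) *\<^sub>R (x - a) \<in> \<Omega>"
proof
  assume "t > 0" "\<rho> x < t"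
  then obtain t' where "t' \<in> gauge_scales x" "t' < t"
    using cInf_lessD[OF gauge_scales_nonempty] unfolding \<rho>_def by blast
  then have "t \<in> gauge_scales x" using gauge_scales_up by simp
  then show "a + (1/t) *\<^sub>R (x - a) \<in> \<Omega>" by (simp add: gauge_scales_def)
next
  assume t: "t > 0" and m: "a + (1/t) *\<^sub>R (x - a) \<in> \<Omega>"
  have "((\<lambda>s. a + (1/s) *\<^sub>R (x - a)) \<longlongrightarrow> a + (1/t) *\<^sub>R (x - a)) (at_left t)"
    using t by (intro tendsto_intros) auto
  then have "eventually (\<lambda>s. a + (1/s) *\<^sub>R (x - a) \<in> \<Omega>) (at_left t)"
    using op m by (simp add: tendsto_def)
  moreover have "eventually (\<lambda>s. s \<in> {0<..<t}) (at_left t)"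
    by (rule eventually_at_leftI[of 0]) (use t in auto)
  ultimately have "eventually (\<lambda>s. s \<in> gauge_scales x \<and> s < t) (at_left t)"
    by eventually_elim (auto simp: gauge_scales_def)
  then obtain s where "s \<in> gauge_scales x" "s < t"
    using eventually_happens trivial_limit_at_left_real by blast
  then show "\<rho> x < t" unfolding \<rho>_def using cInf_lower[OF _ gauge_scales_bdd] by fastforce
qed

lemma in_\<Omega>_iff: "x \<in> \<Omega> \<longleftrightarrow> \<rho> x < 1"
  using \<rho>_less_iff[of 1 x] by simp

lemma \<rho>_scale: "s > 0 \<Longrightarrow> \<rho> (a + s *\<^sub>R (x - a)) = s * \<rho> x"
proof -
  assume s: "s > 0"
  have *: "\<rho> (a + s *\<^sub>R (x - a)) < t \<longleftrightarrow> s * \<rho> x < t" if "t > 0" for t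
  proof -
    have "\<rho> (a + s *\<^sub>R (x - a)) < t \<longleftrightarrow> a + (1/(t/s)) *\<^sub>R (x - a) \<in> \<Omega>"
      using \<rho>_less_iff[OF that, of "a + s *\<^sub>R (x - a)"] by simp
    also have "\<dots> \<longleftrightarrow> \<rho> x < t / s" using \<rho>_less_iff[of "t/s" x] that s by simp
    finally show ?thesis using s by (simp add: field_simps)
  qed
  show ?thesis
  proof (rule antisym; rule field_le_epsilon)
    fix e :: real assume e: "e > 0"
    have "0 \<le> s * \<rho> x" using s \<rho>_nonneg[of x] by simp
    then show "\<rho> (a + s *\<^sub>R (x - a)) \<le> s * \<rho> x + e" using *[of "s * \<rho> x + e"] e by simp
    show "s * \<rho> x \<le> \<rho> (a + s *\<^sub>R (x - a)) + e"
      using *[of "\<rho> (a + s *\<^sub>R (x - a)) + e"] e \<rho>_nonneg[of "a + s *\<^sub>R (x - a)"] by simp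
  qed
qed

lemma \<rho>_upper: "r * \<rho> x \<le> norm (x - a)"
proof -
  have "\<rho> x \<le> norm (x - a) / r"
  proof (rule field_le_epsilon)
    fix e :: real assume "e > 0"
    then have "norm (x - a) / r + e \<in> gauge_scales x"
      using r0 by (intro gauge_scales_large) (auto simp: add_nonneg_pos)
    then show "\<rho> x \<le> norm (x - a) / r + e" unfolding \<rho>_def by (rule cInf_lower[OF _ gauge_scales_bdd])
  qed
  then show ?thesis using r0 by (simp add: field_simps)
qed

lemma \<rho>_lower: "norm (x - a) \<le> R * \<rho> x"
proof -
  have "norm (x - a) / R \<le> \<rho> x"
  proof (rule field_le_epsilon)
    fix e :: real assume e: "e > 0"
    then have "a + (1/(\<rho> x + e)) *\<^sub>R (x - a) \<in> \<Omega>"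
      using \<rho>_less_iff[of "\<rho> x + e" x] \<rho>_nonneg[of x] by auto
    then have "norm (x - a) / (\<rho> x + e) < R" using outer e \<rho>_nonneg[of x] by (auto simp: dist_norm)
    then show "norm (x - a) / R \<le> \<rho> x + e" using e \<rho>_nonneg[of x] R0 by (simp add: field_simps)
  qed
  then show ?thesis using R0 by (simp add: field_simps)
qed

text \<open>Subadditivity, with the vector v represented by the point a + v. The weights p/(p+q) and
  q/(p+q) make the convex combination of the two rescaled points equal to the rescaled sum.\<close>

lemma \<rho>_add: "\<rho> (x + v) \<le> \<rho> x + \<rho> (a + v)"
proof (rule field_le_epsilon)
  fix e :: real assume e: "e > 0"
  define p q where "p = \<rho> x + e / 2" and "q = \<rho> (a + v) + e / 2"
  have pq: "p > 0" "q > 0" using e \<rho>_nonneg[of x] \<rho>_nonneg[of "a + v"] by (auto simp: p_def q_def)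
  have "a + (1/p) *\<^sub>R (x - a) \<in> \<Omega>" "a + (1/q) *\<^sub>R (a + v - a) \<in> \<Omega>"
    using \<rho>_less_iff[OF pq(1), of x] \<rho>_less_iff[OF pq(2), of "a + v"] e by (auto simp: p_def q_def)
  then have "(p/(p+q)) *\<^sub>R (a + (1/p) *\<^sub>R (x - a)) + (q/(p+q)) *\<^sub>R (a + (1/q) *\<^sub>R (a + v - a)) \<in> \<Omega>"
    using pq by (intro convexD[OF cvx]) (auto simp: add_divide_distrib[symmetric])
  also have "(p/(p+q)) *\<^sub>R (a + (1/p) *\<^sub>R (x - a)) + (q/(p+q)) *\<^sub>R (a + (1/q) *\<^sub>R (a + v - a))
     = ((p + q)/(p+q)) *\<^sub>R a + (1/(p+q)) *\<^sub>R (x + v - a)"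
    using pq unfolding add_divide_distrib by (simp add: algebra_simps)
  finally have "a + (1/(p+q)) *\<^sub>R (x + v - a) \<in> \<Omega>" using pq by simp
  then have "\<rho> (x + v) < p + q" using \<rho>_less_iff[of "p + q" "x + v"] pq by simp
  then show "\<rho> (x + v) \<le> \<rho> x + \<rho> (a + v) + e" by (simp add: p_def q_def)
qed

lemma \<rho>_lipschitz: "\<bar>\<rho> x - \<rho> y\<bar> \<le> norm (x - y) / r"
proof -
  have "\<rho> x - \<rho> y \<le> norm (x - y) / r" for x y
  proof -
    have "\<rho> (a + (x - y)) \<le> norm (x - y) / r" using \<rho>_upper[of "a + (x - y)"] r0 by (simp add: field_simps)
    then show ?thesis using \<rho>_add[of y "x - y"] by simp
  qed
  from this[of x y] this[of y x] show ?thesis by (simp add: norm_minus_commute abs_le_iff)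
qed

lemma \<rho>_continuous: "continuous_on S \<rho>"
proof (rule continuous_on_subset[OF _ subset_UNIV])
  show "continuous_on UNIV \<rho>"
  unfolding continuous_on_iff dist_real_def dist_norm
  proof (intro ballI allI impI)
    fix x and e :: real assume "e > 0"
    then show "\<exists>d>0. \<forall>y\<in>UNIV. norm (y - x) < d \<longrightarrow> \<bar>\<rho> y - \<rho> x\<bar> < e"
      using r0 by (intro exI[of _ "e * r"]) (auto intro: le_less_trans[OF \<rho>_lipschitz] simp: field_simps)
  qed
qed

lemma \<rho>_measurable [measurable]: "\<rho> \<in> borel_measurable borel"
  by (rule borel_measurable_continuous_onI[OF \<rho>_continuous])

lemma \<rho>_a: "\<rho> a = 0"
  using \<rho>_upper[of a] \<rho>_nonneg[of a] r0 by (simp add: mult_le_0_iff)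

lemma \<rho>_pos: "x \<noteq> a \<Longrightarrow> \<rho> x > 0"
  using \<rho>_lower[of x] \<rho>_nonneg[of x] by (cases "\<rho> x = 0") auto

lemma \<rho>_convex: "0 \<le> s \<Longrightarrow> s \<le> 1 \<Longrightarrow> \<rho> (x + s *\<^sub>R v) \<le> (1 - s) * \<rho> x + s * \<rho> (x + v)"
proof (cases "s = 0 \<or> s = 1")
  case False
  assume "0 \<le> s" "s \<le> 1"
  then have s: "s > 0" "1 - s > 0" using False by auto
  have e: "x + s *\<^sub>R v = (a + (1 - s) *\<^sub>R (x - a)) + s *\<^sub>R (x + v - a)" by (simp add: algebra_simps)
  show ?thesis
    unfolding e using \<rho>_add[of "a + (1 - s) *\<^sub>R (x - a)" "s *\<^sub>R (x + v - a)"] \<rho>_scale[OF s(1), of "x + v"] \<rho>_scale[OF s(2), of x]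
    by simp
qed auto

text \<open>Radial projection onto the boundary. At the centre \<open>1 / \<rho> a\<close> is 0, so
  \<open>proj a = a\<close>; every other point moves to the boundary along its ray.\<close>

definition proj :: "'a \<Rightarrow> 'a" where
  "proj x = a + (1 / \<rho> x) *\<^sub>R (x - a)"

lemma \<rho>_proj: "x \<noteq> a \<Longrightarrow> \<rho> (proj x) = 1"
  unfolding proj_def using \<rho>_scale[of "1 / \<rho> x" x] \<rho>_pos[of x] by simp

lemma proj_measurable [measurable]: "proj \<in> borel_measurable borel"
  unfolding proj_def[abs_def] by measurable

lemma proj_scale: "s > 0 \<Longrightarrow> proj (a + s *\<^sub>R (x - a)) = proj x"
  by (cases "x = a") (auto simp: proj_def \<rho>_scale)

lemma dist_proj: "x \<noteq> a \<Longrightarrow> norm (x - proj x) \<le> R * \<bar>1 - \<rho> x\<bar>"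
proof -
  assume x: "x \<noteq> a"
  have "x - proj x = (1 - 1 / \<rho> x) *\<^sub>R (x - a)" by (simp add: proj_def algebra_simps)
  then have "norm (x - proj x) = \<bar>1 - 1 / \<rho> x\<bar> * norm (x - a)" by simp
  also have "\<dots> \<le> \<bar>1 - 1 / \<rho> x\<bar> * (R * \<rho> x)" by (intro mult_left_mono \<rho>_lower) auto
  also have "\<dots> = R * \<bar>1 - \<rho> x\<bar>"
  proof -
    have "\<bar>1 - 1 / \<rho> x\<bar> * \<rho> x = \<bar>(1 - 1 / \<rho> x) * \<rho> x\<bar>" using \<rho>_pos[OF x] by (simp add: abs_mult)
    also have "(1 - 1 / \<rho> x) * \<rho> x = \<rho> x - 1" using \<rho>_pos[OF x] by (simp add: algebra_simps)
    finally show ?thesis by (simp add: abs_minus_commute mult_ac)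
  qed
  finally show ?thesis .
qed

lemma frontier_iff: "x \<in> frontier \<Omega> \<longleftrightarrow> \<rho> x = 1"
proof
  assume x: "x \<in> frontier \<Omega>"
  then have "\<not> \<rho> x < 1" using op in_\<Omega>_iff by (simp add: frontier_def interior_open)
  moreover have "closure \<Omega> \<subseteq> {x. \<rho> x \<le> 1}"
    using in_\<Omega>_iff \<rho>_continuous by (intro closure_minimal) (auto intro!: closed_Collect_le)
  ultimately show "\<rho> x = 1" using x by (force simp: frontier_def)
next
  assume x: "\<rho> x = 1"
  have "(\<lambda>n. a + (1 - inverse (real (Suc n))) *\<^sub>R (x - a)) \<longlonglongrightarrow> a + (1 - 0) *\<^sub>R (x - a)"
    by (intro tendsto_intros LIMSEQ_inverse_real_of_nat)
  then have l: "(\<lambda>n. a + (1 - inverse (real (Suc n))) *\<^sub>R (x - a)) \<longlonglongrightarrow> x" by simp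
  have mem: "a + (1 - inverse (real (Suc n))) *\<^sub>R (x - a) \<in> \<Omega>" for n
  proof (cases n)
    case 0 then show ?thesis using a_in by simp
  next
    case (Suc m)
    then have "0 < 1 - inverse (real (Suc n))" by (simp add: field_simps)
    then show ?thesis using x by (simp add: in_\<Omega>_iff \<rho>_scale)
  qed
  have "x \<in> closure \<Omega>"
    by (rule Lim_in_closed_set[OF closed_closure _ sequentially_bot l])
      (intro always_eventually allI subsetD[OF closure_subset] mem)
  then show "x \<in> frontier \<Omega>" using x op in_\<Omega>_iff by (simp add: frontier_def interior_open)
qed

text \<open>For s > 0 the level set lies in a dilated copy of the boundary, which is negligible for
  a convex set; for s \<le> 0 it contains at most the centre.\<close>

lemma null_level: "{x. \<rho> x = s} \<in> null_sets lborel"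
proof (cases "s > 0")
  case True
  have "negligible (frontier \<Omega>)" by (rule negligible_convex_frontier[OF cvx])
  then have "negligible ((\<lambda>x. a + s *\<^sub>R (x - a)) ` frontier \<Omega>)"
    by (intro negligible_differentiable_image_negligible) (auto simp: differentiable_on_def intro!: derivative_intros)
  moreover have "{x. \<rho> x = s} \<subseteq> (\<lambda>x. a + s *\<^sub>R (x - a)) ` frontier \<Omega>"
  proof
    fix x assume "x \<in> {x. \<rho> x = s}"
    then have "a + (1/s) *\<^sub>R (x - a) \<in> frontier \<Omega>" using True by (simp add: frontier_iff \<rho>_scale)
    moreover have "x = a + s *\<^sub>R ((a + (1/s) *\<^sub>R (x - a)) - a)" using True by simp
    ultimately show "x \<in> (\<lambda>x. a + s *\<^sub>R (x - a)) ` frontier \<Omega>" by blast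
  qed
  ultimately have "negligible {x. \<rho> x = s}" by (rule negligible_subset)
  then show ?thesis by (simp add: negligible_iff_null_sets null_sets_completion_iff)
next
  case False
  have "{x. \<rho> x = s} \<subseteq> {a}" using False \<rho>_pos by fastforce
  moreover have "{x. \<rho> x = s} \<in> sets lborel" by measurable
  moreover have "{a} \<in> null_sets lborel" by (rule null_setsI) auto
  ultimately show ?thesis using null_sets_subset by blast
qed

subsection \<open>Directional derivatives of the gauge\<close>

definition qt :: "'a \<Rightarrow> 'a \<Rightarrow> real \<Rightarrow> real" where
  "qt v x t = (\<rho> (x + t *\<^sub>R v) - \<rho> x) / t"

text \<open>The one-sided directional derivative. By convexity the quotients decrease as t decreases
  to 0, so it exists at every point, and a limit along one sequence suffices and is
  measurable.\<close>

definition dd :: "'a \<Rightarrow> 'a \<Rightarrow> real" where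
  "dd v x = lim (\<lambda>n. qt v x (inverse (real (Suc n))))"

lemma qt_mono: "0 < t \<Longrightarrow> t \<le> t' \<Longrightarrow> qt v x t \<le> qt v x t'"
proof -
  assume t: "0 < t" "t \<le> t'"
  then have "\<rho> (x + (t/t') *\<^sub>R (t' *\<^sub>R v)) \<le> (1 - t/t') * \<rho> x + (t/t') * \<rho> (x + t' *\<^sub>R v)"
    by (intro \<rho>_convex) auto
  then have "\<rho> (x + t *\<^sub>R v) - \<rho> x \<le> (t/t') * (\<rho> (x + t' *\<^sub>R v) - \<rho> x)"
    using t by (simp add: algebra_simps)
  then have "(\<rho> (x + t *\<^sub>R v) - \<rho> x) / t \<le> ((t/t') * (\<rho> (x + t' *\<^sub>R v) - \<rho> x)) / t"
    using t by (intro divide_right_mono) auto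
  then show ?thesis using t by (simp add: qt_def)
qed

lemma qt_bound: "t > 0 \<Longrightarrow> \<bar>qt v x t\<bar> \<le> norm v / r"
proof -
  assume t: "t > 0"
  have "\<bar>\<rho> (x + t *\<^sub>R v) - \<rho> x\<bar> \<le> t * (norm v / r)" using \<rho>_lipschitz[of "x + t *\<^sub>R v" x] t by simp
  then show ?thesis using t by (simp add: qt_def abs_divide divide_le_eq mult.commute)
qed

lemma qt_tendsto: "(\<lambda>n. qt v x (inverse (real (Suc n)))) \<longlonglongrightarrow> dd v x"
proof -
  have "decseq (\<lambda>n. qt v x (inverse (real (Suc n))))"
    unfolding decseq_def by (auto intro!: qt_mono le_imp_inverse_le simp del: of_nat_Suc)
  moreover have "- (norm v / r) \<le> qt v x (inverse (real (Suc n)))" for n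
    using qt_bound[of "inverse (real (Suc n))" v x] by (simp del: of_nat_Suc add: abs_le_iff)
  ultimately have "convergent (\<lambda>n. qt v x (inverse (real (Suc n))))"
    by (metis decseq_convergent convergentI)
  then show ?thesis unfolding dd_def by (simp add: convergent_LIMSEQ_iff)
qed

lemma dd_le_qt: "t > 0 \<Longrightarrow> dd v x \<le> qt v x t"
proof (rule tendsto_upperbound[OF qt_tendsto])
  assume t: "t > 0"
  show "eventually (\<lambda>n. qt v x (inverse (real (Suc n))) \<le> qt v x t) sequentially"
    using order_tendstoD(2)[OF LIMSEQ_inverse_real_of_nat t]
    by eventually_elim (intro qt_mono; simp)
qed simp

lemma dd_bound: "\<bar>dd v x\<bar> \<le> norm v / r"
proof -
  have "(\<lambda>n. \<bar>qt v x (inverse (real (Suc n)))\<bar>) \<longlonglongrightarrow> \<bar>dd v x\<bar>" by (intro tendsto_intros qt_tendsto)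
  then show ?thesis
    by (rule tendsto_upperbound) (auto intro!: always_eventually qt_bound simp del: of_nat_Suc)
qed

lemma dd_measurable [measurable]: "dd v \<in> borel_measurable borel"
  unfolding dd_def[abs_def] qt_def by measurable

text \<open>The gauge is homogeneous of degree 1, so its derivatives are constant along rays. One
  inequality for all s and x is enough; used at the dilated point with 1/s it gives the
  other.\<close>

lemma dd_scale: "s > 0 \<Longrightarrow> dd v (a + s *\<^sub>R (x - a)) = dd v x"
proof -
  have q: "qt v (a + s *\<^sub>R (x - a)) t = qt v x (t / s)" if "s > 0" "t > 0" for s t and x :: 'a
  proof -
    have eq: "a + s *\<^sub>R (x - a) + t *\<^sub>R v = a + s *\<^sub>R ((x + (t/s) *\<^sub>R v) - a)" using that by (simp add: algebra_simps)
    have "\<rho> (a + s *\<^sub>R (x - a) + t *\<^sub>R v) = s * \<rho> (x + (t/s) *\<^sub>R v)" unfolding eq by (rule \<rho>_scale[OF that(1)])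
    then have "qt v (a + s *\<^sub>R (x - a)) t = (s * \<rho> (x + (t/s) *\<^sub>R v) - s * \<rho> x) / t"
      by (simp only: qt_def \<rho>_scale[OF that(1)])
    then show ?thesis using that by (simp add: qt_def field_simps)
  qed
  have le: "dd v x \<le> dd v (a + s *\<^sub>R (x - a))" if s: "s > 0" for s and x :: 'a
  proof (rule tendsto_lowerbound[OF qt_tendsto])
    show "eventually (\<lambda>n. dd v x \<le> qt v (a + s *\<^sub>R (x - a)) (inverse (real (Suc n)))) sequentially"
      using s by (intro always_eventually allI) (simp add: q dd_le_qt del: of_nat_Suc)
  qed simp
  assume s: "s > 0"
  have "dd v (a + s *\<^sub>R (x - a)) \<le> dd v (a + (1/s) *\<^sub>R ((a + s *\<^sub>R (x - a)) - a))"
    using s by (intro le) auto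
  then show ?thesis using le[OF s, of x] s by simp
qed

lemma dd_proj: "x \<noteq> a \<Longrightarrow> dd v (proj x) = dd v x"
  unfolding proj_def using \<rho>_pos by (intro dd_scale) auto

lemma dd_add_nonneg: "dd v x + dd (- v) x \<ge> 0"
proof -
  have "0 \<le> qt v x t + qt (- v) x t" if t: "t > 0" for t
  proof -
    have "\<rho> ((x + t *\<^sub>R v) + (1/2) *\<^sub>R ((x - t *\<^sub>R v) - (x + t *\<^sub>R v))) \<le> (1 - 1/2) * \<rho> (x + t *\<^sub>R v) + (1/2) * \<rho> ((x + t *\<^sub>R v) + ((x - t *\<^sub>R v) - (x + t *\<^sub>R v)))"
      by (rule \<rho>_convex) auto
    moreover have "(x + t *\<^sub>R v) + (1/2) *\<^sub>R ((x - t *\<^sub>R v) - (x + t *\<^sub>R v)) = x"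
      by (simp add: algebra_simps flip: scaleR_add_left)
    ultimately have "0 \<le> (\<rho> (x + t *\<^sub>R v) - \<rho> x) + (\<rho> (x - t *\<^sub>R v) - \<rho> x)" by (simp add: algebra_simps)
    then show ?thesis using t by (simp add: qt_def add_divide_distrib[symmetric])
  qed
  then have "eventually (\<lambda>n. 0 \<le> qt v x (inverse (real (Suc n))) + qt (- v) x (inverse (real (Suc n)))) sequentially"
    by (intro always_eventually allI) (simp del: of_nat_Suc)
  then show ?thesis
    by (intro tendsto_lowerbound[OF tendsto_add[OF qt_tendsto qt_tendsto]]) auto
qed

text \<open>Points at which the gauge is differentiable along the coordinate directions.\<close>

definition regular :: "'a \<Rightarrow> bool" where
  "regular x \<longleftrightarrow> (\<forall>b\<in>Basis. dd b x + dd (- b) x = 0)"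

text \<open>A supporting hyperplane, its normal turned outward and scaled to length 1, witnesses the
  choice in \<open>outer_normal\<close>.\<close>

lemma outer_normal_props:
  assumes y: "y \<in> frontier \<Omega>"
  shows "norm (outer_normal \<Omega> y) = 1" "\<And>w. w \<in> \<Omega> \<Longrightarrow> outer_normal \<Omega> y \<bullet> (w - y) \<le> 0"
proof -
  have "y \<in> closure \<Omega>" "y \<notin> rel_interior \<Omega>"
    using y op by (auto simp: frontier_def interior_open rel_interior_open)
  then obtain c where c: "c \<noteq> 0" "\<And>w. w \<in> closure \<Omega> \<Longrightarrow> c \<bullet> y \<le> c \<bullet> w"
    using supporting_hyperplane_relative_frontier[OF cvx] by blast
  have "norm (- (1 / norm c) *\<^sub>R c) = 1" using c(1) by simp
  moreover have "- (1 / norm c) *\<^sub>R c \<bullet> (w - y) \<le> 0" if "w \<in> \<Omega>" for w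
  proof -
    have "c \<bullet> (w - y) \<ge> 0" using c(2)[of w] that closure_subset by (auto simp: inner_diff_right)
    then have "(1 / norm c) * (c \<bullet> (w - y)) \<ge> 0" by (intro mult_nonneg_nonneg) auto
    then show ?thesis by simp
  qed
  ultimately have "norm (outer_normal \<Omega> y) = 1 \<and> (\<forall>w\<in>\<Omega>. outer_normal \<Omega> y \<bullet> (w - y) \<le> 0)"
    unfolding outer_normal_def by (intro someI[of "\<lambda>n. norm n = 1 \<and> (\<forall>w\<in>\<Omega>. n \<bullet> (w - y) \<le> 0)"]) blast
  then show "norm (outer_normal \<Omega> y) = 1" "\<And>w. w \<in> \<Omega> \<Longrightarrow> outer_normal \<Omega> y \<bullet> (w - y) \<le> 0" by auto
qed

text \<open>Divided by h, the chosen normal becomes a subgradient m of the gauge at x, so the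
  product of m with v is at most \<open>dd v x\<close> in every direction. At a regular point the
  inequalities for b and -b force equality, and the normal is a positive multiple of the gradient.
  The second claim is Euler's identity for degree 1.\<close>

lemma regular_normal:
  assumes x: "x \<noteq> a" and reg: "regular x"
  shows "\<exists>h>0. \<forall>b\<in>Basis. outer_normal \<Omega> (proj x) \<bullet> b = h * dd b x"
    and "(\<Sum>b\<in>Basis. ((x - a) \<bullet> b) * dd b x) = \<rho> x"
proof -
  define y where "y = proj x"
  define n where "n = outer_normal \<Omega> y"
  define h where "h = n \<bullet> (y - a)"
  have yf: "y \<in> frontier \<Omega>" using \<rho>_proj[OF x] by (simp add: frontier_iff y_def)
  note n = outer_normal_props[OF yf, folded n_def]
  \<comment> \<open>The inscribed ball keeps the supporting hyperplane at distance at least r from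
    a, so h \<ge> r > 0 and division by h is possible.\<close>
  have "a + r *\<^sub>R n \<in> \<Omega>" using n(1) inner r0 by (auto simp: dist_norm subset_iff)
  then have "n \<bullet> (a + r *\<^sub>R n - y) \<le> 0" by (rule n(2))
  then have "r * (n \<bullet> n) \<le> h" by (simp add: h_def inner_diff_right inner_add_right)
  then have h: "h > 0" using n(1) r0 by (simp add: dot_square_norm)
  define m where "m = (1/h) *\<^sub>R n"
  have sub: "m \<bullet> (v - a) \<le> \<rho> v" for v
  proof (rule field_le_epsilon)
    fix e :: real assume e: "e > 0"
    define t where "t = \<rho> v + e"
    have t: "t > 0" using e \<rho>_nonneg[of v] by (simp add: t_def)
    have "a + (1/t) *\<^sub>R (v - a) \<in> \<Omega>" using \<rho>_less_iff[OF t, of v] e by (simp add: t_def)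
    from n(2)[OF this] have "(1/t) * (n \<bullet> (v - a)) \<le> h" by (simp add: h_def inner_diff_right inner_add_right)
    then have "n \<bullet> (v - a) \<le> h * t" using t by (simp add: field_simps)
    then show "m \<bullet> (v - a) \<le> \<rho> v + e" using h by (simp add: m_def t_def field_simps)
  qed
  have eqx: "m \<bullet> (x - a) = \<rho> x"
  proof -
    have "x - a = \<rho> x *\<^sub>R (y - a)" using \<rho>_pos[OF x] by (simp add: y_def proj_def)
    then have "n \<bullet> (x - a) = \<rho> x * h" by (simp add: h_def)
    then show ?thesis using h by (simp add: m_def)
  qed
  have dm: "m \<bullet> v \<le> dd v x" for v
  proof (rule tendsto_lowerbound[OF qt_tendsto])
    have "m \<bullet> v \<le> qt v x t" if t: "t > 0" for t
    proof -
      have "t * (m \<bullet> v) \<le> \<rho> (x + t *\<^sub>R v) - \<rho> x" using sub[of "x + t *\<^sub>R v"] eqx by (simp add: inner_diff_right inner_add_right)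
      then show ?thesis using t by (simp add: qt_def field_simps)
    qed
    then show "eventually (\<lambda>n. m \<bullet> v \<le> qt v x (inverse (real (Suc n)))) sequentially"
      by (intro always_eventually allI) (simp del: of_nat_Suc)
  qed simp
  have dmb: "dd b x = m \<bullet> b" if "b \<in> Basis" for b
    using dm[of b] dm[of "- b"] reg that by (force simp: regular_def)
  show "\<exists>h>0. \<forall>b\<in>Basis. outer_normal \<Omega> (proj x) \<bullet> b = h * dd b x"
    using h by (intro exI[of _ h]) (auto simp: dmb m_def n_def y_def)
  have "(\<Sum>b\<in>Basis. ((x - a) \<bullet> b) * dd b x) = (\<Sum>b\<in>Basis. ((x - a) \<bullet> b) * (m \<bullet> b))"
    by (intro sum.cong) (auto simp: dmb)
  also have "\<dots> = (x - a) \<bullet> m" by (rule euclidean_inner[symmetric])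
  also have "\<dots> = \<rho> x" using eqx by (simp add: inner_commute)
  finally show "(\<Sum>b\<in>Basis. ((x - a) \<bullet> b) * dd b x) = \<rho> x" .
qed

lemma regular_proj: "x \<noteq> a \<Longrightarrow> regular (proj x) \<longleftrightarrow> regular x"
  by (simp add: regular_def dd_proj)

lemma regular_measurable [measurable]: "Measurable.pred borel regular"
  unfolding regular_def[abs_def] by measurable

subsection \<open>Integration by parts against the gauge\<close>

definition cone :: "real \<Rightarrow> 'a \<Rightarrow> real" where
  "cone s x = max 0 (s - \<rho> x)"

lemma cone_lipschitz: "\<bar>cone s x - cone s y\<bar> \<le> norm (x - y) / r"
  using \<rho>_lipschitz[of x y] unfolding cone_def by linarith

lemma cone_measurable [measurable]: "cone s \<in> borel_measurable borel"
  unfolding cone_def[abs_def] by measurable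

lemma smooth_lipschitz_on:
  fixes f :: "'a \<Rightarrow> real"
  assumes f: "smooth f" and K: "K \<ge> 0"
  obtains L where "L \<ge> 0" "\<And>x. x \<in> cball a K \<Longrightarrow> \<bar>f x\<bar> \<le> L" "\<And>x y. x \<in> cball a K \<Longrightarrow> y \<in> cball a K \<Longrightarrow> \<bar>f x - f y\<bar> \<le> L * norm (x - y)"
    "\<And>b x. b \<in> Basis \<Longrightarrow> x \<in> cball a K \<Longrightarrow> \<bar>partial_deriv b f x\<bar> \<le> L"
proof -
  obtain B0 where B0: "B0 \<ge> 0" "\<And>x. x \<in> cball a K \<Longrightarrow> \<bar>f x\<bar> \<le> B0"
    using continuous_bounded_on_bounded[OF bounded_cball smoothD(2)[OF f]] by blast
  have "\<forall>b\<in>Basis. \<exists>B\<ge>0. \<forall>x\<in>cball a K. \<bar>partial_deriv b f x\<bar> \<le> B"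
    by (intro ballI continuous_bounded_ex bounded_cball smooth_partial_continuous[OF f])
  then obtain B where B: "\<And>b. b \<in> Basis \<Longrightarrow> B b \<ge> 0 \<and> (\<forall>x\<in>cball a K. \<bar>partial_deriv b f x\<bar> \<le> B b)" by metis
  define M where "M = sum B Basis"
  have M0: "M \<ge> 0" using B unfolding M_def by (intro sum_nonneg) auto
  have M: "\<bar>partial_deriv b f x\<bar> \<le> M" if "b \<in> Basis" "x \<in> cball a K" for b x
  proof -
    have "B b \<le> M" unfolding M_def using B that by (intro member_le_sum) auto
    then show ?thesis using B[OF that(1)] that(2) by force
  qed
  have d1: "real DIM('a) \<ge> 1" using DIM_positive[where 'a='a] by (simp add: Suc_le_eq)
  have MM: "M \<le> DIM('a) * M" using mult_right_mono[OF d1 M0] by simp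
  show ?thesis
  proof (rule that[of "B0 + DIM('a) * M"])
    show "0 \<le> B0 + DIM('a) * M" using B0 M0 by simp
    show "\<bar>f x\<bar> \<le> B0 + DIM('a) * M" if "x \<in> cball a K" for x using B0(2)[OF that] M0 by (simp add: add_increasing2)
    show "\<bar>f x - f y\<bar> \<le> (B0 + DIM('a) * M) * norm (x - y)" if "x \<in> cball a K" "y \<in> cball a K" for x y
    proof -
      have "\<bar>f x - f y\<bar> \<le> DIM('a) * M * norm (x - y)"
        by (rule lipschitz_of_partials(2)[OF convex_cball[of a K]]) (use M that smoothD(1)[OF f] in auto)
      also have "\<dots> \<le> (B0 + DIM('a) * M) * norm (x - y)" using B0 by (intro mult_right_mono) auto
      finally show ?thesis .
    qed
    show "\<bar>partial_deriv b f x\<bar> \<le> B0 + DIM('a) * M" if "b \<in> Basis" "x \<in> cball a K" for b x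
      using M[OF that] MM B0(1) by linarith
  qed
qed

lemma cone_outside: "s \<le> 1 \<Longrightarrow> x \<notin> cball a R \<Longrightarrow> cone s x = 0"
proof -
  assume "s \<le> 1" "x \<notin> cball a R"
  then have "R < norm (x - a)" by (simp add: dist_norm norm_minus_commute)
  then have "R * 1 < R * \<rho> x" using \<rho>_lower[of x] by simp
  then have "\<rho> x > 1" using R0 by (simp add: mult_less_cancel_left)
  then show ?thesis using \<open>s \<le> 1\<close> by (simp add: cone_def)
qed

lemma cone_quotient_tendsto:
  assumes "\<rho> x \<noteq> s"
  shows "(\<lambda>n. real (Suc n) * (cone s (x + inverse (real (Suc n)) *\<^sub>R v) - cone s x)) \<longlonglongrightarrow> - indicator {x. \<rho> x < s} x * dd v x"
proof -
  have l: "(\<lambda>n. x + inverse (real (Suc n)) *\<^sub>R v) \<longlonglongrightarrow> x + 0 *\<^sub>R v"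
    by (intro tendsto_intros LIMSEQ_inverse_real_of_nat)
  have "isCont \<rho> (x + 0 *\<^sub>R v)" using \<rho>_continuous[of UNIV] by (simp add: continuous_on_eq_continuous_at)
  from isCont_tendsto_compose[OF this l] have c: "(\<lambda>n. \<rho> (x + inverse (real (Suc n)) *\<^sub>R v)) \<longlonglongrightarrow> \<rho> x" by simp
  show ?thesis
  proof (cases "\<rho> x < s")
    case True
    have "eventually (\<lambda>n. - qt v x (inverse (real (Suc n))) = real (Suc n) * (cone s (x + inverse (real (Suc n)) *\<^sub>R v) - cone s x)) sequentially"
      using order_tendstoD(2)[OF c True]
    proof eventually_elim
      case (elim n)
      have eq: "cone s (x + inverse (real (Suc n)) *\<^sub>R v) - cone s x = - (\<rho> (x + inverse (real (Suc n)) *\<^sub>R v) - \<rho> x)"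
        using elim True by (simp add: cone_def)
      show ?case unfolding eq qt_def by (simp add: divide_inverse mult.commute[of _ "real (Suc n)"] right_diff_distrib del: of_nat_Suc)
    qed
    moreover have "(\<lambda>n. - qt v x (inverse (real (Suc n)))) \<longlonglongrightarrow> - dd v x" by (intro tendsto_intros qt_tendsto)
    ultimately show ?thesis using True by (simp add: Lim_transform_eventually)
  next
    case False
    then have "s < \<rho> x" using assms by simp
    have "eventually (\<lambda>n. real (Suc n) * (cone s (x + inverse (real (Suc n)) *\<^sub>R v) - cone s x) = 0) sequentially"
      using order_tendstoD(1)[OF c \<open>s < \<rho> x\<close>] by eventually_elim (use False in \<open>simp add: cone_def\<close>)
    then show ?thesis using False by (simp add: tendsto_eventually)
  qed
qed

text \<open>A translation moves the difference quotient from f to the cut-off, where the step goes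
  in direction -v. Differentiability of the gauge is not yet known at this point, so the result
  features \<open>dd (- v)\<close> instead of minus \<open>dd v\<close>.\<close>

lemma cone_ibp_direction:
  fixes f :: "'a \<Rightarrow> real"
  assumes f: "smooth f" and s: "s \<le> 1" and v: "norm v = 1"
  shows "(\<integral>x. cone s x * frechet_derivative f (at x) v \<partial>lborel) = - (\<integral>x. indicator {x. \<rho> x < s} x * dd (- v) x * f x \<partial>lborel)"
proof -
  \<comment> \<open>Room for shifts of length at most 1 of points in the ball of radius R, outside
    which the cut-off vanishes.\<close>
  define K where "K = R + 1"
  have K: "K \<ge> 0" using R0 by (simp add: K_def)
  obtain L where L: "L \<ge> 0" "\<And>x. x \<in> cball a K \<Longrightarrow> \<bar>f x\<bar> \<le> L"
    "\<And>x y. x \<in> cball a K \<Longrightarrow> y \<in> cball a K \<Longrightarrow> \<bar>f x - f y\<bar> \<le> L * norm (x - y)"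
    using smooth_lipschitz_on[OF f K] by metis
  have [measurable]: "f \<in> borel_measurable borel" by (intro borel_measurable_continuous_onI smoothD f)
  let ?e = "\<lambda>n. inverse (real (Suc n)) *\<^sub>R v"
  have ne: "norm (?e n) = inverse (real (Suc n))" "inverse (real (Suc n)) \<le> 1" for n
    using v by (auto simp: field_simps)
  have inK: "x + ?e n \<in> cball a K" "x - ?e n \<in> cball a K" "x \<in> cball a K" if "x \<in> cball a R" for x n
  proof -
    have *: "norm (x - a) \<le> R" using that by (simp add: dist_norm norm_minus_commute)
    have "norm (x + ?e n - a) \<le> norm (x - a) + norm (?e n)" using norm_triangle_ineq[of "x - a" "?e n"] by (simp add: algebra_simps)
    moreover have "norm (x - ?e n - a) \<le> norm (x - a) + norm (?e n)" using norm_triangle_ineq4[of "x - a" "?e n"] by (simp add: algebra_simps)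
    ultimately show "x + ?e n \<in> cball a K" "x - ?e n \<in> cball a K" "x \<in> cball a K"
      using * ne[of n] by (auto simp: K_def dist_norm norm_minus_commute[of a])
  qed
  have ind: "integrable lborel (\<lambda>x. c * indicator (cball a K) x :: real)" for c
    using emeasure_bounded_finite[OF bounded_cball[of a K]] by (intro integrable_mult_right integrable_real_indicator) auto
  have u1: "\<bar>cone s x\<bar> \<le> 1" for x using s \<rho>_nonneg[of x] by (simp add: cone_def)
  define q1 where "q1 n x = cone s x * (real (Suc n) * (f (x + ?e n) - f x))" for n x
  define q2 where "q2 n x = (real (Suc n) * (cone s (x + inverse (real (Suc n)) *\<^sub>R (- v)) - cone s x)) * f x" for n x
  have [measurable]: "q1 n \<in> borel_measurable borel" "q2 n \<in> borel_measurable borel" for n unfolding q1_def q2_def by measurable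
  have cf: "integrable lborel (\<lambda>x. cone s x * g x)" if [measurable]: "g \<in> borel_measurable borel" and g: "\<And>x. x \<in> cball a R \<Longrightarrow> \<bar>g x\<bar> \<le> M" for g M
  proof (rule Bochner_Integration.integrable_bound[OF ind[of M]])
    show "AE x in lborel. norm (cone s x * g x) \<le> norm (M * indicator (cball a K) x)"
    proof (rule AE_I2)
      fix x show "norm (cone s x * g x) \<le> norm (M * indicator (cball a K) x)"
      proof (cases "x \<in> cball a R")
        case True
        have "\<bar>cone s x\<bar> * \<bar>g x\<bar> \<le> 1 * M" using u1 g[OF True] by (intro mult_mono) auto
        then show ?thesis using inK(3)[OF True] by (simp add: abs_mult)
      next
        case False then show ?thesis using cone_outside[OF s] by simp
      qed
    qed
  qed auto
  have eq: "(\<integral>x. q1 n x \<partial>lborel) = (\<integral>x. q2 n x \<partial>lborel)" for n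
  proof -
    have i1: "integrable lborel (\<lambda>x. cone s x * f (x + ?e n))" by (rule cf[where M=L]) (use L inK in auto)
    have i2: "integrable lborel (\<lambda>x. cone s x * f x)" by (rule cf[where M=L]) (use L inK in auto)
    have sh: "(\<integral>x. cone s x * f (x + ?e n) \<partial>lborel) = (\<integral>x. cone s (x - ?e n) * f x \<partial>lborel)"
      by (subst integral_lborel_affine[of "\<lambda>x. cone s x * f (x + ?e n)" 1 "- ?e n"]) (auto simp: algebra_simps)
    have i3: "integrable lborel (\<lambda>x. cone s (x - ?e n) * f x)"
      using integrable_affine[OF i1, of 1 "- ?e n"] by (simp add: algebra_simps)
    have "(\<integral>x. q1 n x \<partial>lborel) = (\<integral>x. real (Suc n) * (cone s x * f (x + ?e n) - cone s x * f x) \<partial>lborel)"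
      unfolding q1_def by (intro Bochner_Integration.integral_cong) (auto simp: algebra_simps)
    also have "\<dots> = real (Suc n) * ((\<integral>x. cone s (x - ?e n) * f x \<partial>lborel) - (\<integral>x. cone s x * f x \<partial>lborel))"
      using i1 i2 sh by (simp del: of_nat_Suc)
    also have "\<dots> = (\<integral>x. real (Suc n) * (cone s (x - ?e n) * f x - cone s x * f x) \<partial>lborel)"
      using i2 i3 by (simp del: of_nat_Suc)
    also have "\<dots> = (\<integral>x. q2 n x \<partial>lborel)"
      unfolding q2_def by (intro Bochner_Integration.integral_cong) (auto simp: algebra_simps)
    finally show ?thesis .
  qed
  have l1: "(\<lambda>n. \<integral>x. q1 n x \<partial>lborel) \<longlonglongrightarrow> (\<integral>x. cone s x * frechet_derivative f (at x) v \<partial>lborel)"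
  proof (rule integral_dominated_convergence[where w="\<lambda>x. L * indicator (cball a K) x"])
    show "(\<lambda>x. cone s x * frechet_derivative f (at x) v) \<in> borel_measurable lborel"
      unfolding frechet_derivative_partials[OF smoothD(1)[OF f]]
      using borel_measurable_continuous_onI[OF smooth_partial_continuous[OF f]] by measurable
    show "AE x in lborel. (\<lambda>n. q1 n x) \<longlonglongrightarrow> cone s x * frechet_derivative f (at x) v"
      unfolding q1_def by (intro AE_I2 tendsto_mult_left partial_quotient_tendsto smoothD f)
    show "AE x in lborel. norm (q1 n x) \<le> L * indicator (cball a K) x" for n
    proof (rule AE_I2)
      fix x show "norm (q1 n x) \<le> L * indicator (cball a K) x"
      proof (cases "x \<in> cball a R")
        case True
        have "\<bar>f (x + ?e n) - f x\<bar> \<le> L * inverse (real (Suc n))" using L(3)[OF inK(1,3)[OF True]] ne(1)[of n] by simp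
        then have "real (Suc n) * \<bar>f (x + ?e n) - f x\<bar> \<le> L" by (simp add: field_simps)
        then have "\<bar>real (Suc n) * (f (x + ?e n) - f x)\<bar> \<le> L" by (simp add: abs_mult)
        then have "\<bar>cone s x\<bar> * \<bar>real (Suc n) * (f (x + ?e n) - f x)\<bar> \<le> 1 * L" using u1 by (intro mult_mono) auto
        then show ?thesis using inK(3)[OF True] by (simp add: q1_def abs_mult del: of_nat_Suc)
      next
        case False then show ?thesis using cone_outside[OF s] L(1) by (simp add: q1_def)
      qed
    qed
  qed (use ind in auto)
  have l2: "(\<lambda>n. \<integral>x. q2 n x \<partial>lborel) \<longlonglongrightarrow> (\<integral>x. (- indicator {x. \<rho> x < s} x * dd (- v) x) * f x \<partial>lborel)"
  proof (rule integral_dominated_convergence[where w="\<lambda>x. (1 / r) * L * indicator (cball a K) x"])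
    \<comment> \<open>The quotients of the cut-off converge off its kink, the level set \<rho> = s,
      which is null.\<close>
    have "AE x in lborel. x \<notin> {x. \<rho> x = s}" by (rule AE_not_in[OF null_level])
    then show "AE x in lborel. (\<lambda>n. q2 n x) \<longlonglongrightarrow> (- indicator {x. \<rho> x < s} x * dd (- v) x) * f x"
      unfolding q2_def by eventually_elim (intro tendsto_mult_right cone_quotient_tendsto, simp)
    show "AE x in lborel. norm (q2 n x) \<le> (1 / r) * L * indicator (cball a K) x" for n
    proof (rule AE_I2)
      fix x
      have b: "\<bar>real (Suc n) * (cone s (x + inverse (real (Suc n)) *\<^sub>R (- v)) - cone s x)\<bar> \<le> 1 / r * norm (- v)"
        by (rule lipschitz_quotient_bound) (use cone_lipschitz in simp)
      show "norm (q2 n x) \<le> (1 / r) * L * indicator (cball a K) x"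
      proof (cases "x \<in> cball a K")
        case True
        have "\<bar>real (Suc n) * (cone s (x + inverse (real (Suc n)) *\<^sub>R (- v)) - cone s x)\<bar> * \<bar>f x\<bar> \<le> (1 / r) * L"
          using b v L(2)[OF True] r0 by (intro mult_mono) auto
        then show ?thesis using True by (simp add: q2_def abs_mult del: of_nat_Suc)
      next
        case False
        then have "x \<notin> cball a R" "x - ?e n \<notin> cball a R" using inK(3)[of x] inK(1)[of "x - ?e n" n] by auto
        then show ?thesis using False cone_outside[OF s] by (simp add: q2_def)
      qed
    qed
  qed (use ind in auto)
  have "(\<integral>x. cone s x * frechet_derivative f (at x) v \<partial>lborel) = (\<integral>x. (- indicator {x. \<rho> x < s} x * dd (- v) x) * f x \<partial>lborel)"
    using LIMSEQ_unique[OF l1[unfolded eq] l2] .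
  then show ?thesis by (simp flip: Bochner_Integration.integral_minus)
qed

lemma integrable_on_level:
  fixes g :: "'a \<Rightarrow> real"
  assumes [measurable]: "g \<in> borel_measurable borel" and g: "\<And>x. x \<in> \<Omega> \<Longrightarrow> \<bar>g x\<bar> \<le> M"
    and A[measurable]: "A \<in> sets borel" "A \<subseteq> \<Omega>"
  shows "integrable lborel (\<lambda>x. indicator A x * g x)"
proof (rule integrableI_bounded_set[where A=A and B=M])
  show "emeasure lborel A < \<infinity>" using emeasure_bounded_finite bounded_subset[OF bdd A(2)] by blast
  show "AE x in lborel. x \<in> A \<longrightarrow> norm (indicator A x * g x) \<le> M" using g A(2) by auto
qed (use A(1) in auto)

lemma level_sets:
  shows "{x. \<rho> x < s} \<in> sets borel"
    and "s \<le> 1 \<Longrightarrow> {x. \<rho> x < s} \<subseteq> \<Omega>"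
    and "{x. \<rho> x < 1} = \<Omega>"
proof -
  show "{x. \<rho> x < s} \<in> sets borel" by measurable
  show "s \<le> 1 \<Longrightarrow> {x. \<rho> x < s} \<subseteq> \<Omega>" by (auto simp: in_\<Omega>_iff)
  show "{x. \<rho> x < 1} = \<Omega>" by (auto simp: in_\<Omega>_iff)
qed

text \<open>Integration by parts with f = 1 shows that \<open>dd v\<close> integrates to 0 over
  \<Omega> for every unit vector v. The sum of the derivatives along b and -b is then nonnegative
  with integral zero, hence zero a.e. This takes the place of Rademacher's theorem.\<close>

lemma AE_regular: "AE x in lborel. x \<in> \<Omega> \<longrightarrow> regular x"
proof -
  have "AE x in lborel. x \<in> \<Omega> \<longrightarrow> dd b x + dd (- b) x = 0" if b: "b \<in> Basis" for b
  proof -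
    have z: "(\<integral>x. indicator \<Omega> x * dd (- v) x \<partial>lborel) = 0" if "norm v = 1" for v
      using cone_ibp_direction[OF smooth_const[of 1] order_refl that] by (simp add: frechet_derivative_const level_sets(3))
    have i: "integrable lborel (\<lambda>x. indicator \<Omega> x * dd v x)" for v
      by (rule integrable_on_level[where M="norm v / r"]) (use dd_bound op in auto)
    have i': "integrable lborel (\<lambda>x. indicator \<Omega> x * (dd b x + dd (- b) x))"
      unfolding distrib_left by (intro Bochner_Integration.integrable_add i)
    have "(\<integral>x. indicator \<Omega> x * (dd b x + dd (- b) x) \<partial>lborel) = 0"
      unfolding distrib_left using z[of b] z[of "- b"] b i by simp
    moreover have "AE x in lborel. 0 \<le> indicator \<Omega> x * (dd b x + dd (- b) x)"
      by (intro AE_I2 mult_nonneg_nonneg dd_add_nonneg) auto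
    ultimately have "AE x in lborel. indicator \<Omega> x * (dd b x + dd (- b) x) = 0"
      using integral_nonneg_eq_0_iff_AE[OF i'] by simp
    then show ?thesis by eventually_elim (auto simp: indicator_def)
  qed
  then have "AE x in lborel. \<forall>b\<in>Basis. x \<in> \<Omega> \<longrightarrow> dd b x + dd (- b) x = 0"
    by (intro AE_finite_allI) auto
  then show ?thesis by eventually_elim (auto simp: regular_def)
qed

text \<open>Almost everywhere in \<Omega> minus \<open>dd (- b)\<close> is \<open>dd b\<close>, so
  the directional formulas for the coordinate vectors add up to a divergence theorem tested with the
  cut-off.\<close>

lemma gauss_cone:
  fixes F :: "'a \<Rightarrow> 'a \<Rightarrow> real"
  assumes F: "\<And>b. b \<in> Basis \<Longrightarrow> smooth (F b)" and s: "s \<le> 1"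
  shows "(\<integral>x. cone s x * (\<Sum>b\<in>Basis. partial_deriv b (F b) x) \<partial>lborel)
    = (\<integral>x. indicator {x. \<rho> x < s} x * (\<Sum>b\<in>Basis. F b x * dd b x) \<partial>lborel)"
proof -
  have Fm[measurable]: "F b \<in> borel_measurable borel" if "b \<in> Basis" for b
    by (intro borel_measurable_continuous_onI smoothD F that)
  have pm[measurable]: "partial_deriv b (F b) \<in> borel_measurable borel" if "b \<in> Basis" for b
    by (intro borel_measurable_continuous_onI smooth_partial_continuous F that)
  have one: "(\<integral>x. cone s x * partial_deriv b (F b) x \<partial>lborel) = (\<integral>x. indicator {x. \<rho> x < s} x * (F b x * dd b x) \<partial>lborel)"
    if b: "b \<in> Basis" for b
  proof -
    have "(\<integral>x. cone s x * partial_deriv b (F b) x \<partial>lborel) = - (\<integral>x. indicator {x. \<rho> x < s} x * dd (- b) x * F b x \<partial>lborel)"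
      unfolding partial_deriv_def using b by (intro cone_ibp_direction F s) auto
    also have "\<dots> = (\<integral>x. - (indicator {x. \<rho> x < s} x * dd (- b) x * F b x) \<partial>lborel)" by simp
    also have "\<dots> = (\<integral>x. indicator {x. \<rho> x < s} x * (F b x * dd b x) \<partial>lborel)"
    proof (rule integral_cong_AE)
      show "AE x in lborel. - (indicator {x. \<rho> x < s} x * dd (- b) x * F b x) = indicator {x. \<rho> x < s} x * (F b x * dd b x)"
        using AE_regular
      proof eventually_elim
        case (elim x)
        show ?case
        proof (cases "\<rho> x < s")
          case True
          then have "dd (- b) x = - dd b x" using elim s b in_\<Omega>_iff by (force simp: regular_def)
          then show ?thesis by simp
        qed auto
      qed
    qed (use b in measurable)
    finally show ?thesis .
  qed
  have i1: "integrable lborel (\<lambda>x. cone s x * partial_deriv b (F b) x)" if b: "b \<in> Basis" for b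
  proof -
    obtain M where M: "M \<ge> 0" "\<And>x. x \<in> \<Omega> \<Longrightarrow> \<bar>partial_deriv b (F b) x\<bar> \<le> M"
      using continuous_bounded_on_bounded[OF bdd smooth_partial_continuous[OF F[OF b] b]] by blast
    have "integrable lborel (\<lambda>x. indicator \<Omega> x * (cone s x * partial_deriv b (F b) x))"
    proof (rule integrable_on_level[where M=M])
      show "\<bar>cone s x * partial_deriv b (F b) x\<bar> \<le> M" if "x \<in> \<Omega>" for x
      proof -
        have "\<bar>cone s x\<bar> \<le> 1" using s \<rho>_nonneg[of x] by (simp add: cone_def)
        then have "\<bar>cone s x\<bar> * \<bar>partial_deriv b (F b) x\<bar> \<le> 1 * M" using M that by (intro mult_mono) auto
        then show ?thesis by (simp add: abs_mult)
      qed
    qed (use op b in auto)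
    moreover have "indicator \<Omega> x * (cone s x * partial_deriv b (F b) x) = cone s x * partial_deriv b (F b) x" for x
      using s in_\<Omega>_iff[of x] by (auto simp: cone_def indicator_def)
    ultimately show ?thesis by simp
  qed
  have i2: "integrable lborel (\<lambda>x. indicator {x. \<rho> x < s} x * (F b x * dd b x))" if b: "b \<in> Basis" for b
  proof -
    obtain M where M: "M \<ge> 0" "\<And>x. x \<in> \<Omega> \<Longrightarrow> \<bar>F b x\<bar> \<le> M"
      using continuous_bounded_on_bounded[OF bdd smoothD(2)[OF F[OF b]]] by blast
    show ?thesis
    proof (rule integrable_on_level[where M="M * (norm b / r)"])
      show "\<bar>F b x * dd b x\<bar> \<le> M * (norm b / r)" if "x \<in> \<Omega>" for x
        unfolding abs_mult using M that dd_bound[of b x] by (intro mult_mono) auto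
    qed (use level_sets s b in auto)
  qed
  have "(\<integral>x. cone s x * (\<Sum>b\<in>Basis. partial_deriv b (F b) x) \<partial>lborel) = (\<Sum>b\<in>Basis. \<integral>x. cone s x * partial_deriv b (F b) x \<partial>lborel)"
    unfolding sum_distrib_left by (rule Bochner_Integration.integral_sum[OF i1])
  also have "\<dots> = (\<Sum>b\<in>Basis. \<integral>x. indicator {x. \<rho> x < s} x * (F b x * dd b x) \<partial>lborel)"
    by (intro sum.cong refl one)
  also have "\<dots> = (\<integral>x. indicator {x. \<rho> x < s} x * (\<Sum>b\<in>Basis. F b x * dd b x) \<partial>lborel)"
    unfolding sum_distrib_left by (rule Bochner_Integration.integral_sum[symmetric, OF i2])
  finally show ?thesis .
qed

end

context convex_body
begin

section \<open>Thin boundary layers\<close>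

definition layer :: "real \<Rightarrow> 'a set" where
  "layer e = {x. 1 - e \<le> \<rho> x \<and> \<rho> x < 1}"

lemma layer_sets [measurable]: "layer e \<in> sets borel"
  unfolding layer_def by measurable

lemma layer_subset: "layer e \<subseteq> \<Omega>"
  by (auto simp: layer_def in_\<Omega>_iff)

lemma indicator_layer: "0 \<le> e \<Longrightarrow> indicator (layer e) x = indicator \<Omega> x - (indicator {x. \<rho> x < 1 - e} x :: real)"
  by (auto simp: layer_def indicator_def in_\<Omega>_iff)

text \<open>The weight equals e in \<Omega> off the layer and decreases to 0 across it, so its
  gradient lives on the layer. After division by e both sides approximate those of the divergence
  theorem.\<close>

lemma gauss_layer:
  fixes F :: "'a \<Rightarrow> 'a \<Rightarrow> real"
  assumes F: "\<And>b. b \<in> Basis \<Longrightarrow> smooth (F b)" and e: "0 \<le> e"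
  shows "(\<integral>x. (cone 1 x - cone (1 - e) x) * (\<Sum>b\<in>Basis. partial_deriv b (F b) x) \<partial>lborel)
    = (\<integral>x. indicator (layer e) x * (\<Sum>b\<in>Basis. F b x * dd b x) \<partial>lborel)"
proof -
  have Fm[measurable]: "F b \<in> borel_measurable borel" if "b \<in> Basis" for b
    by (intro borel_measurable_continuous_onI smoothD F that)
  have Hm: "(\<lambda>x. \<Sum>b\<in>Basis. F b x * dd b x) \<in> borel_measurable borel" by measurable
  have cd: "continuous_on UNIV (\<lambda>x. \<Sum>b\<in>Basis. partial_deriv b (F b) x)"
    by (intro continuous_on_sum smooth_partial_continuous F)
  have [measurable]: "(\<lambda>x. \<Sum>b\<in>Basis. partial_deriv b (F b) x) \<in> borel_measurable borel"
    by (rule borel_measurable_continuous_onI[OF cd])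
  from cd obtain D where D: "D \<ge> 0" "\<And>x. x \<in> \<Omega> \<Longrightarrow> \<bar>\<Sum>b\<in>Basis. partial_deriv b (F b) x\<bar> \<le> D"
    using continuous_bounded_on_bounded[OF bdd] by blast
  have "\<forall>b\<in>Basis. \<exists>M\<ge>0. \<forall>x\<in>\<Omega>. \<bar>F b x\<bar> \<le> M"
    by (intro ballI continuous_bounded_ex bdd smoothD(2) F)
  then obtain M where M: "\<And>b. b \<in> Basis \<Longrightarrow> M b \<ge> 0 \<and> (\<forall>x\<in>\<Omega>. \<bar>F b x\<bar> \<le> M b)" by metis
  have ic: "integrable lborel (\<lambda>x. cone s x * (\<Sum>b\<in>Basis. partial_deriv b (F b) x))" if s: "s \<le> 1" for s
  proof -
    have "integrable lborel (\<lambda>x. indicator \<Omega> x * (cone s x * (\<Sum>b\<in>Basis. partial_deriv b (F b) x)))"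
    proof (rule integrable_on_level[where M="1 * D"])
      show "\<bar>cone s x * (\<Sum>b\<in>Basis. partial_deriv b (F b) x)\<bar> \<le> 1 * D" if "x \<in> \<Omega>" for x
        unfolding abs_mult using D(2)[OF that] s \<rho>_nonneg[of x] by (intro mult_mono) (auto simp: cone_def)
    qed (use op in auto)
    moreover have "indicator \<Omega> x * (cone s x * (\<Sum>b\<in>Basis. partial_deriv b (F b) x)) = cone s x * (\<Sum>b\<in>Basis. partial_deriv b (F b) x)" for x
      using s in_\<Omega>_iff[of x] by (auto simp: cone_def indicator_def)
    ultimately show ?thesis by simp
  qed
  have ii: "integrable lborel (\<lambda>x. indicator {x. \<rho> x < s} x * (\<Sum>b\<in>Basis. F b x * dd b x))" if "s \<le> 1" for s
  proof (rule integrable_on_level[OF Hm, where M="\<Sum>b\<in>Basis. M b * (norm b / r)"])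
    show "\<bar>\<Sum>b\<in>Basis. F b x * dd b x\<bar> \<le> (\<Sum>b\<in>Basis. M b * (norm b / r))" if "x \<in> \<Omega>" for x
    proof (rule order_trans[OF sum_abs], rule sum_mono)
      fix b :: 'a assume "b \<in> Basis"
      then show "\<bar>F b x * dd b x\<bar> \<le> M b * (norm b / r)"
        unfolding abs_mult using M that by (intro mult_mono dd_bound) auto
    qed
  qed (use level_sets that in auto)
  have "(\<integral>x. (cone 1 x - cone (1 - e) x) * (\<Sum>b\<in>Basis. partial_deriv b (F b) x) \<partial>lborel)
    = (\<integral>x. cone 1 x * (\<Sum>b\<in>Basis. partial_deriv b (F b) x) \<partial>lborel) - (\<integral>x. cone (1 - e) x * (\<Sum>b\<in>Basis. partial_deriv b (F b) x) \<partial>lborel)"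
    unfolding left_diff_distrib using ic e by (intro Bochner_Integration.integral_diff) auto
  also have "\<dots> = (\<integral>x. indicator {x. \<rho> x < 1} x * (\<Sum>b\<in>Basis. F b x * dd b x) \<partial>lborel) - (\<integral>x. indicator {x. \<rho> x < 1 - e} x * (\<Sum>b\<in>Basis. F b x * dd b x) \<partial>lborel)"
    using e by (intro arg_cong2[where f="(-)"] gauss_cone F) auto
  also have "\<dots> = (\<integral>x. indicator {x. \<rho> x < 1} x * (\<Sum>b\<in>Basis. F b x * dd b x) - indicator {x. \<rho> x < 1 - e} x * (\<Sum>b\<in>Basis. F b x * dd b x) \<partial>lborel)"
    using ii e by (intro Bochner_Integration.integral_diff[symmetric]) auto
  also have "\<dots> = (\<integral>x. indicator (layer e) x * (\<Sum>b\<in>Basis. F b x * dd b x) \<partial>lborel)"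
    by (intro Bochner_Integration.integral_cong refl) (simp add: indicator_layer[OF e] level_sets(3) left_diff_distrib)
  finally show ?thesis .
qed

text \<open>A dilation maps \<Omega> onto the sublevel set of 1 - e and leaves k unchanged, which
  costs the factor (1 - e)^d. For functions constant along rays, integrals over layers thus reduce
  to integrals against the cone measure without any limit.\<close>

lemma integral_layer_homogeneous:
  fixes k :: "'a \<Rightarrow> real"
  assumes [measurable]: "k \<in> borel_measurable borel" and hom: "\<And>s x. s > 0 \<Longrightarrow> k (a + s *\<^sub>R (x - a)) = k x"
    and M: "\<And>x. x \<in> \<Omega> \<Longrightarrow> \<bar>k x\<bar> \<le> M" and e: "0 < e" "e \<le> 1/2"
  shows "(\<integral>x. indicator (layer e) x * k x \<partial>lborel) = (1 - (1 - e) ^ DIM('a)) * (\<integral>x. indicator \<Omega> x * k x \<partial>lborel)"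
proof -
  have i: "integrable lborel (\<lambda>x. indicator {x. \<rho> x < s} x * k x)" if "s \<le> 1" for s
    by (rule integrable_on_level[OF assms(1) M]) (use level_sets that in auto)
  have "(\<integral>x. indicator \<Omega> x * k x \<partial>lborel) = (1/(1-e)) ^ DIM('a) * (\<integral>x. indicator {x. \<rho> x < 1 - e} x * k x \<partial>lborel)"
  proof -
    have s: "1 - e > 0" "1 - e \<noteq> 0" using e by auto
    have [measurable]: "\<Omega> \<in> sets borel" using op by simp
    have "(\<integral>x. indicator \<Omega> x * k x \<partial>lborel) = \<bar>1/(1-e)\<bar> ^ DIM('a) * (\<integral>x. indicator \<Omega> ((a - (1/(1-e)) *\<^sub>R a) + (1/(1-e)) *\<^sub>R x) * k ((a - (1/(1-e)) *\<^sub>R a) + (1/(1-e)) *\<^sub>R x) \<partial>lborel)"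
      using s by (intro integral_lborel_affine) auto
    also have "(\<integral>x. indicator \<Omega> ((a - (1/(1-e)) *\<^sub>R a) + (1/(1-e)) *\<^sub>R x) * k ((a - (1/(1-e)) *\<^sub>R a) + (1/(1-e)) *\<^sub>R x) \<partial>lborel)
       = (\<integral>x. indicator {x. \<rho> x < 1 - e} x * k x \<partial>lborel)"
    proof (intro Bochner_Integration.integral_cong refl)
      fix x
      have eq: "(a - (1/(1-e)) *\<^sub>R a) + (1/(1-e)) *\<^sub>R x = a + (1/(1-e)) *\<^sub>R (x - a)" by (simp add: algebra_simps)
      have "a + (1/(1-e)) *\<^sub>R (x - a) \<in> \<Omega> \<longleftrightarrow> \<rho> x < 1 - e" using \<rho>_less_iff[OF s(1)] by simp
      then show "indicator \<Omega> ((a - (1/(1-e)) *\<^sub>R a) + (1/(1-e)) *\<^sub>R x) * k ((a - (1/(1-e)) *\<^sub>R a) + (1/(1-e)) *\<^sub>R x) = indicator {x. \<rho> x < 1 - e} x * k x"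
        unfolding eq using hom[of "1/(1-e)" x] s by (simp add: indicator_def)
    qed
    finally show ?thesis using s by simp
  qed
  then have sc: "(\<integral>x. indicator {x. \<rho> x < 1 - e} x * k x \<partial>lborel) = (1 - e) ^ DIM('a) * (\<integral>x. indicator \<Omega> x * k x \<partial>lborel)"
    using e by (simp add: power_divide)
  have "(\<integral>x. indicator (layer e) x * k x \<partial>lborel) = (\<integral>x. indicator {x. \<rho> x < 1} x * k x - indicator {x. \<rho> x < 1 - e} x * k x \<partial>lborel)"
    using e by (intro Bochner_Integration.integral_cong refl) (simp add: indicator_layer level_sets(3) left_diff_distrib)
  also have "\<dots> = (\<integral>x. indicator {x. \<rho> x < 1} x * k x \<partial>lborel) - (\<integral>x. indicator {x. \<rho> x < 1 - e} x * k x \<partial>lborel)"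
    using i e by (intro Bochner_Integration.integral_diff) auto
  finally show ?thesis unfolding sc level_sets(3) by (simp add: algebra_simps)
qed

definition vol :: real where
  "vol = (\<integral>x. indicator \<Omega> x \<partial>lborel)"

lemma vol_nonneg: "vol \<ge> 0"
  by (simp add: vol_def)

text \<open>Makes the factor of \<open>integral_layer_homogeneous\<close> comparable with e; the
  upper bound is Bernoulli's inequality.\<close>

lemma layer_factor:
  fixes e :: real
  assumes e: "0 < e" "e \<le> 1/2"
  shows "e \<le> 1 - (1 - e) ^ DIM('a)" "1 - (1 - e) ^ DIM('a) \<le> DIM('a) * e"
proof -
  have "(1 - e) ^ DIM('a) \<le> (1 - e) ^ 1"
    using e DIM_positive[where 'a='a] by (intro power_decreasing) (auto simp: Suc_le_eq)
  then show "e \<le> 1 - (1 - e) ^ DIM('a)" by simp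
  have "1 + real DIM('a) * (- e) \<le> (1 + (- e)) ^ DIM('a)" using e by (intro Bernoulli_inequality) auto
  then show "1 - (1 - e) ^ DIM('a) \<le> DIM('a) * e" by simp
qed

lemma layer_volume:
  fixes e :: real
  assumes e: "0 < e" "e \<le> 1/2"
  shows "(\<integral>x. indicator (layer e) x * (C::real) \<partial>lborel) \<le> DIM('a) * e * vol * \<bar>C\<bar>" "integrable lborel (\<lambda>x. indicator (layer e) x * (C::real))"
proof -
  have "(\<integral>x. indicator (layer e) x * C \<partial>lborel) = (1 - (1 - e) ^ DIM('a)) * (\<integral>x. indicator \<Omega> x * C \<partial>lborel)"
    by (rule integral_layer_homogeneous[OF _ _ _ e, of _ "\<bar>C\<bar>"]) auto
  also have "(\<integral>x. indicator \<Omega> x * C \<partial>lborel) = vol * C" by (simp add: vol_def)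
  also have "(1 - (1 - e) ^ DIM('a)) * (vol * C) \<le> (1 - (1 - e) ^ DIM('a)) * (vol * \<bar>C\<bar>)"
    using layer_factor(1)[OF e] e vol_nonneg by (intro mult_left_mono) auto
  also have "\<dots> \<le> (DIM('a) * e) * (vol * \<bar>C\<bar>)"
    using layer_factor(2)[OF e] vol_nonneg by (intro mult_right_mono) auto
  finally show "(\<integral>x. indicator (layer e) x * C \<partial>lborel) \<le> DIM('a) * e * vol * \<bar>C\<bar>" by (simp add: mult_ac)
  show "integrable lborel (\<lambda>x. indicator (layer e) x * C)"
    by (rule integrable_on_level[where M="\<bar>C\<bar>"]) (use layer_subset in auto)
qed

lemma vanishing_error:
  assumes "\<And>e. 0 < e \<Longrightarrow> e \<le> 1/2 \<Longrightarrow> x \<le> y + C * e"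
  shows "x \<le> (y::real)"
proof (rule field_le_epsilon)
  fix \<delta> :: real assume d: "\<delta> > 0"
  define e where "e = min (1/2) (\<delta> / (\<bar>C\<bar> + 1))"
  have e: "0 < e" "e \<le> 1/2" using d unfolding e_def by (auto simp: min_def)
  have "C * e \<le> \<bar>C\<bar> * e" using e by (intro mult_right_mono) auto
  also have "\<dots> \<le> (\<bar>C\<bar> + 1) * (\<delta> / (\<bar>C\<bar> + 1))" using d by (intro mult_mono) (auto simp: e_def)
  also have "\<dots> = \<delta>" by simp
  finally show "x \<le> y + \<delta>" using assms[OF e] by simp
qed

lemma in_cball: "x \<in> \<Omega> \<Longrightarrow> x \<in> cball a R" "x \<noteq> a \<Longrightarrow> proj x \<in> cball a R"
  using outer \<rho>_lower[of "proj x"] \<rho>_proj[of x] by (auto simp: dist_norm norm_minus_commute)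

lemma layer_dist_proj:
  assumes "x \<in> layer e" "e \<le> 1/2"
  shows "x \<noteq> a" "norm (x - proj x) \<le> R * e"
proof -
  show x: "x \<noteq> a" using assms \<rho>_a by (auto simp: layer_def)
  have "R * \<bar>1 - \<rho> x\<bar> \<le> R * e" using assms R0 by (intro mult_left_mono) (auto simp: layer_def)
  then show "norm (x - proj x) \<le> R * e" using dist_proj[OF x] by linarith
qed

text \<open>In \<open>gauss_layer\<close> the field is replaced by its values at projected points,
  at a cost of order e on a set of volume of order e. The new flux is constant along rays, so its
  integral over the layer is at most d e times the one over \<Omega>. Dividing by e and letting e
  tend to 0 leaves the factor d.\<close>

theorem gauss_inequality:
  fixes F :: "'a \<Rightarrow> 'a \<Rightarrow> real"
  assumes F: "\<And>b. b \<in> Basis \<Longrightarrow> smooth (F b)"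
  shows "\<bar>\<integral>x. indicator \<Omega> x * (\<Sum>b\<in>Basis. partial_deriv b (F b) x) \<partial>lborel\<bar>
    \<le> DIM('a) * (\<integral>x. indicator \<Omega> x * \<bar>\<Sum>b\<in>Basis. F b (proj x) * dd b x\<bar> \<partial>lborel)"
proof -
  define divF where "divF x = (\<Sum>b\<in>Basis. partial_deriv b (F b) x)" for x
  define H where "H x = (\<Sum>b\<in>Basis. F b x * dd b x)" for x
  define H' where "H' x = (\<Sum>b\<in>Basis. F b (proj x) * dd b x)" for x
  have Fm[measurable]: "F b \<in> borel_measurable borel" if "b \<in> Basis" for b
    by (intro borel_measurable_continuous_onI smoothD F that)
  have [measurable]: "H \<in> borel_measurable borel" "H' \<in> borel_measurable borel" unfolding H_def[abs_def] H'_def[abs_def] by measurable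
  have cd: "continuous_on UNIV divF" unfolding divF_def[abs_def] by (intro continuous_on_sum smooth_partial_continuous F)
  then have [measurable]: "divF \<in> borel_measurable borel" by (rule borel_measurable_continuous_onI)
  have [measurable]: "\<Omega> \<in> sets borel" using op by simp
  obtain D where D: "D \<ge> 0" "\<And>x. x \<in> \<Omega> \<Longrightarrow> \<bar>divF x\<bar> \<le> D"
    using continuous_bounded_on_bounded[OF bdd cd] by blast
  have "\<forall>b\<in>Basis. \<exists>L\<ge>0. (\<forall>x\<in>cball a R. \<bar>F b x\<bar> \<le> L) \<and> (\<forall>x\<in>cball a R. \<forall>y\<in>cball a R. \<bar>F b x - F b y\<bar> \<le> L * norm (x - y))"
  proof
    fix b :: 'a assume "b \<in> Basis"
    from F[OF this] less_imp_le[OF R0] show "\<exists>L\<ge>0. (\<forall>x\<in>cball a R. \<bar>F b x\<bar> \<le> L) \<and> (\<forall>x\<in>cball a R. \<forall>y\<in>cball a R. \<bar>F b x - F b y\<bar> \<le> L * norm (x - y))"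
      by (rule smooth_lipschitz_on) blast
  qed
  then obtain L where L: "\<And>b. b \<in> Basis \<Longrightarrow> L b \<ge> 0" "\<And>b x. b \<in> Basis \<Longrightarrow> x \<in> cball a R \<Longrightarrow> \<bar>F b x\<bar> \<le> L b"
    "\<And>b x y. b \<in> Basis \<Longrightarrow> x \<in> cball a R \<Longrightarrow> y \<in> cball a R \<Longrightarrow> \<bar>F b x - F b y\<bar> \<le> L b * norm (x - y)" by metis
  define C where "C = (\<Sum>b\<in>Basis. L b / r) * R"
  have C0: "C \<ge> 0" unfolding C_def using L(1) r0 R0 by (intro mult_nonneg_nonneg sum_nonneg) auto
  have ddb: "\<bar>dd b x\<bar> \<le> 1 / r" if "b \<in> Basis" for b x using dd_bound[of b x] that by simp
  have HB: "\<bar>H x\<bar> \<le> (\<Sum>b\<in>Basis. L b / r)" if "x \<in> cball a R" for x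
    unfolding H_def using L(1,2) ddb that
    by (intro order_trans[OF sum_abs] sum_mono) (auto simp: abs_mult divide_inverse intro!: mult_mono)
  \<comment> \<open>The maximum treats the centre separately: \<open>in_cball\<close> places
    projected points in the ball only for x different from a.\<close>
  have H'B: "\<bar>H' x\<bar> \<le> (\<Sum>b\<in>Basis. max (L b) \<bar>F b (proj a)\<bar> / r)" for x
    unfolding H'_def using L(1,2) ddb in_cball(2)[of x]
    by (intro order_trans[OF sum_abs] sum_mono, cases "x = a") (auto simp: abs_mult divide_inverse le_max_iff_disj intro!: mult_mono)
  have HH: "\<bar>H x\<bar> \<le> \<bar>H' x\<bar> + C * e" if x: "x \<in> layer e" and e: "0 < e" "e \<le> 1/2" for x e
  proof -
    note lx = layer_dist_proj[OF x e(2)]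
    have xc: "x \<in> cball a R" "proj x \<in> cball a R" using in_cball(1)[of x] in_cball(2)[OF lx(1)] layer_subset x by auto
    have "H x - H' x = (\<Sum>b\<in>Basis. (F b x - F b (proj x)) * dd b x)"
      by (simp add: H_def H'_def left_diff_distrib sum_subtractf)
    then have "\<bar>H x - H' x\<bar> \<le> (\<Sum>b\<in>Basis. \<bar>F b x - F b (proj x)\<bar> * \<bar>dd b x\<bar>)"
      using sum_abs[of "\<lambda>b. (F b x - F b (proj x)) * dd b x" Basis] by (simp add: abs_mult)
    also have "\<dots> \<le> (\<Sum>b\<in>Basis. (L b * (R * e)) * (1 / r))"
    proof (intro sum_mono mult_mono)
      fix b :: 'a assume b: "b \<in> Basis"
      show "\<bar>F b x - F b (proj x)\<bar> \<le> L b * (R * e)"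
        using L(3)[OF b xc] mult_left_mono[OF lx(2) L(1)[OF b]] by linarith
    qed (use ddb L(1) R0 e in auto)
    also have "\<dots> = C * e" by (simp add: C_def sum_distrib_right sum_distrib_left mult_ac)
    finally show ?thesis by linarith
  qed
  let ?J = "\<integral>x. indicator \<Omega> x * \<bar>H' x\<bar> \<partial>lborel" and ?I = "\<integral>x. indicator \<Omega> x * divF x \<partial>lborel"
  have "\<bar>?I\<bar> \<le> DIM('a) * ?J"
  proof (rule vanishing_error[where C="(C + D) * (DIM('a) * vol)"])
    fix e :: real assume e: "0 < e" "e \<le> 1/2"
    let ?c = "\<lambda>x. cone 1 x - cone (1 - e) x"
    have i1: "integrable lborel (\<lambda>x. indicator \<Omega> x * divF x)" by (rule integrable_on_level[where M=D]) (use D op in auto)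
    have cb: "0 \<le> ?c x \<and> ?c x \<le> e" "x \<notin> \<Omega> \<Longrightarrow> ?c x = 0" "x \<in> \<Omega> \<Longrightarrow> x \<notin> layer e \<Longrightarrow> ?c x = e" for x
      using e by (auto simp: cone_def in_\<Omega>_iff layer_def)
    have i2: "integrable lborel (\<lambda>x. ?c x * divF x)"
    proof -
      have "integrable lborel (\<lambda>x. indicator \<Omega> x * (?c x * divF x))"
      proof (rule integrable_on_level[where M="e * D"])
        show "\<bar>?c x * divF x\<bar> \<le> e * D" if "x \<in> \<Omega>" for x
          unfolding abs_mult using cb(1)[of x] D(2)[OF that] e by (intro mult_mono) auto
      qed (use op in auto)
      moreover have "indicator \<Omega> x * (?c x * divF x) = ?c x * divF x" for x using cb(2)[of x] by (auto simp: indicator_def)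
      ultimately show ?thesis by simp
    qed
    have i3: "integrable lborel (\<lambda>x. indicator (layer e) x * H x)"
      by (rule integrable_on_level[OF _ HB]) (use in_cball layer_subset in auto)
    have i4: "integrable lborel (\<lambda>x. indicator (layer e) x * \<bar>H' x\<bar>)"
      by (rule integrable_on_level[where M="\<Sum>b\<in>Basis. max (L b) \<bar>F b (proj a)\<bar> / r"]) (use H'B layer_subset in auto)
    have "\<bar>\<integral>x. indicator (layer e) x * H x \<partial>lborel\<bar> \<le> (\<integral>x. indicator (layer e) x * \<bar>H' x\<bar> + indicator (layer e) x * (C * e) \<partial>lborel)"
    proof (rule order_trans[OF integral_abs_bound], rule integral_mono)
      show "integrable lborel (\<lambda>x. \<bar>indicator (layer e) x * H x\<bar>)" using i3 by simp
      show "\<bar>indicator (layer e) x * H x\<bar> \<le> indicator (layer e) x * \<bar>H' x\<bar> + indicator (layer e) x * (C * e)" for x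
        using HH[OF _ e, of x] by (auto simp: indicator_def)
    qed (use i4 layer_volume[OF e] in auto)
    also have "\<dots> = (\<integral>x. indicator (layer e) x * \<bar>H' x\<bar> \<partial>lborel) + (\<integral>x. indicator (layer e) x * (C * e) \<partial>lborel)"
      using i4 layer_volume[OF e] by simp
    also have "(\<integral>x. indicator (layer e) x * \<bar>H' x\<bar> \<partial>lborel) = (1 - (1 - e) ^ DIM('a)) * ?J"
    proof (rule integral_layer_homogeneous[OF _ _ _ e])
      show "\<bar>H' (a + s *\<^sub>R (x - a))\<bar> = \<bar>H' x\<bar>" if "s > 0" for s x
        using that by (simp add: H'_def proj_scale dd_scale)
      show "\<bar>\<bar>H' x\<bar>\<bar> \<le> (\<Sum>b\<in>Basis. max (L b) \<bar>F b (proj a)\<bar> / r)" for x using H'B[of x] by simp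
    qed auto
    also have "(\<integral>x. indicator (layer e) x * (C * e) \<partial>lborel) \<le> DIM('a) * e * vol * \<bar>C * e\<bar>" by (rule layer_volume[OF e])
    also have "(1 - (1 - e) ^ DIM('a)) * ?J \<le> (DIM('a) * e) * ?J"
      using layer_factor(2)[OF e] by (intro mult_right_mono integral_nonneg_AE) auto
    finally have f1: "\<bar>\<integral>x. indicator (layer e) x * H x \<partial>lborel\<bar> \<le> DIM('a) * e * ?J + DIM('a) * e * vol * (C * e)"
      using C0 e by simp
    \<comment> \<open>The weight differs from the constant e on the layer only, whose volume is
      itself of order e; after division by e this error vanishes in the limit.\<close>
    have "\<bar>e * ?I - (\<integral>x. ?c x * divF x \<partial>lborel)\<bar> = \<bar>\<integral>x. e * (indicator \<Omega> x * divF x) - ?c x * divF x \<partial>lborel\<bar>"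
      using i1 i2 by simp
    also have "\<dots> \<le> (\<integral>x. indicator (layer e) x * (e * D) \<partial>lborel)"
    proof (rule order_trans[OF integral_abs_bound], rule integral_mono)
      show "\<bar>e * (indicator \<Omega> x * divF x) - ?c x * divF x\<bar> \<le> indicator (layer e) x * (e * D)" for x
      proof (cases "x \<in> layer e")
        case True
        then have x: "x \<in> \<Omega>" using layer_subset by auto
        have "\<bar>(e - ?c x) * divF x\<bar> \<le> e * D" unfolding abs_mult using cb(1)[of x] D(2)[OF x] e by (intro mult_mono) auto
        then show ?thesis using True x by (simp add: left_diff_distrib)
      next
        case False
        then show ?thesis using cb(2,3)[of x] by (cases "x \<in> \<Omega>") auto
      qed
    qed (use i1 i2 layer_volume[OF e] in auto)
    also have "\<dots> \<le> DIM('a) * e * vol * \<bar>e * D\<bar>" by (rule layer_volume[OF e])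
    finally have f2: "\<bar>e * ?I - (\<integral>x. ?c x * divF x \<partial>lborel)\<bar> \<le> DIM('a) * e * vol * (e * D)" using D e by simp
    have f3: "(\<integral>x. ?c x * divF x \<partial>lborel) = (\<integral>x. indicator (layer e) x * H x \<partial>lborel)"
      unfolding divF_def H_def using e by (intro gauss_layer F) auto
    have "\<bar>e * ?I\<bar> \<le> e * (DIM('a) * ?J + (C + D) * (DIM('a) * vol) * e)"
      using f1 f2 unfolding f3 by (simp add: algebra_simps)
    then have "e * \<bar>?I\<bar> \<le> e * (DIM('a) * ?J + (C + D) * (DIM('a) * vol) * e)" using e by (simp add: abs_mult)
    then show "\<bar>?I\<bar> \<le> DIM('a) * ?J + (C + D) * (DIM('a) * vol) * e" using e by (simp add: mult_le_cancel_left)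
  qed
  then show ?thesis by (simp add: divF_def H'_def)
qed

text \<open>The layer formula is applied to the field f^2 (x - a). Euler's identity turns its flux
  density into f^2 \<rho>, at least f^2 / 2 on the layer, while the weight on the divergence side is
  at most e.\<close>

theorem layer_estimate:
  fixes f :: "'a \<Rightarrow> real"
  assumes f: "smooth f" and e: "0 < e" "e \<le> 1/2"
  shows "(\<integral>x. indicator (layer e) x * (f x)\<^sup>2 \<partial>lborel)
    \<le> e * (2 * DIM('a) * (1 + R)) * (\<integral>x. indicator \<Omega> x * ((f x)\<^sup>2 + (\<Sum>b\<in>Basis. (partial_deriv b f x)\<^sup>2)) \<partial>lborel)"
proof -
  define F where "F b x = (f x * f x) * ((x - a) \<bullet> b)" for b x
  have F: "smooth (F b)" for b unfolding F_def[abs_def] by (intro smooth_mult f smooth_inner)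
  define divF where "divF x = (\<Sum>b\<in>Basis. partial_deriv b (F b) x)" for x
  define E where "E x = (f x)\<^sup>2 + (\<Sum>b\<in>Basis. (partial_deriv b f x)\<^sup>2)" for x
  have cE: "continuous_on UNIV E"
    unfolding E_def[abs_def] by (intro continuous_intros smooth_partial_continuous smoothD(2) f)
  have cd: "continuous_on UNIV divF" unfolding divF_def[abs_def] by (intro continuous_on_sum smooth_partial_continuous F)
  have [measurable]: "E \<in> borel_measurable borel" "divF \<in> borel_measurable borel" "f \<in> borel_measurable borel"
    using cE cd smoothD(2)[OF f] by (auto intro: borel_measurable_continuous_onI)
  have [measurable]: "\<Omega> \<in> sets borel" using op by simp
  have pF: "partial_deriv b (F b) x = (f x)\<^sup>2 + 2 * (f x * partial_deriv b f x) * ((x - a) \<bullet> b)" if b: "b \<in> Basis" for b x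
  proof -
    have pi: "partial_deriv b (\<lambda>x. (x - a) \<bullet> b) x = 1"
      using b by (subst partial_deriv_eq[of _ "\<lambda>h. h \<bullet> b"]) (auto intro!: derivative_eq_intros)
    have "partial_deriv b (F b) x = (f x * f x) * 1 + (f x * partial_deriv b f x + partial_deriv b f x * f x) * ((x - a) \<bullet> b)"
      unfolding F_def[abs_def] partial_deriv_mult[OF smoothD(1)[OF smooth_mult[OF f f]] smoothD(1)[OF smooth_inner]]
        partial_deriv_mult[OF smoothD(1)[OF f] smoothD(1)[OF f]] pi by (rule refl)
    then show ?thesis by (simp only: power2_eq_square mult_2 mult.commute mult_1_right)
  qed
  have divE: "\<bar>divF x\<bar> \<le> DIM('a) * (1 + R) * E x" if x: "x \<in> \<Omega>" for x
  proof -
    have xa: "norm (x - a) \<le> R" using in_cball(1)[OF x] by (simp add: dist_norm norm_minus_commute)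
    have "\<bar>divF x\<bar> \<le> (\<Sum>b\<in>(Basis::'a set). (1 + R) * ((f x)\<^sup>2 + (partial_deriv b f x)\<^sup>2))"
      unfolding divF_def
    proof (rule order_trans[OF sum_abs], rule sum_mono)
      fix b :: 'a assume b: "b \<in> Basis"
      have ip: "\<bar>(x - a) \<bullet> b\<bar> \<le> R" using Basis_le_norm[OF b, of "x - a"] xa by linarith
      have yo: "\<bar>2 * (f x * partial_deriv b f x)\<bar> \<le> (f x)\<^sup>2 + (partial_deriv b f x)\<^sup>2"
        using sum_squares_bound[of "\<bar>f x\<bar>" "\<bar>partial_deriv b f x\<bar>"] by (simp add: abs_mult)
      have "\<bar>2 * (f x * partial_deriv b f x) * ((x - a) \<bullet> b)\<bar> \<le> ((f x)\<^sup>2 + (partial_deriv b f x)\<^sup>2) * R"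
        unfolding abs_mult[of _ "(x - a) \<bullet> b"] using yo ip by (intro mult_mono) auto
      then have "\<bar>partial_deriv b (F b) x\<bar> \<le> (f x)\<^sup>2 + ((f x)\<^sup>2 + (partial_deriv b f x)\<^sup>2) * R"
        unfolding pF[OF b] using zero_le_power2[of "f x"] by linarith
      also have "\<dots> \<le> (1 + R) * ((f x)\<^sup>2 + (partial_deriv b f x)\<^sup>2)" by (simp add: algebra_simps)
      finally show "\<bar>partial_deriv b (F b) x\<bar> \<le> (1 + R) * ((f x)\<^sup>2 + (partial_deriv b f x)\<^sup>2)" .
    qed
    also have "\<dots> = (1 + R) * (DIM('a) * (f x)\<^sup>2 + (\<Sum>b\<in>Basis. (partial_deriv b f x)\<^sup>2))"
      by (simp add: sum_distrib_left[symmetric] sum.distrib)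
    also have "\<dots> \<le> (1 + R) * (DIM('a) * E x)"
    proof (intro mult_left_mono)
      have "1 * (\<Sum>b\<in>Basis. (partial_deriv b f x)\<^sup>2) \<le> DIM('a) * (\<Sum>b\<in>Basis. (partial_deriv b f x)\<^sup>2)"
        using DIM_positive[where 'a='a] by (intro mult_right_mono sum_nonneg) (auto simp: Suc_le_eq)
      then show "DIM('a) * (f x)\<^sup>2 + (\<Sum>b\<in>Basis. (partial_deriv b f x)\<^sup>2) \<le> DIM('a) * E x"
        by (simp add: E_def distrib_left)
    qed (use R0 in auto)
    finally show ?thesis by (simp add: mult_ac)
  qed
  obtain M where M: "M \<ge> 0" "\<And>x. x \<in> \<Omega> \<Longrightarrow> \<bar>E x\<bar> \<le> M" using continuous_bounded_on_bounded[OF bdd cE] by blast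
  have iE: "integrable lborel (\<lambda>x. indicator \<Omega> x * E x)" by (rule integrable_on_level[OF _ M(2)]) (use op in auto)
  have f2E: "0 \<le> (f x)\<^sup>2 \<and> (f x)\<^sup>2 \<le> E x" for x by (simp add: E_def sum_nonneg)
  let ?c = "\<lambda>x. cone 1 x - cone (1 - e) x"
  have cb: "0 \<le> ?c x \<and> ?c x \<le> e" "x \<notin> \<Omega> \<Longrightarrow> ?c x = 0" for x
    using e by (auto simp: cone_def in_\<Omega>_iff)
  have cdE: "\<bar>?c x * divF x\<bar> \<le> e * (DIM('a) * (1 + R)) * (indicator \<Omega> x * E x)" for x
  proof (cases "x \<in> \<Omega>")
    case True
    have "\<bar>?c x\<bar> * \<bar>divF x\<bar> \<le> e * (DIM('a) * (1 + R) * E x)" using cb(1)[of x] divE[OF True] e by (intro mult_mono) auto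
    then show ?thesis using True by (simp add: abs_mult mult_ac)
  qed (use cb(2) in simp)
  have i2: "integrable lborel (\<lambda>x. ?c x * divF x)"
    by (rule Bochner_Integration.integrable_bound[OF integrable_mult_right[OF iE, of "e * (DIM('a) * (1 + R))"]])
      (use cdE in \<open>auto intro!: order_trans[OF cdE] abs_ge_self\<close>)
  have il: "integrable lborel (\<lambda>x. indicator (layer e) x * ((f x)\<^sup>2 * q x))" if [measurable]: "q \<in> borel_measurable borel" and q: "\<And>x. x \<in> \<Omega> \<Longrightarrow> \<bar>q x\<bar> \<le> 1" for q
  proof (rule integrable_on_level[where M="M * 1"])
    show "\<bar>(f x)\<^sup>2 * q x\<bar> \<le> M * 1" if "x \<in> \<Omega>" for x
      unfolding abs_mult using f2E[of x] M(1) M(2)[OF that] q[OF that] by (intro mult_mono) auto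
  qed (use layer_subset in auto)
  have "(\<integral>x. indicator (layer e) x * ((f x)\<^sup>2 * (1/2)) \<partial>lborel) \<le> (\<integral>x. indicator (layer e) x * ((f x)\<^sup>2 * \<rho> x) \<partial>lborel)"
  proof (rule integral_mono)
    show "integrable lborel (\<lambda>x. indicator (layer e) x * ((f x)\<^sup>2 * (1/2)))" by (rule il) auto
    show "integrable lborel (\<lambda>x. indicator (layer e) x * ((f x)\<^sup>2 * \<rho> x))"
      by (rule il) (use \<rho>_nonneg in_\<Omega>_iff in \<open>auto simp: less_imp_le\<close>)
    fix x
    have "(f x)\<^sup>2 * (1/2) \<le> (f x)\<^sup>2 * \<rho> x" if "x \<in> layer e"
      using that e by (intro mult_left_mono) (auto simp: layer_def)
    then show "indicator (layer e) x * ((f x)\<^sup>2 * (1/2)) \<le> indicator (layer e) x * ((f x)\<^sup>2 * \<rho> x)"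
      by (simp add: indicator_def)
  qed
  also have "\<dots> = (\<integral>x. indicator (layer e) x * (\<Sum>b\<in>Basis. F b x * dd b x) \<partial>lborel)"
  proof (rule integral_cong_AE)
    show "AE x in lborel. indicator (layer e) x * ((f x)\<^sup>2 * \<rho> x) = indicator (layer e) x * (\<Sum>b\<in>Basis. F b x * dd b x)"
      using AE_regular
    proof eventually_elim
      case (elim x)
      show ?case
      proof (cases "x \<in> layer e")
        case True
        then have "(\<Sum>b\<in>Basis. ((x - a) \<bullet> b) * dd b x) = \<rho> x"
          using regular_normal(2)[OF layer_dist_proj(1)[OF True e(2)]] elim layer_subset by auto
        then have "(\<Sum>b\<in>Basis. F b x * dd b x) = (f x)\<^sup>2 * \<rho> x"
          by (simp add: F_def power2_eq_square sum_distrib_left mult.assoc flip: sum_distrib_left)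
        then show ?thesis by simp
      qed simp
    qed
    show "(\<lambda>x. indicator (layer e) x * (\<Sum>b\<in>Basis. F b x * dd b x)) \<in> borel_measurable lborel"
      unfolding F_def by measurable
  qed measurable
  also have "\<dots> = (\<integral>x. ?c x * divF x \<partial>lborel)"
    unfolding divF_def using e by (intro gauss_layer[symmetric] F) auto
  also have "\<dots> \<le> (\<integral>x. e * (DIM('a) * (1 + R)) * (indicator \<Omega> x * E x) \<partial>lborel)"
    by (rule integral_mono[OF i2 integrable_mult_right[OF iE]]) (use cdE in \<open>auto intro: order_trans[OF abs_ge_self]\<close>)
  finally have "(\<integral>x. indicator (layer e) x * (f x)\<^sup>2 \<partial>lborel) / 2 \<le> e * (DIM('a) * (1 + R)) * (\<integral>x. indicator \<Omega> x * E x \<partial>lborel)"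
    by (simp del: of_nat_Suc)
  then show ?thesis by (simp add: E_def[symmetric] mult_ac)
qed

text \<open>The projected function is constant along rays, so its squared integral over \<Omega> is
  at most 1/e times the one over the layer. On the layer its square differs from that of f by order
  e, and the factor e from \<open>layer_estimate\<close> cancels.\<close>

theorem trace_inequality:
  fixes f :: "'a \<Rightarrow> real"
  assumes f: "smooth f"
  shows "(\<integral>x. indicator \<Omega> x * (f (proj x))\<^sup>2 \<partial>lborel)
    \<le> (2 * DIM('a) * (1 + R)) * (\<integral>x. indicator \<Omega> x * ((f x)\<^sup>2 + (\<Sum>b\<in>Basis. (partial_deriv b f x)\<^sup>2)) \<partial>lborel)"
proof -
  obtain L where L: "L \<ge> 0" "\<And>x. x \<in> cball a R \<Longrightarrow> \<bar>f x\<bar> \<le> L" "\<And>x y. x \<in> cball a R \<Longrightarrow> y \<in> cball a R \<Longrightarrow> \<bar>f x - f y\<bar> \<le> L * norm (x - y)"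
    using smooth_lipschitz_on[OF f less_imp_le[OF R0]] by metis
  have [measurable]: "f \<in> borel_measurable borel" by (intro borel_measurable_continuous_onI smoothD f)
  have aa: "proj a = a" by (simp add: proj_def)
  have pc: "proj x \<in> cball a R" for x using in_cball(2)[of x] R0 by (cases "x = a") (auto simp: aa)
  have sqb: "\<bar>(f y)\<^sup>2\<bar> \<le> L\<^sup>2" if "y \<in> cball a R" for y using power_mono[OF L(2)[OF that], of 2] by simp
  let ?N = "\<integral>x. indicator \<Omega> x * ((f x)\<^sup>2 + (\<Sum>b\<in>Basis. (partial_deriv b f x)\<^sup>2)) \<partial>lborel" and ?T = "\<integral>x. indicator \<Omega> x * (f (proj x))\<^sup>2 \<partial>lborel"
  show ?thesis
  proof (rule vanishing_error[where C="DIM('a) * vol * (2 * L * L * R)"])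
    fix e :: real assume e: "0 < e" "e \<le> 1/2"
    have i1: "integrable lborel (\<lambda>x. indicator (layer e) x * (f (proj x))\<^sup>2)"
      by (rule integrable_on_level[where M="L\<^sup>2"]) (use sqb pc layer_subset in auto)
    have i2: "integrable lborel (\<lambda>x. indicator (layer e) x * (f x)\<^sup>2)"
      by (rule integrable_on_level[where M="L\<^sup>2"]) (use sqb in_cball(1) layer_subset in auto)
    have "e * ?T \<le> (1 - (1 - e) ^ DIM('a)) * ?T"
      using layer_factor(1)[OF e] by (intro mult_right_mono integral_nonneg_AE) auto
    also have "\<dots> = (\<integral>x. indicator (layer e) x * (f (proj x))\<^sup>2 \<partial>lborel)"
      by (rule integral_layer_homogeneous[symmetric, OF _ _ _ e, of _ "L\<^sup>2"]) (use sqb pc in \<open>auto simp: proj_scale\<close>)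
    also have "\<dots> \<le> (\<integral>x. indicator (layer e) x * (f x)\<^sup>2 + indicator (layer e) x * (2 * L * L * R * e) \<partial>lborel)"
    proof (rule integral_mono[OF i1 Bochner_Integration.integrable_add[OF i2 layer_volume(2)[OF e]]])
      fix x
      show "indicator (layer e) x * (f (proj x))\<^sup>2 \<le> indicator (layer e) x * (f x)\<^sup>2 + indicator (layer e) x * (2 * L * L * R * e)"
      proof (cases "x \<in> layer e")
        case True
        have xc: "x \<in> cball a R" using in_cball(1)[of x] True layer_subset by auto
        have "\<bar>f (proj x) - f x\<bar> \<le> L * norm (proj x - x)" by (rule L(3)[OF pc xc])
        also have "\<dots> \<le> L * (R * e)" using layer_dist_proj(2)[OF True e(2)] L(1) by (intro mult_left_mono) (auto simp: norm_minus_commute)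
        finally have d: "\<bar>f (proj x) - f x\<bar> \<le> L * (R * e)" .
        have "(f (proj x))\<^sup>2 - (f x)\<^sup>2 = (f (proj x) - f x) * (f (proj x) + f x)" by (simp add: power2_eq_square algebra_simps)
        also have "\<dots> \<le> \<bar>f (proj x) - f x\<bar> * \<bar>f (proj x) + f x\<bar>" by (metis abs_ge_self abs_mult)
        also have "\<dots> \<le> (L * (R * e)) * (2 * L)" using d L(2)[OF pc[of x]] L(2)[OF xc] L(1) R0 e by (intro mult_mono) auto
        finally show ?thesis using True by (simp add: mult_ac)
      qed simp
    qed
    also have "\<dots> = (\<integral>x. indicator (layer e) x * (f x)\<^sup>2 \<partial>lborel) + (\<integral>x. indicator (layer e) x * (2 * L * L * R * e) \<partial>lborel)"
      by (rule Bochner_Integration.integral_add[OF i2 layer_volume(2)[OF e]])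
    also have "\<dots> \<le> e * (2 * DIM('a) * (1 + R)) * ?N + DIM('a) * e * vol * \<bar>2 * L * L * R * e\<bar>"
      by (intro add_mono layer_estimate[OF f e] layer_volume(1)[OF e])
    also have "\<dots> = e * ((2 * DIM('a) * (1 + R)) * ?N + DIM('a) * vol * (2 * L * L * R) * e)"
      using L(1) R0 e by (simp add: abs_mult algebra_simps)
    finally show "?T \<le> (2 * DIM('a) * (1 + R)) * ?N + DIM('a) * vol * (2 * L * L * R) * e"
      using e by (simp add: mult_le_cancel_left)
  qed
qed

end

section \<open>Hausdorff measure\<close>

definition hterm :: "nat \<Rightarrow> 'a::euclidean_space set \<Rightarrow> ennreal" where
  "hterm s C = (if C = {} then 0 else ennreal (unit_ball_vol (real s) * (diameter C / 2) ^ s))"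

definition hcovers :: "real \<Rightarrow> 'a::euclidean_space set \<Rightarrow> (nat \<Rightarrow> 'a set) set" where
  "hcovers \<delta> A = {C. A \<subseteq> (\<Union>i. C i) \<and> (\<forall>i. bounded (C i) \<and> diameter (C i) \<le> \<delta>)}"

lemma hausdorff_pre_eq: "hausdorff_pre s \<delta> A = (INF C \<in> hcovers \<delta> A. \<Sum>i. hterm s (C i))"
  by (simp add: hausdorff_pre_def hcovers_def hterm_def)

lemma hausdorff_pre_mono: "A \<subseteq> B \<Longrightarrow> hausdorff_pre s \<delta> A \<le> hausdorff_pre s \<delta> B"
  unfolding hausdorff_pre_eq by (rule INF_superset_mono) (auto simp: hcovers_def)

lemma hausdorff_pre_antimono: "\<delta> \<le> \<delta>' \<Longrightarrow> hausdorff_pre s \<delta>' A \<le> hausdorff_pre s \<delta> A"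
  unfolding hausdorff_pre_eq by (rule INF_superset_mono) (auto simp: hcovers_def intro: order_trans)

lemma hausdorff_outer_mono: "A \<subseteq> B \<Longrightarrow> hausdorff_outer s A \<le> hausdorff_outer s B"
  unfolding hausdorff_outer_def by (intro SUP_mono) (auto intro: hausdorff_pre_mono)

lemma hausdorff_pre_le_outer: "\<delta> > 0 \<Longrightarrow> hausdorff_pre s \<delta> A \<le> hausdorff_outer s A"
  unfolding hausdorff_outer_def by (intro SUP_upper) auto

lemma hausdorff_pre_empty: "\<delta> > 0 \<Longrightarrow> hausdorff_pre s \<delta> {} = 0"
proof -
  assume d: "\<delta> > 0"
  then have "(\<lambda>i. {}) \<in> hcovers \<delta> ({} :: 'a set)" by (auto simp: hcovers_def)
  then have "hausdorff_pre s \<delta> ({} :: 'a set) \<le> (\<Sum>i. hterm s ({} :: 'a set))"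
    unfolding hausdorff_pre_eq by (rule INF_lower)
  then show ?thesis by (simp add: hterm_def)
qed

lemma hausdorff_outer_empty: "hausdorff_outer s {} = 0"
proof -
  have "hausdorff_outer s ({} :: 'a set) \<le> 0"
    unfolding hausdorff_outer_def by (rule SUP_least) (simp add: hausdorff_pre_empty)
  then show ?thesis by simp
qed

lemma hausdorff_pre_subadditive:
  "hausdorff_pre s \<delta> (\<Union>i. A i) \<le> (\<Sum>i. hausdorff_pre s \<delta> (A i))"
proof (cases "(\<Sum>i. hausdorff_pre s \<delta> (A i)) = \<infinity>")
  case False
  have fin: "hausdorff_pre s \<delta> (A i) < \<infinity>" for i
  proof -
    have "hausdorff_pre s \<delta> (A i) = (\<Sum>j\<in>{i}. hausdorff_pre s \<delta> (A j))" by simp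
    also have "\<dots> \<le> (\<Sum>i. hausdorff_pre s \<delta> (A i))" by (intro sum_le_suminf) auto
    finally show ?thesis using False by (auto simp: less_top top_unique)
  qed
  show ?thesis
  proof (rule ennreal_le_epsilon)
    fix e :: real assume e: "e > 0"
    define \<eta> where "\<eta> i = e * (1/2) ^ Suc i" for i
    have eta: "\<eta> i > 0" for i using e by (simp add: \<eta>_def)
    have "\<exists>C\<in>hcovers \<delta> (A i). (\<Sum>j. hterm s (C j)) < hausdorff_pre s \<delta> (A i) + ennreal (\<eta> i)" for i
    proof -
      have "hausdorff_pre s \<delta> (A i) < hausdorff_pre s \<delta> (A i) + ennreal (\<eta> i)"
        using fin[of i] eta[of i] by (cases "hausdorff_pre s \<delta> (A i)" rule: ennreal_cases) (auto simp flip: ennreal_plus intro!: ennreal_lessI)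
      then show ?thesis unfolding hausdorff_pre_eq INF_less_iff by simp
    qed
    then obtain C where C: "\<And>i. C i \<in> hcovers \<delta> (A i)" "\<And>i. (\<Sum>j. hterm s (C i j)) < hausdorff_pre s \<delta> (A i) + ennreal (\<eta> i)"
      by metis
    define D where "D n = (case prod_decode n of (i, j) \<Rightarrow> C i j)" for n
    have "D \<in> hcovers \<delta> (\<Union>i. A i)"
    proof -
      have "x \<in> (\<Union>n. D n)" if xA: "x \<in> A i" for x i
      proof -
        obtain j where "x \<in> C i j" using C(1)[of i] xA unfolding hcovers_def by blast
        then have "x \<in> D (prod_encode (i, j))" by (simp add: D_def)
        then show ?thesis by blast
      qed
      moreover have "bounded (D n) \<and> diameter (D n) \<le> \<delta>" for n
        using C(1) by (auto simp: D_def hcovers_def split: prod.split)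
      ultimately show ?thesis by (auto simp: hcovers_def)
    qed
    then have "hausdorff_pre s \<delta> (\<Union>i. A i) \<le> (\<Sum>n. hterm s (D n))"
      unfolding hausdorff_pre_eq by (rule INF_lower)
    also have "(\<Sum>n. hterm s (D n)) = (\<Sum>n. (\<lambda>(i, j). hterm s (C i j)) (prod_decode n))"
      by (simp add: D_def split: prod.split cong: suminf_cong) (metis (mono_tags, lifting) old.prod.case prod.exhaust_sel)
    also have "\<dots> = (\<Sum>i. \<Sum>j. hterm s (C i j))"
      by (rule suminf_ennreal_2dimen) simp
    also have "\<dots> \<le> (\<Sum>i. hausdorff_pre s \<delta> (A i) + ennreal (\<eta> i))"
      by (intro suminf_le less_imp_le C(2)) auto
    also have "\<dots> = (\<Sum>i. hausdorff_pre s \<delta> (A i)) + (\<Sum>i. ennreal (\<eta> i))"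
      by (rule suminf_add[symmetric]) auto
    also have "(\<Sum>i. ennreal (\<eta> i)) = ennreal e"
    proof -
      have "\<eta> sums (e * 1)" unfolding \<eta>_def by (intro sums_mult power_half_series)
      then show ?thesis using eta by (intro suminf_ennreal_eq) (auto simp: less_imp_le)
    qed
    finally show "hausdorff_pre s \<delta> (\<Union>i. A i) \<le> (\<Sum>i. hausdorff_pre s \<delta> (A i)) + ennreal e" .
  qed
qed simp

lemma hausdorff_outer_subadditive:
  "hausdorff_outer s (\<Union>i. A i) \<le> (\<Sum>i. hausdorff_outer s (A i))"
  unfolding hausdorff_outer_def[of s "\<Union>i. A i"]
proof (rule SUP_least)
  fix \<delta> :: real assume "\<delta> \<in> {0<..}"
  then have "(\<Sum>i. hausdorff_pre s \<delta> (A i)) \<le> (\<Sum>i. hausdorff_outer s (A i))"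
    by (intro suminf_le hausdorff_pre_le_outer) auto
  with hausdorff_pre_subadditive[of s \<delta> A] show "hausdorff_pre s \<delta> (\<Union>i. A i) \<le> (\<Sum>i. hausdorff_outer s (A i))"
    by (rule order_trans)
qed

lemma hausdorff_outer_Un: "hausdorff_outer s (A \<union> B) \<le> hausdorff_outer s A + hausdorff_outer s B"
proof -
  define E where "E i = (if i = 0 then A else if i = 1 then B else {})" for i :: nat
  have "(\<Union>i. E i) = A \<union> B" by (auto simp: E_def split: if_splits)
  then have "hausdorff_outer s (A \<union> B) \<le> (\<Sum>i. hausdorff_outer s (E i))" using hausdorff_outer_subadditive[of s E] by simp
  also have "\<dots> = (\<Sum>i\<in>{0, 1}. hausdorff_outer s (E i))"
    by (rule suminf_finite) (auto simp: E_def hausdorff_outer_empty)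
  finally show ?thesis by (simp add: E_def)
qed

text \<open>A covering set of diameter below d cannot meet both A and B, so a cover of the union
  splits into two. Discarded members become empty sets, which cost 0 for every s.\<close>

lemma hausdorff_pre_separated:
  assumes d: "\<And>x y. x \<in> A \<Longrightarrow> y \<in> B \<Longrightarrow> dist x y \<ge> d" and \<delta>: "\<delta> < d"
  shows "hausdorff_pre s \<delta> A + hausdorff_pre s \<delta> B \<le> hausdorff_pre s \<delta> (A \<union> B)"
  unfolding hausdorff_pre_eq[of s \<delta> "A \<union> B"]
proof (rule INF_greatest)
  fix C assume C: "C \<in> hcovers \<delta> (A \<union> B)"
  define P where "P i = (if C i \<inter> A \<noteq> {} then C i else {})" for i
  define Q where "Q i = (if C i \<inter> A \<noteq> {} then {} else C i)" for i
  have d0: "\<delta> \<ge> 0" using C diameter_ge_0[of "C 0"] by (auto simp: hcovers_def intro: order_trans)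
  have P: "P \<in> hcovers \<delta> A" using C d0 by (fastforce simp: hcovers_def P_def)
  have "x \<in> (\<Union>i. Q i)" if x: "x \<in> B" for x
  proof -
    obtain i where i: "x \<in> C i" using C x by (auto simp: hcovers_def)
    have "C i \<inter> A = {}"
    proof (rule ccontr)
      assume "C i \<inter> A \<noteq> {}"
      then obtain y where y: "y \<in> C i" "y \<in> A" by auto
      have "dist y x \<le> diameter (C i)" using C i y by (intro diameter_bounded_bound) (auto simp: hcovers_def)
      moreover have "diameter (C i) \<le> \<delta>" using C by (simp add: hcovers_def)
      ultimately show False using d[OF y(2) x] \<delta> by linarith
    qed
    then show ?thesis using i by (auto simp: Q_def)
  qed
  then have Q: "Q \<in> hcovers \<delta> B" using C d0 by (auto simp: hcovers_def Q_def)
  have "hausdorff_pre s \<delta> A + hausdorff_pre s \<delta> B \<le> (\<Sum>i. hterm s (P i)) + (\<Sum>i. hterm s (Q i))"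
    unfolding hausdorff_pre_eq by (intro add_mono INF_lower P Q)
  also have "\<dots> = (\<Sum>i. hterm s (P i) + hterm s (Q i))" by (rule suminf_add) auto
  also have "\<dots> = (\<Sum>i. hterm s (C i))" by (intro suminf_cong) (auto simp: P_def Q_def hterm_def)
  finally show "hausdorff_pre s \<delta> A + hausdorff_pre s \<delta> B \<le> (\<Sum>i. hterm s (C i))" .
qed

text \<open>The two suprema run over independent scales; lowering both to a common scale below d
  only increases the left side.\<close>

lemma hausdorff_outer_separated:
  assumes d: "\<And>x y. x \<in> A \<Longrightarrow> y \<in> B \<Longrightarrow> dist x y \<ge> d" "d > 0"
  shows "hausdorff_outer s A + hausdorff_outer s B \<le> hausdorff_outer s (A \<union> B)"
proof -
  have 1: "hausdorff_pre s \<delta>1 A + hausdorff_pre s \<delta>2 B \<le> hausdorff_outer s (A \<union> B)" if p: "\<delta>1 > 0" "\<delta>2 > 0" for \<delta>1 \<delta>2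
  proof -
    define \<delta> where "\<delta> = min (min \<delta>1 \<delta>2) (d / 2)"
    have \<delta>: "\<delta> > 0" "\<delta> \<le> \<delta>1" "\<delta> \<le> \<delta>2" "\<delta> < d" using p d(2) by (auto simp: \<delta>_def)
    have "hausdorff_pre s \<delta>1 A + hausdorff_pre s \<delta>2 B \<le> hausdorff_pre s \<delta> A + hausdorff_pre s \<delta> B"
      using \<delta> by (intro add_mono hausdorff_pre_antimono)
    also have "\<dots> \<le> hausdorff_pre s \<delta> (A \<union> B)" by (rule hausdorff_pre_separated[OF d(1) \<delta>(4)])
    also have "\<dots> \<le> hausdorff_outer s (A \<union> B)" by (rule hausdorff_pre_le_outer[OF \<delta>(1)])
    finally show ?thesis .
  qed
  have 2: "hausdorff_outer s A + hausdorff_pre s \<delta>2 B \<le> hausdorff_outer s (A \<union> B)" if "\<delta>2 > 0" for \<delta>2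
  proof -
    have "hausdorff_outer s A + hausdorff_pre s \<delta>2 B = (SUP \<delta>1\<in>{0<..}. hausdorff_pre s \<delta>1 A + hausdorff_pre s \<delta>2 B)"
      unfolding hausdorff_outer_def by (rule ennreal_SUP_add_left[symmetric]) auto
    also have "\<dots> \<le> hausdorff_outer s (A \<union> B)" using 1 that by (intro SUP_least) auto
    finally show ?thesis .
  qed
  have "hausdorff_outer s A + hausdorff_outer s B = (SUP \<delta>2\<in>{0<..}. hausdorff_outer s A + hausdorff_pre s \<delta>2 B)"
    unfolding hausdorff_outer_def[of s B] by (rule ennreal_SUP_add_right) auto
  also have "\<dots> \<le> hausdorff_outer s (A \<union> B)" using 2 by (intro SUP_least) auto
  finally show ?thesis .
qed

text \<open>The gap d j is required only between the j-th set and the earlier ones, because the gaps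
  between successive annuli shrink with the index.\<close>

lemma hausdorff_outer_separated_sum:
  assumes d: "\<And>i. i < (n::nat) \<Longrightarrow> d i > 0"
    and sep: "\<And>i j x y. i < j \<Longrightarrow> j < n \<Longrightarrow> x \<in> A i \<Longrightarrow> y \<in> A j \<Longrightarrow> dist x y \<ge> d j"
  shows "(\<Sum>i<n. hausdorff_outer s (A i)) \<le> hausdorff_outer s (\<Union>i<n. A i)"
  using assms
proof (induction n)
  case (Suc n)
  have "(\<Sum>i<Suc n. hausdorff_outer s (A i)) \<le> hausdorff_outer s (\<Union>i<n. A i) + hausdorff_outer s (A n)"
    using Suc by (auto intro!: add_mono)
  also have "\<dots> \<le> hausdorff_outer s ((\<Union>i<n. A i) \<union> A n)"
    by (rule hausdorff_outer_separated[of _ _ "d n"]) (use Suc.prems in auto)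
  also have "(\<Union>i<n. A i) \<union> A n = (\<Union>i<Suc n. A i)" by (auto simp: less_Suc_eq)
  finally show ?case .
qed simp

text \<open>Caratheodory's criterion for metric outer measures: the annuli around a closed set are, when
  taken alternatingly, at positive distance from each other.\<close>

lemma hausdorff_outer_closed:
  fixes F X :: "'a::euclidean_space set"
  assumes F: "closed F" "F \<noteq> {}"
  shows "hausdorff_outer s (X \<inter> F) + hausdorff_outer s (X - F) \<le> hausdorff_outer s X"
proof (cases "hausdorff_outer s X = \<infinity>")
  case False
  let ?h = "hausdorff_outer s"
  define r where "r n = inverse (real (Suc n))" for n
  define Y where "Y n = {x \<in> X. infdist x F \<ge> r n}" for n
  define Z where "Z n = {x \<in> X. r (Suc n) \<le> infdist x F \<and> infdist x F < r n}" for n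
  have rpos: "r n > 0" for n by (simp add: r_def)
  have rdec: "m \<le> n \<Longrightarrow> r n \<le> r m" for m n by (simp add: r_def)
  have rdec': "m < n \<Longrightarrow> r n < r m" for m n by (simp add: r_def)
  have far: "dist x y \<ge> infdist x F - infdist y F" for x y
    using infdist_triangle[of x F y] by linarith
  have sumZ: "(\<Sum>i<n. ?h (Z (2 * i + k))) \<le> ?h X" for n k
  proof -
    have "(\<Sum>i<n. ?h (Z (2 * i + k))) \<le> ?h (\<Union>i<n. Z (2 * i + k))"
    \<comment> \<open>The skipped annulus just before the current one provides the gap. The value 1
      at j = 0 is a placeholder, since no set comes earlier.\<close>
    proof (rule hausdorff_outer_separated_sum[where d="\<lambda>j. if j = 0 then 1 else r (2 * j + k - 1) - r (2 * j + k)"])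
      show "0 < (if j = 0 then 1 else r (2 * j + k - 1) - r (2 * j + k))" for j
        using rdec'[of "2 * j + k - 1" "2 * j + k"] by auto
      fix i j x y assume ij: "i < j" and x: "x \<in> Z (2 * i + k)" and y: "y \<in> Z (2 * j + k)"
      have "r (2 * j + k - 1) \<le> r (Suc (2 * i + k))" using ij by (intro rdec) auto
      then show "(if j = 0 then 1 else r (2 * j + k - 1) - r (2 * j + k)) \<le> dist x y"
        using far[of x y] x y ij by (auto simp: Z_def)
    qed
    also have "\<dots> \<le> ?h X" by (intro hausdorff_outer_mono) (auto simp: Z_def)
    finally show ?thesis .
  qed
  have part: "(\<Sum>i<2 * n. ?h (Z i)) = (\<Sum>i<n. ?h (Z (2 * i + 0))) + (\<Sum>i<n. ?h (Z (2 * i + 1)))" for n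
    by (induction n) (simp_all add: ac_simps)
  \<comment> \<open>Even and odd indices each contribute at most the measure of X. The series
    therefore converges, and its tails, which bound the part of X close to F but outside it, tend to
    0.\<close>
  have Zsum: "(\<Sum>i. ?h (Z i)) \<le> ?h X + ?h X"
  proof (rule suminf_le_const)
    fix n
    have "(\<Sum>i<n. ?h (Z i)) \<le> (\<Sum>i<2 * n. ?h (Z i))" by (intro sum_mono2) auto
    also have "\<dots> \<le> ?h X + ?h X" unfolding part by (intro add_mono sumZ)
    finally show "(\<Sum>i<n. ?h (Z i)) \<le> ?h X + ?h X" .
  qed auto
  have Ztop: "?h (Z i) < \<infinity>" for i
  proof -
    have "?h (Z i) \<le> ?h X" by (intro hausdorff_outer_mono) (auto simp: Z_def)
    then show ?thesis using False by (auto simp: less_top[symmetric] top_unique)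
  qed
  define f where "f i = enn2real (?h (Z i))" for i
  have f: "ennreal (f i) = ?h (Z i)" "f i \<ge> 0" for i using Ztop[of i] by (auto simp: f_def)
  have "?h X + ?h X < \<infinity>" using False by (auto simp: less_top)
  then have "(\<Sum>i. ennreal (f i)) \<noteq> top" unfolding f using Zsum by (auto simp: top_unique)
  then have sf: "summable f" using f(2) by (intro summable_suminf_not_top) auto
  have cov: "X - F \<subseteq> Y n \<union> (\<Union>i. Z (i + n))" for n
  proof
    fix x assume x: "x \<in> X - F"
    then have p: "infdist x F > 0" using F by (simp add: infdist_pos_not_in_closed)
    show "x \<in> Y n \<union> (\<Union>i. Z (i + n))"
    proof (cases "infdist x F \<ge> r n")
      case True then show ?thesis using x by (simp add: Y_def)
    next
      case False
      obtain m where m: "r m < infdist x F" using reals_Archimedean[OF p] by (auto simp: r_def)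
      \<comment> \<open>The annulus containing x: the first index whose inner radius is at most the
        distance of x from F.\<close>
      define j where "j = (LEAST j. r (Suc j) \<le> infdist x F)"
      have ex: "r (Suc m) \<le> infdist x F" using m rdec[of m "Suc m"] by simp
      have j: "r (Suc j) \<le> infdist x F" unfolding j_def using ex by (rule LeastI)
      have jn: "j \<ge> n"
      proof (rule ccontr)
        assume "\<not> j \<ge> n"
        then have "r n \<le> r (Suc j)" by (intro rdec) simp
        then show False using j False by simp
      qed
      have "infdist x F < r j"
      proof (cases j)
        case 0 then show ?thesis using jn False by simp
      next
        case (Suc i)
        then have "\<not> r (Suc i) \<le> infdist x F" using not_less_Least[of i "\<lambda>j. r (Suc j) \<le> infdist x F"] by (simp add: j_def)
        then show ?thesis using Suc by simp
      qed
      then have "x \<in> Z ((j - n) + n)" using j jn x by (simp add: Z_def)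
      then show ?thesis by blast
    qed
  qed
  show ?thesis
  proof (rule ennreal_le_epsilon)
    fix e :: real assume e: "e > 0"
    from suminf_exist_split[OF e sf] obtain n where n: "norm (\<Sum>i. f (i + n)) < e" by auto
    have "(\<Sum>i. ?h (Z (i + n))) = ennreal (\<Sum>i. f (i + n))"
      unfolding f(1)[symmetric] using sf f(2) by (intro suminf_ennreal2) (auto simp: summable_iff_shift)
    also have "\<dots> \<le> ennreal e" using n by (intro ennreal_leI) auto
    finally have tail: "(\<Sum>i. ?h (Z (i + n))) \<le> ennreal e" .
    have "?h (X - F) \<le> ?h (Y n \<union> (\<Union>i. Z (i + n)))" by (rule hausdorff_outer_mono[OF cov])
    also have "\<dots> \<le> ?h (Y n) + ?h (\<Union>i. Z (i + n))" by (rule hausdorff_outer_Un)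
    also have "\<dots> \<le> ?h (Y n) + ennreal e"
      by (intro add_left_mono order_trans[OF hausdorff_outer_subadditive tail])
    finally have "?h (X \<inter> F) + ?h (X - F) \<le> (?h (X \<inter> F) + ?h (Y n)) + ennreal e"
      by (simp add: add_left_mono add.assoc)
    also have "?h (X \<inter> F) + ?h (Y n) \<le> ?h ((X \<inter> F) \<union> Y n)"
    proof (rule hausdorff_outer_separated[OF _ rpos[of n]])
      fix x y assume "x \<in> X \<inter> F" "y \<in> Y n"
      then show "r n \<le> dist x y" using infdist_le[of x F y] by (auto simp: Y_def dist_commute)
    qed
    also have "\<dots> \<le> ?h X" by (intro hausdorff_outer_mono) (auto simp: Y_def)
    finally show "?h (X \<inter> F) + ?h (X - F) \<le> ?h X + ennreal e" by (simp add: add_right_mono)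
  qed
qed simp

text \<open>The Caratheodory measurable sets form a \<sigma>-algebra on which the outer measure is
  countably additive; it contains the closed sets by \<open>hausdorff_outer_closed\<close>, hence
  the Borel sets. Without additivity \<open>measure_of\<close> would return the zero
  measure.\<close>

lemma emeasure_hausdorff:
  fixes A :: "'a::euclidean_space set"
  assumes A: "A \<in> sets borel"
  shows "emeasure (hausdorff_measure s) A = hausdorff_outer s A"
proof -
  let ?h = "hausdorff_outer s :: 'a set \<Rightarrow> ennreal"
  interpret P: sigma_algebra UNIV "Pow UNIV :: 'a set set" by (rule sigma_algebra_Pow)
  have "outer_measure_space (Pow UNIV) ?h"
    by (auto simp: outer_measure_space_def positive_def increasing_def countably_subadditive_def
        hausdorff_outer_empty hausdorff_outer_mono hausdorff_outer_subadditive)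
  from P.caratheodory_lemma[OF this] have ms: "measure_space UNIV (lambda_system UNIV (Pow UNIV) ?h) ?h" .
  let ?L = "lambda_system UNIV (Pow UNIV) ?h"
  have sa: "sigma_algebra UNIV ?L" using ms by (simp add: measure_space_def)
  have "F \<in> ?L" if F: "closed F" for F
  proof (cases "F = {}")
    case True
    then show ?thesis using sigma_algebra.sigma_sets_subset[OF sa, of "{}"] sigma_sets.Empty[of UNIV "{}"] by blast
  next
    case False
    have "?h (X \<inter> F) + ?h (X - F) = ?h X" for X
    proof (rule antisym[OF hausdorff_outer_closed[OF F False]])
      have "?h X = ?h ((X \<inter> F) \<union> (X - F))" by (simp add: Int_Diff_Un)
      also have "\<dots> \<le> ?h (X \<inter> F) + ?h (X - F)" by (rule hausdorff_outer_Un)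
      finally show "?h X \<le> ?h (X \<inter> F) + ?h (X - F)" .
    qed
    then show ?thesis unfolding P.lambda_system_eq by blast
  qed
  then have "sigma_sets UNIV (Collect closed) \<subseteq> ?L"
    by (intro sigma_algebra.sigma_sets_subset[OF sa]) auto
  then have bL: "sets (borel :: 'a measure) \<subseteq> ?L" by (simp add: borel_eq_closed)
  have ca: "countably_additive (sets borel) ?h"
    using ms bL unfolding measure_space_def countably_additive_def by (meson order_trans subsetD)
  show ?thesis unfolding hausdorff_measure_def
    by (rule emeasure_measure_of_sigma[OF _ _ ca A])
      (use sets.sigma_algebra_axioms[of "borel :: 'a measure"] in \<open>auto simp: positive_def hausdorff_outer_empty\<close>)
qed

section \<open>Surface measure and the cone measure\<close>

lemma ennreal_mult_le_swap:
  assumes k: "k > 0" and le: "ennreal (1 / k) * x \<le> y"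
  shows "x \<le> ennreal k * y"
proof -
  have "x = ennreal k * (ennreal (1 / k) * x)" using k by (simp flip: mult.assoc ennreal_mult)
  also have "\<dots> \<le> ennreal k * y" by (intro mult_left_mono le) simp
  finally show ?thesis .
qed

lemma ennreal_mult_le_swap':
  assumes k: "k > 0" and le: "x \<le> ennreal k * y"
  shows "ennreal (1 / k) * x \<le> y"
proof -
  have "ennreal (1 / k) * x \<le> ennreal (1 / k) * (ennreal k * y)" by (intro mult_left_mono le) simp
  also have "\<dots> = y" using k by (simp flip: mult.assoc ennreal_mult)
  finally show ?thesis .
qed

context convex_body
begin

declare of_nat_diff [simp del]

text \<open>The volume of \<Omega> carried to the boundary along rays; the centre stays in place and
  has no mass.\<close>

definition cmeas :: "'a measure" where
  "cmeas = distr (restrict_space lborel \<Omega>) borel proj"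

lemma sets_cmeas [simp, measurable_cong]: "sets cmeas = sets borel"
  by (simp add: cmeas_def)

lemma proj_measurable_on: "proj \<in> measurable (restrict_space lborel \<Omega>) borel"
  by (rule measurable_restrict_space1) simp

lemma emeasure_cmeas: "A \<in> sets borel \<Longrightarrow> emeasure cmeas A = emeasure lborel (proj -` A \<inter> \<Omega>)"
  unfolding cmeas_def using op
  by (subst emeasure_distr[OF proj_measurable_on]) (auto simp: emeasure_restrict_space space_restrict_space)

lemma nn_integral_cmeas:
  "f \<in> borel_measurable borel \<Longrightarrow> (\<integral>\<^sup>+x. f x \<partial>cmeas) = (\<integral>\<^sup>+x. f (proj x) * indicator \<Omega> x \<partial>lborel)"
  unfolding cmeas_def using op
  by (subst nn_integral_distr[OF proj_measurable_on]) (auto simp: nn_integral_restrict_space)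

lemma cmeas_finite: "emeasure cmeas (space cmeas) \<noteq> \<infinity>"
proof -
  have "space cmeas = UNIV" by (simp add: cmeas_def)
  then have "emeasure cmeas (space cmeas) = emeasure lborel \<Omega>" by (simp add: emeasure_cmeas)
  then show ?thesis using emeasure_bounded_finite[OF bdd] by simp
qed

lemma norm_level:
  assumes "\<rho> y = 1"
  shows "r \<le> norm (y - a)" "norm (y - a) \<le> R"
  using \<rho>_upper[of y] \<rho>_lower[of y] assms by auto

section \<open>Upper bound for the cone measure\<close>

definition tube_const :: real where
  "tube_const = 3 * unit_ball_vol DIM('a) * (1 + R) ^ DIM('a)"

lemma tube_const_pos: "tube_const > 0"
  unfolding tube_const_def using R0 by (intro mult_pos_pos zero_less_power unit_ball_vol_pos) auto

lemma dim_power: "(x::real) ^ DIM('a) = x * x ^ (DIM('a) - 1)"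
  by (rule power_eq_if[THEN trans]) simp

text \<open>The tube around the segment from a to y is covered by balls of radius (1 + R) D centred
  at parameter steps of D: one D for the width of the tube, R D for the step, as the segment has
  length at most R. At most 3/D such balls are used, each with volume of order D^d, which explains
  \<open>tube_const\<close>.\<close>

lemma tube_cover:
  assumes y: "\<rho> y = 1" and D: "0 < D" "D \<le> 1"
  shows "\<exists>B\<in>sets borel. (\<forall>x s. 0 \<le> s \<and> s \<le> 1 \<and> dist x (a + s *\<^sub>R (y - a)) \<le> D \<longrightarrow> x \<in> B) \<and>
    emeasure lborel B \<le> ennreal (tube_const * D ^ (DIM('a) - 1))"
proof -
  define N where "N = nat \<lceil>1 / D\<rceil>"
  define c where "c j = a + (real j * D) *\<^sub>R (y - a)" for j :: nat
  define B where "B = (\<Union>j\<in>{..N}. cball (c j) ((1 + R) * D))"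
  have RD: "(1 + R) * D \<ge> 0" using R0 D by simp
  have "x \<in> B" if s: "0 \<le> s" "s \<le> 1" and x: "dist x (a + s *\<^sub>R (y - a)) \<le> D" for x s
  proof -
    define j where "j = nat \<lfloor>s / D\<rfloor>"
    have j: "real j = of_int \<lfloor>s / D\<rfloor>" using s D by (simp add: j_def)
    have "s / D \<le> 1 / D" using s D by (simp add: divide_right_mono)
    then have "\<lfloor>s / D\<rfloor> \<le> \<lceil>1 / D\<rceil>" by linarith
    then have jN: "j \<le> N" unfolding j_def N_def by (rule nat_mono)
    have "\<bar>s / D - real j\<bar> \<le> 1" unfolding j by linarith
    then have "\<bar>s / D - real j\<bar> * D \<le> 1 * D" using D by (intro mult_right_mono) auto
    moreover have "\<bar>s / D - real j\<bar> * D = \<bar>(s / D - real j) * D\<bar>" using D by (simp add: abs_mult)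
    moreover have "(s / D - real j) * D = s - real j * D" using D by (simp add: left_diff_distrib)
    ultimately have sj: "\<bar>s - real j * D\<bar> \<le> D" by simp
    have "dist (a + s *\<^sub>R (y - a)) (c j) = \<bar>s - real j * D\<bar> * norm (y - a)"
      by (simp add: c_def dist_norm flip: scaleR_diff_left)
    also have "\<dots> \<le> D * R" using sj norm_level(2)[OF y] by (intro mult_mono) auto
    finally have "dist x (c j) \<le> (1 + R) * D"
      using x dist_triangle[of x "c j" "a + s *\<^sub>R (y - a)"] by (simp add: algebra_simps)
    then show ?thesis using jN by (auto simp: B_def dist_commute)
  qed
  moreover have "B \<in> sets borel" unfolding B_def by (intro sets.finite_UN) auto
  moreover have "emeasure lborel B \<le> ennreal (tube_const * D ^ (DIM('a) - 1))"
  proof -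
    have "emeasure lborel B \<le> (\<Sum>j\<in>{..N}. emeasure lborel (cball (c j) ((1 + R) * D)))"
      unfolding B_def by (rule emeasure_subadditive_finite) auto
    also have "\<dots> = (\<Sum>j\<in>{..N}. ennreal (unit_ball_vol DIM('a) * ((1 + R) * D) ^ DIM('a)))"
      using RD by (intro sum.cong refl emeasure_cball)
    also have "\<dots> = ennreal ((real N + 1) * (unit_ball_vol DIM('a) * ((1 + R) * D) ^ DIM('a)))"
      using RD by (subst sum_ennreal) (auto simp: algebra_simps)
    also have "\<dots> \<le> ennreal (tube_const * D ^ (DIM('a) - 1))"
    proof (rule ennreal_leI)
      have "real N = of_int \<lceil>1 / D\<rceil>" using D by (simp add: N_def)
      then have "real N \<le> 1 / D + 1" by linarith
      moreover have "1 \<le> 1 / D" using D by simp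
      ultimately have "real N + 1 \<le> 3 / D" by simp
      then have "(real N + 1) * (unit_ball_vol DIM('a) * ((1 + R) * D) ^ DIM('a)) \<le> (3 / D) * (unit_ball_vol DIM('a) * ((1 + R) * D) ^ DIM('a))"
        using RD by (intro mult_right_mono) auto
      also have "\<dots> = tube_const * D ^ (DIM('a) - 1)"
        using D by (simp add: tube_const_def power_mult_distrib dim_power[of D])
      finally show "(real N + 1) * (unit_ball_vol DIM('a) * ((1 + R) * D) ^ DIM('a)) \<le> tube_const * D ^ (DIM('a) - 1)" .
    qed
    finally show ?thesis .
  qed
  ultimately show ?thesis by blast
qed

text \<open>Converts the tube bound, taken at the diameter of a set, into the summand of that set in
  the Hausdorff sum.\<close>

definition upper_const :: real where
  "upper_const = tube_const * 2 ^ (DIM('a) - 1) / unit_ball_vol (real (DIM('a) - 1))"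

lemma upper_const_pos: "upper_const > 0"
  unfolding upper_const_def by (intro divide_pos_pos mult_pos_pos zero_less_power unit_ball_vol_pos tube_const_pos) auto

text \<open>A point of \<Omega> whose projection lies in C is within the diameter of C of the
  segment to any fixed boundary point y of C, because scaling towards a by \<rho> < 1 shrinks
  distances.\<close>

lemma cone_cover:
  assumes C: "bounded C" "diameter C \<le> 1/2"
  shows "\<exists>B\<in>sets borel. (\<forall>x\<in>\<Omega>. x \<noteq> a \<and> proj x \<in> C \<longrightarrow> x \<in> B) \<and>
    emeasure lborel B \<le> ennreal upper_const * hterm (DIM('a) - 1) C"
proof (cases "\<exists>y\<in>C. \<rho> y = 1")
  case False
  then have "\<forall>x\<in>\<Omega>. x \<noteq> a \<and> proj x \<in> C \<longrightarrow> x \<in> {}" using \<rho>_proj by blast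
  then show ?thesis by (intro bexI[of _ "{}"]) auto
next
  case True
  then obtain y where y: "y \<in> C" "\<rho> y = 1" by blast
  \<comment> \<open>The tube estimate needs a positive width, but the diameter may be 0. Widths
    decreasing to the diameter are used, and the intersection of the tubes inherits the limiting
    bound.\<close>
  define D where "D n = diameter C + inverse (real (Suc (Suc n)))" for n
  have d0: "diameter C \<ge> 0" using C(1) by (rule diameter_ge_0)
  have D: "0 < D n" "D n \<le> 1" for n
  proof -
    show "0 < D n" using d0 by (simp add: D_def add_nonneg_pos)
    have "inverse (real (Suc (Suc n))) \<le> 1/2" by (simp add: field_simps)
    then show "D n \<le> 1" using C(2) unfolding D_def by linarith
  qed
  from tube_cover[OF y(2) D] obtain B where B: "\<And>n. B n \<in> sets borel"
    "\<And>n x s. 0 \<le> s \<and> s \<le> 1 \<and> dist x (a + s *\<^sub>R (y - a)) \<le> D n \<Longrightarrow> x \<in> B n"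
    "\<And>n. emeasure lborel (B n) \<le> ennreal (tube_const * D n ^ (DIM('a) - 1))"
    by metis
  have "x \<in> (\<Inter>n. B n)" if x: "x \<in> \<Omega>" "x \<noteq> a" "proj x \<in> C" for x
  proof (rule INT_I)
    fix n
    have rx: "0 < \<rho> x" "\<rho> x < 1" using \<rho>_pos[OF x(2)] x(1) in_\<Omega>_iff by auto
    have xe: "x = a + \<rho> x *\<^sub>R (proj x - a)" using rx by (simp add: proj_def)
    have "dist x (a + \<rho> x *\<^sub>R (y - a)) = norm ((a + \<rho> x *\<^sub>R (proj x - a)) - (a + \<rho> x *\<^sub>R (y - a)))"
      unfolding dist_norm using xe by simp
    also have "\<dots> = \<rho> x * dist (proj x) y"
      using rx by (simp add: dist_norm flip: scaleR_diff_right)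
    also have "\<dots> \<le> 1 * diameter C"
      using rx diameter_bounded_bound[OF C(1) x(3) y(1)] by (intro mult_mono) auto
    also have "\<dots> \<le> D n" by (simp add: D_def)
    finally show "x \<in> B n" using rx by (intro B(2)[of "\<rho> x"]) auto
  qed
  moreover have Bm: "(\<Inter>n. B n) \<in> sets borel" using B(1) by blast
  moreover have "emeasure lborel (\<Inter>n. B n) \<le> ennreal upper_const * hterm (DIM('a) - 1) C"
  proof -
    have "(\<lambda>n. inverse (real (Suc (Suc n)))) \<longlonglongrightarrow> 0" using LIMSEQ_Suc[OF LIMSEQ_inverse_real_of_nat] by simp
    then have "D \<longlonglongrightarrow> diameter C + 0" unfolding D_def by (intro tendsto_intros)
    then have "(\<lambda>n. ennreal (tube_const * D n ^ (DIM('a) - 1))) \<longlonglongrightarrow> ennreal (tube_const * (diameter C + 0) ^ (DIM('a) - 1))"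
      by (intro tendsto_ennrealI tendsto_intros)
    moreover have "emeasure lborel (\<Inter>n. B n) \<le> ennreal (tube_const * D n ^ (DIM('a) - 1))" for n
      by (rule order_trans[OF emeasure_mono[of _ "B n"] B(3)]) (use B(1) in auto)
    ultimately have "emeasure lborel (\<Inter>n. B n) \<le> ennreal (tube_const * (diameter C + 0) ^ (DIM('a) - 1))"
      by (intro LIMSEQ_le_const) auto
    also have "\<dots> = ennreal (upper_const * (unit_ball_vol (real (DIM('a) - 1)) * (diameter C / 2) ^ (DIM('a) - 1)))"
    proof -
      have "unit_ball_vol (real (DIM('a) - 1)) \<noteq> 0" using unit_ball_vol_pos[of "real (DIM('a) - 1)"] by linarith
      then show ?thesis unfolding upper_const_def power_divide by simp
    qed
    also have "\<dots> = ennreal upper_const * hterm (DIM('a) - 1) C"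
      proof -
      have "C \<noteq> {}" using y(1) by blast
      then show ?thesis using upper_const_pos d0 unfolding hterm_def by (subst ennreal_mult) auto
    qed
    finally show ?thesis .
  qed
  ultimately show ?thesis by blast
qed

lemma cmeas_le_hausdorff:
  assumes A: "A \<in> sets borel"
  shows "emeasure cmeas A \<le> ennreal upper_const * hausdorff_outer (DIM('a) - 1) A"
proof -
  have "ennreal (1 / upper_const) * emeasure cmeas A \<le> hausdorff_pre (DIM('a) - 1) (1/2) A"
    unfolding hausdorff_pre_eq
  proof (rule INF_greatest, rule ennreal_mult_le_swap'[OF upper_const_pos])
    fix C assume C: "C \<in> hcovers (1/2) A"
    then have "\<exists>B\<in>sets borel. (\<forall>x\<in>\<Omega>. x \<noteq> a \<and> proj x \<in> C i \<longrightarrow> x \<in> B) \<and>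
       emeasure lborel B \<le> ennreal upper_const * hterm (DIM('a) - 1) (C i)" for i
      by (intro cone_cover) (auto simp: hcovers_def)
    then obtain B where B: "\<And>i. B i \<in> sets borel" "\<And>i x. x \<in> \<Omega> \<Longrightarrow> x \<noteq> a \<Longrightarrow> proj x \<in> C i \<Longrightarrow> x \<in> B i"
      "\<And>i. emeasure lborel (B i) \<le> ennreal upper_const * hterm (DIM('a) - 1) (C i)" by metis
    have Bs: "(\<Union>i. B i) \<in> sets lborel" using B(1) by auto
    have sub: "proj -` A \<inter> \<Omega> \<subseteq> {a} \<union> (\<Union>i. B i)"
    proof
      fix x assume x: "x \<in> proj -` A \<inter> \<Omega>"
      then obtain i where "proj x \<in> C i" using C by (auto simp: hcovers_def)
      then show "x \<in> {a} \<union> (\<Union>i. B i)" using B(2)[of x i] x by auto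
    qed
    have "emeasure cmeas A = emeasure lborel (proj -` A \<inter> \<Omega>)" by (rule emeasure_cmeas[OF A])
    also have "\<dots> \<le> emeasure lborel ({a} \<union> (\<Union>i. B i))" using sub Bs by (intro emeasure_mono) auto
    also have "\<dots> \<le> emeasure lborel {a} + emeasure lborel (\<Union>i. B i)" using Bs by (intro emeasure_subadditive) auto
    also have "\<dots> \<le> (\<Sum>i. emeasure lborel (B i))" using B(1) by (simp, intro emeasure_subadditive_countably) auto
    also have "\<dots> \<le> (\<Sum>i. ennreal upper_const * hterm (DIM('a) - 1) (C i))" by (intro suminf_le B(3)) auto
    also have "\<dots> = ennreal upper_const * (\<Sum>i. hterm (DIM('a) - 1) (C i))" by simp
    finally show "emeasure cmeas A \<le> ennreal upper_const * (\<Sum>i. hterm (DIM('a) - 1) (C i))" .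
  qed
  also have "\<dots> \<le> hausdorff_outer (DIM('a) - 1) A" by (rule hausdorff_pre_le_outer) simp
  finally show ?thesis by (rule ennreal_mult_le_swap[OF upper_const_pos])
qed

text \<open>The cone over a boundary ball of radius \<open>\<epsilon>\<close> contains about \<open>1 / \<epsilon>\<close> disjoint balls of radius
  comparable to \<open>\<epsilon>\<close>.\<close>

lemma cone_over_ball:
  "\<exists>c>0. \<exists>e0>0. \<forall>y e. \<rho> y = 1 \<and> 0 < e \<and> e \<le> e0 \<longrightarrow> ennreal (c * e ^ (DIM('a) - 1)) \<le> emeasure cmeas (ball y e)"
proof -
  \<comment> \<open>Chosen so that the balls of radius k e used below project to within 2 k e (1 +
    R/r) = e/2 of y.\<close>
  define k where "k = 1 / (4 * (1 + R / r))"
  have k: "k > 0" using r0 R0 by (simp add: k_def add_pos_pos)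
  have k4: "4 * k * (1 + R / r) = 1" 
  proof -
    have "1 + R / r > 0" using r0 R0 by (simp add: add_pos_pos)
    then show ?thesis by (simp add: k_def)
  qed
  define e0 where "e0 = r / (16 * k)"
  define c where "c = r / (16 * k) * (unit_ball_vol DIM('a) * k ^ DIM('a))"
  have e0: "e0 > 0" using r0 k by (simp add: e0_def)
  have c: "c > 0" using r0 k unit_ball_vol_pos[of "real DIM('a)"] by (simp add: c_def)
  have "ennreal (c * e ^ (DIM('a) - 1)) \<le> emeasure cmeas (ball y e)" if y: "\<rho> y = 1" and e: "0 < e" "e \<le> e0" for y e
  proof -
    have ke: "0 < k * e" "k * e \<le> r / 16" using k e by (auto simp: e0_def field_simps)
    \<comment> \<open>As many balls as fit between the parameters 1/2 and 3/4 at spacing 2 k e / r.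
      The bound \<open>e0\<close> makes the quotient at least 2, so that rounding loses at most half
      of it.\<close>
    define N where "N = nat \<lfloor>r / (8 * (k * e))\<rfloor>"
    have Nr: "real N = of_int \<lfloor>r / (8 * (k * e))\<rfloor>" using r0 ke by (simp add: N_def)
    have big: "2 \<le> r / (8 * (k * e))" using ke by (simp add: field_simps)
    have N1: "real N \<le> r / (8 * (k * e))" unfolding Nr by linarith
    have "r / (8 * (k * e)) = 2 * (r / (16 * (k * e)))" by simp
    then have N2: "r / (16 * (k * e)) \<le> real N" unfolding Nr using big by linarith
    define t where "t j = 1/2 + 2 * (k * e) / r * real j" for j :: nat
    define z where "z j = a + t j *\<^sub>R (y - a)" for j
    have t: "1/2 \<le> t j" "j < N \<Longrightarrow> t j \<le> 3/4" for j
    proof -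
      show "1/2 \<le> t j" using ke r0 by (simp add: t_def)
      assume "j < N"
      then have "2 * (k * e) / r * real j \<le> 2 * (k * e) / r * (r / (8 * (k * e)))"
        using N1 ke r0 by (intro mult_left_mono) auto
      also have "\<dots> = 1/4" using k e r0 by (simp add: field_simps)
      finally show "t j \<le> 3/4" by (simp add: t_def)
    qed
    have disj: "disjoint_family_on (\<lambda>j. ball (z j) (k * e)) {..<N}"
      unfolding disjoint_family_on_def
    proof (intro ballI impI)
      fix i j :: nat assume ij: "i \<noteq> j"
      have "z i - z j = (t i - t j) *\<^sub>R (y - a)" by (simp add: z_def algebra_simps)
      then have "dist (z i) (z j) = \<bar>t i - t j\<bar> * norm (y - a)" by (simp add: dist_norm)
      also have "t i - t j = 2 * (k * e) / r * (real i - real j)" by (simp add: t_def right_diff_distrib)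
      also have "\<bar>2 * (k * e) / r * (real i - real j)\<bar> = 2 * (k * e) / r * \<bar>real i - real j\<bar>"
        unfolding abs_mult using ke r0 by simp
      finally have "dist (z i) (z j) = 2 * (k * e) / r * \<bar>real i - real j\<bar> * norm (y - a)" .
      moreover have "2 * (k * e) / r * 1 * r \<le> 2 * (k * e) / r * \<bar>real i - real j\<bar> * norm (y - a)"
      proof (intro mult_mono[OF mult_left_mono])
        show "1 \<le> \<bar>real i - real j\<bar>" using ij by linarith
      qed (use ke r0 norm_level(1)[OF y] in auto)
      ultimately have "dist (z i) (z j) \<ge> 2 * (k * e)" using r0 by simp
      then show "ball (z i) (k * e) \<inter> ball (z j) (k * e) = {}" by (intro disjoint_ballI) linarith
    qed
    have inn: "ball (z j) (k * e) \<subseteq> proj -` ball y e \<inter> \<Omega>" if j: "j < N" for j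
    proof
      fix x assume "x \<in> ball (z j) (k * e)"
      then have xd: "norm (x - z j) \<le> k * e" by (simp add: dist_norm norm_minus_commute)
      have tj: "1/2 \<le> t j" "t j \<le> 3/4" using t[of j] j by auto
      have rz: "\<rho> (z j) = t j" unfolding z_def using \<rho>_scale[of "t j" y] y tj by simp
      have rd: "\<bar>\<rho> x - t j\<bar> \<le> k * e / r"
      proof -
        have "\<bar>\<rho> x - \<rho> (z j)\<bar> \<le> norm (x - z j) / r" by (rule \<rho>_lipschitz)
        also have "\<dots> \<le> k * e / r" using xd r0 by (simp add: divide_right_mono)
        finally show ?thesis by (simp add: rz)
      qed
      have "k * e / r \<le> 1/16" using ke r0 by (simp add: field_simps)
      then have rx: "1/4 < \<rho> x" "\<rho> x < 1" using rd tj by linarith+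
      have "proj x - y = (1 / t j) *\<^sub>R (x - z j) + (1 / \<rho> x - 1 / t j) *\<^sub>R (x - a)"
      proof -
        have "(1 / t j) *\<^sub>R (x - z j) = (1 / t j) *\<^sub>R (x - a) - (y - a)"
          using tj by (simp add: z_def scaleR_diff_right scaleR_add_right)
        then show ?thesis by (simp add: proj_def scaleR_diff_left)
      qed
      then have "norm (proj x - y) \<le> norm ((1 / t j) *\<^sub>R (x - z j)) + norm ((1 / \<rho> x - 1 / t j) *\<^sub>R (x - a))"
        by (simp only: norm_triangle_ineq)
      then have "norm (proj x - y) \<le> \<bar>1 / t j\<bar> * norm (x - z j) + \<bar>1 / \<rho> x - 1 / t j\<bar> * norm (x - a)"
        by (simp only: norm_scaleR)
      also have "\<dots> \<le> 2 * (k * e) + 2 * (k * e / r) * R"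
      proof (rule add_mono)
        show "\<bar>1 / t j\<bar> * norm (x - z j) \<le> 2 * (k * e)"
          using tj xd ke by (intro mult_mono) (auto simp: field_simps)
        have "1 / \<rho> x - 1 / t j = (t j - \<rho> x) / (t j * \<rho> x)" using tj rx by (simp add: field_simps)
        then have "\<bar>1 / \<rho> x - 1 / t j\<bar> * norm (x - a) = \<bar>\<rho> x - t j\<bar> / (t j * \<rho> x) * norm (x - a)"
          using tj rx by (simp add: abs_divide abs_mult abs_minus_commute)
        also have "\<dots> \<le> \<bar>\<rho> x - t j\<bar> / (t j * \<rho> x) * (R * \<rho> x)"
          using tj rx by (intro mult_left_mono \<rho>_lower) auto
        also have "\<dots> = \<bar>\<rho> x - t j\<bar> * (1 / t j) * R" using tj rx by simp
        also have "\<dots> \<le> (k * e / r) * 2 * R"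
        proof (intro mult_right_mono mult_mono rd)
          show "1 / t j \<le> 2" using tj by (simp add: field_simps)
        qed (use tj R0 ke r0 in auto)
        also have "\<dots> = 2 * (k * e / r) * R" by simp
        finally show "\<bar>1 / \<rho> x - 1 / t j\<bar> * norm (x - a) \<le> 2 * (k * e / r) * R" .
      qed
      also have "\<dots> = e * (4 * k * (1 + R / r)) / 2" using r0 by (simp add: field_simps)
      also have "\<dots> < e" unfolding k4 using e by simp
      finally have "proj x \<in> ball y e" by (simp add: dist_norm norm_minus_commute)
      then show "x \<in> proj -` ball y e \<inter> \<Omega>" using rx in_\<Omega>_iff by simp
    qed
    have "c * e ^ (DIM('a) - 1) = r / (16 * (k * e)) * (unit_ball_vol DIM('a) * (k * e) ^ DIM('a))"
      using e k by (simp add: c_def power_mult_distrib dim_power[of e])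
    also have "\<dots> \<le> real N * (unit_ball_vol DIM('a) * (k * e) ^ DIM('a))"
      using N2 ke by (intro mult_right_mono) auto
    finally have "ennreal (c * e ^ (DIM('a) - 1)) \<le> ennreal (real N * (unit_ball_vol DIM('a) * (k * e) ^ DIM('a)))"
      by (rule ennreal_leI)
    also have "\<dots> = (\<Sum>j\<in>{..<N}. ennreal (unit_ball_vol DIM('a) * (k * e) ^ DIM('a)))"
      using ke by (subst sum_ennreal) auto
    also have "\<dots> = (\<Sum>j\<in>{..<N}. emeasure lborel (ball (z j) (k * e)))"
      using ke by (intro sum.cong refl emeasure_ball[symmetric]) simp
    also have "\<dots> = emeasure lborel (\<Union>j\<in>{..<N}. ball (z j) (k * e))"
      by (rule sum_emeasure) (use disj in auto)
    also have "\<dots> \<le> emeasure lborel (proj -` ball y e \<inter> \<Omega>)"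
    proof (rule emeasure_mono)
      show "(\<Union>j\<in>{..<N}. ball (z j) (k * e)) \<subseteq> proj -` ball y e \<inter> \<Omega>" using inn by blast
      have "proj -` ball y e \<inter> space borel \<in> sets borel" by (rule measurable_sets[OF proj_measurable]) simp
      then show "proj -` ball y e \<inter> \<Omega> \<in> sets lborel" using op by auto
    qed
    also have "\<dots> = emeasure cmeas (ball y e)" by (rule emeasure_cmeas[symmetric]) simp
    finally show ?thesis .
  qed
  then show ?thesis using c e0 by blast
qed

text \<open>Outer regularity replaces A by an open U. A Vitali family of disjoint balls inside U,
  centred on A, has fivefold enlargements covering A. Each enlargement costs at most K times the
  cone measure of its original ball, and disjointness keeps the sum below K times the cone measure
  of U.\<close>

lemma hausdorff_le_cmeas:
  "\<exists>K>0. \<forall>A\<in>sets borel. A \<subseteq> frontier \<Omega> \<longrightarrow> hausdorff_outer (DIM('a) - 1) A \<le> ennreal K * emeasure cmeas A"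
proof -
  obtain c e0 where c: "c > 0" and e0: "e0 > 0"
    and low: "\<And>y e. \<rho> y = 1 \<Longrightarrow> 0 < e \<Longrightarrow> e \<le> e0 \<Longrightarrow> ennreal (c * e ^ (DIM('a) - 1)) \<le> emeasure cmeas (ball y e)"
    using cone_over_ball by blast
  let ?s = "DIM('a) - 1"
  \<comment> \<open>Ratio of the Hausdorff summand of a ball of radius 5 q to the lower bound c
    q^(d-1) for the cone measure of the ball of radius q.\<close>
  define K where "K = unit_ball_vol (real ?s) * 5 ^ ?s / c"
  have K: "K > 0" using c unit_ball_vol_pos[of "real ?s"] by (simp add: K_def)
  have "hausdorff_outer ?s A \<le> ennreal K * emeasure cmeas A" if A: "A \<in> sets borel" "A \<subseteq> frontier \<Omega>" for A
    unfolding hausdorff_outer_def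
  proof (rule SUP_least, rule ennreal_mult_le_swap[OF K])
    fix \<delta> :: real assume "\<delta> \<in> {0<..}"
    then have d: "\<delta> > 0" by simp
    have "emeasure cmeas A = (INF U \<in> {U. A \<subseteq> U \<and> open U}. emeasure cmeas U)"
      by (rule outer_regular[OF sets_cmeas cmeas_finite A(1)])
    moreover have "ennreal (1 / K) * hausdorff_pre ?s \<delta> A \<le> (INF U \<in> {U. A \<subseteq> U \<and> open U}. emeasure cmeas U)"
    proof (rule INF_greatest, rule ennreal_mult_le_swap'[OF K])
      fix U assume "U \<in> {U. A \<subseteq> U \<and> open U}"
      then have U: "A \<subseteq> U" "open U" by auto
      \<comment> \<open>The bound \<delta>/10 keeps the diameters of the fivefold enlarged balls at
        most \<delta>; \<open>e0\<close> is the range in which the lower bound for the cone measure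
        holds.\<close>
      have "\<forall>y\<in>A. \<exists>e. 0 < e \<and> e \<le> min e0 (\<delta> / 10) \<and> ball y e \<subseteq> U"
      proof
        fix y assume "y \<in> A"
        then obtain e where e: "e > 0" "ball y e \<subseteq> U" using U open_contains_ball by blast
        have "ball y (min e (min e0 (\<delta> / 10))) \<subseteq> U" using e(2) by (auto simp: subset_iff)
        then show "\<exists>e. 0 < e \<and> e \<le> min e0 (\<delta> / 10) \<and> ball y e \<subseteq> U"
          using e e0 d by (intro exI[of _ "min e (min e0 (\<delta> / 10))"]) auto
      qed
      then obtain q where q: "\<And>y. y \<in> A \<Longrightarrow> 0 < q y" "\<And>y. y \<in> A \<Longrightarrow> q y \<le> min e0 (\<delta> / 10)" "\<And>y. y \<in> A \<Longrightarrow> ball y (q y) \<subseteq> U"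
        by metis
      have cov: "A \<subseteq> (\<Union>y\<in>A. ball y (q y))" using q(1) by force
      have qb: "\<And>y. y \<in> A \<Longrightarrow> 0 < q y \<and> q y \<le> min e0 (\<delta> / 10)" using q by blast
      have "\<exists>C. countable C \<and> C \<subseteq> A \<and> pairwise (\<lambda>i j. disjnt (ball i (q i)) (ball j (q j))) C \<and> A \<subseteq> (\<Union>y\<in>C. ball y (5 * q y))"
        by (rule Vitali_covering_lemma_balls[OF cov qb]) (assumption | intro exI conjI)+
      then obtain C where C: "countable C" "C \<subseteq> A" "pairwise (\<lambda>i j. disjnt (ball i (q i)) (ball j (q j))) C" "A \<subseteq> (\<Union>y\<in>C. ball y (5 * q y))"
        by blast
      obtain f :: "'a \<Rightarrow> nat" where f: "inj_on f C" using C(1) by (auto simp: countable_def)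
      define D where "D n = (\<Union>y\<in>{y\<in>C. f y = n}. ball y (5 * q y))" for n
      define E where "E n = (\<Union>y\<in>{y\<in>C. f y = n}. ball y (q y))" for n
      have one: "(\<exists>y\<in>C. f y = n \<and> D n = ball y (5 * q y) \<and> E n = ball y (q y)) \<or> (D n = {} \<and> E n = {})" for n
      proof (cases "\<exists>y\<in>C. f y = n")
        case True
        then obtain y where y: "y \<in> C" "f y = n" by blast
        then have "{z\<in>C. f z = n} = {y}" using f by (auto simp: inj_on_def)
        then show ?thesis using y by (auto simp: D_def E_def)
      qed (auto simp: D_def E_def)
      have Dc: "D \<in> hcovers \<delta> A"
        unfolding hcovers_def
      proof (intro CollectI conjI allI)
        show "A \<subseteq> (\<Union>i. D i)" using C(4) by (fastforce simp: D_def)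
        fix n
        have "D n = {} \<or> (\<exists>y\<in>A. D n = ball y (5 * q y))" using one[of n] C(2) by blast
        moreover have "10 * q y \<le> \<delta>" if "y \<in> A" for y using q(2)[OF that] by simp
        ultimately show "bounded (D n)" "diameter (D n) \<le> \<delta>" using d q(1) by (fastforce simp: less_imp_le)+
      qed
      have En: "E n \<in> sets cmeas" for n using one[of n] by auto
      have term_le: "hterm ?s (D n) \<le> ennreal K * emeasure cmeas (E n)" for n
        using one[of n]
      proof
        assume "\<exists>y\<in>C. f y = n \<and> D n = ball y (5 * q y) \<and> E n = ball y (q y)"
        then obtain y where y: "y \<in> A" "D n = ball y (5 * q y)" "E n = ball y (q y)" using C(2) by blast
        have q0: "q y > 0" "q y \<le> e0" using q(1,2)[OF y(1)] by auto
        have "hterm ?s (D n) = ennreal (unit_ball_vol (real ?s) * (5 * q y) ^ ?s)"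
          using q0 by (simp add: hterm_def y(2))
        also have "unit_ball_vol (real ?s) * (5 * q y) ^ ?s = K * (c * q y ^ ?s)" using c by (simp add: K_def power_mult_distrib)
        also have "ennreal (K * (c * q y ^ ?s)) = ennreal K * ennreal (c * q y ^ ?s)" using K c q0 by (intro ennreal_mult) auto
        also have "\<dots> \<le> ennreal K * emeasure cmeas (ball y (q y))"
          using y(1) A(2) frontier_iff by (intro mult_left_mono low q0) auto
        finally show ?thesis by (simp add: y(3))
      qed (simp add: hterm_def)
      have dE: "disjoint_family E"
        unfolding disjoint_family_on_def
      proof (intro ballI impI)
        fix m n :: nat assume mn: "m \<noteq> n"
        show "E m \<inter> E n = {}"
        proof (rule ccontr)
          assume "E m \<inter> E n \<noteq> {}"
          then obtain x where "x \<in> E m" "x \<in> E n" by blast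
          then obtain y z where yz: "y \<in> C" "z \<in> C" "f y = m" "f z = n" "x \<in> ball y (q y)" "x \<in> ball z (q z)"
            unfolding E_def by blast
          have "y \<noteq> z" using yz(3,4) mn by metis
          from pairwiseD[OF C(3) yz(1,2) this] have "disjnt (ball y (q y)) (ball z (q z))" .
          then show False using yz(5,6) unfolding disjnt_iff by metis
        qed
      qed
      have "hausdorff_pre ?s \<delta> A \<le> (\<Sum>n. hterm ?s (D n))" unfolding hausdorff_pre_eq by (rule INF_lower[OF Dc])
      also have "\<dots> \<le> (\<Sum>n. ennreal K * emeasure cmeas (E n))" by (intro suminf_le term_le) auto
      also have "\<dots> = ennreal K * (\<Sum>n. emeasure cmeas (E n))" by simp
      also have "(\<Sum>n. emeasure cmeas (E n)) = emeasure cmeas (\<Union>n. E n)" by (rule suminf_emeasure) (use En dE in auto)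
      also have "\<dots> \<le> emeasure cmeas U"
      proof (rule emeasure_mono)
        show "(\<Union>n. E n) \<subseteq> U" using C(2) q(3) by (fastforce simp: E_def)
      qed (use U(2) in auto)
      finally show "hausdorff_pre ?s \<delta> A \<le> ennreal K * emeasure cmeas U" by (simp add: mult_left_mono)
    qed
    ultimately show "ennreal (1 / K) * hausdorff_pre ?s \<delta> A \<le> emeasure cmeas A" by simp
  qed
  then show ?thesis using K by blast
qed

section \<open>Comparison of surface measure and cone measure\<close>

lemma sets_hausdorff: "sets (hausdorff_measure s :: 'a measure) = sets borel"
  unfolding hausdorff_measure_def using sets.sigma_sets_eq[of "borel :: 'a measure"] by simp

lemma sets_surface: "sets (surface_measure \<Omega>) = sets (restrict_space borel (frontier \<Omega>))"
  unfolding surface_measure_def by (rule sets_restrict_space_cong[OF sets_hausdorff])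

lemma frontier_sets: "frontier \<Omega> \<in> sets borel"
  by (intro borel_closed frontier_closed)

lemma surface_measurable: "f \<in> borel_measurable borel \<Longrightarrow> f \<in> borel_measurable (surface_measure \<Omega>)"
  using measurable_restrict_space1[of f borel borel "frontier \<Omega>"] measurable_cong_sets[OF sets_surface refl] by blast

lemma emeasure_surface: "A \<in> sets borel \<Longrightarrow> A \<subseteq> frontier \<Omega> \<Longrightarrow> emeasure (surface_measure \<Omega>) A = hausdorff_outer (DIM('a) - 1) A"
proof -
  assume A: "A \<in> sets borel" "A \<subseteq> frontier \<Omega>"
  have sp: "space (hausdorff_measure (DIM('a) - 1) :: 'a measure) = UNIV"
    using sets_eq_imp_space_eq[OF sets_hausdorff] by simp
  have "emeasure (surface_measure \<Omega>) A = emeasure (hausdorff_measure (DIM('a) - 1)) A"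
    unfolding surface_measure_def using A frontier_sets
    by (intro emeasure_restrict_space) (simp_all add: sp sets_hausdorff)
  then show ?thesis using emeasure_hausdorff[OF A(1)] by simp
qed

text \<open>Setwise inequalities between measures on the boundary pass to integrals of nonnegative
  functions. Projected points lie on the boundary except for the image of the centre, a single point
  and hence harmless.\<close>

theorem surface_comparison:
  obtains K1 K2 where "K1 > 0" "K2 > 0"
    "\<And>f. f \<in> borel_measurable borel \<Longrightarrow> (\<integral>\<^sup>+x. f (proj x) * indicator \<Omega> x \<partial>lborel) \<le> ennreal K1 * (\<integral>\<^sup>+x. f x \<partial>surface_measure \<Omega>)"
    "\<And>f. f \<in> borel_measurable borel \<Longrightarrow> (\<integral>\<^sup>+x. f x \<partial>surface_measure \<Omega>) \<le> ennreal K2 * (\<integral>\<^sup>+x. f (proj x) * indicator \<Omega> x \<partial>lborel)"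
proof -
  obtain K where K: "K > 0" "\<And>A. A \<in> sets borel \<Longrightarrow> A \<subseteq> frontier \<Omega> \<Longrightarrow> hausdorff_outer (DIM('a) - 1) A \<le> ennreal K * emeasure cmeas A"
    using hausdorff_le_cmeas by blast
  let ?S = "surface_measure \<Omega>" and ?M = "restrict_space cmeas (frontier \<Omega>)"
  have sM: "sets ?M = sets (restrict_space borel (frontier \<Omega>))" by (rule sets_restrict_space_cong) simp
  have spc: "space cmeas = UNIV" by (simp add: cmeas_def)
  have Aset: "A \<in> sets borel \<and> A \<subseteq> frontier \<Omega>" if "A \<in> sets (restrict_space borel (frontier \<Omega>))" for A
    using that frontier_sets by (simp add: sets_restrict_space_iff)
  have eM: "emeasure ?M A = emeasure cmeas A" if "A \<subseteq> frontier \<Omega>" for A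
    using that frontier_sets spc by (intro emeasure_restrict_space) auto
  have le1: "?M \<le> scale_measure (ennreal upper_const) ?S"
    using cmeas_le_hausdorff Aset by (subst le_measure) (auto simp: sM sets_surface eM emeasure_surface)
  have le2: "?S \<le> scale_measure (ennreal K) ?M"
    using K(2) Aset by (subst le_measure) (auto simp: sM sets_surface eM emeasure_surface)
  have nM: "(\<integral>\<^sup>+x. f x \<partial>?M) = (\<integral>\<^sup>+x. f (proj x) * indicator \<Omega> x \<partial>lborel)" if f[measurable]: "f \<in> borel_measurable borel" for f
  proof -
    have [measurable]: "frontier \<Omega> \<in> sets borel" by (rule frontier_sets)
    have "(\<integral>\<^sup>+x. f x \<partial>?M) = (\<integral>\<^sup>+x. f x * indicator (frontier \<Omega>) x \<partial>cmeas)"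
      using frontier_sets by (intro nn_integral_restrict_space) (simp add: spc)
    also have "\<dots> = (\<integral>\<^sup>+x. (f (proj x) * indicator (frontier \<Omega>) (proj x)) * indicator \<Omega> x \<partial>lborel)"
      by (rule nn_integral_cmeas) measurable
    also have "\<dots> = (\<integral>\<^sup>+x. f (proj x) * indicator \<Omega> x \<partial>lborel)"
    proof (rule nn_integral_cong_AE)
      have "AE x in lborel. x \<noteq> a" using AE_lborel_singleton by blast
      then show "AE x in lborel. (f (proj x) * indicator (frontier \<Omega>) (proj x)) * indicator \<Omega> x = f (proj x) * indicator \<Omega> x"
        by eventually_elim (simp add: frontier_iff \<rho>_proj)
    qed
    finally show ?thesis .
  qed
  have mM: "f \<in> borel_measurable ?M" if "f \<in> borel_measurable borel" for f :: "'a \<Rightarrow> ennreal"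
    using that by (intro measurable_restrict_space1) simp
  show ?thesis
  proof (rule that[OF upper_const_pos K(1)])
    fix f :: "'a \<Rightarrow> ennreal" assume f: "f \<in> borel_measurable borel"
    have "(\<integral>\<^sup>+x. f x \<partial>?M) \<le> (\<integral>\<^sup>+x. f x \<partial>scale_measure (ennreal upper_const) ?S)"
      by (rule nn_integral_mono_measure[OF _ le1]) (simp add: sM sets_surface)
    then show "(\<integral>\<^sup>+x. f (proj x) * indicator \<Omega> x \<partial>lborel) \<le> ennreal upper_const * (\<integral>\<^sup>+x. f x \<partial>?S)"
      using nM[OF f] surface_measurable[OF f] by (simp add: nn_integral_scale_measure)
    have "(\<integral>\<^sup>+x. f x \<partial>?S) \<le> (\<integral>\<^sup>+x. f x \<partial>scale_measure (ennreal K) ?M)"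
      by (rule nn_integral_mono_measure[OF _ le2]) (simp add: sM sets_surface)
    then show "(\<integral>\<^sup>+x. f x \<partial>?S) \<le> ennreal K * (\<integral>\<^sup>+x. f (proj x) * indicator \<Omega> x \<partial>lborel)"
      using nM[OF f] mM[OF f] by (simp add: nn_integral_scale_measure)
  qed
qed

end

section \<open>Traces and the weak Neumann condition\<close>

text \<open>The pointwise bound |t| \<le> t^2 / e + e stands in for Cauchy-Schwarz and stays in the
  extended reals; e is free and gets adjusted to the size of the squared norm.\<close>

lemma nn_integral_abs_le:
  assumes [measurable]: "u \<in> borel_measurable M" and e: "e > 0"
  shows "(\<integral>\<^sup>+x. ennreal \<bar>u x\<bar> \<partial>M) \<le> ennreal (1 / e) * nsq M u + ennreal e * emeasure M (space M)"
proof -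
  have "\<bar>t\<bar> \<le> 1 / e * t\<^sup>2 + e" for t :: real
  proof (cases "\<bar>t\<bar> \<le> e")
    case True
    moreover have "1 / e * t\<^sup>2 \<ge> 0" using e by simp
    ultimately show ?thesis by linarith
  next
    case False
    then have "\<bar>t\<bar> * e \<le> \<bar>t\<bar> * \<bar>t\<bar>" by (intro mult_left_mono) auto
    then have "\<bar>t\<bar> \<le> 1 / e * t\<^sup>2" using e by (simp add: field_simps power2_eq_square)
    then show ?thesis using e by linarith
  qed
  then have "ennreal \<bar>u x\<bar> \<le> ennreal (1 / e) * ennreal ((u x)\<^sup>2) + ennreal e" for x
    using e by (simp flip: ennreal_mult ennreal_plus)
  then have "(\<integral>\<^sup>+x. ennreal \<bar>u x\<bar> \<partial>M) \<le> (\<integral>\<^sup>+x. ennreal (1 / e) * ennreal ((u x)\<^sup>2) + ennreal e \<partial>M)"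
    by (intro nn_integral_mono)
  also have "\<dots> = ennreal (1 / e) * nsq M u + ennreal e * emeasure M (space M)"
    by (simp add: nn_integral_add nn_integral_cmult nsq_def)
  finally show ?thesis .
qed

lemma nn_integral_abs_tendsto_0:
  fixes u :: "nat \<Rightarrow> 'a \<Rightarrow> real"
  assumes u: "\<And>k. u k \<in> borel_measurable M" and fin: "emeasure M (space M) < \<infinity>"
    and lim: "(\<lambda>k. nsq M (u k)) \<longlonglongrightarrow> 0"
  shows "(\<lambda>k. \<integral>\<^sup>+x. ennreal \<bar>u k x\<bar> \<partial>M) \<longlonglongrightarrow> 0"
proof (rule order_tendstoI)
  fix E :: ennreal assume E: "0 < E"
  obtain \<sigma> where \<sigma>: "\<sigma> \<ge> 0" "emeasure M (space M) = ennreal \<sigma>" using fin by (cases "emeasure M (space M)") auto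
  obtain e where e: "0 < e" "ennreal e \<le> E"
  proof (cases E)
    case (real q)
    then show ?thesis using that[of q] E by (simp add: ennreal_less_zero_iff)
  qed (use that[of 1] in auto)
  \<comment> \<open>Small enough that the total mass contributes at most e/2; the squared norm is
    then asked to be below \<eta> e / 4.\<close>
  define \<eta> where "\<eta> = e / (2 * (\<sigma> + 1))"
  have \<eta>: "\<eta> > 0" using e \<sigma> by (simp add: \<eta>_def add_nonneg_pos)
  have \<eta>\<sigma>: "\<eta> * \<sigma> \<le> e / 2"
  proof -
    have "\<eta> * \<sigma> \<le> \<eta> * (\<sigma> + 1)" using \<eta> by (intro mult_left_mono) auto
    also have "\<dots> = e / 2" using \<sigma> by (simp add: \<eta>_def field_simps)
    finally show ?thesis .
  qed
  have "ennreal (\<eta> * e / 4) > 0" using \<eta> e by simp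
  from order_tendstoD(2)[OF lim this] show "\<forall>\<^sub>F k in sequentially. (\<integral>\<^sup>+x. ennreal \<bar>u k x\<bar> \<partial>M) < E"
  proof eventually_elim
    case (elim k)
    have "(\<integral>\<^sup>+x. ennreal \<bar>u k x\<bar> \<partial>M) \<le> ennreal (1 / \<eta>) * nsq M (u k) + ennreal \<eta> * emeasure M (space M)"
      by (rule nn_integral_abs_le[OF u \<eta>])
    also have "\<dots> \<le> ennreal (1 / \<eta>) * ennreal (\<eta> * e / 4) + ennreal (\<eta> * \<sigma>)"
      using elim \<eta> \<sigma> by (intro add_mono mult_left_mono) (auto simp: ennreal_mult less_imp_le)
    also have "\<dots> = ennreal (e / 4 + \<eta> * \<sigma>)" using \<eta> e \<sigma> by (simp flip: ennreal_mult ennreal_plus)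
    also have "\<dots> < ennreal e" using \<eta>\<sigma> e \<eta> \<sigma> by (intro ennreal_lessI) auto
    finally show ?case using e(2) by (rule less_le_trans)
  qed
qed simp

text \<open>The geometric rate makes the steps summable in L1, so the sequence converges a.e.; Fatou
  transfers the rate to the limit.\<close>

lemma L2_fast_Cauchy_limit:
  fixes f :: "nat \<Rightarrow> 'a \<Rightarrow> real"
  assumes fin: "emeasure M (space M) < \<infinity>" and [measurable]: "\<And>k. f k \<in> borel_measurable M"
    and C: "C \<ge> 0" "\<And>k m. k \<le> m \<Longrightarrow> nsq M (\<lambda>x. f m x - f k x) \<le> ennreal (C * (1/4) ^ k)"
  obtains g where "g \<in> borel_measurable M" "\<And>k. nsq M (\<lambda>x. f k x - g x) \<le> ennreal (C * (1/4) ^ k)"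
proof -
  obtain \<sigma> where \<sigma>: "\<sigma> \<ge> 0" "emeasure M (space M) = ennreal \<sigma>" using fin by (cases "emeasure M (space M)") auto
  \<comment> \<open>The weight (1/2)^k in \<open>nn_integral_abs_le\<close> balances the rate
    (1/4)^k of the squares.\<close>
  have step: "(\<integral>\<^sup>+x. ennreal \<bar>f (Suc k) x - f k x\<bar> \<partial>M) \<le> ennreal ((C + \<sigma>) * (1/2) ^ k)" for k
  proof -
    have "(\<integral>\<^sup>+x. ennreal \<bar>f (Suc k) x - f k x\<bar> \<partial>M)
        \<le> ennreal (1 / (1/2) ^ k) * nsq M (\<lambda>x. f (Suc k) x - f k x) + ennreal ((1/2) ^ k) * emeasure M (space M)"
      by (rule nn_integral_abs_le) auto
    also have "\<dots> \<le> ennreal (1 / (1/2) ^ k) * ennreal (C * (1/4) ^ k) + ennreal ((1/2) ^ k) * ennreal \<sigma>"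
      unfolding \<sigma>(2) by (intro add_mono mult_left_mono C(2) order_refl) auto
    also have "\<dots> = ennreal (1 / (1/2) ^ k * (C * (1/4) ^ k) + (1/2) ^ k * \<sigma>)"
      using C(1) \<sigma> by (simp flip: ennreal_mult ennreal_plus)
    also have "1 / (1/2) ^ k * (C * (1/4) ^ k) + (1/2) ^ k * \<sigma> = (C + \<sigma>) * (1/2) ^ k"
    proof -
      have "(1/4::real) ^ k = (1/2) ^ k * (1/2) ^ k" by (simp flip: power_mult_distrib)
      then show ?thesis by (simp add: algebra_simps)
    qed
    finally show ?thesis .
  qed
  have "(\<integral>\<^sup>+x. (\<Sum>k. ennreal \<bar>f (Suc k) x - f k x\<bar>) \<partial>M) = (\<Sum>k. \<integral>\<^sup>+x. ennreal \<bar>f (Suc k) x - f k x\<bar> \<partial>M)"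
    by (rule nn_integral_suminf) auto
  also have "\<dots> \<le> (\<Sum>k. ennreal ((C + \<sigma>) * (1/2) ^ k))" by (intro suminf_le step) auto
  also have "\<dots> = ennreal (\<Sum>k. (C + \<sigma>) * (1/2) ^ k)"
    using C(1) \<sigma> by (intro suminf_ennreal2 summable_mult summable_geometric) auto
  also have "\<dots> < \<infinity>" by simp
  finally have "(\<integral>\<^sup>+x. (\<Sum>k. ennreal \<bar>f (Suc k) x - f k x\<bar>) \<partial>M) \<noteq> \<infinity>" by simp
  then have "AE x in M. (\<Sum>k. ennreal \<bar>f (Suc k) x - f k x\<bar>) \<noteq> \<infinity>" by (intro nn_integral_PInf_AE) auto
  then have ae: "AE x in M. (\<lambda>n. f n x) \<longlonglongrightarrow> lim (\<lambda>n. f n x)"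
  proof eventually_elim
    case (elim x)
    then have "summable (\<lambda>k. \<bar>f (Suc k) x - f k x\<bar>)" by (intro summable_suminf_not_top) auto
    then have "summable (\<lambda>k. f (Suc k) x - f k x)" by (rule summable_rabs_cancel)
    then have "(\<lambda>n. \<Sum>k<n. f (Suc k) x - f k x) \<longlonglongrightarrow> (\<Sum>k. f (Suc k) x - f k x)" by (rule summable_LIMSEQ)
    then have "(\<lambda>n. (f n x - f 0 x) + f 0 x) \<longlonglongrightarrow> (\<Sum>k. f (Suc k) x - f k x) + f 0 x"
      unfolding sum_lessThan_telescope[of "\<lambda>k. f k x"] by (intro tendsto_add tendsto_const)
    then have "convergent (\<lambda>n. f n x)" by (auto simp: convergent_def)
    then show ?case by (simp add: convergent_LIMSEQ_iff)
  qed
  define g where "g x = lim (\<lambda>n. f n x)" for x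
  have gm[measurable]: "g \<in> borel_measurable M" unfolding g_def[abs_def] by (rule borel_measurable_lim_metric) auto
  moreover have "nsq M (\<lambda>x. f k x - g x) \<le> ennreal (C * (1/4) ^ k)" for k
  proof -
    have "AE x in M. ennreal ((f k x - g x)\<^sup>2) = liminf (\<lambda>m. ennreal ((f m x - f k x)\<^sup>2))"
      using ae
    proof eventually_elim
      case (elim x)
      then have "(\<lambda>m. ennreal ((f m x - f k x)\<^sup>2)) \<longlonglongrightarrow> ennreal ((g x - f k x)\<^sup>2)"
        unfolding g_def by (intro tendsto_ennrealI tendsto_intros)
      from lim_imp_Liminf[OF trivial_limit_sequentially this]
      show ?case by (simp add: power2_commute[of "f k x"])
    qed
    then have "nsq M (\<lambda>x. f k x - g x) = (\<integral>\<^sup>+x. liminf (\<lambda>m. ennreal ((f m x - f k x)\<^sup>2)) \<partial>M)"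
      unfolding nsq_def by (rule nn_integral_cong_AE)
    also have "\<dots> \<le> liminf (\<lambda>m. nsq M (\<lambda>x. f m x - f k x))"
      unfolding nsq_def by (rule nn_integral_liminf) auto
    also have "\<dots> \<le> limsup (\<lambda>m. nsq M (\<lambda>x. f m x - f k x))" by (rule Liminf_le_Limsup) simp
    also have "\<dots> \<le> ennreal (C * (1/4) ^ k)"
      by (rule Limsup_bounded, rule eventually_sequentiallyI[of k], rule C(2))
    finally show ?thesis .
  qed
  ultimately show thesis by (rule that)
qed

definition smooth_energy :: "'a::euclidean_space set \<Rightarrow> ('a \<Rightarrow> real) \<Rightarrow> real" where
  "smooth_energy \<Omega> f = (L2_nrm \<Omega> f)\<^sup>2 + (\<Sum>b\<in>Basis. (L2_nrm \<Omega> (partial_deriv b f))\<^sup>2)"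

text \<open>The squared H1 distance of a smooth f from w, with the classical partials of f and the
  chosen weak partials of w. The weak partials chosen for the difference f - w agree with these
  differences only a.e.\<close>

definition approx_error :: "'a::euclidean_space set \<Rightarrow> ('a \<Rightarrow> real) \<Rightarrow> ('a \<Rightarrow> real) \<Rightarrow> real" where
  "approx_error \<Omega> w f = (L2_nrm \<Omega> (\<lambda>x. f x - w x))\<^sup>2 +
     (\<Sum>b\<in>Basis. (L2_nrm \<Omega> (\<lambda>x. partial_deriv b f x - weak_partial \<Omega> b w x))\<^sup>2)"

lemma partial_deriv_diff:
  assumes "smooth f" "smooth g"
  shows "partial_deriv b (\<lambda>x. f x - g x) x = partial_deriv b f x - partial_deriv b g x"
  using partial_deriv_eq[OF has_derivative_diff[OF differentiable_partial_deriv[OF smoothD(1)[OF assms(1)]] differentiable_partial_deriv[OF smoothD(1)[OF assms(2)]]]]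
  by (simp add: partial_deriv_def[symmetric])

lemma smooth_energy_eq:
  assumes \<Omega>: "open \<Omega>" "bounded \<Omega>" and f: "smooth f"
  shows "smooth_energy \<Omega> f = (\<integral>x. indicator \<Omega> x * ((f x)\<^sup>2 + (\<Sum>b\<in>Basis. (partial_deriv b f x)\<^sup>2)) \<partial>lborel)"
proof -
  have L: "f \<in> L2 \<Omega>" "\<And>b. b \<in> Basis \<Longrightarrow> partial_deriv b f \<in> L2 \<Omega>"
    using L2_continuous[OF \<Omega>] smoothD[OF f] smooth_partial_continuous[OF f] by auto
  have c: "continuous_on UNIV (\<lambda>x. (f x)\<^sup>2 + (\<Sum>b\<in>Basis. (partial_deriv b f x)\<^sup>2))"
    by (intro continuous_intros smoothD smooth_partial_continuous f)
  have "smooth_energy \<Omega> f = (LINT x|lebesgue_on \<Omega>. (f x)\<^sup>2) + (\<Sum>b\<in>Basis. (LINT x|lebesgue_on \<Omega>. (partial_deriv b f x)\<^sup>2))"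
    by (simp add: smooth_energy_def L2_nrm_sq)
  also have "\<dots> = (LINT x|lebesgue_on \<Omega>. (f x)\<^sup>2 + (\<Sum>b\<in>Basis. (partial_deriv b f x)\<^sup>2))"
    using L by (subst Bochner_Integration.integral_add) (auto simp: L2_def)
  also have "\<dots> = (\<integral>x. indicator \<Omega> x * ((f x)\<^sup>2 + (\<Sum>b\<in>Basis. (partial_deriv b f x)\<^sup>2)) \<partial>lborel)"
    by (rule integral_lebesgue_on[OF \<Omega>(1) borel_measurable_continuous_onI[OF c]])
  finally show ?thesis .
qed

lemma approx_error_nonneg: "approx_error \<Omega> w f \<ge> 0"
  by (simp add: approx_error_def sum_nonneg)

lemma approx_error_ge:
  shows "L2_nrm \<Omega> (\<lambda>x. f x - w x) \<le> sqrt (approx_error \<Omega> w f)"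
    and "b \<in> Basis \<Longrightarrow> L2_nrm \<Omega> (\<lambda>x. partial_deriv b f x - weak_partial \<Omega> b w x) \<le> sqrt (approx_error \<Omega> w f)"
proof -
  show "L2_nrm \<Omega> (\<lambda>x. f x - w x) \<le> sqrt (approx_error \<Omega> w f)"
    by (rule real_le_rsqrt) (simp add: approx_error_def sum_nonneg)
  assume b: "b \<in> Basis"
  have "(L2_nrm \<Omega> (\<lambda>x. partial_deriv b f x - weak_partial \<Omega> b w x))\<^sup>2
      \<le> (\<Sum>b\<in>Basis. (L2_nrm \<Omega> (\<lambda>x. partial_deriv b f x - weak_partial \<Omega> b w x))\<^sup>2)"
    by (rule member_le_sum[OF b]) auto
  then show "L2_nrm \<Omega> (\<lambda>x. partial_deriv b f x - weak_partial \<Omega> b w x) \<le> sqrt (approx_error \<Omega> w f)"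
    by (intro real_le_rsqrt) (simp add: approx_error_def add_increasing)
qed

lemma approx_error_H1_nrm:
  assumes \<Omega>: "open \<Omega>" "bounded \<Omega>" and f: "smooth f" and w: "w \<in> H1 \<Omega>"
  shows "H1_nrm \<Omega> (\<lambda>x. f x - w x) = sqrt (approx_error \<Omega> w f)"
proof -
  have "L2_nrm \<Omega> (weak_partial \<Omega> b (\<lambda>x. f x - w x)) = L2_nrm \<Omega> (\<lambda>x. partial_deriv b f x - weak_partial \<Omega> b w x)"
    if b: "b \<in> Basis" for b
    by (rule L2_nrm_weak_partial[OF \<Omega> is_weak_partial_diff[OF \<Omega> b L2_continuous[OF \<Omega> smoothD(2)[OF f]] H1_L2(1)[OF w]
        is_weak_partial_smooth[OF \<Omega> b f] H1_weak_partial[OF w b]]])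
  then show ?thesis by (simp add: H1_nrm_def approx_error_def)
qed

lemma power2_triangle: "0 \<le> x \<Longrightarrow> x \<le> p + q \<Longrightarrow> x\<^sup>2 \<le> 2 * p\<^sup>2 + 2 * (q::real)\<^sup>2"
proof -
  assume "0 \<le> x" "x \<le> p + q"
  then have "x\<^sup>2 \<le> (p + q)\<^sup>2" by (intro power_mono) auto
  also have "\<dots> \<le> 2 * p\<^sup>2 + 2 * q\<^sup>2" using zero_le_power2[of "p - q"] by (simp add: power2_sum power2_diff)
  finally show ?thesis .
qed

lemma smooth_energy_diff:
  assumes \<Omega>: "open \<Omega>" "bounded \<Omega>" and f: "smooth f" and g: "smooth g" and w: "w \<in> H1 \<Omega>"
  shows "smooth_energy \<Omega> (\<lambda>x. f x - g x) \<le> 2 * approx_error \<Omega> w f + 2 * approx_error \<Omega> w g"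
proof -
  have tri: "(L2_nrm \<Omega> (\<lambda>x. u x - v x))\<^sup>2 \<le> 2 * (L2_nrm \<Omega> (\<lambda>x. u x - y x))\<^sup>2 + 2 * (L2_nrm \<Omega> (\<lambda>x. v x - y x))\<^sup>2"
    if "u \<in> L2 \<Omega>" "v \<in> L2 \<Omega>" "y \<in> L2 \<Omega>" for u v y
  proof (rule power2_triangle[OF L2_nrm_nonneg])
    show "L2_nrm \<Omega> (\<lambda>x. u x - v x) \<le> L2_nrm \<Omega> (\<lambda>x. u x - y x) + L2_nrm \<Omega> (\<lambda>x. v x - y x)"
    proof -
      have "L2_nrm \<Omega> (\<lambda>x. u x - v x) = L2_nrm \<Omega> (\<lambda>x. (u x - y x) + (y x - v x))" by simp
      also have "\<dots> \<le> L2_nrm \<Omega> (\<lambda>x. u x - y x) + L2_nrm \<Omega> (\<lambda>x. y x - v x)"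
        by (rule L2_nrm_triangle[OF L2_diff[OF that(1,3)] L2_diff[OF that(3,2)]])
      finally show ?thesis by (simp only: L2_nrm_minus_commute[of \<Omega> v y])
    qed
  qed
  have L: "f \<in> L2 \<Omega>" "g \<in> L2 \<Omega>" "\<And>b. b \<in> Basis \<Longrightarrow> partial_deriv b f \<in> L2 \<Omega>" "\<And>b. b \<in> Basis \<Longrightarrow> partial_deriv b g \<in> L2 \<Omega>"
    using L2_continuous[OF \<Omega>] smoothD[OF f] smoothD[OF g] smooth_partial_continuous[OF f] smooth_partial_continuous[OF g] by auto
  have "smooth_energy \<Omega> (\<lambda>x. f x - g x) = (L2_nrm \<Omega> (\<lambda>x. f x - g x))\<^sup>2
      + (\<Sum>b\<in>Basis. (L2_nrm \<Omega> (\<lambda>x. partial_deriv b f x - partial_deriv b g x))\<^sup>2)"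
    unfolding smooth_energy_def partial_deriv_diff[OF f g, abs_def] ..
  also have "\<dots> \<le> (2 * (L2_nrm \<Omega> (\<lambda>x. f x - w x))\<^sup>2 + 2 * (L2_nrm \<Omega> (\<lambda>x. g x - w x))\<^sup>2)
      + (\<Sum>b\<in>Basis. 2 * (L2_nrm \<Omega> (\<lambda>x. partial_deriv b f x - weak_partial \<Omega> b w x))\<^sup>2 + 2 * (L2_nrm \<Omega> (\<lambda>x. partial_deriv b g x - weak_partial \<Omega> b w x))\<^sup>2)"
    by (intro add_mono sum_mono tri L H1_L2 w)
  also have "\<dots> = 2 * approx_error \<Omega> w f + 2 * approx_error \<Omega> w g"
    by (simp add: approx_error_def sum.distrib sum_distrib_left)
  finally show ?thesis .
qed

lemma fast_smooth_approx:
  fixes \<Omega> :: "'a::euclidean_space set"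
  assumes \<Omega>: "open \<Omega>" "bounded \<Omega>" "convex \<Omega>" "\<Omega> \<noteq> {}" and w: "w \<in> H1 \<Omega>"
  obtains f where "\<And>k. smooth (f k)" "\<And>k. approx_error \<Omega> w (f k) \<le> (1/4) ^ k"
proof -
  obtain f where f: "\<And>k. smooth (f k)" "(\<lambda>k. L2_nrm \<Omega> (\<lambda>x. f k x - w x)) \<longlonglongrightarrow> 0"
    "\<And>b. b \<in> Basis \<Longrightarrow> (\<lambda>k. L2_nrm \<Omega> (\<lambda>x. partial_deriv b (f k) x - weak_partial \<Omega> b w x)) \<longlonglongrightarrow> 0"
    using H1_smooth_approx[OF \<Omega> w] by blast
  have "(\<lambda>k. approx_error \<Omega> w (f k)) \<longlonglongrightarrow> 0\<^sup>2 + (\<Sum>b\<in>(Basis::'a set). 0\<^sup>2)"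
    unfolding approx_error_def by (intro tendsto_intros f)
  then have lim: "(\<lambda>k. approx_error \<Omega> w (f k)) \<longlonglongrightarrow> 0" by simp
  have "\<exists>n. approx_error \<Omega> w (f n) \<le> (1/4) ^ k" for k :: nat
  proof -
    have "(1/4::real) ^ k > 0" by simp
    from order_tendstoD(2)[OF lim this] show ?thesis by (auto simp: eventually_sequentially intro: less_imp_le)
  qed
  then obtain n where "\<And>k. approx_error \<Omega> w (f (n k)) \<le> (1/4) ^ k" by metis
  then show thesis using that[of "\<lambda>k. f (n k)"] f(1) by blast
qed

lemma approx_error_L2_tendsto:
  assumes lim: "(\<lambda>k. approx_error \<Omega> w (f k)) \<longlonglongrightarrow> 0"
  shows "(\<lambda>k. L2_nrm \<Omega> (\<lambda>x. f k x - w x)) \<longlonglongrightarrow> 0"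
    and "b \<in> Basis \<Longrightarrow> (\<lambda>k. L2_nrm \<Omega> (\<lambda>x. partial_deriv b (f k) x - weak_partial \<Omega> b w x)) \<longlonglongrightarrow> 0"
proof -
  have s: "(\<lambda>k. sqrt (approx_error \<Omega> w (f k))) \<longlonglongrightarrow> 0" using tendsto_real_sqrt[OF lim] by simp
  show "(\<lambda>k. L2_nrm \<Omega> (\<lambda>x. f k x - w x)) \<longlonglongrightarrow> 0"
    by (rule tendsto_sandwich[OF _ _ tendsto_const s]) (simp_all add: L2_nrm_nonneg approx_error_ge(1))
  show "(\<lambda>k. L2_nrm \<Omega> (\<lambda>x. partial_deriv b (f k) x - weak_partial \<Omega> b w x)) \<longlonglongrightarrow> 0" if "b \<in> Basis"
    by (rule tendsto_sandwich[OF _ _ tendsto_const s]) (simp_all add: L2_nrm_nonneg approx_error_ge(2) that)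
qed

section \<open>Boundary traces on the convex body\<close>

context convex_body
begin

lemma nonempty: "\<Omega> \<noteq> {}"
  using a_in by blast

lemma surface_le_cone: "\<exists>K>0. \<forall>f\<in>borel_measurable borel. (\<integral>\<^sup>+x. f x \<partial>surface_measure \<Omega>) \<le> ennreal K * (\<integral>\<^sup>+x. f (proj x) * indicator \<Omega> x \<partial>lborel)"
  by (rule surface_comparison) auto

lemma cone_le_surface: "\<exists>K>0. \<forall>f\<in>borel_measurable borel. (\<integral>\<^sup>+x. f (proj x) * indicator \<Omega> x \<partial>lborel) \<le> ennreal K * (\<integral>\<^sup>+x. f x \<partial>surface_measure \<Omega>)"
  by (rule surface_comparison) auto

lemma surface_finite: "emeasure (surface_measure \<Omega>) (space (surface_measure \<Omega>)) < \<infinity>"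
proof -
  obtain K where "\<forall>f\<in>borel_measurable borel. (\<integral>\<^sup>+x. f x \<partial>surface_measure \<Omega>) \<le> ennreal K * (\<integral>\<^sup>+x. f (proj x) * indicator \<Omega> x \<partial>lborel)"
    using surface_le_cone by blast
  from bspec[OF this borel_measurable_const[of 1]] have K: "(\<integral>\<^sup>+x. (1::ennreal) \<partial>surface_measure \<Omega>) \<le> ennreal K * (\<integral>\<^sup>+x. 1 * indicator \<Omega> x \<partial>lborel)" .
  have "emeasure (surface_measure \<Omega>) (space (surface_measure \<Omega>)) \<le> ennreal K * emeasure lborel \<Omega>"
    using K op by simp
  also have "\<dots> < \<infinity>" using emeasure_bounded_finite[OF bdd] by (simp add: ennreal_mult_less_top)
  finally show ?thesis .
qed

text \<open>\<open>trace_inequality\<close> bounds the square integral against the cone measure,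
  which dominates the surface measure up to a factor.\<close>

lemma trace_surface:
  "\<exists>K>0. \<forall>f. smooth f \<longrightarrow> nsq (surface_measure \<Omega>) f \<le> ennreal (K * smooth_energy \<Omega> f)"
proof -
  obtain K where K: "K > 0" "\<And>f. f \<in> borel_measurable borel \<Longrightarrow>
      (\<integral>\<^sup>+x. f x \<partial>surface_measure \<Omega>) \<le> ennreal K * (\<integral>\<^sup>+x. f (proj x) * indicator \<Omega> x \<partial>lborel)"
    using surface_le_cone by blast
  define k where "k = 2 * real DIM('a) * (1 + R)"
  have k: "k > 0" using R0 by (simp add: k_def)
  have "nsq (surface_measure \<Omega>) f \<le> ennreal (K * k * smooth_energy \<Omega> f)" if f: "smooth f" for f
  proof -
    have [measurable]: "f \<in> borel_measurable borel" by (intro borel_measurable_continuous_onI smoothD f)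
    obtain L where L: "\<And>x. x \<in> cball a R \<Longrightarrow> \<bar>f x\<bar> \<le> L"
      using continuous_bounded_on_bounded[OF bounded_cball smoothD(2)[OF f]] by metis
    have pc: "proj x \<in> cball a R" for x using in_cball(2)[of x] R0 by (cases "x = a") (auto simp: proj_def)
    have int: "integrable lborel (\<lambda>x. indicator \<Omega> x * (f (proj x))\<^sup>2)"
    proof (rule integrable_on_level[where M="L\<^sup>2"])
      show "\<bar>(f (proj x))\<^sup>2\<bar> \<le> L\<^sup>2" for x using power_mono[OF L[OF pc[of x]], of 2] by simp
    qed (use op in auto)
    have "nsq (surface_measure \<Omega>) f \<le> ennreal K * (\<integral>\<^sup>+x. ennreal ((f (proj x))\<^sup>2) * indicator \<Omega> x \<partial>lborel)"
      unfolding nsq_def by (rule K(2)) measurable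
    also have "(\<integral>\<^sup>+x. ennreal ((f (proj x))\<^sup>2) * indicator \<Omega> x \<partial>lborel) = (\<integral>\<^sup>+x. ennreal (indicator \<Omega> x * (f (proj x))\<^sup>2) \<partial>lborel)"
      by (intro nn_integral_cong) (auto simp: indicator_def)
    also have "\<dots> = ennreal (\<integral>x. indicator \<Omega> x * (f (proj x))\<^sup>2 \<partial>lborel)"
      by (rule nn_integral_eq_integral[OF int]) simp
    also have "ennreal K * \<dots> \<le> ennreal K * ennreal (k * smooth_energy \<Omega> f)"
      using trace_inequality[OF f] by (intro mult_left_mono ennreal_leI) (simp_all add: smooth_energy_eq[OF op bdd f] k_def)
    also have "\<dots> = ennreal (K * k * smooth_energy \<Omega> f)"
      using K(1) k by (subst ennreal_mult[symmetric]) (auto simp: smooth_energy_def sum_nonneg mult.assoc)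
    finally show ?thesis .
  qed
  then show ?thesis using K(1) k by (intro exI[of _ "K * k"]) auto
qed

text \<open>The choice in \<open>trace_op\<close> has no content before existence is known. A
  rapidly converging smooth approximation of w is Cauchy on the boundary by
  \<open>trace_surface\<close>, and its limit there is a trace.\<close>

lemma trace_exists:
  assumes w: "w \<in> H1 \<Omega>"
  shows "\<exists>g. is_trace \<Omega> w g"
proof -
  let ?S = "surface_measure \<Omega>"
  obtain f where f: "\<And>k. smooth (f k)" "\<And>k. approx_error \<Omega> w (f k) \<le> (1/4) ^ k"
    using fast_smooth_approx[OF op bdd cvx nonempty w] by blast
  obtain K where K: "K > 0" "\<And>f. smooth f \<Longrightarrow> nsq ?S f \<le> ennreal (K * smooth_energy \<Omega> f)"
    using trace_surface by blast
  have fm[measurable]: "f k \<in> borel_measurable ?S" for k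
    by (intro surface_measurable borel_measurable_continuous_onI smoothD f)
  have cau: "nsq ?S (\<lambda>x. f m x - f k x) \<le> ennreal ((4 * K) * (1/4) ^ k)" if km: "k \<le> m" for k m
  proof -
    have "(1/4::real) ^ m \<le> (1/4) ^ k" using km by (intro power_decreasing) auto
    then have "2 * approx_error \<Omega> w (f m) + 2 * approx_error \<Omega> w (f k) \<le> 4 * (1/4) ^ k" using f(2)[of m] f(2)[of k] by linarith
    then have "smooth_energy \<Omega> (\<lambda>x. f m x - f k x) \<le> 4 * (1/4) ^ k"
      using smooth_energy_diff[OF op bdd f(1) f(1) w, of m k] by linarith
    then have "K * smooth_energy \<Omega> (\<lambda>x. f m x - f k x) \<le> K * (4 * (1/4) ^ k)" using K(1) by (intro mult_left_mono) auto
    then show ?thesis using order_trans[OF K(2)[OF smooth_diff[OF f(1) f(1)], of m k] ennreal_leI] by (simp add: mult_ac)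
  qed
  have "\<exists>g\<in>borel_measurable ?S. \<forall>k. nsq ?S (\<lambda>x. f k x - g x) \<le> ennreal ((4 * K) * (1/4) ^ k)"
    using K(1) by - (rule L2_fast_Cauchy_limit[OF surface_finite fm _ cau], auto)
  then obtain g where g[measurable]: "g \<in> borel_measurable ?S" and gl: "\<And>k. nsq ?S (\<lambda>x. f k x - g x) \<le> ennreal ((4 * K) * (1/4) ^ k)"
    by blast
  have "nsq ?S g = nsq ?S (\<lambda>x. (g x - f 0 x) + f 0 x)" by simp
  also have "\<dots> \<le> 2 * nsq ?S (\<lambda>x. g x - f 0 x) + 2 * nsq ?S (f 0)" by (rule nsq_add_le) auto
  also have "\<dots> < \<infinity>"
    using le_less_trans[OF gl[of 0]] le_less_trans[OF K(2)[OF f(1)[of 0]]] by (simp add: nsq_minus_commute[of _ g] ennreal_mult_less_top)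
  finally have "integrable ?S (\<lambda>x. (g x)\<^sup>2)" by (intro integrableI_bounded) (auto simp: nsq_def)
  moreover have "(\<lambda>k. H1_nrm \<Omega> (\<lambda>x. f k x - w x)) \<longlonglongrightarrow> 0"
  proof -
    have "(\<lambda>k. approx_error \<Omega> w (f k)) \<longlonglongrightarrow> 0"
      by (rule tendsto_sandwich[OF _ _ tendsto_const LIMSEQ_power_zero[of "1/4"]]) (simp_all add: approx_error_nonneg f(2))
    then show ?thesis using tendsto_real_sqrt by (fastforce simp: approx_error_H1_nrm[OF op bdd f(1) w])
  qed
  moreover have "(\<lambda>k. nsq ?S (\<lambda>x. f k x - g x)) \<longlonglongrightarrow> 0"
  proof (rule tendsto_sandwich[OF _ _ tendsto_const])
    have "(\<lambda>k. (4 * K) * (1/4) ^ k) \<longlonglongrightarrow> (4 * K) * 0" by (intro tendsto_mult tendsto_const LIMSEQ_power_zero) simp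
    then show "(\<lambda>k. ennreal ((4 * K) * (1/4) ^ k)) \<longlonglongrightarrow> 0" using tendsto_ennrealI by fastforce
  qed (simp_all add: gl)
  ultimately show ?thesis unfolding is_trace_def nsq_def using f(1) g by blast
qed

text \<open>Whichever trace is chosen, its defining property supplies smooth functions that converge
  in H1 and on the boundary simultaneously.\<close>

lemma trace_op_approx:
  assumes w: "w \<in> H1 \<Omega>"
  shows "trace_op \<Omega> w \<in> borel_measurable (surface_measure \<Omega>)"
    and "\<exists>f. (\<forall>k. smooth (f k)) \<and> (\<lambda>k. approx_error \<Omega> w (f k)) \<longlonglongrightarrow> 0 \<and>
      (\<lambda>k. nsq (surface_measure \<Omega>) (\<lambda>x. f k x - trace_op \<Omega> w x)) \<longlonglongrightarrow> 0"
proof -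
  have t: "is_trace \<Omega> w (trace_op \<Omega> w)" unfolding trace_op_def by (rule someI_ex[OF trace_exists[OF w]])
  then show "trace_op \<Omega> w \<in> borel_measurable (surface_measure \<Omega>)" by (simp add: is_trace_def)
  from t obtain f :: "nat \<Rightarrow> 'a \<Rightarrow> real" where f: "\<And>k. smooth (f k)" "(\<lambda>k. H1_nrm \<Omega> (\<lambda>x. f k x - w x)) \<longlonglongrightarrow> 0"
    "(\<lambda>k. nsq (surface_measure \<Omega>) (\<lambda>x. f k x - trace_op \<Omega> w x)) \<longlonglongrightarrow> 0"
    unfolding is_trace_def nsq_def by blast
  have "(\<lambda>k. (sqrt (approx_error \<Omega> w (f k)))\<^sup>2) \<longlonglongrightarrow> 0\<^sup>2"
    using f(2) unfolding approx_error_H1_nrm[OF op bdd f(1) w] by (rule tendsto_power)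
  then have "(\<lambda>k. approx_error \<Omega> w (f k)) \<longlonglongrightarrow> 0" by (simp add: approx_error_nonneg)
  then show "\<exists>f. (\<forall>k. smooth (f k)) \<and> (\<lambda>k. approx_error \<Omega> w (f k)) \<longlonglongrightarrow> 0 \<and>
      (\<lambda>k. nsq (surface_measure \<Omega>) (\<lambda>x. f k x - trace_op \<Omega> w x)) \<longlonglongrightarrow> 0"
    using f by blast
qed

text \<open>Regularity is constant along rays, so the irregular boundary points have cone measure
  zero because the irregular points of \<Omega> are null; the comparison carries this over to the
  surface measure.\<close>

lemma AE_surface_regular: "AE y in surface_measure \<Omega>. \<rho> y = 1 \<and> regular y"
proof -
  obtain K where K: "\<And>f. f \<in> borel_measurable borel \<Longrightarrow>
      (\<integral>\<^sup>+x. f x \<partial>surface_measure \<Omega>) \<le> ennreal K * (\<integral>\<^sup>+x. f (proj x) * indicator \<Omega> x \<partial>lborel)"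
    using surface_le_cone by blast
  let ?N = "{y. \<not> regular y}"
  have N: "?N \<in> sets borel" by simp
  have "(\<integral>\<^sup>+x. indicator ?N (proj x) * indicator \<Omega> x \<partial>lborel) = (\<integral>\<^sup>+x. (0::ennreal) \<partial>(lborel :: 'a measure))"
  proof (rule nn_integral_cong_AE)
    have "AE x in lborel. x \<noteq> a" using AE_lborel_singleton by blast
    with AE_regular show "AE x in lborel. indicator ?N (proj x) * indicator \<Omega> x = (0::ennreal)"
      by eventually_elim (auto simp: indicator_def regular_proj)
  qed
  then have "(\<integral>\<^sup>+x. indicator ?N x \<partial>surface_measure \<Omega>) = 0" using K[of "indicator ?N"] N by simp
  then have "AE x in surface_measure \<Omega>. indicator ?N x = (0::ennreal)"
    using N by (subst (asm) nn_integral_0_iff_AE) (auto intro!: surface_measurable)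
  moreover have "space (surface_measure \<Omega>) = frontier \<Omega>"
    using sets_eq_imp_space_eq[OF sets_surface] by (simp add: space_restrict_space)
  then have "AE y in surface_measure \<Omega>. y \<in> frontier \<Omega>" using AE_space[of "surface_measure \<Omega>"] by simp
  ultimately show ?thesis by eventually_elim (auto simp: frontier_iff indicator_def split: if_splits)
qed

text \<open>The gradient field is approximated componentwise by smooth fields converging also on the boundary,
  where the flux of the limit vanishes; by the Gauss inequality the divergence terms then vanish in the
  limit.\<close>

theorem weak_Neumann:
  assumes z: "z \<in> H2n \<Omega>" and \<phi>: "smooth \<phi>"
  shows "(\<Sum>b\<in>Basis. LINT x|lebesgue_on \<Omega>. weak_partial \<Omega> b z x * partial_deriv b \<phi> x)
    + (\<Sum>b\<in>Basis. LINT x|lebesgue_on \<Omega>. weak_partial \<Omega> b (weak_partial \<Omega> b z) x * \<phi> x) = 0"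
proof -
  let ?S = "surface_measure \<Omega>"
  define w where "w b = weak_partial \<Omega> b z" for b
  have wH: "w b \<in> H1 \<Omega>" if "b \<in> Basis" for b using z that by (simp add: H2n_def H2_def w_def)
  have "\<forall>b\<in>Basis. \<exists>f. (\<forall>k. smooth (f k)) \<and> (\<lambda>k. approx_error \<Omega> (w b) (f k)) \<longlonglongrightarrow> 0 \<and>
      (\<lambda>k. nsq ?S (\<lambda>x. f k x - trace_op \<Omega> (w b) x)) \<longlonglongrightarrow> 0"
    using trace_op_approx(2) wH by blast
  from bchoice[OF this] obtain f where f': "\<forall>b\<in>Basis. (\<forall>k. smooth (f b k)) \<and> (\<lambda>k. approx_error \<Omega> (w b) (f b k)) \<longlonglongrightarrow> 0 \<and>
      (\<lambda>k. nsq ?S (\<lambda>x. f b k x - trace_op \<Omega> (w b) x)) \<longlonglongrightarrow> 0" ..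
  have f: "smooth (f b k)" "(\<lambda>k. approx_error \<Omega> (w b) (f b k)) \<longlonglongrightarrow> 0"
    "(\<lambda>k. nsq ?S (\<lambda>x. f b k x - trace_op \<Omega> (w b) x)) \<longlonglongrightarrow> 0" if "b \<in> Basis" for b k
    using bspec[OF f' that] by simp_all
  have L\<phi>: "\<phi> \<in> L2 \<Omega>" "b \<in> Basis \<Longrightarrow> partial_deriv b \<phi> \<in> L2 \<Omega>" for b
    using L2_continuous[OF op bdd] smoothD[OF \<phi>] smooth_partial_continuous[OF \<phi>] by auto
  have Lf: "f b k \<in> L2 \<Omega>" "partial_deriv b (f b k) \<in> L2 \<Omega>" if "b \<in> Basis" for b k
    using L2_continuous[OF op bdd] smoothD[OF f(1)] smooth_partial_continuous[OF f(1)] that by auto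
  \<comment> \<open>The claimed expression for the approximating fields; by the product rule it is
    the integral of the divergence of the field multiplied by \<phi>.\<close>
  define I where "I k = (\<Sum>b\<in>Basis. LINT x|lebesgue_on \<Omega>. f b k x * partial_deriv b \<phi> x)
      + (\<Sum>b\<in>Basis. LINT x|lebesgue_on \<Omega>. partial_deriv b (f b k) x * \<phi> x)" for k
  let ?I = "(\<Sum>b\<in>Basis. LINT x|lebesgue_on \<Omega>. w b x * partial_deriv b \<phi> x)
      + (\<Sum>b\<in>Basis. LINT x|lebesgue_on \<Omega>. weak_partial \<Omega> b (w b) x * \<phi> x)"
  have limI: "I \<longlonglongrightarrow> ?I"
    unfolding I_def
    by (intro tendsto_add tendsto_sum L2_inner_tendsto approx_error_L2_tendsto f(2) Lf L\<phi> H1_L2 wH)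
  obtain B where B: "B \<ge> 0" "\<And>x. x \<in> frontier \<Omega> \<Longrightarrow> \<bar>\<phi> x\<bar> \<le> B"
    using continuous_bounded_on_bounded[OF compact_imp_bounded[OF compact_frontier_bounded[OF bdd]] smoothD(2)[OF \<phi>]] by blast
  obtain K where K: "K > 0" "\<And>f. f \<in> borel_measurable borel \<Longrightarrow> (\<integral>\<^sup>+x. f (proj x) * indicator \<Omega> x \<partial>lborel) \<le> ennreal K * (\<integral>\<^sup>+x. f x \<partial>?S)"
    using cone_le_surface by blast
  define E where "E k = (\<Sum>b\<in>Basis. \<integral>\<^sup>+x. ennreal \<bar>f b k x - trace_op \<Omega> (w b) x\<bar> \<partial>?S)" for k
  have limE: "E \<longlonglongrightarrow> 0"
  proof -
    have "E \<longlonglongrightarrow> (\<Sum>b\<in>(Basis::'a set). 0)"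
      unfolding E_def
    proof (intro tendsto_sum nn_integral_abs_tendsto_0 surface_finite f(3) borel_measurable_diff)
      show "f b k \<in> borel_measurable ?S" if "b \<in> Basis" for b k
        by (intro surface_measurable borel_measurable_continuous_onI smoothD f that)
    qed (auto intro: trace_op_approx(1) wH)
    then show ?thesis by simp
  qed
  \<comment> \<open>At regular boundary points the chosen normal is h > 0 times the gradient of the
    gauge, so a vanishing normal derivative means a vanishing flux.\<close>
  have flux: "AE y in ?S. \<rho> y = 1 \<and> (\<Sum>b\<in>Basis. trace_op \<Omega> (w b) y * dd b y) = 0"
  proof -
    have "AE y in ?S. normal_deriv \<Omega> z y = 0" using z by (simp add: H2n_def)
    with AE_surface_regular show ?thesis
    proof eventually_elim
      case (elim y)
      have ya: "y \<noteq> a" using elim(1) \<rho>_a by auto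
      have py: "proj y = y" using elim(1) by (simp add: proj_def)
      obtain h where h: "h > 0" "\<And>b. b \<in> Basis \<Longrightarrow> outer_normal \<Omega> y \<bullet> b = h * dd b y"
        using regular_normal(1)[OF ya] elim(1) py by auto
      have "normal_deriv \<Omega> z y = (\<Sum>b\<in>Basis. trace_op \<Omega> (w b) y * (h * dd b y))"
        unfolding normal_deriv_def w_def by (intro sum.cong refl) (simp add: h(2))
      also have "\<dots> = h * (\<Sum>b\<in>Basis. trace_op \<Omega> (w b) y * dd b y)" by (simp add: sum_distrib_left mult_ac)
      finally show ?case using elim h(1) by simp
    qed
  qed
  define F where "F k b = (\<lambda>x. f b k x * \<phi> x)" for k b
  define J where "J k x = \<bar>\<Sum>b\<in>Basis. F k b x * dd b x\<bar>" for k x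
  have Fs: "smooth (F k b)" if "b \<in> Basis" for k b unfolding F_def by (intro smooth_mult f \<phi> that)
  have Fm[measurable]: "F k b \<in> borel_measurable borel" if "b \<in> Basis" for k b
    by (intro borel_measurable_continuous_onI smoothD Fs that)
  have Jm[measurable]: "J k \<in> borel_measurable borel" for k unfolding J_def[abs_def] by measurable
  have Jle: "(\<integral>\<^sup>+y. ennreal (J k y) \<partial>?S) \<le> ennreal (B / r) * E k" for k
  proof -
    \<comment> \<open>Subtracting the vanishing flux of the limit leaves only the boundary errors,
      weighted by |\<phi>| \<le> B and by gauge derivatives of size at most 1/r.\<close>
    have "AE y in ?S. ennreal (J k y) \<le> ennreal (B / r) * (\<Sum>b\<in>Basis. ennreal \<bar>f b k y - trace_op \<Omega> (w b) y\<bar>)"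
      using flux
    proof eventually_elim
      case (elim y)
      have "(\<Sum>b\<in>Basis. F k b y * dd b y) = \<phi> y * (\<Sum>b\<in>Basis. f b k y * dd b y)"
        by (simp add: F_def sum_distrib_left mult_ac)
      also have "(\<Sum>b\<in>Basis. f b k y * dd b y) = (\<Sum>b\<in>Basis. (f b k y - trace_op \<Omega> (w b) y) * dd b y)"
        using elim by (simp add: left_diff_distrib sum_subtractf)
      finally have "J k y = \<bar>\<phi> y\<bar> * \<bar>\<Sum>b\<in>Basis. (f b k y - trace_op \<Omega> (w b) y) * dd b y\<bar>"
        by (simp add: J_def abs_mult)
      also have "\<dots> \<le> B * (\<Sum>b\<in>Basis. \<bar>f b k y - trace_op \<Omega> (w b) y\<bar> * (1 / r))"
      proof (intro mult_mono)
        show "\<bar>\<phi> y\<bar> \<le> B" using B(2) elim frontier_iff by blast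
        show "\<bar>\<Sum>b\<in>Basis. (f b k y - trace_op \<Omega> (w b) y) * dd b y\<bar> \<le> (\<Sum>b\<in>Basis. \<bar>f b k y - trace_op \<Omega> (w b) y\<bar> * (1 / r))"
        proof (rule order_trans[OF sum_abs sum_mono])
          fix b :: 'a assume "b \<in> Basis"
          then have "\<bar>dd b y\<bar> \<le> 1 / r" using dd_bound[of b y] by simp
          then show "\<bar>(f b k y - trace_op \<Omega> (w b) y) * dd b y\<bar> \<le> \<bar>f b k y - trace_op \<Omega> (w b) y\<bar> * (1 / r)"
            unfolding abs_mult by (intro mult_left_mono) auto
        qed
      qed (use B(1) in auto)
      also have "\<dots> = (B / r) * (\<Sum>b\<in>Basis. \<bar>f b k y - trace_op \<Omega> (w b) y\<bar>)" by (simp add: sum_distrib_left)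
      finally have "ennreal (J k y) \<le> ennreal ((B / r) * (\<Sum>b\<in>Basis. \<bar>f b k y - trace_op \<Omega> (w b) y\<bar>))" by (rule ennreal_leI)
      also have "\<dots> = ennreal (B / r) * ennreal (\<Sum>b\<in>Basis. \<bar>f b k y - trace_op \<Omega> (w b) y\<bar>)"
        using B(1) r0 by (intro ennreal_mult) (auto simp: sum_nonneg)
      finally show ?case by (simp add: sum_ennreal)
    qed
    then have "(\<integral>\<^sup>+y. ennreal (J k y) \<partial>?S) \<le> (\<integral>\<^sup>+y. ennreal (B / r) * (\<Sum>b\<in>Basis. ennreal \<bar>f b k y - trace_op \<Omega> (w b) y\<bar>) \<partial>?S)"
      by (rule nn_integral_mono_AE)
    also have "\<dots> = ennreal (B / r) * E k"
    proof -
      have m: "(\<lambda>y. ennreal \<bar>f b k y - trace_op \<Omega> (w b) y\<bar>) \<in> borel_measurable ?S" if b: "b \<in> Basis" for b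
      proof -
        have [measurable]: "f b k \<in> borel_measurable ?S" "trace_op \<Omega> (w b) \<in> borel_measurable ?S"
          using b by (auto intro!: surface_measurable borel_measurable_continuous_onI smoothD f trace_op_approx(1) wH)
        show ?thesis by measurable
      qed
      show ?thesis unfolding E_def
        by (subst nn_integral_cmult, rule borel_measurable_sum, erule m, subst nn_integral_sum, erule m, rule refl)
    qed
    finally show ?thesis .
  qed
  have bound: "ennreal \<bar>I k\<bar> \<le> ennreal (DIM('a) * K * (B / r)) * E k" for k
  proof -
    have "I k = (LINT x|lebesgue_on \<Omega>. (\<Sum>b\<in>Basis. partial_deriv b (F k b) x))"
    proof -
      have i1: "integrable (lebesgue_on \<Omega>) (\<lambda>x. f b k x * partial_deriv b \<phi> x)"
        and i2: "integrable (lebesgue_on \<Omega>) (\<lambda>x. partial_deriv b (f b k) x * \<phi> x)" if "b \<in> Basis" for b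
        using that by (auto intro!: L2_mult_integrable Lf L\<phi>)
      have "partial_deriv b (F k b) x = f b k x * partial_deriv b \<phi> x + partial_deriv b (f b k) x * \<phi> x" if "b \<in> Basis" for b x
        unfolding F_def by (intro partial_deriv_mult smoothD f \<phi> that)
      then have "(LINT x|lebesgue_on \<Omega>. (\<Sum>b\<in>Basis. partial_deriv b (F k b) x))
          = (LINT x|lebesgue_on \<Omega>. (\<Sum>b\<in>Basis. f b k x * partial_deriv b \<phi> x + partial_deriv b (f b k) x * \<phi> x))"
        by simp
      also have "\<dots> = (\<Sum>b\<in>Basis. LINT x|lebesgue_on \<Omega>. f b k x * partial_deriv b \<phi> x + partial_deriv b (f b k) x * \<phi> x)"
        by (rule Bochner_Integration.integral_sum) (intro Bochner_Integration.integrable_add i1 i2)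
      also have "\<dots> = I k" unfolding I_def by (simp add: i1 i2 sum.distrib)
      finally show ?thesis ..
    qed
    also have "\<dots> = (\<integral>x. indicator \<Omega> x * (\<Sum>b\<in>Basis. partial_deriv b (F k b) x) \<partial>lborel)"
      by (rule integral_lebesgue_on[OF op]) (intro borel_measurable_continuous_onI continuous_on_sum smooth_partial_continuous Fs)
    finally have "\<bar>I k\<bar> \<le> DIM('a) * (\<integral>x. indicator \<Omega> x * \<bar>\<Sum>b\<in>Basis. F k b (proj x) * dd b x\<bar> \<partial>lborel)"
      using gauss_inequality[of "F k"] Fs by simp
    also have "(\<integral>x. indicator \<Omega> x * \<bar>\<Sum>b\<in>Basis. F k b (proj x) * dd b x\<bar> \<partial>lborel) = (\<integral>x. indicator \<Omega> x * J k (proj x) \<partial>lborel)"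
    proof (rule integral_cong_AE)
      have [measurable]: "\<Omega> \<in> sets borel" using op by simp
      show "(\<lambda>x. indicator \<Omega> x * \<bar>\<Sum>b\<in>Basis. F k b (proj x) * dd b x\<bar>) \<in> borel_measurable lborel"
        "(\<lambda>x. indicator \<Omega> x * J k (proj x)) \<in> borel_measurable lborel" by measurable
      have "AE x in lborel. x \<noteq> a" using AE_lborel_singleton by blast
      then show "AE x in lborel. indicator \<Omega> x * \<bar>\<Sum>b\<in>Basis. F k b (proj x) * dd b x\<bar> = indicator \<Omega> x * J k (proj x)"
        by eventually_elim (simp add: J_def dd_proj)
    qed
    finally have "ennreal \<bar>I k\<bar> \<le> ennreal (DIM('a)) * ennreal (\<integral>x. indicator \<Omega> x * J k (proj x) \<partial>lborel)"
      by (subst ennreal_mult[symmetric]) (auto simp: J_def intro!: integral_nonneg_AE ennreal_leI)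
    \<comment> \<open>Without integrability the Bochner integral is 0, so the inequality holds in
      either case.\<close>
    also have "ennreal (\<integral>x. indicator \<Omega> x * J k (proj x) \<partial>lborel) \<le> (\<integral>\<^sup>+x. ennreal (indicator \<Omega> x * J k (proj x)) \<partial>lborel)"
    proof (cases "integrable lborel (\<lambda>x. indicator \<Omega> x * J k (proj x))")
      case True
      then show ?thesis by (subst nn_integral_eq_integral) (auto simp: J_def)
    qed (simp add: not_integrable_integral_eq)
    also have "\<dots> = (\<integral>\<^sup>+x. ennreal (J k (proj x)) * indicator \<Omega> x \<partial>lborel)"
      by (intro nn_integral_cong) (auto simp: indicator_def)
    also have "\<dots> \<le> ennreal K * (\<integral>\<^sup>+y. ennreal (J k y) \<partial>?S)" by (rule K(2)) measurable
    also have "\<dots> \<le> ennreal K * (ennreal (B / r) * E k)" by (intro mult_left_mono Jle) simp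
    finally have "ennreal \<bar>I k\<bar> \<le> ennreal (DIM('a)) * (ennreal K * (ennreal (B / r) * E k))"
      by (simp add: mult_left_mono)
    also have "\<dots> = ennreal (DIM('a) * K * (B / r)) * E k"
    proof -
      have "ennreal (DIM('a) * K * (B / r)) = ennreal (DIM('a)) * (ennreal K * ennreal (B / r))"
        using K(1) B(1) r0 unfolding mult.assoc by (subst ennreal_mult, simp, simp, subst ennreal_mult) auto
      then show ?thesis by (simp only: mult.assoc)
    qed
    finally show ?thesis .
  qed
  have "(\<lambda>k. ennreal (DIM('a) * K * (B / r)) * E k) \<longlonglongrightarrow> ennreal (DIM('a) * K * (B / r)) * 0"
    by (intro ennreal_tendsto_cmult limE) simp
  then have up: "(\<lambda>k. ennreal (DIM('a) * K * (B / r)) * E k) \<longlonglongrightarrow> 0" by simp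
  have "(\<lambda>k. ennreal \<bar>I k\<bar>) \<longlonglongrightarrow> ennreal \<bar>?I\<bar>" by (intro tendsto_ennrealI tendsto_rabs limI)
  from LIMSEQ_le[OF this up] have "ennreal \<bar>?I\<bar> \<le> 0" using bound by blast
  then show ?thesis by (simp add: w_def)
qed

end

section \<open>The sampling inequality\<close>

lemma L2_nrm_mono:
  assumes "f \<in> L2 \<Omega>" "g \<in> L2 \<Omega>" "\<And>x. \<bar>f x\<bar> \<le> \<bar>g x\<bar>"
  shows "L2_nrm \<Omega> f \<le> L2_nrm \<Omega> g"
  unfolding L2_nrm_def using assms
  by (intro real_sqrt_le_mono integral_mono) (auto simp: L2_def abs_le_square_iff)

lemma L2_indicator:
  assumes A: "A \<in> sets borel" and f: "f \<in> L2 \<Omega>"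
  shows "(\<lambda>x. indicator A x * f x) \<in> L2 \<Omega>"
proof -
  have [measurable]: "f \<in> borel_measurable (lebesgue_on \<Omega>)" using f by (simp add: L2_def)
  have [measurable]: "(indicator A :: _ \<Rightarrow> real) \<in> borel_measurable (lebesgue_on \<Omega>)"
    by (rule measurable_lebesgue_on_borel) (use A in simp)
  have m0: "(\<lambda>x. indicator A x * f x) \<in> borel_measurable (lebesgue_on \<Omega>)" by measurable
  have m: "(\<lambda>x. (indicator A x * f x)\<^sup>2) \<in> borel_measurable (lebesgue_on \<Omega>)" by measurable
  have "integrable (lebesgue_on \<Omega>) (\<lambda>x. (f x)\<^sup>2)" using f by (simp add: L2_def)
  then have "integrable (lebesgue_on \<Omega>) (\<lambda>x. (indicator A x * f x)\<^sup>2)"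
    by (rule Bochner_Integration.integrable_bound[OF _ m]) (simp add: indicator_def)
  with m0 show ?thesis by (simp add: L2_def)
qed

lemma smooth_energy_tendsto:
  assumes \<Omega>: "open \<Omega>" "bounded \<Omega>" and w: "w \<in> H1 \<Omega>" and f: "\<And>k. smooth (f k)"
    and lim: "(\<lambda>k. approx_error \<Omega> w (f k)) \<longlonglongrightarrow> 0"
  shows "(\<lambda>k. smooth_energy \<Omega> (f k)) \<longlonglongrightarrow> (L2_nrm \<Omega> w)\<^sup>2 + (\<Sum>b\<in>Basis. (L2_nrm \<Omega> (weak_partial \<Omega> b w))\<^sup>2)"
  unfolding smooth_energy_def
  by (intro tendsto_add tendsto_sum tendsto_power L2_nrm_tendsto approx_error_L2_tendsto[OF lim] H1_L2 w
      L2_continuous[OF \<Omega>] smoothD(2) smooth_partial_continuous f)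

lemma interior_representative:
  fixes \<Omega> :: "'a::euclidean_space set"
  assumes \<Omega>: "open \<Omega>" "bounded \<Omega>" and d3: "DIM('a) \<le> 3"
  shows "\<exists>C L. C \<ge> 0 \<and> (\<forall>s>0. L s \<ge> 0) \<and> (\<forall>z\<in>H2 \<Omega>. \<exists>u. continuous_on \<Omega> u \<and> (AE x in lebesgue_on \<Omega>. u x = z x) \<and>
      (\<forall>x s. 0 < s \<longrightarrow> s \<le> 1 \<longrightarrow> cball x s \<subseteq> \<Omega> \<longrightarrow>
         \<bar>u x\<bar> \<le> C * sqrt s * L2_nrm \<Omega> (laplacian \<Omega> z) + L s * L2_nrm \<Omega> z) \<and>
      (\<forall>x y s. 0 < s \<longrightarrow> s \<le> 1 \<longrightarrow> cball x s \<subseteq> \<Omega> \<longrightarrow> cball y s \<subseteq> \<Omega> \<longrightarrow>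
         \<bar>u x - u y\<bar> \<le> C * sqrt s * L2_nrm \<Omega> (laplacian \<Omega> z) + L s * norm (x - y) * L2_nrm \<Omega> z))"
proof (rule interior_estimate[OF \<Omega> d3])
  fix C :: real and L :: "real \<Rightarrow> real"
  assume h: "C \<ge> 0" "\<And>s. s > 0 \<Longrightarrow> L s \<ge> 0"
    "\<And>z. z \<in> H2 \<Omega> \<Longrightarrow> \<exists>u. continuous_on \<Omega> u \<and> (AE x in lebesgue_on \<Omega>. u x = z x) \<and>
      (\<forall>x s. 0 < s \<longrightarrow> s \<le> 1 \<longrightarrow> cball x s \<subseteq> \<Omega> \<longrightarrow>
         \<bar>u x\<bar> \<le> C * sqrt s * L2_nrm \<Omega> (laplacian \<Omega> z) + L s * L2_nrm \<Omega> z) \<and>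
      (\<forall>x y s. 0 < s \<longrightarrow> s \<le> 1 \<longrightarrow> cball x s \<subseteq> \<Omega> \<longrightarrow> cball y s \<subseteq> \<Omega> \<longrightarrow>
         \<bar>u x - u y\<bar> \<le> C * sqrt s * L2_nrm \<Omega> (laplacian \<Omega> z) + L s * norm (x - y) * L2_nrm \<Omega> z)"
  show ?thesis by (intro exI[of _ C] exI[of _ L] conjI allI impI ballI h)
qed

context convex_body
begin

lemma H1_approx: "w \<in> H1 \<Omega> \<Longrightarrow> \<exists>f. (\<forall>k. smooth (f k)) \<and> (\<lambda>k. approx_error \<Omega> w (f k)) \<longlonglongrightarrow> 0"
  using trace_op_approx(2) by blast

text \<open>\<open>weak_Neumann\<close> admits only smooth test functions, so z enters as an H1
  limit of such; the limit identity and Cauchy-Schwarz give the bound.\<close>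

lemma H2n_energy:
  assumes z: "z \<in> H2n \<Omega>"
  shows "(\<Sum>b\<in>Basis. (L2_nrm \<Omega> (weak_partial \<Omega> b z))\<^sup>2) \<le> L2_nrm \<Omega> (laplacian \<Omega> z) * L2_nrm \<Omega> z"
proof -
  have z2: "z \<in> H2 \<Omega>" and z1: "z \<in> H1 \<Omega>" using z by (auto simp: H2n_def H2_def)
  obtain f where f: "\<And>k. smooth (f k)" "(\<lambda>k. approx_error \<Omega> z (f k)) \<longlonglongrightarrow> 0" using H1_approx[OF z1] by blast
  have Lz: "z \<in> L2 \<Omega>" "b \<in> Basis \<Longrightarrow> weak_partial \<Omega> b z \<in> L2 \<Omega>"
    "b \<in> Basis \<Longrightarrow> weak_partial \<Omega> b (weak_partial \<Omega> b z) \<in> L2 \<Omega>" for b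
    using z1 z2 by (auto simp: H2_def intro: H1_L2)
  have Lf: "f k \<in> L2 \<Omega>" "b \<in> Basis \<Longrightarrow> partial_deriv b (f k) \<in> L2 \<Omega>" for b k
    using L2_continuous[OF op bdd] smoothD(2)[OF f(1)] smooth_partial_continuous[OF f(1)] by auto
  have "(\<lambda>k. (\<Sum>b\<in>Basis. LINT x|lebesgue_on \<Omega>. partial_deriv b (f k) x * weak_partial \<Omega> b z x)
      + (\<Sum>b\<in>Basis. LINT x|lebesgue_on \<Omega>. f k x * weak_partial \<Omega> b (weak_partial \<Omega> b z) x))
    \<longlonglongrightarrow> (\<Sum>b\<in>Basis. LINT x|lebesgue_on \<Omega>. weak_partial \<Omega> b z x * weak_partial \<Omega> b z x)
      + (\<Sum>b\<in>Basis. LINT x|lebesgue_on \<Omega>. z x * weak_partial \<Omega> b (weak_partial \<Omega> b z) x)"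
    by (intro tendsto_add tendsto_sum L2_inner_tendsto approx_error_L2_tendsto[OF f(2)] Lz Lf)
  moreover have "(\<Sum>b\<in>Basis. LINT x|lebesgue_on \<Omega>. partial_deriv b (f k) x * weak_partial \<Omega> b z x)
      + (\<Sum>b\<in>Basis. LINT x|lebesgue_on \<Omega>. f k x * weak_partial \<Omega> b (weak_partial \<Omega> b z) x) = 0" for k
    using weak_Neumann[OF z f(1)[of k]] by (simp add: mult.commute)
  ultimately have "(\<Sum>b\<in>Basis. LINT x|lebesgue_on \<Omega>. weak_partial \<Omega> b z x * weak_partial \<Omega> b z x)
      + (\<Sum>b\<in>Basis. LINT x|lebesgue_on \<Omega>. z x * weak_partial \<Omega> b (weak_partial \<Omega> b z) x) = 0"
    by (simp add: LIMSEQ_const_iff)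
  moreover have "(\<Sum>b\<in>Basis. LINT x|lebesgue_on \<Omega>. z x * weak_partial \<Omega> b (weak_partial \<Omega> b z) x)
      = (LINT x|lebesgue_on \<Omega>. laplacian \<Omega> z x * z x)"
  proof -
    have "(LINT x|lebesgue_on \<Omega>. laplacian \<Omega> z x * z x)
        = (LINT x|lebesgue_on \<Omega>. (\<Sum>b\<in>Basis. z x * weak_partial \<Omega> b (weak_partial \<Omega> b z) x))"
      by (simp add: laplacian_def sum_distrib_left mult.commute)
    also have "\<dots> = (\<Sum>b\<in>Basis. LINT x|lebesgue_on \<Omega>. z x * weak_partial \<Omega> b (weak_partial \<Omega> b z) x)"
      by (rule Bochner_Integration.integral_sum) (intro L2_mult_integrable Lz)
    finally show ?thesis ..
  qed
  moreover have "(\<Sum>b\<in>Basis. (L2_nrm \<Omega> (weak_partial \<Omega> b z))\<^sup>2)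
      = (\<Sum>b\<in>Basis. LINT x|lebesgue_on \<Omega>. weak_partial \<Omega> b z x * weak_partial \<Omega> b z x)"
    by (simp only: L2_nrm_sq) (simp add: power2_eq_square)
  ultimately show ?thesis using L2_Cauchy_Schwarz[OF H2_laplacian_L2[OF z2] Lz(1)] by linarith
qed

text \<open>\<open>layer_estimate\<close> extends to H1 by density. Then \<open>H2n_energy\<close>
  and 2 p q \<le> p^2 + q^2 trade the gradient for the Laplacian, which doubles the
  constant.\<close>

lemma layer_H2n:
  assumes z: "z \<in> H2n \<Omega>" and e: "0 < e" "e \<le> 1/2"
  shows "(L2_nrm \<Omega> (\<lambda>x. indicator (layer e) x * z x))\<^sup>2
    \<le> e * (4 * real DIM('a) * (1 + R)) * ((L2_nrm \<Omega> (laplacian \<Omega> z))\<^sup>2 + (L2_nrm \<Omega> z)\<^sup>2)"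
proof -
  define k where "k = 2 * real DIM('a) * (1 + R)"
  have k: "k \<ge> 0" using R0 by (simp add: k_def)
  have z1: "z \<in> H1 \<Omega>" using z by (simp add: H2n_def H2_def)
  obtain f where f: "\<And>k. smooth (f k)" "(\<lambda>k. approx_error \<Omega> z (f k)) \<longlonglongrightarrow> 0" using H1_approx[OF z1] by blast
  have Lf: "f j \<in> L2 \<Omega>" for j using L2_continuous[OF op bdd] smoothD(2)[OF f(1)] by blast
  have smooth_case: "(L2_nrm \<Omega> (\<lambda>x. indicator (layer e) x * f j x))\<^sup>2 \<le> e * k * smooth_energy \<Omega> (f j)" for j
  proof -
    have [measurable]: "f j \<in> borel_measurable borel" by (intro borel_measurable_continuous_onI smoothD f)
    have "(L2_nrm \<Omega> (\<lambda>x. indicator (layer e) x * f j x))\<^sup>2 = (\<integral>x. indicator \<Omega> x * (indicator (layer e) x * f j x)\<^sup>2 \<partial>lborel)"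
      unfolding L2_nrm_sq by (rule integral_lebesgue_on[OF op]) measurable
    also have "\<dots> = (\<integral>x. indicator (layer e) x * (f j x)\<^sup>2 \<partial>lborel)"
      by (rule Bochner_Integration.integral_cong) (use layer_subset in \<open>auto simp: indicator_def\<close>)
    also have "\<dots> \<le> e * k * smooth_energy \<Omega> (f j)"
      using layer_estimate[OF f(1) e] by (simp add: k_def smooth_energy_eq[OF op bdd f(1)])
    finally show ?thesis .
  qed
  have d: "(\<lambda>j. L2_nrm \<Omega> (\<lambda>x. indicator (layer e) x * f j x - indicator (layer e) x * z x)) \<longlonglongrightarrow> 0"
  proof (rule tendsto_sandwich[OF _ _ tendsto_const approx_error_L2_tendsto(1)[OF f(2)]])
    have "L2_nrm \<Omega> (\<lambda>x. indicator (layer e) x * f j x - indicator (layer e) x * z x) \<le> L2_nrm \<Omega> (\<lambda>x. f j x - z x)" for j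
    proof (rule L2_nrm_mono)
      show "\<bar>indicator (layer e) x * f j x - indicator (layer e) x * z x\<bar> \<le> \<bar>f j x - z x\<bar>" for x by (simp add: indicator_def)
    qed (intro L2_diff L2_indicator layer_sets Lf H1_L2(1)[OF z1])+
    then show "\<forall>\<^sub>F j in sequentially. L2_nrm \<Omega> (\<lambda>x. indicator (layer e) x * f j x - indicator (layer e) x * z x) \<le> L2_nrm \<Omega> (\<lambda>x. f j x - z x)"
      by simp
  qed (simp add: L2_nrm_nonneg)
  have l1: "(\<lambda>j. (L2_nrm \<Omega> (\<lambda>x. indicator (layer e) x * f j x))\<^sup>2) \<longlonglongrightarrow> (L2_nrm \<Omega> (\<lambda>x. indicator (layer e) x * z x))\<^sup>2"
    by (intro tendsto_power L2_nrm_tendsto L2_indicator layer_sets Lf H1_L2(1)[OF z1] d)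
  have l2: "(\<lambda>j. e * k * smooth_energy \<Omega> (f j)) \<longlonglongrightarrow> e * k * ((L2_nrm \<Omega> z)\<^sup>2 + (\<Sum>b\<in>Basis. (L2_nrm \<Omega> (weak_partial \<Omega> b z))\<^sup>2))"
    by (intro tendsto_mult tendsto_const smooth_energy_tendsto[OF op bdd z1 f])
  have "(L2_nrm \<Omega> (\<lambda>x. indicator (layer e) x * z x))\<^sup>2 \<le> e * k * ((L2_nrm \<Omega> z)\<^sup>2 + (\<Sum>b\<in>Basis. (L2_nrm \<Omega> (weak_partial \<Omega> b z))\<^sup>2))"
    by (rule LIMSEQ_le[OF l1 l2]) (use smooth_case in blast)
  also have "\<dots> \<le> e * k * (2 * ((L2_nrm \<Omega> (laplacian \<Omega> z))\<^sup>2 + (L2_nrm \<Omega> z)\<^sup>2))"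
  proof (rule mult_left_mono)
    have "2 * (L2_nrm \<Omega> (laplacian \<Omega> z) * L2_nrm \<Omega> z) \<le> (L2_nrm \<Omega> (laplacian \<Omega> z))\<^sup>2 + (L2_nrm \<Omega> z)\<^sup>2"
      using sum_squares_bound[of "L2_nrm \<Omega> (laplacian \<Omega> z)" "L2_nrm \<Omega> z"] by (simp add: mult.assoc)
    then have amgm: "2 * (L2_nrm \<Omega> (laplacian \<Omega> z) * L2_nrm \<Omega> z) \<le> (L2_nrm \<Omega> (laplacian \<Omega> z))\<^sup>2 + (L2_nrm \<Omega> z)\<^sup>2"
      "0 \<le> (L2_nrm \<Omega> (laplacian \<Omega> z))\<^sup>2" "0 \<le> (L2_nrm \<Omega> z)\<^sup>2" by simp_all
    show "(L2_nrm \<Omega> z)\<^sup>2 + (\<Sum>b\<in>Basis. (L2_nrm \<Omega> (weak_partial \<Omega> b z))\<^sup>2) \<le> 2 * ((L2_nrm \<Omega> (laplacian \<Omega> z))\<^sup>2 + (L2_nrm \<Omega> z)\<^sup>2)"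
      using H2n_energy[OF z] amgm unfolding distrib_left by linarith
  qed (use e k in auto)
  also have "\<dots> = e * (2 * k) * ((L2_nrm \<Omega> (laplacian \<Omega> z))\<^sup>2 + (L2_nrm \<Omega> z)\<^sup>2)" by (simp only: mult_ac)
  also have "2 * k = 4 * real DIM('a) * (1 + R)" by (simp add: k_def)
  finally show ?thesis .
qed

text \<open>Over the ball the gauge varies by at most s / r \<le> e/2.\<close>

lemma cball_in_\<Omega>:
  assumes "\<rho> x \<le> 1 - e" "e > 0" "s \<le> e * r / 2"
  shows "cball x s \<subseteq> \<Omega>"
proof
  fix y assume "y \<in> cball x s"
  then have "norm (y - x) / r \<le> s / r" using r0 by (simp add: dist_norm norm_minus_commute divide_right_mono)
  also have "\<dots> \<le> e / 2" using assms r0 by (simp add: field_simps)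
  finally show "y \<in> \<Omega>" using \<rho>_lipschitz[of y x] assms unfolding in_\<Omega>_iff by linarith
qed

text \<open>Only the subdomains away from the boundary are compared with their sample values. The others
  lie in a thin layer, where the function itself is small in mean square.\<close>

theorem sampling_inequality:
  assumes d3: "DIM('a) \<le> 3" and \<theta>: "\<theta> > 0"
  shows "\<exists>H0>0. \<forall>c H \<T> p. 0 < H \<and> H \<le> H0 \<and> quasi_uniform_partition c H \<Omega> \<T> \<and> (\<forall>T\<in>\<T>. p T \<in> T) \<longrightarrow>
    (\<forall>z\<in>H2n \<Omega>. (L2_nrm \<Omega> z)\<^sup>2 \<le> 2 * (\<Sum>T\<in>\<T>. measure lebesgue T * (point_value \<Omega> z (p T))\<^sup>2)
      + \<theta> * ((L2_nrm \<Omega> (laplacian \<Omega> z))\<^sup>2 + (L2_nrm \<Omega> z)\<^sup>2))"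
proof -
  obtain C L where C: "C \<ge> 0" and L: "\<And>s. s > 0 \<Longrightarrow> L s \<ge> (0::real)"
    and rep: "\<And>z. z \<in> H2 \<Omega> \<Longrightarrow> \<exists>u. continuous_on \<Omega> u \<and> (AE x in lebesgue_on \<Omega>. u x = z x) \<and>
      (\<forall>x s. 0 < s \<longrightarrow> s \<le> 1 \<longrightarrow> cball x s \<subseteq> \<Omega> \<longrightarrow>
         \<bar>u x\<bar> \<le> C * sqrt s * L2_nrm \<Omega> (laplacian \<Omega> z) + L s * L2_nrm \<Omega> z) \<and>
      (\<forall>x y s. 0 < s \<longrightarrow> s \<le> 1 \<longrightarrow> cball x s \<subseteq> \<Omega> \<longrightarrow> cball y s \<subseteq> \<Omega> \<longrightarrow>
         \<bar>u x - u y\<bar> \<le> C * sqrt s * L2_nrm \<Omega> (laplacian \<Omega> z) + L s * norm (x - y) * L2_nrm \<Omega> z)"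
    using interior_representative[OF op bdd d3] by blast
  have lm: "\<Omega> \<in> lmeasurable" by (rule lmeasurable_open[OF bdd op])
  define V where "V = measure (lebesgue_on \<Omega>) \<Omega>"
  have V0: "V \<ge> 0" by (simp add: V_def)
  define k where "k = 4 * real DIM('a) * (1 + R)"
  have k: "k > 0" using R0 by (simp add: k_def)
  \<comment> \<open>Layer thickness: \<open>layer_H2n\<close> at 2 e costs 2 e k \<le> \<theta>/2,
    half of the allowed error. The bound 1/4 keeps 2 e within the range of that lemma.\<close>
  define e where "e = min (1/4) (\<theta> / (4 * k))"
  have e: "0 < e" "2 * e \<le> 1/2" "2 * e * k \<le> \<theta> / 2"
  proof -
    show "0 < e" "2 * e \<le> 1/2" using \<theta> k by (auto simp: e_def)
    have "2 * e * k \<le> 2 * (\<theta> / (4 * k)) * k" using k by (intro mult_right_mono mult_left_mono) (auto simp: e_def)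
    then show "2 * e * k \<le> \<theta> / 2" using k by simp
  qed
  \<comment> \<open>Scale of the interior estimate: balls of radius s around points of level at most
    1 - e stay in \<Omega>, and the Laplacian part of the oscillation costs at most
    \<theta>/2.\<close>
  define s where "s = min (min 1 (e * r / 2)) (\<theta> / (8 * (V * C\<^sup>2 + 1)))"
  have VC: "V * C\<^sup>2 \<ge> 0" using V0 by simp
  have s: "0 < s" "s \<le> 1" "s \<le> e * r / 2" "4 * V * C\<^sup>2 * s \<le> \<theta> / 2"
  proof -
    show "0 < s" using \<theta> e r0 VC by (auto simp: s_def add_nonneg_pos)
    show "s \<le> 1" "s \<le> e * r / 2" unfolding s_def by (rule min.coboundedI1, simp)+
    have "4 * V * C\<^sup>2 * s \<le> 4 * (V * C\<^sup>2 + 1) * s" using \<open>0 < s\<close> by (simp add: mult.assoc)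
    also have "\<dots> \<le> 4 * (V * C\<^sup>2 + 1) * (\<theta> / (8 * (V * C\<^sup>2 + 1)))"
      using VC by (intro mult_left_mono) (auto simp: s_def)
    also have "\<dots> = \<theta> / 2"
    proof -
      have "q \<noteq> 0 \<Longrightarrow> 4 * q * (\<theta> / (8 * q)) = \<theta> / 2" for q by simp
      moreover have "V * C\<^sup>2 + 1 \<noteq> 0" using VC by linarith
      ultimately show ?thesis by blast
    qed
    finally show "4 * V * C\<^sup>2 * s \<le> \<theta> / 2" .
  qed
  \<comment> \<open>Dominates the coefficient of H^2 in the other part of the oscillation, which is
    known once s is fixed; the 1 keeps l positive.\<close>
  define l where "l = 16 * V * (L s)\<^sup>2 + 1"
  have l: "l > 0" using V0 by (simp add: l_def add_nonneg_pos)
  \<comment> \<open>H \<le> 1 bounds H^2 by H, and 2 H \<le> e r ensures that a subdomain reaching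
    above level 1 - e stays at levels at least 1 - 2 e.\<close>
  define H0 where "H0 = min (min 1 (\<theta> / (2 * l))) (e * r / 2)"
  have H0: "H0 > 0" using \<theta> l e r0 by (simp add: H0_def)
  have "(L2_nrm \<Omega> z)\<^sup>2 \<le> 2 * (\<Sum>T\<in>\<T>. measure lebesgue T * (point_value \<Omega> z (p T))\<^sup>2)
      + \<theta> * ((L2_nrm \<Omega> (laplacian \<Omega> z))\<^sup>2 + (L2_nrm \<Omega> z)\<^sup>2)"
    if H: "0 < H" "H \<le> H0" and part: "quasi_uniform_partition c H \<Omega> \<T>" and p: "\<And>T. T \<in> \<T> \<Longrightarrow> p T \<in> T" and z: "z \<in> H2n \<Omega>"
    for c H \<T> p z
  proof -
    have z2: "z \<in> H2 \<Omega>" and Lz: "z \<in> L2 \<Omega>" using z by (auto simp: H2n_def H2_def intro: H1_L2)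
    obtain u where u: "continuous_on \<Omega> u" "AE x in lebesgue_on \<Omega>. u x = z x"
      and osc: "\<And>x y. cball x s \<subseteq> \<Omega> \<Longrightarrow> cball y s \<subseteq> \<Omega> \<Longrightarrow>
         \<bar>u x - u y\<bar> \<le> C * sqrt s * L2_nrm \<Omega> (laplacian \<Omega> z) + L s * norm (x - y) * L2_nrm \<Omega> z"
      using rep[OF z2] s(1,2) by blast
    have fin: "finite \<T>" and neg: "negligible (\<Omega> - \<Union>\<T>)" and TO: "\<And>T. T \<in> \<T> \<Longrightarrow> T \<subseteq> \<Omega>" and opT: "\<And>T. T \<in> \<T> \<Longrightarrow> open T"
      and small: "\<And>T. T \<in> \<T> \<Longrightarrow> \<exists>y. T \<subseteq> ball y H"
      using part by (auto simp: quasi_uniform_partition_def)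
    have dT: "norm (x - y) \<le> 2 * H" if T: "T \<in> \<T>" "x \<in> T" "y \<in> T" for T x y
    proof -
      obtain q where "T \<subseteq> ball q H" using small[OF T(1)] by blast
      then have "dist q x < H" "dist q y < H" using T by auto
      then show ?thesis using dist_triangle3[of x y q] by (simp add: dist_norm)
    qed
    \<comment> \<open>Bound for the oscillation of u between two points of one subdomain that stays
      below level 1 - e.\<close>
    define \<omega> where "\<omega> = C * sqrt s * L2_nrm \<Omega> (laplacian \<Omega> z) + L s * (2 * H) * L2_nrm \<Omega> z"
    have \<omega>: "2 * V * \<omega>\<^sup>2 \<le> \<theta> / 2 * ((L2_nrm \<Omega> (laplacian \<Omega> z))\<^sup>2 + (L2_nrm \<Omega> z)\<^sup>2)"
    proof -
      have "H \<le> 1" "H \<le> \<theta> / (2 * l)" using H by (auto simp: H0_def)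
      then have "H * H \<le> 1 * (\<theta> / (2 * l))" using H by (intro mult_mono) auto
      then have "l * H\<^sup>2 \<le> \<theta> / 2" using l by (simp add: field_simps power2_eq_square)
      moreover have "16 * V * (L s)\<^sup>2 * H\<^sup>2 \<le> l * H\<^sup>2" by (intro mult_right_mono) (auto simp: l_def)
      ultimately have h: "16 * V * (L s)\<^sup>2 * H\<^sup>2 \<le> \<theta> / 2" by linarith
      have "\<omega>\<^sup>2 \<le> 2 * (C * sqrt s * L2_nrm \<Omega> (laplacian \<Omega> z))\<^sup>2 + 2 * (L s * (2 * H) * L2_nrm \<Omega> z)\<^sup>2"
        unfolding \<omega>_def using C L[OF s(1)] s(1) H by (intro power2_triangle add_nonneg_nonneg mult_nonneg_nonneg L2_nrm_nonneg) auto
      then have "2 * V * \<omega>\<^sup>2 \<le> 2 * V * (2 * (C * sqrt s * L2_nrm \<Omega> (laplacian \<Omega> z))\<^sup>2 + 2 * (L s * (2 * H) * L2_nrm \<Omega> z)\<^sup>2)"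
        using V0 by (intro mult_left_mono) auto
      also have "\<dots> = (4 * V * C\<^sup>2 * s) * (L2_nrm \<Omega> (laplacian \<Omega> z))\<^sup>2 + (16 * V * (L s)\<^sup>2 * H\<^sup>2) * (L2_nrm \<Omega> z)\<^sup>2"
        using s(1) by (simp add: power_mult_distrib algebra_simps)
      also have "\<dots> \<le> \<theta> / 2 * (L2_nrm \<Omega> (laplacian \<Omega> z))\<^sup>2 + \<theta> / 2 * (L2_nrm \<Omega> z)\<^sup>2"
        by (intro add_mono mult_right_mono s(4) h) auto
      finally show ?thesis by (simp add: algebra_simps)
    qed
    \<comment> \<open>Subdomains reaching above level 1 - e lie in the layer, where the last term
      alone suffices; on the others the sample controls u up to \<omega>. One inequality covers both
      because all terms are nonnegative.\<close>
    have pw: "(u x)\<^sup>2 \<le> (2 * (u (p T))\<^sup>2 + 2 * \<omega>\<^sup>2) + (indicator (layer (2 * e)) x * u x)\<^sup>2" if T: "T \<in> \<T>" "x \<in> T" for T x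
    proof (cases "\<exists>y\<in>T. \<rho> y > 1 - e")
      case True
      then obtain y where y: "y \<in> T" "\<rho> y > 1 - e" by blast
      have "norm (y - x) / r \<le> e"
      proof -
        have "norm (y - x) \<le> e * r" using dT[OF T(1) y(1) T(2)] H(2) by (simp add: H0_def)
        then show ?thesis using r0 by (simp add: field_simps)
      qed
      then have "\<rho> x \<ge> 1 - 2 * e" using \<rho>_lipschitz[of y x] y(2) by linarith
      moreover have "\<rho> x < 1" using TO T in_\<Omega>_iff by blast
      ultimately have "x \<in> layer (2 * e)" by (simp add: layer_def)
      then show ?thesis by simp
    next
      case False
      then have g: "\<rho> x \<le> 1 - e" "\<rho> (p T) \<le> 1 - e" using T p by (auto simp: not_less)
      have "\<bar>u x - u (p T)\<bar> \<le> C * sqrt s * L2_nrm \<Omega> (laplacian \<Omega> z) + L s * norm (x - p T) * L2_nrm \<Omega> z"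
        by (intro osc cball_in_\<Omega>[OF g(1) e(1) s(3)] cball_in_\<Omega>[OF g(2) e(1) s(3)])
      also have "\<dots> \<le> \<omega>"
        unfolding \<omega>_def using dT[OF T p[OF T(1)]] L[OF s(1)] L2_nrm_nonneg[of \<Omega> z]
        by (intro add_left_mono mult_right_mono mult_left_mono) auto
      finally have "\<bar>u x\<bar> \<le> \<bar>u (p T)\<bar> + \<omega>" by linarith
      from power2_triangle[OF abs_ge_zero this] have "(u x)\<^sup>2 \<le> 2 * (u (p T))\<^sup>2 + 2 * \<omega>\<^sup>2" by simp
      moreover have "0 \<le> (indicator (layer (2 * e)) x * u x)\<^sup>2" by simp
      ultimately show ?thesis by linarith
    qed
    let ?g = "\<lambda>x. (\<Sum>T\<in>\<T>. indicator T x * (2 * (u (p T))\<^sup>2)) + 2 * \<omega>\<^sup>2 + (indicator (layer (2 * e)) x * z x)\<^sup>2"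
    interpret fm: finite_measure "lebesgue_on \<Omega>" by (rule finite_measure_lebesgue_on[OF lm])
    have ms: "measure (lebesgue_on \<Omega>) T = measure lebesgue T" "T \<in> sets (lebesgue_on \<Omega>)" if "T \<in> \<T>" for T
    proof -
      have "T \<in> sets lebesgue" using opT[OF that] by simp
      then show "T \<in> sets (lebesgue_on \<Omega>)" using TO[OF that] lm by (simp add: sets_restrict_space_iff fmeasurableD)
      show "measure (lebesgue_on \<Omega>) T = measure lebesgue T"
        using TO[OF that] lm by (intro measure_restrict_space) (auto simp: fmeasurableD)
    qed
    have iT: "integrable (lebesgue_on \<Omega>) (\<lambda>x. indicator T x * (2 * (u (p T))\<^sup>2))" if "T \<in> \<T>" for T
      using ms(2)[OF that] by (intro integrable_mult_left integrable_real_indicator) (simp_all add: fm.emeasure_eq_measure)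
    have iL: "integrable (lebesgue_on \<Omega>) (\<lambda>x. (indicator (layer (2 * e)) x * z x)\<^sup>2)"
      using L2_indicator[OF layer_sets Lz] by (simp add: L2_def)
    have isum: "integrable (lebesgue_on \<Omega>) (\<lambda>x. \<Sum>T\<in>\<T>. indicator T x * (2 * (u (p T))\<^sup>2))"
      by (intro Bochner_Integration.integrable_sum iT)
    have ic: "integrable (lebesgue_on \<Omega>) (\<lambda>x. 2 * \<omega>\<^sup>2)" by simp
    have ae: "AE x in lebesgue_on \<Omega>. (z x)\<^sup>2 \<le> ?g x"
    proof -
      have "AE x in lebesgue. x \<notin> \<Omega> - \<Union>\<T>" using neg by (intro AE_not_in) (simp add: negligible_iff_null_sets)
      then have "AE x in lebesgue. x \<in> \<Omega> \<longrightarrow> x \<in> \<Union>\<T>" by eventually_elim blast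
      then have "AE x in lebesgue_on \<Omega>. x \<in> \<Union>\<T>"
        using lm by (subst AE_restrict_space_iff) (simp_all add: fmeasurableD)
      with u(2) show ?thesis
      proof eventually_elim
        case (elim x)
        then obtain T where T: "T \<in> \<T>" "x \<in> T" by blast
        have "2 * (u (p T))\<^sup>2 = indicator T x * (2 * (u (p T))\<^sup>2)" using T by simp
        also have "\<dots> \<le> (\<Sum>T\<in>\<T>. indicator T x * (2 * (u (p T))\<^sup>2))"
          by (rule member_le_sum[OF T(1) _ fin]) simp
        finally show ?case using pw[OF T] elim(1) by simp
      qed
    qed
    have "(L2_nrm \<Omega> z)\<^sup>2 \<le> (LINT x|lebesgue_on \<Omega>. ?g x)"
      unfolding L2_nrm_sq using Lz
      by (intro integral_mono_AE Bochner_Integration.integrable_add isum ic iL ae) (simp add: L2_def)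
    also have "\<dots> = (LINT x|lebesgue_on \<Omega>. (\<Sum>T\<in>\<T>. indicator T x * (2 * (u (p T))\<^sup>2))) + (LINT x|lebesgue_on \<Omega>. 2 * \<omega>\<^sup>2)
        + (LINT x|lebesgue_on \<Omega>. (indicator (layer (2 * e)) x * z x)\<^sup>2)"
      using isum ic iL by (simp only: Bochner_Integration.integral_add Bochner_Integration.integrable_add)
    also have "(LINT x|lebesgue_on \<Omega>. (\<Sum>T\<in>\<T>. indicator T x * (2 * (u (p T))\<^sup>2))) = 2 * (\<Sum>T\<in>\<T>. measure lebesgue T * (point_value \<Omega> z (p T))\<^sup>2)"
    proof -
      have "(LINT x|lebesgue_on \<Omega>. (\<Sum>T\<in>\<T>. indicator T x * (2 * (u (p T))\<^sup>2))) = (\<Sum>T\<in>\<T>. LINT x|lebesgue_on \<Omega>. indicator T x * (2 * (u (p T))\<^sup>2))"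
        by (rule Bochner_Integration.integral_sum[OF iT])
      also have "\<dots> = (\<Sum>T\<in>\<T>. 2 * (measure lebesgue T * (point_value \<Omega> z (p T))\<^sup>2))"
      proof (rule sum.cong[OF refl])
        fix T assume T: "T \<in> \<T>"
        have "point_value \<Omega> z (p T) = u (p T)" using TO[OF T] p[OF T] by (intro point_value_eq[OF op u]) blast
        moreover have "T \<inter> \<Omega> = T" using TO[OF T] by blast
        ultimately show "(LINT x|lebesgue_on \<Omega>. indicator T x * (2 * (u (p T))\<^sup>2)) = 2 * (measure lebesgue T * (point_value \<Omega> z (p T))\<^sup>2)"
          using ms[OF T] by simp
      qed
      finally show ?thesis by (simp add: sum_distrib_left)
    qed
    also have "(LINT x|lebesgue_on \<Omega>. 2 * \<omega>\<^sup>2) = 2 * V * \<omega>\<^sup>2" by (simp add: V_def)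
    also have "(LINT x|lebesgue_on \<Omega>. (indicator (layer (2 * e)) x * z x)\<^sup>2) = (L2_nrm \<Omega> (\<lambda>x. indicator (layer (2 * e)) x * z x))\<^sup>2"
      by (simp add: L2_nrm_sq)
    finally have *: "(L2_nrm \<Omega> z)\<^sup>2 \<le> 2 * (\<Sum>T\<in>\<T>. measure lebesgue T * (point_value \<Omega> z (p T))\<^sup>2) + 2 * V * \<omega>\<^sup>2
        + (L2_nrm \<Omega> (\<lambda>x. indicator (layer (2 * e)) x * z x))\<^sup>2" .
    have "(L2_nrm \<Omega> (\<lambda>x. indicator (layer (2 * e)) x * z x))\<^sup>2 \<le> 2 * e * k * ((L2_nrm \<Omega> (laplacian \<Omega> z))\<^sup>2 + (L2_nrm \<Omega> z)\<^sup>2)"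
      unfolding k_def using layer_H2n[OF z, of "2 * e"] e by simp
    also have "\<dots> \<le> \<theta> / 2 * ((L2_nrm \<Omega> (laplacian \<Omega> z))\<^sup>2 + (L2_nrm \<Omega> z)\<^sup>2)"
      by (rule mult_right_mono[OF e(3)]) simp
    finally have "2 * V * \<omega>\<^sup>2 + (L2_nrm \<Omega> (\<lambda>x. indicator (layer (2 * e)) x * z x))\<^sup>2
        \<le> \<theta> * ((L2_nrm \<Omega> (laplacian \<Omega> z))\<^sup>2 + (L2_nrm \<Omega> z)\<^sup>2)" using \<omega> by (simp add: algebra_simps)
    then show ?thesis using * by linarith
  qed
  note main = this
  show ?thesis
    by (intro exI[of _ H0] conjI H0 allI impI ballI, elim conjE, rule main) blast+
qed

end

section \<open>The feedback functional\<close>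

lemma L2_nrm_le_H2_nrm:
  fixes z :: "'a::euclidean_space \<Rightarrow> real"
  shows "L2_nrm \<Omega> z \<le> H2_nrm \<Omega> z"
    and "z \<in> H2 \<Omega> \<Longrightarrow> L2_nrm \<Omega> (laplacian \<Omega> z) \<le> DIM('a) * H2_nrm \<Omega> z"
proof -
  show "L2_nrm \<Omega> z \<le> H2_nrm \<Omega> z"
    unfolding H2_nrm_def by (rule real_le_rsqrt) (auto intro!: sum_nonneg add_nonneg_nonneg simp: add.assoc)
  assume z: "z \<in> H2 \<Omega>"
  have "L2_nrm \<Omega> (weak_partial \<Omega> b (weak_partial \<Omega> b z)) \<le> H2_nrm \<Omega> z" if b: "b \<in> Basis" for b
    unfolding H2_nrm_def
  proof (rule real_le_rsqrt)
    let ?q = "\<lambda>b c. (L2_nrm \<Omega> (weak_partial \<Omega> c (weak_partial \<Omega> b z)))\<^sup>2"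
    have "?q b b \<le> (\<Sum>c\<in>Basis. ?q b c)" by (rule member_le_sum[OF b]) auto
    also have "\<dots> \<le> (\<Sum>b\<in>Basis. \<Sum>c\<in>Basis. ?q b c)" by (rule member_le_sum[OF b]) (auto simp: sum_nonneg)
    finally have "?q b b \<le> (\<Sum>b\<in>Basis. \<Sum>c\<in>Basis. ?q b c)" .
    moreover have "0 \<le> (\<Sum>b\<in>Basis. (L2_nrm \<Omega> (weak_partial \<Omega> b z))\<^sup>2)" by (intro sum_nonneg) simp
    moreover have "0 \<le> (L2_nrm \<Omega> z)\<^sup>2" by simp
    ultimately show "?q b b \<le> (L2_nrm \<Omega> z)\<^sup>2 + (\<Sum>b\<in>Basis. (L2_nrm \<Omega> (weak_partial \<Omega> b z))\<^sup>2) + (\<Sum>b\<in>Basis. \<Sum>c\<in>Basis. ?q b c)"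
      by linarith
  qed
  then have "(\<Sum>b\<in>Basis. L2_nrm \<Omega> (weak_partial \<Omega> b (weak_partial \<Omega> b z))) \<le> (\<Sum>b\<in>(Basis::'a set). H2_nrm \<Omega> z)"
    by (rule sum_mono)
  moreover have "L2_nrm \<Omega> (laplacian \<Omega> z) \<le> (\<Sum>b\<in>Basis. L2_nrm \<Omega> (weak_partial \<Omega> b (weak_partial \<Omega> b z)))"
    unfolding laplacian_def[abs_def] using z by (intro L2_nrm_sum_le) (auto simp: H2_def intro: H1_L2(2))
  ultimately show "L2_nrm \<Omega> (laplacian \<Omega> z) \<le> DIM('a) * H2_nrm \<Omega> z" by simp
qed

text \<open>Sums and multiples of continuous representatives are again continuous representatives;
  the interior estimate at one scale fitting into \<Omega> around x bounds the value.\<close>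

lemma point_value_H2:
  fixes \<Omega> :: "'a::euclidean_space set"
  assumes \<Omega>: "open \<Omega>" "bounded \<Omega>" and d3: "DIM('a) \<le> 3" and x: "x \<in> \<Omega>"
  shows "u \<in> H2 \<Omega> \<Longrightarrow> v \<in> H2 \<Omega> \<Longrightarrow> point_value \<Omega> (\<lambda>y. u y + v y) x = point_value \<Omega> u x + point_value \<Omega> v x"
    and "u \<in> H2 \<Omega> \<Longrightarrow> point_value \<Omega> (\<lambda>y. t * u y) x = t * point_value \<Omega> u x"
    and "\<exists>K. \<forall>u\<in>H2 \<Omega>. \<bar>point_value \<Omega> u x\<bar> \<le> K * H2_nrm \<Omega> u"
proof -
  obtain C L where C: "C \<ge> 0" and L: "\<And>s. s > 0 \<Longrightarrow> L s \<ge> (0::real)"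
    and rep: "\<And>z. z \<in> H2 \<Omega> \<Longrightarrow> \<exists>u. continuous_on \<Omega> u \<and> (AE x in lebesgue_on \<Omega>. u x = z x) \<and>
      (\<forall>x s. 0 < s \<longrightarrow> s \<le> 1 \<longrightarrow> cball x s \<subseteq> \<Omega> \<longrightarrow>
         \<bar>u x\<bar> \<le> C * sqrt s * L2_nrm \<Omega> (laplacian \<Omega> z) + L s * L2_nrm \<Omega> z) \<and>
      (\<forall>x y s. 0 < s \<longrightarrow> s \<le> 1 \<longrightarrow> cball x s \<subseteq> \<Omega> \<longrightarrow> cball y s \<subseteq> \<Omega> \<longrightarrow>
         \<bar>u x - u y\<bar> \<le> C * sqrt s * L2_nrm \<Omega> (laplacian \<Omega> z) + L s * norm (x - y) * L2_nrm \<Omega> z)"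
    using interior_representative[OF \<Omega> d3] by blast
  show "point_value \<Omega> (\<lambda>y. u y + v y) x = point_value \<Omega> u x + point_value \<Omega> v x" if uv: "u \<in> H2 \<Omega>" "v \<in> H2 \<Omega>"
  proof -
    obtain u' v' where u': "continuous_on \<Omega> u'" "AE x in lebesgue_on \<Omega>. u' x = u x"
      and v': "continuous_on \<Omega> v'" "AE x in lebesgue_on \<Omega>. v' x = v x" using rep[OF uv(1)] rep[OF uv(2)] by blast
    have "AE y in lebesgue_on \<Omega>. u' y + v' y = u y + v y" using u'(2) v'(2) by eventually_elim simp
    then show ?thesis
      using point_value_eq[OF \<Omega>(1) continuous_on_add[OF u'(1) v'(1)] _ x] point_value_eq[OF \<Omega>(1) u' x] point_value_eq[OF \<Omega>(1) v' x] by simp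
  qed
  show "point_value \<Omega> (\<lambda>y. t * u y) x = t * point_value \<Omega> u x" if u: "u \<in> H2 \<Omega>"
  proof -
    obtain u' where u': "continuous_on \<Omega> u'" "AE x in lebesgue_on \<Omega>. u' x = u x" using rep[OF u] by blast
    have "AE y in lebesgue_on \<Omega>. t * u' y = t * u y" using u'(2) by eventually_elim simp
    then show ?thesis
      using point_value_eq[OF \<Omega>(1) continuous_on_mult_left[OF u'(1)] _ x] point_value_eq[OF \<Omega>(1) u' x] by simp
  qed
  obtain s0 where s0: "s0 > 0" "cball x s0 \<subseteq> \<Omega>" using \<Omega>(1) x open_contains_cball by blast
  define s where "s = min 1 s0"
  have s: "0 < s" "s \<le> 1" "cball x s \<subseteq> \<Omega>" using s0 by (auto simp: s_def)
  show "\<exists>K. \<forall>u\<in>H2 \<Omega>. \<bar>point_value \<Omega> u x\<bar> \<le> K * H2_nrm \<Omega> u"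
  proof (intro exI ballI)
    fix u assume u: "u \<in> H2 \<Omega>"
    obtain u' where u': "continuous_on \<Omega> u'" "AE x in lebesgue_on \<Omega>. u' x = u x"
      and b: "\<bar>u' x\<bar> \<le> C * sqrt s * L2_nrm \<Omega> (laplacian \<Omega> u) + L s * L2_nrm \<Omega> u" using rep[OF u] s by blast
    have "point_value \<Omega> u x = u' x" by (rule point_value_eq[OF \<Omega>(1) u' x])
    moreover have "C * sqrt s * L2_nrm \<Omega> (laplacian \<Omega> u) + L s * L2_nrm \<Omega> u
        \<le> C * sqrt s * (DIM('a) * H2_nrm \<Omega> u) + L s * H2_nrm \<Omega> u"
      using C s(1) L[OF s(1)] by (intro add_mono mult_left_mono L2_nrm_le_H2_nrm u) auto
    ultimately show "\<bar>point_value \<Omega> u x\<bar> \<le> (C * sqrt s * DIM('a) + L s) * H2_nrm \<Omega> u"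
      using b by (simp add: algebra_simps)
  qed
qed

lemma feedback_in_dual:
  fixes \<Omega> :: "'a::euclidean_space set"
  assumes \<Omega>: "open \<Omega>" "bounded \<Omega>" and d3: "DIM('a) \<le> 3" and p: "\<And>T. T \<in> \<T> \<Longrightarrow> p T \<in> \<Omega>"
  shows "feedback \<Omega> lam \<T> p z \<in> H2n_dual \<Omega>"
  unfolding H2n_dual_def
proof (intro CollectI conjI allI ballI)
  note pv = point_value_H2[OF \<Omega> d3 p]
  have sub: "u \<in> H2 \<Omega>" if "u \<in> H2n \<Omega>" for u using that by (simp add: H2n_def)
  let ?m = "\<lambda>T. measure lebesgue T * point_value \<Omega> z (p T)"
  show "feedback \<Omega> lam \<T> p z (\<lambda>x. u x + v x) = feedback \<Omega> lam \<T> p z u + feedback \<Omega> lam \<T> p z v" if "u \<in> H2n \<Omega>" "v \<in> H2n \<Omega>" for u v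
  proof -
    have "(\<Sum>T\<in>\<T>. ?m T * point_value \<Omega> (\<lambda>x. u x + v x) (p T)) = (\<Sum>T\<in>\<T>. ?m T * point_value \<Omega> u (p T) + ?m T * point_value \<Omega> v (p T))"
      by (intro sum.cong refl) (simp add: pv(1) sub that distrib_left)
    then show ?thesis by (simp add: feedback_def sum.distrib distrib_left)
  qed
  show "feedback \<Omega> lam \<T> p z (\<lambda>x. t * u x) = t * feedback \<Omega> lam \<T> p z u" if "u \<in> H2n \<Omega>" for t u
  proof -
    have "(\<Sum>T\<in>\<T>. ?m T * point_value \<Omega> (\<lambda>x. t * u x) (p T)) = (\<Sum>T\<in>\<T>. t * (?m T * point_value \<Omega> u (p T)))"
      by (intro sum.cong refl) (simp add: pv(2) sub that)
    then show ?thesis by (simp add: feedback_def sum_distrib_left mult_ac)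
  qed
  have "\<forall>T\<in>\<T>. \<exists>K. \<forall>u\<in>H2 \<Omega>. \<bar>point_value \<Omega> u (p T)\<bar> \<le> K * H2_nrm \<Omega> u" using pv(3) by blast
  from bchoice[OF this] obtain K where K: "\<forall>T\<in>\<T>. \<forall>u\<in>H2 \<Omega>. \<bar>point_value \<Omega> u (p T)\<bar> \<le> K T * H2_nrm \<Omega> u" ..
  show "\<exists>C. \<forall>u\<in>H2n \<Omega>. \<bar>feedback \<Omega> lam \<T> p z u\<bar> \<le> C * H2_nrm \<Omega> u"
  proof (intro exI ballI)
    fix u assume u: "u \<in> H2n \<Omega>"
    have "\<bar>\<Sum>T\<in>\<T>. ?m T * point_value \<Omega> u (p T)\<bar> \<le> (\<Sum>T\<in>\<T>. \<bar>?m T\<bar> * (K T * H2_nrm \<Omega> u))"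
    proof (rule order_trans[OF sum_abs sum_mono])
      fix T assume "T \<in> \<T>"
      then show "\<bar>?m T * point_value \<Omega> u (p T)\<bar> \<le> \<bar>?m T\<bar> * (K T * H2_nrm \<Omega> u)"
        unfolding abs_mult[of "?m T"] using K sub[OF u] by (intro mult_left_mono) auto
    qed
    then have "\<bar>lam\<bar> * \<bar>\<Sum>T\<in>\<T>. ?m T * point_value \<Omega> u (p T)\<bar> \<le> \<bar>lam\<bar> * (\<Sum>T\<in>\<T>. \<bar>?m T\<bar> * (K T * H2_nrm \<Omega> u))"
      by (rule mult_left_mono) simp
    then show "\<bar>feedback \<Omega> lam \<T> p z u\<bar> \<le> (\<bar>lam\<bar> * (\<Sum>T\<in>\<T>. \<bar>?m T\<bar> * K T)) * H2_nrm \<Omega> u"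
      by (simp only: feedback_def abs_mult[of lam] sum_distrib_right mult.assoc)
  qed
qed

theorem mainTheorem6:
  fixes \<Omega> :: "(real ^ 'n) set" and \<nu> R c :: real
  assumes "CARD('n) \<le> 3"
    and "open \<Omega>" and "\<Omega> \<noteq> {}" and "bounded \<Omega>" and "convex \<Omega>"
    and "\<nu> > 0" and "R > 0" and "c > 0"
  shows "\<forall>\<gamma>>0. \<forall>lam \<ge> 2 * (C_star R \<nu> + \<gamma>). \<exists>H\<^sub>0>0.
    \<forall>H \<T> p. 0 < H \<and> H \<le> H\<^sub>0 \<and> quasi_uniform_partition c H \<Omega> \<T> \<and> (\<forall>T\<in>\<T>. p T \<in> T) \<longrightarrow>
      (\<forall>z\<in>H2n \<Omega>. feedback \<Omega> lam \<T> p z \<in> H2n_dual \<Omega>) \<and>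
      (\<forall>z\<in>H2n \<Omega>. \<nu> * (L2_nrm \<Omega> (laplacian \<Omega> z))\<^sup>2 + 2 * feedback \<Omega> lam \<T> p z z
                   \<ge> (C_star R \<nu> + \<gamma>) * (L2_nrm \<Omega> z)\<^sup>2)"
proof (intro allI impI)
  fix \<gamma> lam :: real assume \<gamma>: "\<gamma> > 0" and lam: "lam \<ge> 2 * (C_star R \<nu> + \<gamma>)"
  have d3: "DIM(real ^ 'n) \<le> 3" using assms(1) by simp
  define M where "M = C_star R \<nu> + \<gamma>"
  have "C_star R \<nu> > 0" unfolding C_star_def using assms(6) by (intro add_nonneg_pos mult_nonneg_nonneg add_nonneg_nonneg) auto
  then have M: "M > 0" using \<gamma> by (simp add: M_def)
  \<comment> \<open>After multiplication by 2 M the error terms are at most \<nu> times the squared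
    norm of the Laplacian and M times that of z; the latter is absorbed by half of the left
    side.\<close>
  define \<theta> where "\<theta> = min \<nu> M / (2 * M)"
  have \<theta>: "\<theta> > 0" "2 * M * \<theta> \<le> \<nu>" "2 * M * \<theta> \<le> M" using M assms(6) by (auto simp: \<theta>_def)
  obtain a where a: "a \<in> \<Omega>" using assms(3) by blast
  obtain r where r: "r > 0" "cball a r \<subseteq> \<Omega>" using assms(2) a open_contains_cball by blast
  obtain q where q: "\<Omega> \<subseteq> ball a q" using bounded_subset_ballD[OF assms(4)] by blast
  interpret convex_body \<Omega> a r q
    by unfold_locales (use assms(2,5) r q in auto)
  obtain H0 where H0: "H0 > 0" and smp: "\<forall>c H \<T> p. 0 < H \<and> H \<le> H0 \<and> quasi_uniform_partition c H \<Omega> \<T> \<and> (\<forall>T\<in>\<T>. p T \<in> T) \<longrightarrow>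
      (\<forall>z\<in>H2n \<Omega>. (L2_nrm \<Omega> z)\<^sup>2 \<le> 2 * (\<Sum>T\<in>\<T>. measure lebesgue T * (point_value \<Omega> z (p T))\<^sup>2)
        + \<theta> * ((L2_nrm \<Omega> (laplacian \<Omega> z))\<^sup>2 + (L2_nrm \<Omega> z)\<^sup>2))"
    using sampling_inequality[OF d3 \<theta>(1)] by (elim exE conjE)
  show "\<exists>H\<^sub>0>0. \<forall>H \<T> p. 0 < H \<and> H \<le> H\<^sub>0 \<and> quasi_uniform_partition c H \<Omega> \<T> \<and> (\<forall>T\<in>\<T>. p T \<in> T) \<longrightarrow>
      (\<forall>z\<in>H2n \<Omega>. feedback \<Omega> lam \<T> p z \<in> H2n_dual \<Omega>) \<and>
      (\<forall>z\<in>H2n \<Omega>. \<nu> * (L2_nrm \<Omega> (laplacian \<Omega> z))\<^sup>2 + 2 * feedback \<Omega> lam \<T> p z z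
                   \<ge> (C_star R \<nu> + \<gamma>) * (L2_nrm \<Omega> z)\<^sup>2)"
  proof (intro exI[of _ H0] conjI H0 allI impI ballI)
    fix H \<T> p z
    assume h: "0 < H \<and> H \<le> H0 \<and> quasi_uniform_partition c H \<Omega> \<T> \<and> (\<forall>T\<in>\<T>. p T \<in> T)" and z: "z \<in> H2n \<Omega>"
    show "feedback \<Omega> lam \<T> p z \<in> H2n_dual \<Omega>"
      by (rule feedback_in_dual[OF assms(2,4) d3]) (use h in \<open>auto simp: quasi_uniform_partition_def\<close>)
    define Q where "Q = (\<Sum>T\<in>\<T>. measure lebesgue T * (point_value \<Omega> z (p T))\<^sup>2)"
    define N where "N = (L2_nrm \<Omega> z)\<^sup>2"
    define D where "D = (L2_nrm \<Omega> (laplacian \<Omega> z))\<^sup>2"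
    have nn: "Q \<ge> 0" "N \<ge> 0" "D \<ge> 0" by (auto simp: Q_def N_def D_def intro!: sum_nonneg)
    have fb: "feedback \<Omega> lam \<T> p z z = lam * Q" by (simp add: feedback_def Q_def power2_eq_square mult.assoc)
    have "N \<le> 2 * Q + \<theta> * (D + N)"
      unfolding Q_def N_def D_def by (rule bspec[OF mp[OF spec[OF spec[OF spec[OF spec[OF smp]]]] h] z])
    then have "2 * M * N \<le> 2 * M * (2 * Q + \<theta> * (D + N))" using M by (intro mult_left_mono) auto
    also have "\<dots> = 2 * (2 * M * Q) + (2 * M * \<theta>) * D + (2 * M * \<theta>) * N" by (simp add: algebra_simps)
    also have "\<dots> \<le> 2 * (lam * Q) + \<nu> * D + M * N"
      using lam nn \<theta> by (intro add_mono mult_left_mono mult_right_mono) (auto simp: M_def)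
    finally have "M * N \<le> \<nu> * D + 2 * (lam * Q)" by linarith
    then show "(C_star R \<nu> + \<gamma>) * (L2_nrm \<Omega> z)\<^sup>2 \<le> \<nu> * (L2_nrm \<Omega> (laplacian \<Omega> z))\<^sup>2 + 2 * feedback \<Omega> lam \<T> p z z"
      by (simp only: fb flip: M_def N_def D_def)
  qed
qed

end
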